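(* Let $m\ge 1$, $n\ge m+3$ and $p\ge p_*:=\frac{n-m}{n-m-2}$. Let $M_0\subset\mathbb{R}^n$, $I$, $F$, $M_t=F_t(M_0)$ be as in the context, let $F$ be $B$-bounded on $I$ for some constant $B>0$, and let $\Omega\subset\mathbb{R}^n$ be a (not necessarily bounded) domain with $M_t\subset\Omega$ for all $t\in\overline I$. Suppose that a nonnegative function $u\in C^{2,1}(Q_{\Omega,I}\setminus M_I)$ satisfies $$\partial_t u-\Delta u=-u^p\quad\text{in } Q_{\Omega,I}\setminus M_I .$$ Then $u\in C^{2,1}(Q_{\Omega,I})$ (i.e. $u$ extends across $M_I$ to such a function) and $u$ is a classical solution of $\partial_t u-\Delta u=-u^p$ in $Q_{\Omega,I}$.
   Context: Setting. $M_0\subset\mathbb{R}^n$ is a connected compact $m$-dimensional smooth embedded submanifold without boundary, $I$ is an open interval with $0\in I$, and $F\in C^\infty(\mathbb{R}^n\times I;\mathbb{R}^n)$ is a one parameter family of diffeomorphisms of $\mathbb{R}^n$: each $F_t:=F(\cdot,t)$ is a diffeomorphism and $F_0=\mathrm{id}$. Moreover $F$ extends to a smooth one parameter family of diffeomorphisms $\tilde F\in C^\infty(\mathbb{R}^n\times J;\mathbb{R}^n)$ for some open interval $J\supset\overline I$. Put $M_t:=F_t(M_0)$ for $t\in I$ and $M_t:=\tilde F_t(M_0)$ for $t\in J\setminus I$. $B$-bounded: $F$ is called $B$-bounded on $I$ if $$\sup_{s\in I}\sup_{p\in M_0}|\partial_tF(p,s)|+\sum_{i}\|\partial_{x_i}F\|_{L^\infty(\mathbb{R}^n\times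 I)}+\sum_i\|\partial_t\partial_{x_i}F\|_{L^\infty(\mathbb{R}^n\times I)}+\sum_{i,j}\|\partial_{x_i}\partial_{x_j}F\|_{L^\infty(\mathbb{R}^n\times I)}\le B$$ and $|F_t(p)-F_t(q)|\ge B^{-1}|p-q|$ for all $p,q\in M_0$ and $t\in I$. Notation. $Q_{\Omega,I'}:=\Omega\times I'$ and $M_{I'}:=\{(x,t)\in\mathbb{R}^n\times I': x\in M_t\}$ for an interval $I'\subset I$. $C^{2,1}$ is the space of functions twice continuously differentiable in $x$ and once in $t$. *)

theory Defs
  imports "HOL-Analysis.Analysis" "HOL-Probability.Essential_Supremum"
begin

section \<open>Smooth maps, diffeomorphisms and submanifolds\<close>

text \<open>Only meaningful for open \<open>S\<close>, the derivatives being taken in the ambient space.\<close>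

primrec Ck_on :: "nat \<Rightarrow> ('a::real_normed_vector \<Rightarrow> 'b::real_normed_vector) \<Rightarrow> 'a set \<Rightarrow> bool"
where
  "Ck_on 0 f S \<longleftrightarrow> continuous_on S f"
| "Ck_on (Suc k) f S \<longleftrightarrow>
     (\<forall>x\<in>S. f differentiable (at x)) \<and> (\<forall>v. Ck_on k (\<lambda>x. frechet_derivative f (at x) v) S)"

definition smooth_on :: "('a::real_normed_vector \<Rightarrow> 'b::real_normed_vector) \<Rightarrow> 'a set \<Rightarrow> bool"
  where "smooth_on f S \<longleftrightarrow> (\<forall>k. Ck_on k f S)"

definition diffeomorphism ::
  "'a::real_normed_vector set \<Rightarrow> 'b::real_normed_vector set \<Rightarrow> ('a \<Rightarrow> 'b) \<Rightarrow> bool"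
  where "diffeomorphism U V f \<longleftrightarrow>
    open U \<and> open V \<and> bij_betw f U V \<and> smooth_on f U \<and> smooth_on (inv_into U f) V"

text \<open>The dimension is the number \<open>m\<close> of coordinates left free in the slice charts.\<close>

definition embedded_submanifold :: "nat \<Rightarrow> (real ^ 'n) set \<Rightarrow> bool"
  where "embedded_submanifold m M \<longleftrightarrow>
    (\<forall>x\<in>M. \<exists>U V \<phi> S. x \<in> U \<and> diffeomorphism U V \<phi> \<and> card S = m \<and>
       \<phi> ` (M \<inter> U) = V \<inter> {y :: real ^ 'n. \<forall>i. i \<notin> S \<longrightarrow> y $ i = 0})"

section \<open>Partial derivatives in space-time\<close>

text \<open>\<open>dirderiv v f z\<close> is the derivative of \<open>f\<close> at \<open>z\<close> along \<open>v\<close>; with space-time points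
  written \<open>(x, t)\<close>, it gives the partial derivatives in \<open>x\<^sub>i\<close> and in \<open>t\<close>.\<close>

definition dirderiv ::
  "'a::real_normed_vector \<Rightarrow> ('a \<Rightarrow> 'b::real_normed_vector) \<Rightarrow> 'a \<Rightarrow> 'b"
  where "dirderiv v f z = vector_derivative (\<lambda>s. f (z + s *\<^sub>R v)) (at 0)"

definition has_cont_dirderiv_on ::
  "'a::real_normed_vector \<Rightarrow> ('a \<Rightarrow> 'b::real_normed_vector) \<Rightarrow> 'a set \<Rightarrow> bool"
  where "has_cont_dirderiv_on v f S \<longleftrightarrow>
    (\<forall>z\<in>S. (\<lambda>s::real. f (z + s *\<^sub>R v)) differentiable (at 0)) \<and> continuous_on S (dirderiv v f)"

abbreviation dir_x :: "'n::finite \<Rightarrow> (real ^ 'n) \<times> real"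
  where "dir_x i \<equiv> (axis i 1, 0)"

abbreviation dir_t :: "(real ^ 'n) \<times> real"
  where "dir_t \<equiv> (0, 1)"

definition C21_on :: "((real ^ 'n) \<times> real \<Rightarrow> real) \<Rightarrow> ((real ^ 'n) \<times> real) set \<Rightarrow> bool"
  where "C21_on u S \<longleftrightarrow>
    continuous_on S u \<and>
    has_cont_dirderiv_on dir_t u S \<and>
    (\<forall>i. has_cont_dirderiv_on (dir_x i) u S) \<and>
    (\<forall>i j. has_cont_dirderiv_on (dir_x j) (dirderiv (dir_x i) u) S)"

definition laplacian_x :: "((real ^ 'n) \<times> real \<Rightarrow> real) \<Rightarrow> (real ^ 'n) \<times> real \<Rightarrow> real"
  where "laplacian_x u z = (\<Sum>i\<in>UNIV. dirderiv (dir_x i) (dirderiv (dir_x i) u) z)"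

text \<open>Nonnegativity is part of the notion: for negative \<open>u\<close>, \<open>u powr p\<close> is a junk value.\<close>

definition nonneg_classical_solution ::
  "real \<Rightarrow> ((real ^ 'n) \<times> real) set \<Rightarrow> ((real ^ 'n) \<times> real \<Rightarrow> real) \<Rightarrow> bool"
  where "nonneg_classical_solution p S u \<longleftrightarrow>
    C21_on u S \<and> (\<forall>z\<in>S. u z \<ge> 0) \<and>
    (\<forall>z\<in>S. dirderiv dir_t u z - laplacian_x u z = - (u z powr p))"

section \<open>Families of diffeomorphisms\<close>

definition diffeo_family :: "((real ^ 'n) \<times> real \<Rightarrow> real ^ 'n) \<Rightarrow> real set \<Rightarrow> bool"
  where "diffeo_family F I \<longleftrightarrow>
    smooth_on F (UNIV \<times> I) \<and> (\<forall>t\<in>I. diffeomorphism UNIV UNIV (\<lambda>x. F (x, t)))"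

definition Linf_norm ::
  "('a::euclidean_space) set \<Rightarrow> ('a \<Rightarrow> 'b::real_normed_vector) \<Rightarrow> ennreal"
  where "Linf_norm S f = esssup (restrict_space lborel S) (\<lambda>z. ennreal (norm (f z)))"

definition B_bounded ::
  "real \<Rightarrow> (real ^ 'n) set \<Rightarrow> real set \<Rightarrow> ((real ^ 'n) \<times> real \<Rightarrow> real ^ 'n) \<Rightarrow> bool"
  where "B_bounded B M0 I F \<longleftrightarrow>
    (SUP s\<in>I. SUP q\<in>M0. ennreal (norm (dirderiv dir_t F (q, s))))
      + (\<Sum>i\<in>UNIV. Linf_norm (UNIV \<times> I) (dirderiv (dir_x i) F))
      + (\<Sum>i\<in>UNIV. Linf_norm (UNIV \<times> I) (dirderiv dir_t (dirderiv (dir_x i) F)))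
      + (\<Sum>i\<in>UNIV. \<Sum>j\<in>UNIV.
           Linf_norm (UNIV \<times> I) (dirderiv (dir_x i) (dirderiv (dir_x j) F)))
      \<le> ennreal B \<and>
    (\<forall>t\<in>I. \<forall>a\<in>M0. \<forall>b\<in>M0. norm (F (a, t) - F (b, t)) \<ge> inverse B * norm (a - b))"

text \<open>
  \<open>M\<^sub>t\<close> for \<open>t \<in> J\<close>, where \<open>G\<close> is the family on \<open>J\<close> extending the family \<open>F\<close> on \<open>I\<close>.
\<close>

definition moving_set ::
  "((real ^ 'n) \<times> real \<Rightarrow> real ^ 'n) \<Rightarrow> ((real ^ 'n) \<times> real \<Rightarrow> real ^ 'n) \<Rightarrow>
   real set \<Rightarrow> (real ^ 'n) set \<Rightarrow> real \<Rightarrow> (real ^ 'n) set"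
  where "moving_set F G I M0 t = (if t \<in> I then (\<lambda>x. F (x, t)) ` M0 else (\<lambda>x. G (x, t)) ` M0)"

definition track :: "(real \<Rightarrow> (real ^ 'n) set) \<Rightarrow> real set \<Rightarrow> ((real ^ 'n) \<times> real) set"
  where "track M I = {(x, t). t \<in> I \<and> x \<in> M t}"

end

theory Submission
  imports Defs "HOL-Probability.Distributions" "HOL-Analysis.Ball_Volume"
begin

text \<open>The space-time track of \<open>M_0\<close> over a compact time interval is covered by \<open>C \<epsilon>^{-(m+2)}\<close>
  parabolic cylinders of radius \<open>\<epsilon>\<close>, which yields cutoffs \<open>\<eta>\<close> vanishing near the track, equal to \<open>1\<close>
  off a set of measure \<open>C \<epsilon>^{n-m}\<close>, whose heat operator is of size \<open>\<epsilon>^{-2}\<close>. Since \<open>p \<ge> p_*\<close> means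
  \<open>2 p / (p - 1) \<le> n - m\<close>, testing the equation with powers of \<open>\<psi> \<eta>\<close> and absorbing by Young's inequality
  bounds \<open>u^p\<close> in \<open>L^1\<close> up to the track, and then shows that the equation holds across it in the
  sense of distributions. Testing with a truncated heat kernel bounds \<open>u\<close> (the term with \<open>u^p\<close> has a good sign)
  and represents it as a sum of heat potentials of bounded functions; hence \<open>u\<close> is \<open>C^1\<close>, and then
  \<open>C^2\<close>, in space. The equation itself supplies the time derivative.\<close>

text \<open>The exponent enters through a single product. Young's inequality pairs \<open>u\<close>
  with a heat operator of size \<open>\<epsilon>^-2\<close>; its conjugate power
  \<open>p/(p-1)\<close> is integrated over a set of measure \<open>\<epsilon>^(n-m)\<close>, and
  the result stays bounded as long as \<open>2p/(p-1) \<le> n-m\<close>. At equality it is bounded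
  but does not tend to \<open>0\<close>, which forces two passes: one yields only the integrability
  of \<open>u^p\<close>; the other puts a large weight on the integral of \<open>u^p\<close> over
  the shrinking set, which tends to \<open>0\<close> by then, and a small weight on the bounded
  term. No tubular neighbourhood of the track is used, only a count of cylinders and Lipschitz
  bounds, so the argument is local in space and time. No Hoelder theory is used either: one spatial
  derivative of the heat kernel is integrable, two are not, so the second derivative is put on the
  density once \<open>u\<close> is known to be \<open>C^1\<close> in space. The representation
  formula defines a function everywhere that agrees with \<open>u\<close> off a null set; continuity
  does the rest.\<close>

lemma has_cont_dirderiv_onD:
  assumes "has_cont_dirderiv_on v f S" "z \<in> S"
  shows "((\<lambda>s. f (z + s *\<^sub>R v)) has_vector_derivative dirderiv v f z) (at 0)"
  using assms unfolding has_cont_dirderiv_on_def dirderiv_def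
  by (simp add: vector_derivative_works)

lemma dirderiv_eqI:
  assumes "((\<lambda>s. f (z + s *\<^sub>R v)) has_vector_derivative d) (at 0)"
  shows "dirderiv v f z = d"
  using assms unfolding dirderiv_def by (rule vector_derivative_at)

lemma has_cont_dirderiv_onI:
  assumes "\<And>z. z \<in> S \<Longrightarrow> ((\<lambda>s. f (z + s *\<^sub>R v)) has_vector_derivative f' z) (at 0)"
    and "continuous_on S f'"
  shows "has_cont_dirderiv_on v f S"
proof -
  have "dirderiv v f z = f' z" if "z \<in> S" for z
    using assms(1)[OF that] by (rule dirderiv_eqI)
  then show ?thesis
    unfolding has_cont_dirderiv_on_def using assms
    by (auto intro: differentiableI_vector cong: continuous_on_cong)
qed

lemma has_cont_dirderiv_on_subset:
  "has_cont_dirderiv_on v f S \<Longrightarrow> T \<subseteq> S \<Longrightarrow> has_cont_dirderiv_on v f T"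
  unfolding has_cont_dirderiv_on_def using continuous_on_subset by blast

lemma eventually_line_in_open:
  fixes z v :: "'a::real_normed_vector"
  assumes "open S" "z \<in> S"
  shows "\<forall>\<^sub>F s in at (0::real). z + s *\<^sub>R v \<in> S"
proof -
  have "((\<lambda>s::real. z + s *\<^sub>R v) \<longlongrightarrow> z + 0 *\<^sub>R v) (at 0)"
    by (intro tendsto_intros)
  then show ?thesis
    using assms by (auto dest: topological_tendstoD)
qed

lemma dirderiv_transfer:
  fixes z v :: "'a::real_normed_vector"
  assumes "open S" "z \<in> S" "\<And>w. w \<in> S \<Longrightarrow> f w = g w"
    and "((\<lambda>s. f (z + s *\<^sub>R v)) has_vector_derivative d) (at 0)"
  shows "((\<lambda>s. g (z + s *\<^sub>R v)) has_vector_derivative d) (at 0)"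
proof -
  have "\<forall>\<^sub>F s in nhds 0. s \<in> UNIV \<longrightarrow> f (z + s *\<^sub>R v) = g (z + s *\<^sub>R v)"
    using eventually_line_in_open[OF assms(1,2), of v] assms(2,3)
    by (auto simp: eventually_at_filter elim: eventually_mono)
  from has_vector_derivative_cong_ev[OF this] show ?thesis
    using assms(2,3,4) by simp
qed

lemma dirderiv_cong_open:
  assumes "open S" "z \<in> S" "\<And>w. w \<in> S \<Longrightarrow> f w = g w"
  shows "dirderiv v f z = dirderiv v g z"
proof -
  have "\<forall>\<^sub>F s in nhds 0. f (z + s *\<^sub>R v) = g (z + s *\<^sub>R v)"
    using eventually_line_in_open[OF assms(1,2), of v] assms(2,3)
    by (auto simp: eventually_at_filter elim: eventually_mono)
  then show ?thesis
    unfolding dirderiv_def by (intro vector_derivative_cong_eq) (auto simp: assms)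
qed

lemma has_cont_dirderiv_on_cong_open:
  assumes "open S" "\<And>w. w \<in> S \<Longrightarrow> f w = g w" "has_cont_dirderiv_on v f S"
  shows "has_cont_dirderiv_on v g S"
proof (rule has_cont_dirderiv_onI)
  show "((\<lambda>s. g (z + s *\<^sub>R v)) has_vector_derivative dirderiv v f z) (at 0)" if "z \<in> S" for z
    by (rule dirderiv_transfer[OF assms(1) that assms(2)])
       (auto intro: has_cont_dirderiv_onD assms that)
  show "continuous_on S (dirderiv v f)"
    using assms(3) unfolding has_cont_dirderiv_on_def by auto
qed

lemma dirderiv_along_line:
  fixes z v :: "'a::real_normed_vector"
  assumes "((\<lambda>s. f ((z + x *\<^sub>R v) + s *\<^sub>R v)) has_vector_derivative d) (at 0)"
  shows "((\<lambda>s. f (z + s *\<^sub>R v)) has_vector_derivative d) (at x)"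
proof -
  have "((\<lambda>s. s - x) has_vector_derivative 1) (at x)"
    by (auto intro!: derivative_eq_intros)
  from vector_diff_chain_at[OF this, of "\<lambda>s. f ((z + x *\<^sub>R v) + s *\<^sub>R v)" d]
  moreover have "z + x *\<^sub>R v + (s - x) *\<^sub>R v = z + s *\<^sub>R v" for s
    by (simp add: algebra_simps)
  ultimately show ?thesis using assms by (simp add: o_def)
qed

lemma has_cont_dirderiv_on_line:
  assumes "has_cont_dirderiv_on v f S" "z + x *\<^sub>R v \<in> S"
  shows "((\<lambda>s. f (z + s *\<^sub>R v)) has_vector_derivative dirderiv v f (z + x *\<^sub>R v)) (at x)"
  using has_cont_dirderiv_onD[OF assms] by (rule dirderiv_along_line)

text \<open>The mean value inequality along a line. It supplies the dominating function whenever
  difference quotients are passed to the limit under an integral.\<close>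

lemma dirderiv_diff_bound:
  fixes f :: "'a::real_normed_vector \<Rightarrow> real"
  assumes "has_cont_dirderiv_on v f UNIV" "\<And>z. \<bar>dirderiv v f z\<bar> \<le> C"
  shows "\<bar>f (z + s *\<^sub>R v) - f z\<bar> \<le> C * \<bar>s\<bar>"
proof -
  have "norm (f (z + s *\<^sub>R v) - f (z + 0 *\<^sub>R v)) \<le> C * norm (s - 0)"
  proof (rule differentiable_bound[where S=UNIV])
    fix x :: real
    show "((\<lambda>s. f (z + s *\<^sub>R v)) has_derivative (\<lambda>h. h *\<^sub>R dirderiv v f (z + x *\<^sub>R v))) (at x within UNIV)"
      using has_cont_dirderiv_on_line[OF assms(1), of z x] by (simp add: has_vector_derivative_def)
    have "norm (h *\<^sub>R dirderiv v f (z + x *\<^sub>R v)) \<le> C * norm h" for h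
      using mult_left_mono[OF assms(2)[of "z + x *\<^sub>R v"], of "\<bar>h\<bar>"]
      by (simp add: abs_mult mult.commute)
    then show "onorm (\<lambda>h. h *\<^sub>R dirderiv v f (z + x *\<^sub>R v)) \<le> C"
      by (intro onorm_le)
  qed auto
  then show ?thesis by simp
qed

section \<open>Integration of functions with compact support, translations and reflections\<close>

lemma compact_support_imp_bounded:
  fixes f :: "'a::metric_space \<Rightarrow> real"
  assumes "continuous_on UNIV f" "compact C" "\<And>z. z \<notin> C \<Longrightarrow> f z = 0"
  obtains b where "b \<ge> 0" "\<And>z. \<bar>f z\<bar> \<le> b"
proof -
  have "compact (f ` C)"
    using assms by (intro compact_continuous_image) (auto intro: continuous_on_subset)
  then obtain b where b: "\<And>y. y \<in> f ` C \<Longrightarrow> \<bar>y\<bar> \<le> b"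
    by (meson bounded_real compact_imp_bounded)
  have "\<bar>f z\<bar> \<le> max b 0" for z
    using b[of "f z"] assms(3)[of z] by (cases "z \<in> C") auto
  then show thesis by (intro that[of "max b 0"]) auto
qed

lemma compact_support_integrable:
  fixes f :: "'a::euclidean_space \<Rightarrow> real"
  assumes "continuous_on UNIV f" "compact C" "\<And>z. z \<notin> C \<Longrightarrow> f z = 0"
  shows "integrable lborel f"
proof -
  have "integrable lborel (\<lambda>x. indicator C x *\<^sub>R f x)"
    using assms by (intro borel_integrable_compact) (auto intro: continuous_on_subset)
  moreover have "(\<lambda>x. indicator C x *\<^sub>R f x) = f"
    using assms(3) by (auto simp: indicator_def fun_eq_iff)
  ultimately show ?thesis by simp
qed

lemma dirderiv_zero_outside:
  fixes f :: "'a::real_normed_vector \<Rightarrow> 'b::real_normed_vector"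
  assumes "closed C" "\<And>z. z \<notin> C \<Longrightarrow> f z = 0" "z \<notin> C"
  shows "dirderiv v f z = 0"
proof -
  have "dirderiv v f z = dirderiv v (\<lambda>_. 0) z"
    using assms by (intro dirderiv_cong_open[where S="- C"]) auto
  also have "\<dots> = 0" by (intro dirderiv_eqI) simp
  finally show ?thesis .
qed

lemma integral_lborel_translate:
  fixes f :: "'a::euclidean_space \<Rightarrow> real"
  assumes "f \<in> borel_measurable borel"
  shows "(\<integral>w. f (c + w) \<partial>lborel) = (\<integral>w. f w \<partial>lborel)"
proof -
  have "(\<integral>w. f w \<partial>lborel) = (\<integral>w. f w \<partial>(distr lborel borel ((+) c)))"
    by (simp add: lborel_distr_plus)
  also have "\<dots> = (\<integral>w. f (c + w) \<partial>lborel)"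
    using assms by (subst integral_distr) auto
  finally show ?thesis by simp
qed

lemma lborel_distr_reflect:
  "distr lborel borel (\<lambda>w. z - w) = (lborel :: 'a::euclidean_space measure)"
  by (subst (2) lborel_affine[of "-1" z]) (auto simp: density_1)

lemma integral_lborel_reflect:
  fixes f :: "'a::euclidean_space \<Rightarrow> real"
  assumes "f \<in> borel_measurable borel"
  shows "(\<integral>w. f (z - w) \<partial>lborel) = (\<integral>w. f w \<partial>lborel)"
proof -
  have "(\<integral>w. f w \<partial>lborel) = (\<integral>w. f w \<partial>(distr lborel borel (\<lambda>w. z - w)))"
    by (simp add: lborel_distr_reflect)
  also have "\<dots> = (\<integral>w. f (z - w) \<partial>lborel)"
    using assms by (subst integral_distr) auto
  finally show ?thesis by simp
qed

text \<open>For convolutions with functions that are regular only off a null set: the bad values of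
  the integration variable form a reflected null set.\<close>

lemma AE_lborel_reflect:
  assumes "N \<in> null_sets (lborel :: 'a::euclidean_space measure)"
  shows "AE w in lborel. z - w \<notin> N"
proof -
  have "AE w in distr lborel borel (\<lambda>w. z - w). w \<notin> N"
    using assms by (simp add: lborel_distr_reflect AE_not_in)
  then show ?thesis
    using assms by (subst (asm) AE_distr_iff) (auto simp: null_sets_def)
qed

text \<open>The difference quotients of \<open>f\<close> have integral \<open>0\<close> by translation invariance.\<close>

lemma integral_dirderiv_eq_0:
  fixes f :: "'a::euclidean_space \<Rightarrow> real"
  assumes f: "continuous_on UNIV f" "has_cont_dirderiv_on v f UNIV"
    and C: "compact C" "\<And>z. z \<notin> C \<Longrightarrow> f z = 0"
  shows "(\<integral>z. dirderiv v f z \<partial>lborel) = 0"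
proof -
  have cont: "continuous_on UNIV (dirderiv v f)"
    using f(2) unfolding has_cont_dirderiv_on_def by auto
  have zero: "dirderiv v f z = 0" if "z \<notin> C" for z
    using dirderiv_zero_outside[OF compact_imp_closed[OF C(1)] C(2) that] .
  obtain b where b: "b \<ge> 0" "\<And>z. \<bar>dirderiv v f z\<bar> \<le> b"
    using compact_support_imp_bounded[OF cont C(1) zero] by blast
  have [measurable]: "f \<in> borel_measurable borel" "dirderiv v f \<in> borel_measurable borel"
    using f(1) cont by (auto intro: borel_measurable_continuous_onI)
  define \<delta> where "\<delta> = (\<lambda>j::nat. inverse (real (Suc j)))"
  have \<delta>: "\<delta> j > 0" "\<delta> j \<le> 1" for j by (auto simp: \<delta>_def field_simps)
  have \<delta>lim: "\<delta> \<longlonglongrightarrow> 0" unfolding \<delta>_def by (rule LIMSEQ_inverse_real_of_nat)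
  let ?q = "\<lambda>j z. (f (z + \<delta> j *\<^sub>R v) - f z) / \<delta> j"
  \<comment> \<open>\<open>K\<close> contains every point from which \<open>C\<close> is reached by
    a step along \<open>v\<close> of length factor at most \<open>1\<close>, so all difference
    quotients vanish off one compact set.\<close>
  define K where "K = (\<lambda>(x, s). x - s *\<^sub>R v) ` (C \<times> {0..1::real})"
  have K: "compact K"
    unfolding K_def using C(1)
    by (intro compact_continuous_image compact_Times) (auto intro!: continuous_intros simp: case_prod_beta)
  have out: "?q j z = 0" if "z \<notin> K" for j z
  proof -
    have "z + s *\<^sub>R v \<notin> C" if "s \<in> {0..1}" for s
      using \<open>z \<notin> K\<close> that unfolding K_def by (force simp: image_iff)
    from this[of 0] this[of "\<delta> j"] show ?thesis using \<delta>[of j] C(2) by auto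
  qed
  have "(\<lambda>j. \<integral>z. ?q j z \<partial>lborel) \<longlonglongrightarrow> (\<integral>z. dirderiv v f z \<partial>lborel)"
  proof (rule integral_dominated_convergence[where w="\<lambda>z. b * indicator K z"])
    show "integrable lborel (\<lambda>z. b * indicator K z)"
      using K emeasure_compact_finite[OF K]
      by (intro integrable_mult_right integrable_real_indicator) (auto intro: borel_compact)
    show "AE z in lborel. norm (?q j z) \<le> b * indicator K z" for j
    proof (intro AE_I2)
      fix z
      show "norm (?q j z) \<le> b * indicator K z"
      proof (cases "z \<in> K")
        case True
        have "\<bar>f (z + \<delta> j *\<^sub>R v) - f z\<bar> \<le> b * \<delta> j"
          using dirderiv_diff_bound[OF f(2) b(2), of z "\<delta> j"] \<delta>[of j] by simp
        then show ?thesis using True \<delta>[of j] by (simp add: field_simps)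
      qed (use out in auto)
    qed
    show "AE z in lborel. (\<lambda>j. ?q j z) \<longlonglongrightarrow> dirderiv v f z"
    proof (intro AE_I2)
      fix z
      have "((\<lambda>s. f (z + s *\<^sub>R v)) has_real_derivative dirderiv v f z) (at 0)"
        using has_cont_dirderiv_onD[OF f(2)] by (simp add: has_real_derivative_iff_has_vector_derivative)
      then have "((\<lambda>s. (f (z + s *\<^sub>R v) - f z) / s) \<longlongrightarrow> dirderiv v f z) (at 0)"
        by (simp add: DERIV_def)
      moreover have "filterlim \<delta> (at 0) sequentially"
        using \<delta>lim \<delta>(1) by (simp add: filterlim_at less_imp_neq[THEN not_sym])
      ultimately show "(\<lambda>j. ?q j z) \<longlonglongrightarrow> dirderiv v f z"
        by (rule filterlim_compose)
    qed
  qed measurable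
  moreover have "(\<integral>z. ?q j z \<partial>lborel) = 0" for j
  proof -
    have i1: "integrable lborel f" using compact_support_integrable[OF f(1) C] .
    have "continuous_on UNIV (\<lambda>z. f (z + \<delta> j *\<^sub>R v))"
      by (intro continuous_on_compose2[OF f(1)] continuous_intros) auto
    moreover have "f (z + \<delta> j *\<^sub>R v) = 0" if "z \<notin> K" for z
    proof -
      have "z + \<delta> j *\<^sub>R v \<notin> C"
        using that \<delta>[of j] unfolding K_def by (force simp: image_iff)
      then show ?thesis using C(2) by auto
    qed
    ultimately have i2: "integrable lborel (\<lambda>z. f (z + \<delta> j *\<^sub>R v))"
      using compact_support_integrable K by blast
    have "(\<integral>z. f (z + \<delta> j *\<^sub>R v) \<partial>lborel) = (\<integral>z. f z \<partial>lborel)"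
      using integral_lborel_translate[of f "\<delta> j *\<^sub>R v"] by (simp add: add.commute)
    then show ?thesis using i1 i2 by simp
  qed
  ultimately have "(\<lambda>j. 0) \<longlonglongrightarrow> (\<integral>z. dirderiv v f z \<partial>lborel)"
    by (simp only:)
  then show ?thesis by (simp only: LIMSEQ_const_iff)
qed

section \<open>Convolution of an integrable kernel with a bounded function\<close>

definition conv :: "('a::euclidean_space \<Rightarrow> real) \<Rightarrow> ('a \<Rightarrow> real) \<Rightarrow> 'a \<Rightarrow> real"
  where "conv k g z = (\<integral>w. k w * g (z - w) \<partial>lborel)"

lemma abs_mult_le_mult_abs: "\<bar>b\<bar> \<le> C \<Longrightarrow> \<bar>a * b\<bar> \<le> C * \<bar>a\<bar>" for a b C :: real
  using mult_left_mono[of "\<bar>b\<bar>" C "\<bar>a\<bar>"] by (simp add: abs_mult mult.commute)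

lemma conv_comm:
  fixes k g :: "'a::euclidean_space \<Rightarrow> real"
  assumes [measurable]: "k \<in> borel_measurable borel" "g \<in> borel_measurable borel"
  shows "conv k g z = conv g k z"
  unfolding conv_def
  using integral_lborel_reflect[of "\<lambda>w. k w * g (z - w)" z] by (simp add: mult.commute)

lemma conv_integrable:
  fixes k g :: "'a::euclidean_space \<Rightarrow> real"
  assumes k: "integrable lborel k" and [measurable]: "g \<in> borel_measurable borel"
    and g: "\<And>z. \<bar>g z\<bar> \<le> C"
  shows "integrable lborel (\<lambda>w. k w * g (z - w))"
proof (rule Bochner_Integration.integrable_bound[OF integrable_mult_right[OF k, of C]])
  have [measurable]: "k \<in> borel_measurable borel" using k by auto
  show "(\<lambda>w. k w * g (z - w)) \<in> borel_measurable lborel" by simp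
  show "AE w in lborel. norm (k w * g (z - w)) \<le> norm (C * k w)"
    using abs_mult_le_mult_abs[OF order_trans[OF g abs_ge_self]] by (intro AE_I2) (simp add: abs_mult)
qed

lemma conv_abs_le:
  fixes k g :: "'a::euclidean_space \<Rightarrow> real"
  assumes k: "integrable lborel k" and "g \<in> borel_measurable borel"
    and g: "\<And>z. \<bar>g z\<bar> \<le> C"
  shows "\<bar>conv k g z\<bar> \<le> C * (\<integral>w. \<bar>k w\<bar> \<partial>lborel)"
proof -
  have "\<bar>conv k g z\<bar> \<le> (\<integral>w. \<bar>k w * g (z - w)\<bar> \<partial>lborel)"
    unfolding conv_def by (rule integral_abs_bound)
  also have "\<dots> \<le> (\<integral>w. C * \<bar>k w\<bar> \<partial>lborel)"
    using conv_integrable[OF assms, of z] k g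
    by (intro integral_mono integrable_mult_right integrable_abs abs_mult_le_mult_abs) auto
  finally show ?thesis by simp
qed

text \<open>\<open>g\<close> may jump across the closed null set \<open>N\<close>: for fixed
  \<open>z\<close>, almost every \<open>w\<close> has \<open>z - w\<close> off \<open>N\<close>, so
  dominated convergence still applies. This makes potentials continuous everywhere although their
  densities are continuous only off the singular set.\<close>

lemma conv_continuous:
  fixes k g :: "'a::euclidean_space \<Rightarrow> real"
  assumes k: "integrable lborel k" and [measurable]: "g \<in> borel_measurable borel"
    and g: "\<And>z. \<bar>g z\<bar> \<le> C"
    and N: "N \<in> null_sets lborel" "closed N" "continuous_on (- N) g"
  shows "continuous_on UNIV (conv k g)"
proof (intro continuous_at_imp_continuous_on ballI continuous_at_sequentially[THEN iffD2] allI impI)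
  fix f :: "nat \<Rightarrow> 'a" and z assume fz: "f \<longlonglongrightarrow> z"
  have [measurable]: "k \<in> borel_measurable borel" using k by auto
  show "(conv k g \<circ> f) \<longlonglongrightarrow> conv k g z"
    unfolding conv_def o_def
  proof (rule integral_dominated_convergence[where w="\<lambda>w. C * \<bar>k w\<bar>"])
    show "AE w in lborel. (\<lambda>j. k w * g (f j - w)) \<longlonglongrightarrow> k w * g (z - w)"
      using AE_lborel_reflect[OF N(1), of z]
    proof eventually_elim
      case (elim w)
      then have "isCont g (z - w)"
        using N(2,3) by (auto simp: continuous_on_eq_continuous_at open_Compl)
      then have "(\<lambda>j. g (f j - w)) \<longlonglongrightarrow> g (z - w)"
        by (rule isCont_tendsto_compose) (intro tendsto_intros fz)
      then show ?case by (intro tendsto_intros)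
    qed
    show "AE w in lborel. norm (k w * g (f j - w)) \<le> C * \<bar>k w\<bar>" for j
      using abs_mult_le_mult_abs[OF g] by (intro AE_I2) simp
  qed (use k in auto)
qed

text \<open>Differentiation under the integral, with the derivative on the bounded factor; the
  difference quotients are dominated by the bound on the derivative times the kernel.\<close>

lemma conv_dirderiv_right:
  fixes k g :: "'a::euclidean_space \<Rightarrow> real"
  assumes k: "integrable lborel k"
    and g: "continuous_on UNIV g" "has_cont_dirderiv_on v g UNIV"
    and C: "\<And>z. \<bar>g z\<bar> \<le> C" "\<And>z. \<bar>dirderiv v g z\<bar> \<le> C"
  shows "((\<lambda>s. conv k g (z + s *\<^sub>R v)) has_vector_derivative conv k (dirderiv v g) z) (at 0)"
proof -
  have [measurable]: "k \<in> borel_measurable borel" using k by auto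
  have cont: "continuous_on UNIV (dirderiv v g)"
    using g(2) unfolding has_cont_dirderiv_on_def by auto
  have [measurable]: "g \<in> borel_measurable borel" "dirderiv v g \<in> borel_measurable borel"
    using g(1) cont by (auto intro: borel_measurable_continuous_onI)
  have "((\<lambda>s. (conv k g (z + s *\<^sub>R v) - conv k g z) / s) \<longlongrightarrow> conv k (dirderiv v g) z) (at 0)"
  proof (rule tendsto_at_iff_sequentially[THEN iffD2], intro allI impI)
    fix \<delta> :: "nat \<Rightarrow> real"
    assume d: "\<forall>i. \<delta> i \<in> UNIV - {0}" and lim: "\<delta> \<longlonglongrightarrow> 0"
    have eq: "(conv k g (z + \<delta> j *\<^sub>R v) - conv k g z) / \<delta> j =
        (\<integral>w. k w * ((g (z - w + \<delta> j *\<^sub>R v) - g (z - w)) / \<delta> j) \<partial>lborel)" for j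
    proof -
      have "conv k g (z + \<delta> j *\<^sub>R v) - conv k g z =
        (\<integral>w. k w * g (z + \<delta> j *\<^sub>R v - w) - k w * g (z - w) \<partial>lborel)"
        unfolding conv_def
        by (intro Bochner_Integration.integral_diff[symmetric] conv_integrable[OF k _ C(1)]) auto
      also have "\<dots> / \<delta> j = (\<integral>w. (k w * g (z + \<delta> j *\<^sub>R v - w) - k w * g (z - w)) / \<delta> j \<partial>lborel)"
        by simp
      finally show ?thesis by (simp add: algebra_simps diff_divide_distrib)
    qed
    show "((\<lambda>s. (conv k g (z + s *\<^sub>R v) - conv k g z) / s) \<circ> \<delta>) \<longlonglongrightarrow> conv k (dirderiv v g) z"
      unfolding o_def eq unfolding conv_def
    proof (rule integral_dominated_convergence[where w="\<lambda>w. C * \<bar>k w\<bar>"])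
      show "AE w in lborel. (\<lambda>j. k w * ((g (z - w + \<delta> j *\<^sub>R v) - g (z - w)) / \<delta> j))
              \<longlonglongrightarrow> k w * dirderiv v g (z - w)"
      proof (intro AE_I2 tendsto_intros)
        fix w
        have "((\<lambda>s. g (z - w + s *\<^sub>R v)) has_real_derivative dirderiv v g (z - w)) (at 0)"
          using has_cont_dirderiv_onD[OF g(2)] by (simp add: has_real_derivative_iff_has_vector_derivative)
        then have "((\<lambda>s. (g (z - w + s *\<^sub>R v) - g (z - w)) / s) \<longlongrightarrow> dirderiv v g (z - w)) (at 0)"
          by (simp add: DERIV_def)
        moreover have "filterlim \<delta> (at 0) sequentially"
          using lim d by (auto simp: filterlim_at)
        ultimately show "(\<lambda>j. (g (z - w + \<delta> j *\<^sub>R v) - g (z - w)) / \<delta> j) \<longlonglongrightarrow> dirderiv v g (z - w)"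
          by (rule filterlim_compose)
      qed
      show "AE w in lborel. norm (k w * ((g (z - w + \<delta> j *\<^sub>R v) - g (z - w)) / \<delta> j)) \<le> C * \<bar>k w\<bar>" for j
      proof (intro AE_I2)
        fix w
        have "\<bar>(g (z - w + \<delta> j *\<^sub>R v) - g (z - w)) / \<delta> j\<bar> \<le> C"
          using dirderiv_diff_bound[OF g(2) C(2), of "z - w" "\<delta> j"] d by (simp add: divide_le_eq)
        then show "norm (k w * ((g (z - w + \<delta> j *\<^sub>R v) - g (z - w)) / \<delta> j)) \<le> C * \<bar>k w\<bar>"
          unfolding real_norm_def by (rule abs_mult_le_mult_abs)
      qed
    qed (use k in auto)
  qed
  then show ?thesis
    by (simp add: has_real_derivative_iff_has_vector_derivative[symmetric] DERIV_def)
qed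

lemma conv_dirderiv_right':
  fixes k g :: "'a::euclidean_space \<Rightarrow> real"
  assumes k: "integrable lborel k"
    and g: "continuous_on UNIV g" "has_cont_dirderiv_on v g UNIV"
    and C: "\<And>z. \<bar>g z\<bar> \<le> C" "\<And>z. \<bar>dirderiv v g z\<bar> \<le> C"
  shows "has_cont_dirderiv_on v (conv k g) UNIV" "dirderiv v (conv k g) = conv k (dirderiv v g)"
proof -
  note D = conv_dirderiv_right[OF assms]
  have cont: "continuous_on UNIV (dirderiv v g)"
    using g(2) unfolding has_cont_dirderiv_on_def by auto
  show "has_cont_dirderiv_on v (conv k g) UNIV"
  proof (rule has_cont_dirderiv_onI[OF D])
    show "continuous_on UNIV (conv k (dirderiv v g))"
      by (rule conv_continuous[OF k _ C(2), where N="{}"]) (use cont in \<open>auto intro: borel_measurable_continuous_onI\<close>)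
  qed
  show "dirderiv v (conv k g) = conv k (dirderiv v g)"
    using dirderiv_eqI[OF D] by auto
qed

text \<open>Here the derivative falls on a kernel that may be singular. The regular approximations
  \<open>kj\<close> can be differentiated, and since \<open>g\<close> is bounded, convergence in L^1
  of the kernels and of their derivatives becomes uniform convergence of the convolutions, so the
  limit may be differentiated.\<close>

lemma conv_dirderiv_left_singular:
  fixes k k1 g :: "'a::euclidean_space \<Rightarrow> real" and kj :: "nat \<Rightarrow> 'a \<Rightarrow> real"
  assumes k: "integrable lborel k" "integrable lborel k1"
    and kj: "\<And>j. continuous_on UNIV (kj j)" "\<And>j. has_cont_dirderiv_on v (kj j) UNIV"
    and supp: "\<And>j. compact (A j)" "\<And>j z. z \<notin> A j \<Longrightarrow> kj j z = 0"
    and lim: "(\<lambda>j. \<integral>w. \<bar>kj j w - k w\<bar> \<partial>lborel) \<longlonglongrightarrow> 0"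
    and lim1: "(\<lambda>j. \<integral>w. \<bar>dirderiv v (kj j) w - k1 w\<bar> \<partial>lborel) \<longlonglongrightarrow> 0"
    and g: "integrable lborel g" "\<And>z. \<bar>g z\<bar> \<le> C"
  shows "((\<lambda>s. conv k g (z + s *\<^sub>R v)) has_vector_derivative conv k1 g z) (at 0)"
proof -
  have [measurable]: "g \<in> borel_measurable borel" "k \<in> borel_measurable borel" "k1 \<in> borel_measurable borel"
    using k g by auto
  have contd: "continuous_on UNIV (dirderiv v (kj j))" for j
    using kj(2) unfolding has_cont_dirderiv_on_def by auto
  have [measurable]: "kj j \<in> borel_measurable borel" "dirderiv v (kj j) \<in> borel_measurable borel" for j
    using kj(1) contd by (auto intro: borel_measurable_continuous_onI)
  have supp': "dirderiv v (kj j) z = 0" if "z \<notin> A j" for j z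
    using dirderiv_zero_outside[OF compact_imp_closed[OF supp(1)] supp(2) that] .
  have int: "integrable lborel (kj j)" "integrable lborel (dirderiv v (kj j))" for j
    by (rule compact_support_integrable[where C="A j"]; use kj(1) contd supp supp' in simp)+
  have diff: "\<bar>conv a g y - conv b g y\<bar> \<le> C * (\<integral>w. \<bar>a w - b w\<bar> \<partial>lborel)"
    if "integrable lborel a" "integrable lborel b" for a b y
  proof -
    have "conv a g y - conv b g y = conv (\<lambda>w. a w - b w) g y"
      unfolding conv_def
      using conv_integrable[where g=g and k=a and z=y and C=C] conv_integrable[where g=g and k=b and z=y and C=C] that g(2)
      by (simp add: left_diff_distrib)
    then show ?thesis
      using conv_abs_le[where g=g and k="\<lambda>w. a w - b w" and z=y and C=C] that g(2) by simp
  qed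
  \<comment> \<open>With the factors exchanged, \<open>g\<close> is the integrable kernel and
    \<open>kj j\<close> the bounded differentiable factor; this is the use of the integrability of
    \<open>g\<close>.\<close>
  have deriv: "((\<lambda>s. conv (kj j) g (y + s *\<^sub>R v)) has_vector_derivative conv (dirderiv v (kj j)) g y) (at 0)" for j y
  proof -
    obtain b1 where b1: "\<And>z. \<bar>kj j z\<bar> \<le> b1"
      using compact_support_imp_bounded[OF kj(1) supp(1) supp(2)] by blast
    obtain b2 where b2: "\<And>z. \<bar>dirderiv v (kj j) z\<bar> \<le> b2"
      using compact_support_imp_bounded[OF contd supp(1) supp'] by blast
    have "((\<lambda>s. conv g (kj j) (y + s *\<^sub>R v)) has_vector_derivative conv g (dirderiv v (kj j)) y) (at 0)"
      by (rule conv_dirderiv_right[OF g(1) kj, where C="max b1 b2"]) (use b1 b2 in \<open>auto simp: le_max_iff_disj\<close>)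
    then show ?thesis by (simp add: conv_comm)
  qed
  have lim0: "(\<lambda>n. conv (kj n) g y) \<longlonglongrightarrow> conv k g y" for y
  proof -
    have "(\<lambda>n. C * (\<integral>w. \<bar>kj n w - k w\<bar> \<partial>lborel)) \<longlonglongrightarrow> 0"
      using tendsto_mult_left[OF lim, of C] by simp
    then have "(\<lambda>n. conv (kj n) g y - conv k g y) \<longlonglongrightarrow> 0"
      by (rule Lim_null_comparison[rotated])
        (use diff[OF int(1) k(1), of _ y] in \<open>auto intro!: always_eventually\<close>)
    then show ?thesis by (rule LIM_zero_cancel)
  qed
  have "\<exists>G. \<forall>x\<in>UNIV. (\<lambda>n. conv (kj n) g (z + x *\<^sub>R v)) \<longlonglongrightarrow> G x \<and>
      (G has_derivative (\<lambda>h. h * conv k1 g (z + x *\<^sub>R v))) (at x within UNIV)"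
  proof (rule has_derivative_sequence[where l="conv k g (z + 0 *\<^sub>R v)"])
    show "((\<lambda>x. conv (kj n) g (z + x *\<^sub>R v)) has_derivative (\<lambda>h. h * conv (dirderiv v (kj n)) g (z + x *\<^sub>R v)))
        (at x within UNIV)" for n x
      using dirderiv_along_line[where f="conv (kj n) g" and z=z and x=x and v=v, OF deriv] by (simp add: has_vector_derivative_def)
    fix e :: real assume "e > 0"
    have "(\<lambda>n. C * (\<integral>w. \<bar>dirderiv v (kj n) w - k1 w\<bar> \<partial>lborel)) \<longlonglongrightarrow> C * 0"
      by (intro tendsto_intros lim1)
    then have "\<forall>\<^sub>F n in sequentially. C * (\<integral>w. \<bar>dirderiv v (kj n) w - k1 w\<bar> \<partial>lborel) < e"
      using \<open>e > 0\<close> by (intro order_tendstoD) auto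
    then show "\<forall>\<^sub>F n in sequentially. \<forall>x\<in>UNIV. \<forall>h. norm (h * conv (dirderiv v (kj n)) g (z + x *\<^sub>R v)
        - h * conv k1 g (z + x *\<^sub>R v)) \<le> e * norm h"
    proof eventually_elim
      case (elim n)
      show ?case
      proof (intro ballI allI)
        fix x h :: real
        have "\<bar>conv (dirderiv v (kj n)) g (z + x *\<^sub>R v) - conv k1 g (z + x *\<^sub>R v)\<bar> \<le> e"
          using diff[OF int(2)[of n] k(2), of "z + x *\<^sub>R v"] elim by simp
        from mult_left_mono[OF this, of "\<bar>h\<bar>"]
        show "norm (h * conv (dirderiv v (kj n)) g (z + x *\<^sub>R v) - h * conv k1 g (z + x *\<^sub>R v)) \<le> e * norm h"
          unfolding right_diff_distrib[symmetric] real_norm_def abs_mult by (simp add: mult.commute)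
      qed
    qed
  next
    show "(\<lambda>n. conv (kj n) g (z + 0 *\<^sub>R v)) \<longlonglongrightarrow> conv k g (z + 0 *\<^sub>R v)"
      by (rule lim0)
  qed auto
  then obtain G where G: "\<And>x. (\<lambda>n. conv (kj n) g (z + x *\<^sub>R v)) \<longlonglongrightarrow> G x"
      "\<And>x. (G has_derivative (\<lambda>h. h * conv k1 g (z + x *\<^sub>R v))) (at x)"
    by auto
  have "G = (\<lambda>x. conv k g (z + x *\<^sub>R v))"
  proof
    fix x
    show "G x = conv k g (z + x *\<^sub>R v)"
      using G(1)[of x] lim0 by (rule LIMSEQ_unique)
  qed
  then show ?thesis using G(2)[of 0] by (simp add: has_vector_derivative_def)
qed

text \<open>Truncated powers make the polynomial pieces of the cutoffs differentiable without case
  distinctions. An exponent of at least \<open>2\<close> flattens the kink at \<open>0\<close>: the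
  difference quotient there is again a truncated power.\<close>

lemma has_real_derivative_max0_power:
  "((\<lambda>t::real. max 0 t ^ Suc (Suc n)) has_real_derivative real (Suc (Suc n)) * max 0 t ^ Suc n) (at t)"
proof -
  consider "t < 0" | "t > 0" | "t = 0" by linarith
  then show ?thesis
  proof cases
    case 1
    have "((\<lambda>t::real. 0) has_real_derivative 0) (at t)" by simp
    then have "((\<lambda>t::real. max 0 t ^ Suc (Suc n)) has_real_derivative 0) (at t)"
      by (rule has_field_derivative_transform_within_open[where S="{..<0}"]) (use 1 in auto)
    then show ?thesis using 1 by simp
  next
    case 2
    have "((\<lambda>t::real. t ^ Suc (Suc n)) has_real_derivative real (Suc (Suc n)) * t ^ Suc n) (at t)"
      using DERIV_pow[of "Suc (Suc n)" t UNIV] by simp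
    then have "((\<lambda>t::real. max 0 t ^ Suc (Suc n)) has_real_derivative real (Suc (Suc n)) * t ^ Suc n) (at t)"
      by (rule has_field_derivative_transform_within_open[where S="{0<..}"]) (use 2 in auto)
    then show ?thesis using 2 by simp
  next
    case 3
    have "((\<lambda>h::real. max 0 h ^ Suc n * (if h > 0 then 1 else 0)) \<longlongrightarrow> 0) (at 0)"
    proof (rule Lim_null_comparison)
      show "\<forall>\<^sub>F h::real in at 0. norm (max 0 h ^ Suc n * (if h > 0 then 1 else 0)) \<le> max 0 h ^ Suc n"
        by (intro always_eventually) auto
      have "((\<lambda>h::real. max 0 h ^ Suc n) \<longlongrightarrow> max 0 0 ^ Suc n) (at 0)"
        by (intro tendsto_intros)
      then show "((\<lambda>h::real. max 0 h ^ Suc n) \<longlongrightarrow> 0) (at 0)" by simp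
    qed
    moreover have "max 0 h ^ Suc n * (if h > 0 then 1 else 0) = max 0 h ^ Suc (Suc n) / h" for h :: real
      by (cases "h > 0") (auto simp: max_def)
    ultimately show ?thesis using 3 by (simp add: DERIV_def)
  qed
qed

section \<open>Cutoff functions and the heat operator\<close>

text \<open>The polynomial below is the septic smoothstep, with derivative \<open>140 t\<^sup>3 (1 - t)\<^sup>3\<close>.\<close>

definition smoothstep :: "real \<Rightarrow> real"
  where "smoothstep t = (if t < 1 then (\<lambda>r. 35*r^4 - 84*r^5 + 70*r^6 - 20*r^7) (max 0 t) else 1)"

text \<open>Equal to \<open>1\<close> up to \<open>1\<close> and to \<open>0\<close> from
  \<open>2\<close> on. The degree of the step is dictated by the heat kernel: the remainder
  \<open>rem1\<close> contains \<open>cut2\<close> and is differentiated once more in space, so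
  \<open>cut3\<close> has to be continuous.\<close>

definition cut :: "real \<Rightarrow> real" where "cut x = 1 - smoothstep (x - 1)"
definition cut1 :: "real \<Rightarrow> real" where "cut1 x = -140 * (max 0 (x - 1) ^ 3 * max 0 (2 - x) ^ 3)"
definition cut2 :: "real \<Rightarrow> real" where
  "cut2 x = -420 * (max 0 (x - 1) ^ 2 * max 0 (2 - x) ^ 3 - max 0 (x - 1) ^ 3 * max 0 (2 - x) ^ 2)"
definition cut3 :: "real \<Rightarrow> real" where
  "cut3 x = -420 * (2 * max 0 (x - 1) * max 0 (2 - x) ^ 3 - 6 * (max 0 (x - 1) ^ 2 * max 0 (2 - x) ^ 2)
     + 2 * max 0 (x - 1) ^ 3 * max 0 (2 - x))"

lemma max0_derivs:
  "((\<lambda>t::real. max 0 t ^ 2) has_real_derivative 2 * max 0 t) (at t)"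
  "((\<lambda>t::real. max 0 t ^ 3) has_real_derivative 3 * max 0 t ^ 2) (at t)"
  using has_real_derivative_max0_power[of 0 t] has_real_derivative_max0_power[of 1 t]
  by (simp_all add: numeral_2_eq_2 numeral_3_eq_3)

lemma smoothstep_deriv:
  "(smoothstep has_real_derivative 140 * (max 0 t ^ 3 * max 0 (1 - t) ^ 3)) (at t)"
proof (cases "t < 1")
  case True
  have p: "((\<lambda>t::real. max 0 t ^ 4) has_real_derivative 4 * max 0 t ^ 3) (at t)"
    "((\<lambda>t::real. max 0 t ^ 5) has_real_derivative 5 * max 0 t ^ 4) (at t)"
    "((\<lambda>t::real. max 0 t ^ 6) has_real_derivative 6 * max 0 t ^ 5) (at t)"
    "((\<lambda>t::real. max 0 t ^ 7) has_real_derivative 7 * max 0 t ^ 6) (at t)"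
    using has_real_derivative_max0_power[of 2 t] has_real_derivative_max0_power[of 3 t]
      has_real_derivative_max0_power[of 4 t] has_real_derivative_max0_power[of 5 t]
    by (simp_all add: eval_nat_numeral)
  have "((\<lambda>t. 35 * max 0 t ^ 4 - 84 * max 0 t ^ 5 + 70 * max 0 t ^ 6 - 20 * max 0 t ^ 7) has_real_derivative
      35 * (4 * max 0 t ^ 3) - 84 * (5 * max 0 t ^ 4) + 70 * (6 * max 0 t ^ 5) - 20 * (7 * max 0 t ^ 6)) (at t)"
    by (intro DERIV_add DERIV_diff DERIV_cmult p)
  also have "35 * (4 * max 0 t ^ 3) - 84 * (5 * max 0 t ^ 4) + 70 * (6 * max 0 t ^ 5) - 20 * (7 * max 0 t ^ 6)
     = 140 * (max 0 t ^ 3 * (1 - max 0 t) ^ 3)" by algebra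
  also have "max 0 t ^ 3 * (1 - max 0 t) ^ 3 = max 0 t ^ 3 * max 0 (1 - t) ^ 3"
    using True by (cases "t \<le> 0") (auto simp: max_def)
  finally have "((\<lambda>t. 35 * max 0 t ^ 4 - 84 * max 0 t ^ 5 + 70 * max 0 t ^ 6 - 20 * max 0 t ^ 7)
    has_real_derivative 140 * (max 0 t ^ 3 * max 0 (1 - t) ^ 3)) (at t)" .
  then show ?thesis
    by (rule has_field_derivative_transform_within_open[where S="{..<1}"]) (use True in \<open>auto simp: smoothstep_def\<close>)
next
  case False
  have h: "((\<lambda>t::real. 1 - t) has_real_derivative -1) (at t)"
    by (auto intro!: derivative_eq_intros)
  have d: "((\<lambda>t::real. max 0 (1 - t) ^ Suc (Suc n)) has_real_derivative - (real (Suc (Suc n)) * max 0 (1 - t) ^ Suc n)) (at t)" for n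
    using DERIV_chain2[where f="\<lambda>t. max 0 t ^ Suc (Suc n)" and g="\<lambda>t. 1 - t" and x=t and s=UNIV and Db="-1",
        OF has_real_derivative_max0_power[of n "1 - t"] h]
    by (simp only: mult_minus1_right)
  have z: "max 0 (1 - t) = 0" using False by auto
  \<comment> \<open>The step is symmetric about \<open>1/2\<close>: one minus the polynomial in
    \<open>1 - t\<close> is the polynomial in \<open>t\<close>. In this form the constant value
    beyond \<open>1\<close> is expressed by truncated powers of \<open>1 - t\<close>.\<close>
  have "((\<lambda>t. 1 - (35 * max 0 (1 - t) ^ 4 - 84 * max 0 (1 - t) ^ 5 + 70 * max 0 (1 - t) ^ 6 - 20 * max 0 (1 - t) ^ 7))
     has_real_derivative 0 - (35 * 0 - 84 * 0 + 70 * 0 - 20 * 0)) (at t)"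
    using d[of 2] d[of 3] d[of 4] d[of 5] unfolding z
    by (intro DERIV_add DERIV_diff DERIV_cmult DERIV_const) (simp_all add: eval_nat_numeral)
  then have "(smoothstep has_real_derivative 0 - (35 * 0 - 84 * 0 + 70 * 0 - 20 * 0)) (at t)"
  proof (rule has_field_derivative_transform_within_open[where S="{0<..}"])
    fix s :: real assume s: "s \<in> {0<..}"
    have "1 - (35 * (1 - s) ^ 4 - 84 * (1 - s) ^ 5 + 70 * (1 - s) ^ 6 - 20 * (1 - s) ^ 7)
      = 35 * s ^ 4 - 84 * s ^ 5 + 70 * s ^ 6 - 20 * s ^ 7" by algebra
    then show "1 - (35 * max 0 (1 - s) ^ 4 - 84 * max 0 (1 - s) ^ 5 + 70 * max 0 (1 - s) ^ 6 - 20 * max 0 (1 - s) ^ 7) = smoothstep s"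
      using s by (auto simp: smoothstep_def max_def)
  qed (use False in auto)
  then show ?thesis using z by simp
qed

lemma cut_deriv: "(cut has_real_derivative cut1 x) (at x)"
proof -
  have "((\<lambda>x. smoothstep (x - 1)) has_real_derivative 140 * (max 0 (x - 1) ^ 3 * max 0 (1 - (x - 1)) ^ 3) * 1) (at x)"
    by (rule DERIV_chain2[OF smoothstep_deriv]) (auto intro!: derivative_eq_intros)
  then have "((\<lambda>x. 1 - smoothstep (x - 1)) has_real_derivative 0 - 140 * (max 0 (x - 1) ^ 3 * max 0 (1 - (x - 1)) ^ 3) * 1) (at x)"
    by (intro DERIV_diff DERIV_const) simp
  then show ?thesis by (simp add: cut_def[abs_def] cut1_def)
qed

lemma shifted_max0_derivs:
  "((\<lambda>x::real. max 0 (x - 1) ^ 2) has_real_derivative 2 * max 0 (x - 1)) (at x)"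
  "((\<lambda>x::real. max 0 (x - 1) ^ 3) has_real_derivative 3 * max 0 (x - 1) ^ 2) (at x)"
  "((\<lambda>x::real. max 0 (2 - x) ^ 2) has_real_derivative - (2 * max 0 (2 - x))) (at x)"
  "((\<lambda>x::real. max 0 (2 - x) ^ 3) has_real_derivative - (3 * max 0 (2 - x) ^ 2)) (at x)"
proof -
  have s: "((\<lambda>x::real. x - 1) has_real_derivative 1) (at x)" "((\<lambda>x::real. 2 - x) has_real_derivative -1) (at x)"
    by (auto intro!: derivative_eq_intros)
  show "((\<lambda>x::real. max 0 (x - 1) ^ 2) has_real_derivative 2 * max 0 (x - 1)) (at x)"
    "((\<lambda>x::real. max 0 (x - 1) ^ 3) has_real_derivative 3 * max 0 (x - 1) ^ 2) (at x)"
    "((\<lambda>x::real. max 0 (2 - x) ^ 2) has_real_derivative - (2 * max 0 (2 - x))) (at x)"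
    "((\<lambda>x::real. max 0 (2 - x) ^ 3) has_real_derivative - (3 * max 0 (2 - x) ^ 2)) (at x)"
    using DERIV_chain2[OF max0_derivs(1) s(1)] DERIV_chain2[OF max0_derivs(2) s(1)]
      DERIV_chain2[OF max0_derivs(1) s(2)] DERIV_chain2[OF max0_derivs(2) s(2)] by simp_all
qed

lemma cut1_deriv: "(cut1 has_real_derivative cut2 x) (at x)"
  unfolding cut1_def[abs_def] cut2_def
  by (rule derivative_eq_intros shifted_max0_derivs refl)+ (simp add: algebra_simps)

lemma cut2_deriv: "(cut2 has_real_derivative cut3 x) (at x)"
  unfolding cut2_def[abs_def] cut3_def
  by (rule derivative_eq_intros shifted_max0_derivs refl)+ (simp add: algebra_simps power2_eq_square)

lemma cut_continuous [continuous_intros]: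
  "continuous_on S f \<Longrightarrow> continuous_on S (\<lambda>x. cut (f x))"
  "continuous_on S f \<Longrightarrow> continuous_on S (\<lambda>x. cut1 (f x))"
  "continuous_on S f \<Longrightarrow> continuous_on S (\<lambda>x. cut2 (f x))"
  "continuous_on S f \<Longrightarrow> continuous_on S (\<lambda>x. cut3 (f x))"
proof -
  have "continuous_on UNIV cut" using cut_deriv by (meson DERIV_continuous_on has_field_derivative_at_within)
  then show "continuous_on S f \<Longrightarrow> continuous_on S (\<lambda>x. cut (f x))"
    by (rule continuous_on_compose2) auto
qed (auto simp: cut1_def cut2_def cut3_def intro!: continuous_intros)

lemma cut_eq: "x \<le> 1 \<Longrightarrow> cut x = 1" "x \<ge> 2 \<Longrightarrow> cut x = 0"
  by (auto simp: cut_def smoothstep_def)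

lemma cut_derivs_eq_0:
  assumes "x \<le> 1 \<or> x \<ge> 2"
  shows "cut1 x = 0" "cut2 x = 0" "cut3 x = 0"
  using assms by (auto simp: cut1_def cut2_def cut3_def max_def)

lemma cut1_nonpos: "cut1 x \<le> 0"
  by (simp add: cut1_def)

lemma cut_antimono: "x \<le> y \<Longrightarrow> cut y \<le> cut x"
  by (rule DERIV_nonpos_imp_nonincreasing) (use cut_deriv cut1_nonpos in blast)+

lemma cut_bounds: "0 \<le> cut x" "cut x \<le> 1"
  using cut_antimono[of x "max x 2"] cut_eq(2)[of "max x 2"] cut_antimono[of "min x 1" x] cut_eq(1)[of "min x 1"]
  by auto

lemma cut_derivs_bound:
  obtains K where "K \<ge> 1" "\<And>x. \<bar>cut1 x\<bar> \<le> K" "\<And>x. \<bar>cut2 x\<bar> \<le> K" "\<And>x. \<bar>cut3 x\<bar> \<le> K"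
proof -
  have *: "\<exists>b\<ge>0. \<forall>x. \<bar>f x\<bar> \<le> b" if "continuous_on UNIV f" "\<And>x. x \<notin> {1..2} \<Longrightarrow> f x = 0" for f :: "real \<Rightarrow> real"
    using compact_support_imp_bounded[of f "{1..2}"] that by (metis compact_Icc)
  have "continuous_on UNIV cut1" "continuous_on UNIV cut2" "continuous_on UNIV cut3"
    using cut_continuous[of UNIV "\<lambda>x. x"] by simp_all
  then obtain b1 b2 b3 where b: "\<And>x. \<bar>cut1 x\<bar> \<le> b1" "\<And>x. \<bar>cut2 x\<bar> \<le> b2" "\<And>x. \<bar>cut3 x\<bar> \<le> b3"
    using *[of cut1] *[of cut2] *[of cut3] cut_derivs_eq_0 by (metis atLeastAtMost_iff linorder_le_cases)
  show thesis
    by (rule that[of "max 1 (max b1 (max b2 b3))"]) (use b in \<open>auto simp: le_max_iff_disj\<close>)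
qed

section \<open>Product and chain rules, the class \<open>C21t\<close> and the adjoint heat
  operator\<close>

lemma dirderiv_mult:
  fixes f g :: "'a::real_normed_vector \<Rightarrow> real"
  assumes "has_cont_dirderiv_on v f S" "has_cont_dirderiv_on v g S" "continuous_on S f" "continuous_on S g"
  shows "has_cont_dirderiv_on v (\<lambda>z. f z * g z) S"
    and "z \<in> S \<Longrightarrow> dirderiv v (\<lambda>z. f z * g z) z = dirderiv v f z * g z + f z * dirderiv v g z"
proof -
  have d: "((\<lambda>s. f (z + s *\<^sub>R v) * g (z + s *\<^sub>R v)) has_vector_derivative dirderiv v f z * g z + f z * dirderiv v g z) (at 0)"
    if "z \<in> S" for z
    using has_cont_dirderiv_onD[OF assms(1) that] has_cont_dirderiv_onD[OF assms(2) that]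
    unfolding has_real_derivative_iff_has_vector_derivative[symmetric]
    by (auto intro!: derivative_eq_intros)
  show "has_cont_dirderiv_on v (\<lambda>z. f z * g z) S"
    using assms by (intro has_cont_dirderiv_onI[OF d]) (auto simp: has_cont_dirderiv_on_def intro!: continuous_intros)
  show "dirderiv v (\<lambda>z. f z * g z) z = dirderiv v f z * g z + f z * dirderiv v g z" if "z \<in> S"
    by (rule dirderiv_eqI[OF d[OF that]])
qed

lemma dirderiv_add:
  fixes f g :: "'a::real_normed_vector \<Rightarrow> real"
  assumes "has_cont_dirderiv_on v f S" "has_cont_dirderiv_on v g S"
  shows "has_cont_dirderiv_on v (\<lambda>z. f z + g z) S"
    and "z \<in> S \<Longrightarrow> dirderiv v (\<lambda>z. f z + g z) z = dirderiv v f z + dirderiv v g z"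
proof -
  have d: "((\<lambda>s. f (z + s *\<^sub>R v) + g (z + s *\<^sub>R v)) has_vector_derivative dirderiv v f z + dirderiv v g z) (at 0)"
    if "z \<in> S" for z
    using has_cont_dirderiv_onD[OF assms(1) that] has_cont_dirderiv_onD[OF assms(2) that]
    by (auto intro!: derivative_eq_intros)
  show "has_cont_dirderiv_on v (\<lambda>z. f z + g z) S"
    using assms by (intro has_cont_dirderiv_onI[OF d]) (auto simp: has_cont_dirderiv_on_def intro!: continuous_intros)
  show "dirderiv v (\<lambda>z. f z + g z) z = dirderiv v f z + dirderiv v g z" if "z \<in> S"
    by (rule dirderiv_eqI[OF d[OF that]])
qed

lemma dirderiv_const:
  "has_cont_dirderiv_on v (\<lambda>_. c) S" "dirderiv v (\<lambda>_. c) = (\<lambda>_. 0)"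
proof -
  show "has_cont_dirderiv_on v (\<lambda>_. c) S"
    by (rule has_cont_dirderiv_onI[where f'="\<lambda>_. 0"]) auto
  show "dirderiv v (\<lambda>_. c) = (\<lambda>_. 0)"
    by (rule ext, rule dirderiv_eqI) simp
qed

lemma dirderiv_chain:
  fixes f :: "'a::real_normed_vector \<Rightarrow> real" and h h' :: "real \<Rightarrow> real"
  assumes f: "has_cont_dirderiv_on v f S" "continuous_on S f"
    and h: "\<And>x. (h has_real_derivative h' x) (at x)" "continuous_on UNIV h'"
  shows "has_cont_dirderiv_on v (\<lambda>z. h (f z)) S"
    and "z \<in> S \<Longrightarrow> dirderiv v (\<lambda>z. h (f z)) z = h' (f z) * dirderiv v f z"
proof -
  have d: "((\<lambda>s. h (f (z + s *\<^sub>R v))) has_vector_derivative h' (f z) * dirderiv v f z) (at 0)"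
    if "z \<in> S" for z
    using has_cont_dirderiv_onD[OF f(1) that] h(1)
    unfolding has_real_derivative_iff_has_vector_derivative[symmetric]
    by (intro DERIV_chain2) auto
  show "has_cont_dirderiv_on v (\<lambda>z. h (f z)) S"
    using f by (intro has_cont_dirderiv_onI[OF d])
      (auto simp: has_cont_dirderiv_on_def intro!: continuous_intros continuous_on_compose2[OF h(2)])
  show "dirderiv v (\<lambda>z. h (f z)) z = h' (f z) * dirderiv v f z" if "z \<in> S"
    by (rule dirderiv_eqI[OF d[OF that]])
qed

lemma dirderiv_shift:
  fixes f :: "'a::real_normed_vector \<Rightarrow> real"
  assumes "has_cont_dirderiv_on v f UNIV"
  shows "has_cont_dirderiv_on v (\<lambda>w. f (w - c)) UNIV"
    and "dirderiv v (\<lambda>w. f (w - c)) = (\<lambda>w. dirderiv v f (w - c))"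
proof -
  have d: "((\<lambda>s. f (w + s *\<^sub>R v - c)) has_vector_derivative dirderiv v f (w - c)) (at 0)" for w
    using has_cont_dirderiv_onD[OF assms, of "w - c"] by (simp add: algebra_simps)
  show "has_cont_dirderiv_on v (\<lambda>w. f (w - c)) UNIV"
    using assms by (intro has_cont_dirderiv_onI[OF d])
      (auto simp: has_cont_dirderiv_on_def intro!: continuous_intros elim!: continuous_on_compose2)
  show "dirderiv v (\<lambda>w. f (w - c)) = (\<lambda>w. dirderiv v f (w - c))"
    by (rule ext, rule dirderiv_eqI[OF d])
qed

lemma dirderiv_reflect:
  fixes f :: "'a::real_normed_vector \<Rightarrow> real"
  assumes "has_cont_dirderiv_on v f UNIV"
  shows "has_cont_dirderiv_on v (\<lambda>w. f (c - w)) UNIV"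
    and "dirderiv v (\<lambda>w. f (c - w)) = (\<lambda>w. - dirderiv v f (c - w))"
proof -
  have d: "((\<lambda>s. f (c - (w + s *\<^sub>R v))) has_vector_derivative - dirderiv v f (c - w)) (at 0)" for w
  proof -
    have "(uminus has_vector_derivative (-1)) (at (0::real))" by (auto intro!: derivative_eq_intros)
    from vector_diff_chain_at[OF this, of "\<lambda>s. f (c - w + s *\<^sub>R v)" "dirderiv v f (c - w)"]
    show ?thesis using has_cont_dirderiv_onD[OF assms, of "c - w"] by (simp add: o_def algebra_simps)
  qed
  show "has_cont_dirderiv_on v (\<lambda>w. f (c - w)) UNIV"
    using assms by (intro has_cont_dirderiv_onI[OF d])
      (auto simp: has_cont_dirderiv_on_def intro!: continuous_intros elim!: continuous_on_compose2)
  show "dirderiv v (\<lambda>w. f (c - w)) = (\<lambda>w. - dirderiv v f (c - w))"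
    by (rule ext, rule dirderiv_eqI[OF d])
qed

text \<open>Only pure second derivatives are asked for, which is all that the calculus with the
  Laplacian needs. The mixed ones required by \<open>C21_on\<close> are established separately, for
  the extension only.\<close>

definition C21t :: "('a::euclidean_space \<times> real \<Rightarrow> real) \<Rightarrow> ('a \<times> real) set \<Rightarrow> bool"
  where "C21t f S \<longleftrightarrow> continuous_on S f \<and> has_cont_dirderiv_on (0, 1) f S \<and>
    (\<forall>b\<in>Basis. has_cont_dirderiv_on (b, 0) f S \<and>
       has_cont_dirderiv_on (b, 0) (dirderiv (b, 0) f) S)"

definition lapl :: "('a::euclidean_space \<times> real \<Rightarrow> real) \<Rightarrow> 'a \<times> real \<Rightarrow> real"
  where "lapl f z = (\<Sum>b\<in>Basis. dirderiv (b, 0) (dirderiv (b, 0) f) z)"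

text \<open>The formal adjoint of the Laplacian minus the time derivative. With this sign, testing
  the equation equates the integrals of \<open>u^p * \<psi>\<close> and of
  \<open>u * adj_heat \<psi>\<close> without minus signs.\<close>

definition adj_heat :: "('a::euclidean_space \<times> real \<Rightarrow> real) \<Rightarrow> 'a \<times> real \<Rightarrow> real"
  where "adj_heat f z = dirderiv (0, 1) f z + lapl f z"

lemma C21tD:
  assumes "C21t f S"
  shows "continuous_on S f" "has_cont_dirderiv_on (0, 1) f S"
    "b \<in> Basis \<Longrightarrow> has_cont_dirderiv_on (b, 0) f S"
    "b \<in> Basis \<Longrightarrow> has_cont_dirderiv_on (b, 0) (dirderiv (b, 0) f) S"
    "continuous_on S (dirderiv (0, 1) f)"
    "b \<in> Basis \<Longrightarrow> continuous_on S (dirderiv (b, 0) f)"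
    "b \<in> Basis \<Longrightarrow> continuous_on S (dirderiv (b, 0) (dirderiv (b, 0) f))"
  using assms unfolding C21t_def has_cont_dirderiv_on_def by auto

lemma adj_heat_continuous: "C21t f S \<Longrightarrow> continuous_on S (adj_heat f)"
  unfolding adj_heat_def[abs_def] lapl_def by (intro continuous_intros C21tD)

lemma lapl_continuous: "C21t f S \<Longrightarrow> continuous_on S (lapl f)"
  unfolding lapl_def[abs_def] by (intro continuous_intros C21tD)

lemma adj_heat_zero_outside:
  assumes "closed C" "\<And>z. z \<notin> C \<Longrightarrow> f z = 0" "z \<notin> C"
  shows "adj_heat f z = 0"
proof -
  have "dirderiv v f w = 0" if "w \<notin> C" for v w
    using dirderiv_zero_outside[OF assms(1,2) that] .
  then have "dirderiv v (dirderiv v f) z = 0" for v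
    using dirderiv_zero_outside[OF assms(1) _ assms(3)] by blast
  then show ?thesis using \<open>\<And>w v. w \<notin> C \<Longrightarrow> dirderiv v f w = 0\<close> assms(3)
    by (simp add: adj_heat_def lapl_def)
qed

lemma C21t_subset: "C21t f S \<Longrightarrow> T \<subseteq> S \<Longrightarrow> C21t f T"
  unfolding C21t_def by (auto intro: has_cont_dirderiv_on_subset continuous_on_subset)

lemma dirderiv2_mult:
  fixes f g :: "'a::real_normed_vector \<Rightarrow> real"
  assumes S: "open S" and f: "has_cont_dirderiv_on v f S" "continuous_on S f" "has_cont_dirderiv_on v (dirderiv v f) S"
    and g: "has_cont_dirderiv_on v g S" "continuous_on S g" "has_cont_dirderiv_on v (dirderiv v g) S"
  shows "has_cont_dirderiv_on v (dirderiv v (\<lambda>z. f z * g z)) S"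
    and "z \<in> S \<Longrightarrow> dirderiv v (dirderiv v (\<lambda>z. f z * g z)) z =
      dirderiv v (dirderiv v f) z * g z + f z * dirderiv v (dirderiv v g) z + 2 * (dirderiv v f z * dirderiv v g z)"
proof -
  have c: "continuous_on S (dirderiv v f)" "continuous_on S (dirderiv v g)"
    using f g unfolding has_cont_dirderiv_on_def by auto
  have e: "dirderiv v f w * g w + f w * dirderiv v g w = dirderiv v (\<lambda>z. f z * g z) w" if "w \<in> S" for w
    using dirderiv_mult(2)[OF f(1) g(1) f(2) g(2) that] by simp
  note a1 = dirderiv_mult(1)[OF f(3) g(1) c(1) g(2)] and a2 = dirderiv_mult(1)[OF f(1) g(3) f(2) c(2)]
  show "has_cont_dirderiv_on v (dirderiv v (\<lambda>z. f z * g z)) S"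
    by (rule has_cont_dirderiv_on_cong_open[OF S e dirderiv_add(1)[OF a1 a2]])
  assume z: "z \<in> S"
  have "dirderiv v (dirderiv v (\<lambda>z. f z * g z)) z = dirderiv v (\<lambda>w. dirderiv v f w * g w + f w * dirderiv v g w) z"
    using e by (intro dirderiv_cong_open[OF S z]) simp
  also have "\<dots> = dirderiv v (dirderiv v f) z * g z + f z * dirderiv v (dirderiv v g) z + 2 * (dirderiv v f z * dirderiv v g z)"
    using dirderiv_add(2)[OF a1 a2 z] dirderiv_mult(2)[OF f(3) g(1) c(1) g(2) z]
      dirderiv_mult(2)[OF f(1) g(3) f(2) c(2) z] by simp
  finally show "dirderiv v (dirderiv v (\<lambda>z. f z * g z)) z =
      dirderiv v (dirderiv v f) z * g z + f z * dirderiv v (dirderiv v g) z + 2 * (dirderiv v f z * dirderiv v g z)" .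
qed

lemma C21t_mult:
  assumes "open S" "C21t f S" "C21t g S"
  shows "C21t (\<lambda>z. f z * g z) S"
  unfolding C21t_def
proof (intro conjI ballI)
  note f = C21tD[OF assms(2)] and g = C21tD[OF assms(3)]
  show "continuous_on S (\<lambda>z. f z * g z)" by (intro continuous_intros f g)
  show "has_cont_dirderiv_on (0, 1) (\<lambda>z. f z * g z) S" by (intro dirderiv_mult(1) f g)
  show "has_cont_dirderiv_on (b, 0) (\<lambda>z. f z * g z) S" if "b \<in> Basis" for b
    using that by (intro dirderiv_mult(1) f g)
  show "has_cont_dirderiv_on (b, 0) (dirderiv (b, 0) (\<lambda>z. f z * g z)) S" if "b \<in> Basis" for b
    using that by (intro dirderiv2_mult(1) f g assms(1))
qed

lemma adj_heat_mult:
  assumes "open S" "C21t f S" "C21t g S" "z \<in> S"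
  shows "adj_heat (\<lambda>z. f z * g z) z = adj_heat f z * g z + f z * adj_heat g z
     + 2 * (\<Sum>b\<in>Basis. dirderiv (b, 0) f z * dirderiv (b, 0) g z)"
proof -
  have "lapl (\<lambda>z. f z * g z) z = (\<Sum>b\<in>Basis. dirderiv (b, 0) (dirderiv (b, 0) f) z * g z
    + f z * dirderiv (b, 0) (dirderiv (b, 0) g) z + 2 * (dirderiv (b, 0) f z * dirderiv (b, 0) g z))"
    unfolding lapl_def using assms by (intro sum.cong refl dirderiv2_mult(2)[where S=S] C21tD)
  also have "\<dots> = lapl f z * g z + f z * lapl g z + 2 * (\<Sum>b\<in>Basis. dirderiv (b, 0) f z * dirderiv (b, 0) g z)"
    by (simp add: lapl_def sum.distrib sum_distrib_left sum_distrib_right)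
  finally show ?thesis
    unfolding adj_heat_def using assms
    by (simp add: dirderiv_mult(2)[of "(0,1)" f S g z] C21tD algebra_simps)
qed

lemma C21t_power:
  assumes "open S" "C21t f S"
  shows "C21t (\<lambda>z. f z ^ n) S"
proof (induction n)
  case 0
  then show ?case by (simp add: C21t_def dirderiv_const)
next
  case (Suc n)
  then show ?case using C21t_mult[OF assms(1,2) Suc] by simp
qed

text \<open>Both terms retain the factor \<open>f z ^ n\<close>. That factor is attached to
  \<open>u\<close> in the absorption argument, so that the heat operator of a power can be
  controlled by the same power.\<close>

lemma adj_heat_power:
  assumes "open S" "C21t f S" "z \<in> S"
  shows "adj_heat (\<lambda>z. f z ^ Suc (Suc n)) z = real (Suc (Suc n)) * f z ^ Suc n * adj_heat f z
     + real (Suc (Suc n)) * real (Suc n) * f z ^ n * (\<Sum>b\<in>Basis. (dirderiv (b, 0) f z)\<^sup>2)"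
proof -
  have d: "dirderiv v (\<lambda>z. f z ^ Suc k) w = real (Suc k) * f w ^ k * dirderiv v f w"
    if "has_cont_dirderiv_on v f S" "w \<in> S" for v w k
  proof (rule dirderiv_chain(2)[OF that(1) C21tD(1)[OF assms(2)], where h="\<lambda>x. x ^ Suc k" and h'="\<lambda>x. real (Suc k) * x ^ k", OF _ _ that(2)])
    show "((\<lambda>x. x ^ Suc k) has_real_derivative real (Suc k) * x ^ k) (at x)" for x :: real
      using DERIV_pow[of "Suc k" x UNIV] by simp
  qed (intro continuous_intros)
  have "dirderiv (b, 0) (dirderiv (b, 0) (\<lambda>z. f z ^ Suc (Suc n))) z =
    real (Suc (Suc n)) * f z ^ Suc n * dirderiv (b, 0) (dirderiv (b, 0) f) z +
    real (Suc (Suc n)) * real (Suc n) * f z ^ n * (dirderiv (b, 0) f z)\<^sup>2" if b: "b \<in> Basis" for b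
  proof -
    note c = C21tD(3,4,6)[OF assms(2) b]
    have pw: "((\<lambda>x. real (Suc (Suc n)) * x ^ Suc n) has_real_derivative real (Suc (Suc n)) * (real (Suc n) * x ^ n)) (at x)" for x
      by (rule DERIV_cmult) (use DERIV_pow[of "Suc n" x UNIV] in simp)
    have "dirderiv (b, 0) (dirderiv (b, 0) (\<lambda>z. f z ^ Suc (Suc n))) z =
      dirderiv (b, 0) (\<lambda>w. (real (Suc (Suc n)) * f w ^ Suc n) * dirderiv (b, 0) f w) z"
      by (intro dirderiv_cong_open[OF assms(1,3)] d c)
    also have "\<dots> = dirderiv (b, 0) (\<lambda>w. real (Suc (Suc n)) * f w ^ Suc n) z * dirderiv (b, 0) f z +
      (real (Suc (Suc n)) * f z ^ Suc n) * dirderiv (b, 0) (dirderiv (b, 0) f) z"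
    proof (rule dirderiv_mult(2)[where S=S])
      show "has_cont_dirderiv_on (b, 0) (\<lambda>w. real (Suc (Suc n)) * f w ^ Suc n) S"
        by (rule dirderiv_chain(1)[OF c(1) C21tD(1)[OF assms(2)], where h="\<lambda>x. real (Suc (Suc n)) * x ^ Suc n" and h'="\<lambda>x. real (Suc (Suc n)) * (real (Suc n) * x ^ n)"])
           (intro pw continuous_intros)+
      show "continuous_on S (\<lambda>w. real (Suc (Suc n)) * f w ^ Suc n)"
        by (intro continuous_intros C21tD(1)[OF assms(2)])
    qed (use c assms in auto)
    also have "dirderiv (b, 0) (\<lambda>w. real (Suc (Suc n)) * f w ^ Suc n) z =
       real (Suc (Suc n)) * (real (Suc n) * f z ^ n) * dirderiv (b, 0) f z"
      by (rule dirderiv_chain(2)[OF c(1) C21tD(1)[OF assms(2)], where h="\<lambda>x. real (Suc (Suc n)) * x ^ Suc n" and h'="\<lambda>x. real (Suc (Suc n)) * (real (Suc n) * x ^ n)", OF _ _ assms(3)])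
         (intro pw continuous_intros)+
    finally show ?thesis by (simp add: power2_eq_square algebra_simps)
  qed
  then have "lapl (\<lambda>z. f z ^ Suc (Suc n)) z = (\<Sum>b\<in>Basis. real (Suc (Suc n)) * f z ^ Suc n * dirderiv (b, 0) (dirderiv (b, 0) f) z +
    real (Suc (Suc n)) * real (Suc n) * f z ^ n * (dirderiv (b, 0) f z)\<^sup>2)"
    unfolding lapl_def by (intro sum.cong refl)
  then have "lapl (\<lambda>z. f z ^ Suc (Suc n)) z = real (Suc (Suc n)) * f z ^ Suc n * lapl f z +
    real (Suc (Suc n)) * real (Suc n) * f z ^ n * (\<Sum>b\<in>Basis. (dirderiv (b, 0) f z)\<^sup>2)"
    by (simp only: lapl_def sum.distrib sum_distrib_left)
  moreover have "dirderiv (0, 1) (\<lambda>z. f z ^ Suc (Suc n)) z = real (Suc (Suc n)) * f z ^ Suc n * dirderiv (0, 1) f z"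
    by (rule d[OF C21tD(2)[OF assms(2)] assms(3)])
  ultimately show ?thesis by (simp only: adj_heat_def distrib_left add.assoc)
qed

text \<open>A squared norm with separate weights: equal ones for the isotropic truncation of the
  heat kernel, \<open>1 / \<epsilon>^2\<close> and \<open>1 / \<epsilon>^4\<close> for bumps at
  parabolic scale.\<close>

definition quad :: "real \<Rightarrow> real \<Rightarrow> 'a::euclidean_space \<times> real \<Rightarrow> real"
  where "quad A B z = A * (norm (fst z))\<^sup>2 + B * (snd z)\<^sup>2"

lemma dirderiv_quad:
  fixes v :: "'a::euclidean_space \<times> real"
  shows "has_cont_dirderiv_on v (quad A B) UNIV"
    and "dirderiv v (quad A B) = (\<lambda>z. 2 * A * (fst z \<bullet> fst v) + 2 * B * (snd z * snd v))"
proof -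
  have d: "((\<lambda>s. quad A B (z + s *\<^sub>R v)) has_vector_derivative 2 * A * (fst z \<bullet> fst v) + 2 * B * (snd z * snd v)) (at 0)" for z
  proof -
    have "(\<lambda>s. quad A B (z + s *\<^sub>R v)) = (\<lambda>s. quad A B z + s * (2 * A * (fst z \<bullet> fst v) + 2 * B * (snd z * snd v))
       + s\<^sup>2 * quad A B v)"
    proof
      fix s
      have "(norm (fst z + s *\<^sub>R fst v))\<^sup>2 = (norm (fst z))\<^sup>2 + 2 * s * (fst z \<bullet> fst v) + s\<^sup>2 * (norm (fst v))\<^sup>2"
        unfolding power2_norm_eq_inner by (simp add: inner_simps inner_commute power2_eq_square algebra_simps)
      then show "quad A B (z + s *\<^sub>R v) = quad A B z + s * (2 * A * (fst z \<bullet> fst v) + 2 * B * (snd z * snd v)) + s\<^sup>2 * quad A B v"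
        by (simp add: quad_def power2_eq_square algebra_simps)
    qed
    then show ?thesis
      unfolding has_real_derivative_iff_has_vector_derivative[symmetric]
      by (auto intro!: derivative_eq_intros)
  qed
  show "has_cont_dirderiv_on v (quad A B) UNIV"
    by (rule has_cont_dirderiv_onI[OF d]) (intro continuous_intros)
  show "dirderiv v (quad A B) = (\<lambda>z. 2 * A * (fst z \<bullet> fst v) + 2 * B * (snd z * snd v))"
    by (rule ext, rule dirderiv_eqI[OF d])
qed

lemma quad_continuous [continuous_intros]: "continuous_on S f \<Longrightarrow> continuous_on S (\<lambda>x. quad A B (f x))"
  unfolding quad_def by (intro continuous_intros)

lemma dirderiv_inner:
  fixes v :: "'a::euclidean_space \<times> real"
  shows "has_cont_dirderiv_on v (\<lambda>z. c * (fst z \<bullet> b)) UNIV"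
    and "dirderiv v (\<lambda>z. c * (fst z \<bullet> b)) = (\<lambda>z. c * (fst v \<bullet> b))"
proof -
  have d: "((\<lambda>s. c * (fst (z + s *\<^sub>R v) \<bullet> b)) has_vector_derivative c * (fst v \<bullet> b)) (at 0)" for z
    unfolding has_real_derivative_iff_has_vector_derivative[symmetric]
    by (auto simp: inner_simps intro!: derivative_eq_intros)
  show "has_cont_dirderiv_on v (\<lambda>z. c * (fst z \<bullet> b)) UNIV"
    by (rule has_cont_dirderiv_onI[OF d]) (intro continuous_intros)
  show "dirderiv v (\<lambda>z. c * (fst z \<bullet> b)) = (\<lambda>z. c * (fst v \<bullet> b))"
    by (rule ext, rule dirderiv_eqI[OF d])
qed

definition ecut :: "real \<Rightarrow> real \<Rightarrow> 'a::euclidean_space \<times> real \<Rightarrow> real"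
  where "ecut A B z = cut (quad A B z)"

lemma continuous_cuts: "continuous_on UNIV cut1" "continuous_on UNIV cut2" "continuous_on UNIV cut3"
  using cut_continuous[of UNIV "\<lambda>x. x"] by simp_all

lemma dirderiv_cut_quad:
  fixes v :: "'a::euclidean_space \<times> real"
  shows "has_cont_dirderiv_on v (\<lambda>z. cut (quad A B z)) UNIV"
    "dirderiv v (\<lambda>z. cut (quad A B z)) = (\<lambda>z. cut1 (quad A B z) * (2 * A * (fst z \<bullet> fst v) + 2 * B * (snd z * snd v)))"
    "has_cont_dirderiv_on v (\<lambda>z. cut1 (quad A B z)) UNIV"
    "dirderiv v (\<lambda>z. cut1 (quad A B z)) = (\<lambda>z. cut2 (quad A B z) * (2 * A * (fst z \<bullet> fst v) + 2 * B * (snd z * snd v)))"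
    "has_cont_dirderiv_on v (\<lambda>z. cut2 (quad A B z)) UNIV"
    "dirderiv v (\<lambda>z. cut2 (quad A B z)) = (\<lambda>z. cut3 (quad A B z) * (2 * A * (fst z \<bullet> fst v) + 2 * B * (snd z * snd v)))"
proof -
  have q: "continuous_on UNIV (quad A B :: 'a \<times> real \<Rightarrow> real)" by (intro continuous_intros)
  show "has_cont_dirderiv_on v (\<lambda>z. cut (quad A B z)) UNIV"
    "has_cont_dirderiv_on v (\<lambda>z. cut1 (quad A B z)) UNIV"
    "has_cont_dirderiv_on v (\<lambda>z. cut2 (quad A B z)) UNIV"
    by (rule dirderiv_chain(1)[OF dirderiv_quad(1) q] cut_deriv cut1_deriv cut2_deriv continuous_cuts)+
  have "dirderiv v (\<lambda>z. cut (quad A B z)) z = cut1 (quad A B z) * dirderiv v (quad A B) z"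
    "dirderiv v (\<lambda>z. cut1 (quad A B z)) z = cut2 (quad A B z) * dirderiv v (quad A B) z"
    "dirderiv v (\<lambda>z. cut2 (quad A B z)) z = cut3 (quad A B z) * dirderiv v (quad A B) z" for z
    by (rule dirderiv_chain(2)[OF dirderiv_quad(1) q] cut_deriv cut1_deriv cut2_deriv continuous_cuts UNIV_I)+
  then show "dirderiv v (\<lambda>z. cut (quad A B z)) = (\<lambda>z. cut1 (quad A B z) * (2 * A * (fst z \<bullet> fst v) + 2 * B * (snd z * snd v)))"
    "dirderiv v (\<lambda>z. cut1 (quad A B z)) = (\<lambda>z. cut2 (quad A B z) * (2 * A * (fst z \<bullet> fst v) + 2 * B * (snd z * snd v)))"
    "dirderiv v (\<lambda>z. cut2 (quad A B z)) = (\<lambda>z. cut3 (quad A B z) * (2 * A * (fst z \<bullet> fst v) + 2 * B * (snd z * snd v)))"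
    by (auto simp: dirderiv_quad(2))
qed

lemma ecut_derivs:
  fixes b :: "'a::euclidean_space"
  shows "dirderiv (0, 1) (ecut A B) = (\<lambda>z::'a\<times>real. cut1 (quad A B z) * (2 * B * snd z))"
    and "dirderiv (b, 0) (ecut A B) = (\<lambda>z. cut1 (quad A B z) * (2 * A * (fst z \<bullet> b)))"
    and "b \<in> Basis \<Longrightarrow> dirderiv (b, 0) (dirderiv (b, 0) (ecut A B)) =
       (\<lambda>z. cut2 (quad A B z) * (2 * A * (fst z \<bullet> b))\<^sup>2 + cut1 (quad A B z) * (2 * A))"
    and "C21t (ecut A B :: 'a \<times> real \<Rightarrow> real) UNIV"
proof -
  show "dirderiv (0, 1) (ecut A B) = (\<lambda>z::'a\<times>real. cut1 (quad A B z) * (2 * B * snd z))"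
    using dirderiv_cut_quad(2)[of "(0::'a, 1)" A B] by (simp add: ecut_def[abs_def])
  have 1: "dirderiv (b, 0) (ecut A B) = (\<lambda>z. cut1 (quad A B z) * (2 * A * (fst z \<bullet> b)))" for b :: 'a
    using dirderiv_cut_quad(2)[of "(b, 0)" A B] by (simp add: ecut_def[abs_def])
  then show "dirderiv (b, 0) (ecut A B) = (\<lambda>z. cut1 (quad A B z) * (2 * A * (fst z \<bullet> b)))" .
  have 2: "has_cont_dirderiv_on (b, 0) (\<lambda>z. cut1 (quad A B z) * (2 * A * (fst z \<bullet> b))) UNIV" for b :: 'a
    by (intro dirderiv_mult(1) dirderiv_cut_quad(3) dirderiv_inner(1) continuous_intros)
  show "dirderiv (b, 0) (dirderiv (b, 0) (ecut A B)) =
       (\<lambda>z. cut2 (quad A B z) * (2 * A * (fst z \<bullet> b))\<^sup>2 + cut1 (quad A B z) * (2 * A))" if b: "b \<in> Basis"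
  proof
    fix z
    have "dirderiv (b, 0) (dirderiv (b, 0) (ecut A B)) z = dirderiv (b, 0) (\<lambda>z. cut1 (quad A B z)) z * (2 * A * (fst z \<bullet> b))
      + cut1 (quad A B z) * dirderiv (b, 0) (\<lambda>z. 2 * A * (fst z \<bullet> b)) z"
      unfolding 1 by (intro dirderiv_mult(2)[where S=UNIV] dirderiv_cut_quad(3) dirderiv_inner(1) continuous_intros UNIV_I)
    then show "dirderiv (b, 0) (dirderiv (b, 0) (ecut A B)) z = cut2 (quad A B z) * (2 * A * (fst z \<bullet> b))\<^sup>2 + cut1 (quad A B z) * (2 * A)"
      using b by (simp add: dirderiv_cut_quad(4) dirderiv_inner(2) power2_eq_square)
  qed
  show "C21t (ecut A B :: 'a \<times> real \<Rightarrow> real) UNIV"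
    unfolding C21t_def
  proof (intro conjI ballI)
    show "continuous_on UNIV (ecut A B :: 'a \<times> real \<Rightarrow> real)" unfolding ecut_def[abs_def] by (intro continuous_intros)
    show "has_cont_dirderiv_on v (ecut A B :: 'a \<times> real \<Rightarrow> real) UNIV"
      "has_cont_dirderiv_on v (ecut A B :: 'a \<times> real \<Rightarrow> real) UNIV" for v
      using dirderiv_cut_quad(1)[of v A B] by (simp_all add: ecut_def[abs_def])
    show "has_cont_dirderiv_on (b, 0) (dirderiv (b, 0) (ecut A B)) UNIV" for b :: 'a
      unfolding 1 by (rule 2)
  qed
qed

lemma C21t_shift:
  fixes f :: "'a::euclidean_space \<times> real \<Rightarrow> real"
  assumes "C21t f UNIV"
  shows "C21t (\<lambda>w. f (w - c)) UNIV"
  using assms unfolding C21t_def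
  by (auto simp: dirderiv_shift intro!: continuous_intros elim!: continuous_on_compose2)

text \<open>Reflection changes the sign of the time derivative but not of the Laplacian, so the
  forward kernel evaluated at \<open>c - w\<close> is a natural test function in \<open>w\<close>
  for the adjoint operator.\<close>

lemma C21t_reflect:
  fixes f :: "'a::euclidean_space \<times> real \<Rightarrow> real"
  assumes "C21t f UNIV"
  shows "C21t (\<lambda>w. f (c - w)) UNIV"
    and "adj_heat (\<lambda>w. f (c - w)) = (\<lambda>w. lapl f (c - w) - dirderiv (0, 1) f (c - w))"
proof -
  have m: "has_cont_dirderiv_on v (\<lambda>w. - g w) UNIV" "dirderiv v (\<lambda>w. - g w) = (\<lambda>w. - dirderiv v g w)"
    if "has_cont_dirderiv_on v g UNIV" for v and g :: "'a \<times> real \<Rightarrow> real"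
  proof -
    have "continuous_on UNIV (\<lambda>x::real. -1::real)" by (rule continuous_on_const)
    then show "has_cont_dirderiv_on v (\<lambda>w. - g w) UNIV" "dirderiv v (\<lambda>w. - g w) = (\<lambda>w. - dirderiv v g w)"
      using has_cont_dirderiv_onD[OF that] that unfolding has_cont_dirderiv_on_def[of v g]
      by (auto intro!: has_cont_dirderiv_onI[where f'="\<lambda>w. - dirderiv v g w"] dirderiv_eqI derivative_eq_intros ext continuous_intros)
  qed
  note f = C21tD[OF assms]
  have c: "continuous_on UNIV (\<lambda>w. f (c - w))"
    by (intro continuous_on_compose2[OF f(1)] continuous_intros) auto
  have 2: "has_cont_dirderiv_on (b, 0) (\<lambda>w. - dirderiv (b, 0) f (c - w)) UNIV"
    "dirderiv (b, 0) (\<lambda>w. - dirderiv (b, 0) f (c - w)) = (\<lambda>w. dirderiv (b, 0) (dirderiv (b, 0) f) (c - w))"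
    if "b \<in> Basis" for b
    using m[OF dirderiv_reflect(1)[OF f(4)[OF that], of c]] dirderiv_reflect(2)[OF f(4)[OF that], of c] by auto
  show "C21t (\<lambda>w. f (c - w)) UNIV"
    unfolding C21t_def using c 2 f by (auto simp: dirderiv_reflect)
  show "adj_heat (\<lambda>w. f (c - w)) = (\<lambda>w. lapl f (c - w) - dirderiv (0, 1) f (c - w))"
    unfolding adj_heat_def[abs_def] lapl_def using 2 f by (auto simp: dirderiv_reflect fun_eq_iff)
qed

section \<open>Gaussian integrals and the heat kernel\<close>

lemma nn_integral_gauss_real:
  assumes "a > 0"
  shows "(\<integral>\<^sup>+x. ennreal (exp (- (a * (x::real)\<^sup>2))) \<partial>lborel) = ennreal (sqrt (pi / a))"
proof -
  \<comment> \<open>The standard deviation for which the normal density has exponent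
    \<open>- a * x^2\<close>.\<close>
  define \<sigma> where "\<sigma> = sqrt (1 / (2 * a))"
  have \<sigma>: "\<sigma> > 0" "\<sigma>\<^sup>2 = 1 / (2 * a)" using assms by (auto simp: \<sigma>_def)
  have d: "exp (- (a * x\<^sup>2)) = sqrt (pi / a) * normal_density 0 \<sigma> x" for x
    using assms by (simp add: normal_density_def \<sigma> real_sqrt_divide field_simps)
  have "(\<integral>\<^sup>+x. ennreal (exp (- (a * x\<^sup>2))) \<partial>lborel) = (\<integral>\<^sup>+x. ennreal (sqrt (pi / a)) * ennreal (normal_density 0 \<sigma> x) \<partial>lborel)"
    unfolding d using assms by (intro nn_integral_cong ennreal_mult) auto
  also have "\<dots> = ennreal (sqrt (pi / a)) * (\<integral>\<^sup>+x. ennreal (normal_density 0 \<sigma> x) \<partial>lborel)"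
    by (intro nn_integral_cmult) auto
  also have "(\<integral>\<^sup>+x. ennreal (normal_density 0 \<sigma> x) \<partial>lborel) = ennreal (\<integral>x. normal_density 0 \<sigma> x \<partial>lborel)"
    using \<sigma>(1) by (intro nn_integral_eq_integral) (auto intro: integrable_normal_density)
  finally show ?thesis using \<sigma>(1) by (simp add: integral_normal_density)
qed

lemma norm_square_eq_sum_Basis: "(norm (y::'a::euclidean_space))\<^sup>2 = (\<Sum>b\<in>Basis. (y \<bullet> b)\<^sup>2)"
  unfolding power2_norm_eq_inner by (subst euclidean_inner) (simp add: power2_eq_square)

lemma nn_integral_gauss:
  assumes "a > 0"
  shows "(\<integral>\<^sup>+y. ennreal (exp (- (a * (norm (y::'a::euclidean_space))\<^sup>2))) \<partial>lborel) = ennreal (sqrt (pi / a) ^ DIM('a))"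
proof -
  have e: "exp (- (a * (norm y)\<^sup>2)) = (\<Prod>b\<in>Basis. exp (- (a * (y \<bullet> b)\<^sup>2)))" for y :: 'a
    unfolding exp_sum[symmetric, OF finite_Basis]
    by (simp add: norm_square_eq_sum_Basis sum_distrib_left sum_negf)
  show ?thesis
    unfolding e
    by (subst prod_ennreal[symmetric], simp, subst nn_integral_lborel_prod)
       (use nn_integral_gauss_real[OF assms] assms in \<open>simp_all add: ennreal_power\<close>)
qed

text \<open>The usual kernel \<open>(4 pi t)^(-n/2) exp (-|x|^2 / (4 t))\<close> with its constant
  split off, so that a pure power of the time remains. The value \<open>0\<close> for nonpositive
  times includes the singular point, the origin.\<close>

definition heat :: "'a::euclidean_space \<times> real \<Rightarrow> real"
  where "heat z = (if snd z > 0 then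
     snd z powr (- real DIM('a) / 2) * exp (- (norm (fst z))\<^sup>2 / (4 * snd z)) / (2 * sqrt pi) ^ DIM('a) else 0)"

lemma heat_nonneg: "heat z \<ge> 0"
  by (auto simp: heat_def)

lemma heat_continuous: "continuous_on {z. snd z > 0} (heat :: 'a::euclidean_space \<times> real \<Rightarrow> real)"
proof -
  have "continuous_on {z::'a\<times>real. snd z > 0} (\<lambda>z. snd z powr (- real DIM('a) / 2) * exp (- (norm (fst z))\<^sup>2 / (4 * snd z)) / (2 * sqrt pi) ^ DIM('a))"
    by (intro continuous_intros) auto
  then show ?thesis by (rule continuous_on_eq) (auto simp: heat_def)
qed

lemma open_snd_pos: "open {z :: 'a::topological_space \<times> real. snd z > h}"
  by (intro open_Collect_less continuous_intros)

lemma open_snd_less: "open {z :: 'a::topological_space \<times> real. snd z < h}"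
  by (intro open_Collect_less continuous_intros)

lemma borel_measurable_half_space:
  fixes f :: "'a::euclidean_space \<times> real \<Rightarrow> real"
  assumes "continuous_on {z. snd z > 0} f" "\<And>z. snd z \<le> 0 \<Longrightarrow> f z = 0"
  shows "f \<in> borel_measurable borel"
proof -
  have "(\<lambda>z. indicator {z. snd z > 0} z *\<^sub>R f z) \<in> borel_measurable borel"
    by (intro borel_measurable_continuous_on_indicator) (auto intro: borel_open open_snd_pos assms)
  moreover have "(\<lambda>z. indicator {z. snd z > 0} z *\<^sub>R f z) = f"
    using assms(2) by (auto simp: indicator_def fun_eq_iff not_less)
  ultimately show ?thesis by simp
qed

lemma heat_measurable [measurable]: "(heat :: 'a::euclidean_space \<times> real \<Rightarrow> real) \<in> borel_measurable borel"
  by (rule borel_measurable_half_space[OF heat_continuous]) (auto simp: heat_def)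

lemma nn_integral_lborel_scale:
  fixes f :: "'a::euclidean_space \<Rightarrow> ennreal"
  assumes [measurable]: "f \<in> borel_measurable borel" and "c > 0"
  shows "(\<integral>\<^sup>+y. f y \<partial>lborel) = ennreal (c ^ DIM('a)) * (\<integral>\<^sup>+y. f (c *\<^sub>R y) \<partial>lborel)"
  using assms by (subst lborel_affine[of c 0]) (auto simp: nn_integral_density nn_integral_distr nn_integral_cmult)

lemma heat_scale:
  assumes "s > 0"
  shows "sqrt s ^ DIM('a) * heat (sqrt s *\<^sub>R y :: 'a::euclidean_space, s) = heat (y, 1)"
proof -
  have "sqrt s ^ DIM('a) = s powr (real DIM('a) / 2)"
    using assms by (simp add: powr_half_sqrt[symmetric] powr_realpow[symmetric] powr_powr)
  then have 1: "sqrt s ^ DIM('a) * s powr (- real DIM('a) / 2) = 1"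
    using assms by (simp add: powr_add[symmetric])
  have 2: "- (norm (sqrt s *\<^sub>R y))\<^sup>2 / (4 * s) = - (norm y)\<^sup>2 / 4"
    using assms by (simp add: power_mult_distrib)
  have "sqrt s ^ DIM('a) * heat (sqrt s *\<^sub>R y, s) = (sqrt s ^ DIM('a) * s powr (- real DIM('a) / 2)) *
    exp (- (norm (sqrt s *\<^sub>R y))\<^sup>2 / (4 * s)) / (2 * sqrt pi) ^ DIM('a)"
    using assms by (simp add: heat_def)
  then show ?thesis
    unfolding 1 2 by (simp add: heat_def)
qed

text \<open>The substitution \<open>sqrt s *\<^sub>R y\<close> reduces every moment to time
  \<open>1\<close>, because the kernel is self-similar at parabolic scale.\<close>

lemma heat_moment_scale:
  assumes s: "s > 0"
  shows "(\<integral>\<^sup>+y. ennreal (norm y ^ j * heat (y::'a::euclidean_space, s)) \<partial>lborel) =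
     ennreal (sqrt s ^ j) * (\<integral>\<^sup>+y. ennreal (norm y ^ j * heat (y::'a, 1)) \<partial>lborel)"
proof -
  have m[measurable]: "(\<lambda>y::'a. heat (y, r)) \<in> borel_measurable borel" for r
    by (rule measurable_compose[OF _ heat_measurable]) simp
  have "(\<integral>\<^sup>+y. ennreal (norm y ^ j * heat (y::'a::euclidean_space, s)) \<partial>lborel) =
    ennreal (sqrt s ^ DIM('a)) * (\<integral>\<^sup>+y. ennreal (norm (sqrt s *\<^sub>R y) ^ j * heat (sqrt s *\<^sub>R y::'a, s)) \<partial>lborel)"
    using s by (intro nn_integral_lborel_scale) auto
  also have "\<dots> = (\<integral>\<^sup>+y. ennreal (sqrt s ^ DIM('a)) * ennreal (norm (sqrt s *\<^sub>R y) ^ j * heat (sqrt s *\<^sub>R y::'a, s)) \<partial>lborel)"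
    by (intro nn_integral_cmult[symmetric]) auto
  also have "\<dots> = (\<integral>\<^sup>+y. ennreal (sqrt s ^ j) * ennreal (norm y ^ j * heat (y::'a, 1)) \<partial>lborel)"
  proof (intro nn_integral_cong)
    fix y :: 'a
    show "ennreal (sqrt s ^ DIM('a)) * ennreal (norm (sqrt s *\<^sub>R y) ^ j * heat (sqrt s *\<^sub>R y, s)) =
       ennreal (sqrt s ^ j) * ennreal (norm y ^ j * heat (y, 1))"
      using s heat_scale[OF s, of y, symmetric] by (simp add: ennreal_mult'[symmetric] power_mult_distrib mult_ac)
  qed
  also have "\<dots> = ennreal (sqrt s ^ j) * (\<integral>\<^sup>+y. ennreal (norm y ^ j * heat (y::'a, 1)) \<partial>lborel)"
    by (intro nn_integral_cmult) auto
  finally show ?thesis .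
qed

lemma heat_mass_1: "(\<integral>\<^sup>+y. ennreal (heat (y::'a::euclidean_space, 1)) \<partial>lborel) = 1"
proof -
  have "(\<integral>\<^sup>+y. ennreal (heat (y::'a, 1)) \<partial>lborel) =
     (\<integral>\<^sup>+y. ennreal (1 / (2 * sqrt pi) ^ DIM('a)) * ennreal (exp (- (1/4 * (norm (y::'a))\<^sup>2))) \<partial>lborel)"
    by (intro nn_integral_cong) (simp add: heat_def ennreal_mult'[symmetric])
  also have "\<dots> = ennreal (1 / (2 * sqrt pi) ^ DIM('a)) * ennreal (sqrt (pi / (1/4)) ^ DIM('a))"
    by (subst nn_integral_cmult, simp, subst nn_integral_gauss) simp_all
  also have "sqrt (pi / (1/4)) = 2 * sqrt pi" by (simp add: real_sqrt_mult)
  finally show ?thesis by (simp add: ennreal_mult'[symmetric])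
qed

lemma heat_moment2_finite: "(\<integral>\<^sup>+y. ennreal (norm y ^ 2 * heat (y::'a::euclidean_space, 1)) \<partial>lborel) < \<infinity>"
proof -
  have "(\<integral>\<^sup>+y. ennreal (norm y ^ 2 * heat (y::'a, 1)) \<partial>lborel) \<le>
     (\<integral>\<^sup>+y. ennreal (8 / (2 * sqrt pi) ^ DIM('a)) * ennreal (exp (- (1/8 * (norm (y::'a))\<^sup>2))) \<partial>lborel)"
  proof (intro nn_integral_mono)
    fix y :: 'a
    \<comment> \<open>Half of the Gaussian exponent pays for the quadratic weight; the other half
      remains integrable.\<close>
    have "norm y ^ 2 / 8 \<le> exp (norm y ^ 2 / 8)"
      using exp_ge_add_one_self[of "norm y ^ 2 / 8"] by linarith
    then have "norm y ^ 2 * exp (- (norm y)\<^sup>2 / 4) \<le> (8 * exp (norm y ^ 2 / 8)) * exp (- (norm y)\<^sup>2 / 4)"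
      by (intro mult_right_mono) auto
    also have "\<dots> = 8 * exp (- (1/8 * (norm y)\<^sup>2))"
      by (simp add: exp_add[symmetric])
    finally show "ennreal (norm y ^ 2 * heat (y, 1)) \<le> ennreal (8 / (2 * sqrt pi) ^ DIM('a)) * ennreal (exp (- (1/8 * (norm y)\<^sup>2)))"
      by (auto simp: heat_def ennreal_mult'[symmetric] intro!: ennreal_leI divide_right_mono)
  qed
  also have "\<dots> = ennreal (8 / (2 * sqrt pi) ^ DIM('a)) * ennreal (sqrt (pi / (1/8)) ^ DIM('a))"
    by (subst nn_integral_cmult, simp, subst nn_integral_gauss) simp_all
  also have "\<dots> < \<infinity>" by (simp add: ennreal_mult'[symmetric])
  finally show ?thesis .
qed

lemma heat_moments:
  obtains M where "M \<ge> 0"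
    "\<And>s. s > 0 \<Longrightarrow> (\<integral>\<^sup>+y. ennreal (heat (y::'a::euclidean_space, s)) \<partial>lborel) = 1"
    "\<And>s. s > 0 \<Longrightarrow> (\<integral>\<^sup>+y. ennreal (norm y * heat (y::'a, s)) \<partial>lborel) \<le> ennreal (M * sqrt s)"
    "\<And>s. s > 0 \<Longrightarrow> (\<integral>\<^sup>+y. ennreal ((norm y)\<^sup>2 * heat (y::'a, s)) \<partial>lborel) \<le> ennreal (M * s)"
proof -
  have m[measurable]: "(\<lambda>y::'a. heat (y, r)) \<in> borel_measurable borel" for r
    by (rule measurable_compose[OF _ heat_measurable]) simp
  define M2 where "M2 = enn2real (\<integral>\<^sup>+y. ennreal (norm y ^ 2 * heat (y::'a, 1)) \<partial>lborel)"
  have M2: "(\<integral>\<^sup>+y. ennreal (norm y ^ 2 * heat (y::'a, 1)) \<partial>lborel) = ennreal M2" "M2 \<ge> 0"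
    using heat_moment2_finite[where 'a='a] by (auto simp: M2_def ennreal_enn2real)
  have "(\<integral>\<^sup>+y. ennreal (norm y ^ 1 * heat (y::'a, 1)) \<partial>lborel) \<le>
      (\<integral>\<^sup>+y. ennreal (heat (y::'a, 1)) + ennreal (norm y ^ 2 * heat (y::'a, 1)) \<partial>lborel)"
  proof (intro nn_integral_mono)
    fix y :: 'a
    have "norm y \<le> 1 + norm y ^ 2"
      using zero_le_power2[of "norm y - 1/2"] by (simp add: power2_eq_square algebra_simps)
    from mult_right_mono[OF this heat_nonneg[of "(y, 1)"]]
    have "ennreal (norm y ^ 1 * heat (y, 1)) \<le> ennreal (heat (y, 1) + norm y ^ 2 * heat (y, 1))"
      by (intro ennreal_leI) (simp add: algebra_simps)
    then show "ennreal (norm y ^ 1 * heat (y, 1)) \<le> ennreal (heat (y, 1)) + ennreal (norm y ^ 2 * heat (y, 1))"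
      by (simp add: ennreal_plus heat_nonneg)
  qed
  also have "\<dots> = 1 + ennreal M2"
    by (subst nn_integral_add) (auto simp: heat_mass_1 M2)
  also have "\<dots> = ennreal (1 + M2)" using M2(2) by (simp add: ennreal_plus)
  finally have M1: "(\<integral>\<^sup>+y. ennreal (norm y ^ 1 * heat (y::'a, 1)) \<partial>lborel) \<le> ennreal (1 + M2)" .
  show thesis
  proof (rule that[of "1 + M2"])
    fix s :: real assume s: "s > 0"
    show "(\<integral>\<^sup>+y. ennreal (heat (y::'a::euclidean_space, s)) \<partial>lborel) = 1"
      using heat_moment_scale[OF s, where j=0 and 'a='a] by (simp add: heat_mass_1)
    show "(\<integral>\<^sup>+y. ennreal (norm y * heat (y::'a, s)) \<partial>lborel) \<le> ennreal ((1 + M2) * sqrt s)"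
    proof -
      have "(\<integral>\<^sup>+y. ennreal (norm y * heat (y::'a, s)) \<partial>lborel) \<le> ennreal (sqrt s) * ennreal (1 + M2)"
        using heat_moment_scale[OF s, where j=1 and 'a='a] mult_left_mono[OF M1, of "ennreal (sqrt s)"] by simp
      also have "\<dots> = ennreal ((1 + M2) * sqrt s)"
        using M2(2) s by (subst ennreal_mult'[symmetric]) (auto simp: mult.commute)
      finally show ?thesis .
    qed
    have "(\<integral>\<^sup>+y. ennreal ((norm y)\<^sup>2 * heat (y::'a, s)) \<partial>lborel) = ennreal s * ennreal M2"
      using heat_moment_scale[OF s, where j=2 and 'a='a] M2 s by simp
    also have "\<dots> \<le> ennreal ((1 + M2) * s)"
      using s M2(2) by (auto simp: ennreal_mult'[symmetric] algebra_simps intro!: ennreal_leI)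
    finally show "(\<integral>\<^sup>+y. ennreal ((norm y)\<^sup>2 * heat (y::'a, s)) \<partial>lborel) \<le> ennreal ((1 + M2) * s)" .
  qed (use M2 in auto)
qed

lemma nn_integral_space_time:
  fixes f :: "'a::euclidean_space \<times> real \<Rightarrow> ennreal"
  assumes [measurable]: "f \<in> borel_measurable borel"
  shows "(\<integral>\<^sup>+z. f z \<partial>lborel) = (\<integral>\<^sup>+s. (\<integral>\<^sup>+y. f (y, s) \<partial>lborel) \<partial>lborel)"
proof -
  have "f \<in> borel_measurable (lborel \<Otimes>\<^sub>M lborel)" by (simp add: lborel_prod)
  from lborel_pair.nn_integral_snd[OF this] show ?thesis by (simp add: lborel_prod)
qed

lemma heat_derivs:
  fixes z :: "'a::euclidean_space \<times> real"
  assumes z: "snd z > 0"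
  shows "((\<lambda>r. heat (z + r *\<^sub>R (0, 1))) has_vector_derivative
      (- real DIM('a) / (2 * snd z) + (norm (fst z))\<^sup>2 / (4 * (snd z)\<^sup>2)) * heat z) (at 0)"
    and "((\<lambda>r. heat (z + r *\<^sub>R (b, 0))) has_vector_derivative - (fst z \<bullet> b) / (2 * snd z) * heat z) (at 0)"
proof -
  define n where "n = real DIM('a)"
  define c where "c = 1 / (2 * sqrt pi) ^ DIM('a)"
  define y s where "y = fst z" and "s = snd z"
  have zz: "z = (y, s)" "s > 0" using z by (auto simp: y_def s_def)
  have "((\<lambda>r. c * ((s + r) powr (- n / 2) * exp (- (norm y)\<^sup>2 / (4 * (s + r))))) has_real_derivative
      c * ((- n / 2) * s powr (- n / 2 - 1) * exp (- (norm y)\<^sup>2 / (4 * s)) + s powr (- n / 2) * (exp (- (norm y)\<^sup>2 / (4 * s)) * ((norm y)\<^sup>2 / (4 * s\<^sup>2))))) (at 0)"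
    using zz(2) by (auto intro!: derivative_eq_intros simp: field_simps power2_eq_square)
  also have "s powr (- n / 2 - 1) = s powr (- n / 2) / s"
    using zz(2) by (simp add: powr_diff)
  finally have d: "((\<lambda>r. c * ((s + r) powr (- n / 2) * exp (- (norm y)\<^sup>2 / (4 * (s + r))))) has_real_derivative
     (- n / (2 * s) + (norm y)\<^sup>2 / (4 * s\<^sup>2)) * heat z) (at 0)"
    using zz by (simp add: heat_def c_def n_def field_simps)
  then have "((\<lambda>r. heat (z + r *\<^sub>R (0, 1))) has_real_derivative
      (- n / (2 * s) + (norm y)\<^sup>2 / (4 * s\<^sup>2)) * heat z) (at 0)"
    by (rule has_field_derivative_transform_within_open[where S="{-s<..}"])
      (use zz in \<open>auto simp: heat_def c_def n_def\<close>)
  then show "((\<lambda>r. heat (z + r *\<^sub>R (0, 1))) has_vector_derivative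
      (- real DIM('a) / (2 * snd z) + (norm (fst z))\<^sup>2 / (4 * (snd z)\<^sup>2)) * heat z) (at 0)"
    using zz by (simp add: has_real_derivative_iff_has_vector_derivative n_def)
  have e: "(norm (y + r *\<^sub>R b))\<^sup>2 = (norm y)\<^sup>2 + 2 * r * (y \<bullet> b) + r\<^sup>2 * (norm b)\<^sup>2" for r
    unfolding power2_norm_eq_inner by (simp add: inner_simps inner_commute power2_eq_square algebra_simps)
  have "((\<lambda>r. s powr (- n / 2) * c * exp (- ((norm y)\<^sup>2 + 2 * r * (y \<bullet> b) + r\<^sup>2 * (norm b)\<^sup>2) / (4 * s))) has_real_derivative
     s powr (- n / 2) * c * (exp (- (norm y)\<^sup>2 / (4 * s)) * (- (y \<bullet> b) / (2 * s)))) (at 0)"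
    using zz(2) by (auto intro!: derivative_eq_intros simp: field_simps)
  moreover have "(\<lambda>r. s powr (- n / 2) * c * exp (- ((norm y)\<^sup>2 + 2 * r * (y \<bullet> b) + r\<^sup>2 * (norm b)\<^sup>2) / (4 * s))) =
     (\<lambda>r. heat (z + r *\<^sub>R (b, 0)))"
    using zz by (auto simp: heat_def c_def n_def e[symmetric] fun_eq_iff)
  ultimately show "((\<lambda>r. heat (z + r *\<^sub>R (b, 0))) has_vector_derivative - (fst z \<bullet> b) / (2 * snd z) * heat z) (at 0)"
    using zz unfolding has_real_derivative_iff_has_vector_derivative[symmetric]
    by (simp add: heat_def c_def n_def field_simps)
qed

abbreviation (input) upper :: "('a::euclidean_space \<times> real) set"
  where "upper \<equiv> {z. snd z > 0}"

lemma heat_C21t: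
  "C21t (heat :: 'a::euclidean_space \<times> real \<Rightarrow> real) upper"
  "snd z > 0 \<Longrightarrow> dirderiv (b, 0) heat z = - (fst z \<bullet> b) / (2 * snd z) * heat z"
  "snd (z :: 'a \<times> real) > 0 \<Longrightarrow> lapl heat z = dirderiv (0, 1) heat z"
proof -
  have cont: "continuous_on upper (\<lambda>z::'a\<times>real. f z * heat z)" if "continuous_on upper f" for f
    by (intro continuous_intros that heat_continuous)
  have b1: "has_cont_dirderiv_on (b, 0) (heat :: 'a \<times> real \<Rightarrow> real) upper" for b
    by (rule has_cont_dirderiv_onI[OF heat_derivs(2)]) (auto intro!: cont continuous_intros)
  have b2: "dirderiv (b, 0) heat z = - (fst z \<bullet> b) / (2 * snd z) * heat z" if "snd z > 0" for b and z :: "'a \<times> real"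
    by (rule dirderiv_eqI[OF heat_derivs(2)[OF that]])
  then show "snd z > 0 \<Longrightarrow> dirderiv (b, 0) heat z = - (fst z \<bullet> b) / (2 * snd z) * heat z" .
  have lin: "((\<lambda>r. - (fst (z + r *\<^sub>R (b, 0)) \<bullet> b) / (2 * snd (z + r *\<^sub>R (b, 0)))) has_vector_derivative - 1 / (2 * snd z)) (at 0)"
    if "b \<in> Basis" "snd z > 0" for b and z :: "'a \<times> real"
  proof -
    have "((\<lambda>r. - (fst z \<bullet> b + r) / (2 * snd z)) has_real_derivative - 1 / (2 * snd z)) (at 0)"
      using that by (auto intro!: derivative_eq_intros)
    then show ?thesis using that
      by (simp add: has_real_derivative_iff_has_vector_derivative inner_simps)
  qed
  define f2 where "f2 = (\<lambda>b. \<lambda>z::'a\<times>real. ((fst z \<bullet> b)\<^sup>2 / (4 * (snd z)\<^sup>2) - 1 / (2 * snd z)) * heat z)"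
  have d2: "((\<lambda>r. dirderiv (b, 0) heat (z + r *\<^sub>R (b, 0))) has_vector_derivative f2 b z) (at 0)"
    if "b \<in> Basis" "snd z > 0" for b and z :: "'a \<times> real"
  proof (rule dirderiv_transfer[OF open_snd_pos[of 0], where f="\<lambda>z. - (fst z \<bullet> b) / (2 * snd z) * heat z"])
    show "((\<lambda>s. - (fst (z + s *\<^sub>R (b, 0)) \<bullet> b) / (2 * snd (z + s *\<^sub>R (b, 0))) * heat (z + s *\<^sub>R (b, 0))) has_vector_derivative f2 b z) (at 0)"
      using lin[OF that] heat_derivs(2)[OF that(2), of b]
      unfolding has_real_derivative_iff_has_vector_derivative[symmetric]
      by (rule DERIV_mult[THEN DERIV_cong]) (use that in \<open>simp add: f2_def field_simps power2_eq_square zero_prod_def[symmetric]\<close>)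
  qed (use that b2 in auto)
  show "C21t (heat :: 'a \<times> real \<Rightarrow> real) upper"
    unfolding C21t_def
  proof (intro conjI ballI b1 heat_continuous)
    show "has_cont_dirderiv_on (0, 1) (heat :: 'a \<times> real \<Rightarrow> real) upper"
      by (rule has_cont_dirderiv_onI[OF heat_derivs(1)]) (auto intro!: cont continuous_intros)
    show "has_cont_dirderiv_on (b, 0) (dirderiv (b, 0) (heat :: 'a \<times> real \<Rightarrow> real)) upper" if "b \<in> Basis" for b
      by (rule has_cont_dirderiv_onI[OF d2[OF that]]) (auto simp: f2_def intro!: cont continuous_intros)
  qed
  show "lapl heat z = dirderiv (0, 1) heat z" if "snd z > 0" for z :: "'a \<times> real"
  proof -
    have "lapl heat z = (\<Sum>b\<in>Basis. f2 b z)"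
      unfolding lapl_def by (intro sum.cong refl dirderiv_eqI d2 that)
    also have "\<dots> = ((\<Sum>b\<in>Basis. (fst z \<bullet> b)\<^sup>2) / (4 * (snd z)\<^sup>2) - DIM('a) / (2 * snd z)) * heat z"
      by (simp add: f2_def sum_distrib_right[symmetric] sum_subtractf sum_divide_distrib)
    also have "(\<Sum>b\<in>Basis. (fst z \<bullet> b)\<^sup>2) = (norm (fst z))\<^sup>2"
      by (simp add: norm_square_eq_sum_Basis)
    also have "((norm (fst z))\<^sup>2 / (4 * (snd z)\<^sup>2) - DIM('a) / (2 * snd z)) * heat z = dirderiv (0, 1) heat z"
      using dirderiv_eqI[OF heat_derivs(1)[OF that]] by simp
    finally show ?thesis .
  qed
qed

lemma has_cont_dirderiv_on_Un:
  assumes "open S" "open T" "has_cont_dirderiv_on v f S" "has_cont_dirderiv_on v f T"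
  shows "has_cont_dirderiv_on v f (S \<union> T)"
  using assms unfolding has_cont_dirderiv_on_def by (auto intro: continuous_on_open_Un)

text \<open>The half-space of positive times and the region where \<open>f\<close> vanishes overlap
  and cover everything, so nothing has to be examined at time \<open>0\<close>. Kernels switched off
  at small times enter the calculus this way.\<close>

lemma has_cont_dirderiv_on_extend:
  fixes f :: "'a::euclidean_space \<times> real \<Rightarrow> real"
  assumes h: "h > 0" and f: "has_cont_dirderiv_on v f upper" "\<And>z. snd z < h \<Longrightarrow> f z = 0"
  shows "has_cont_dirderiv_on v f UNIV" "snd z < h \<Longrightarrow> dirderiv v f z = 0"
proof -
  have 1: "has_cont_dirderiv_on v f {z. snd z < h}"
    by (rule has_cont_dirderiv_on_cong_open[OF open_snd_less _ dirderiv_const(1)[of v 0]]) (use f(2) in auto)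
  have "upper \<union> {z. snd z < h} = (UNIV :: ('a \<times> real) set)" using h by auto
  then show "has_cont_dirderiv_on v f UNIV"
    using has_cont_dirderiv_on_Un[OF open_snd_pos[of 0] open_snd_less[of h] f(1) 1] by simp
  show "dirderiv v f z = 0" if "snd z < h"
    using dirderiv_cong_open[OF open_snd_less[of h], of z f "\<lambda>_. 0" v] that f(2) by (simp add: dirderiv_const)
qed

lemma continuous_on_extend:
  fixes f :: "'a::euclidean_space \<times> real \<Rightarrow> real"
  assumes h: "h > 0" and f: "continuous_on upper f" "\<And>z. snd z < h \<Longrightarrow> f z = 0"
  shows "continuous_on UNIV f"
proof -
  have "continuous_on {z. snd z < h} f"
    by (rule continuous_on_eq[where f="\<lambda>_. 0"]) (use f in auto)
  moreover have "upper \<union> {z. snd z < h} = (UNIV :: ('a \<times> real) set)" using h by auto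
  ultimately show ?thesis
    using continuous_on_open_Un[OF open_snd_pos[of 0] open_snd_less[of h] f(1)] by simp
qed

lemma C21t_extend:
  fixes f :: "'a::euclidean_space \<times> real \<Rightarrow> real"
  assumes "h > 0" "C21t f upper" "\<And>z. snd z < h \<Longrightarrow> f z = 0"
  shows "C21t f UNIV"
  using assms unfolding C21t_def
  by (auto intro!: has_cont_dirderiv_on_extend(1)[OF assms(1)] continuous_on_extend[OF assms(1)]
      has_cont_dirderiv_on_extend(2)[OF assms(1)])

lemma lapl_mult:
  assumes "open S" "C21t f S" "C21t g S" "z \<in> S"
  shows "lapl (\<lambda>z. f z * g z) z = lapl f z * g z + f z * lapl g z
     + 2 * (\<Sum>b\<in>Basis. dirderiv (b, 0) f z * dirderiv (b, 0) g z)"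
proof -
  have "dirderiv (0, 1) (\<lambda>z. f z * g z) z = dirderiv (0, 1) f z * g z + f z * dirderiv (0, 1) g z"
    using assms by (intro dirderiv_mult(2)[where S=S] C21tD)
  with adj_heat_mult[OF assms] show ?thesis
    by (simp add: adj_heat_def algebra_simps)
qed

section \<open>The truncated heat kernel\<close>

text \<open>Switches the kernel on between the times \<open>h\<close> and \<open>2 * h\<close> and
  so keeps it away from its singularity. The price is the time derivative of this factor, which
  times \<open>heat\<close> is \<open>rho h\<close>.\<close>

definition tcut :: "real \<Rightarrow> 'a::euclidean_space \<times> real \<Rightarrow> real"
  where "tcut h z = 1 - cut (snd z / h)"

text \<open>\<open>heat\<close> truncated in space-time by \<open>ecut \<kappa> \<kappa>\<close>; off the origin it solves the heat equation
  up to the bounded remainder \<open>rem1 \<kappa> * heat + rem2 \<kappa> * heat / t\<close>, supported in the annulus.\<close>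

definition kern :: "real \<Rightarrow> 'a::euclidean_space \<times> real \<Rightarrow> real"
  where "kern \<kappa> z = ecut \<kappa> \<kappa> z * heat z"

text \<open>\<open>rem1\<close> collects the derivatives that fall on the truncation alone.
  \<open>rem2\<close> is the cross term, in which the gradient of the heat kernel contributes
  \<open>- x / (2 t)\<close> and hence the extra factor \<open>1 / t\<close>.\<close>

definition rem1 :: "real \<Rightarrow> 'a::euclidean_space \<times> real \<Rightarrow> real"
  where "rem1 \<kappa> z = cut1 (quad \<kappa> \<kappa> z) * (2 * \<kappa> * snd z - 2 * \<kappa> * real DIM('a)) - 4 * \<kappa>\<^sup>2 * (quad 1 0 z * cut2 (quad \<kappa> \<kappa> z))"

definition rem2 :: "real \<Rightarrow> 'a::euclidean_space \<times> real \<Rightarrow> real"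
  where "rem2 \<kappa> z = 2 * \<kappa> * (quad 1 0 z * cut1 (quad \<kappa> \<kappa> z))"

definition hrem :: "real \<Rightarrow> 'a::euclidean_space \<times> real \<Rightarrow> real"
  where "hrem \<kappa> z = (rem1 \<kappa> z + rem2 \<kappa> z / snd z) * heat z"

text \<open>\<open>dkern\<close> and \<open>dhrem\<close> are closed forms of the spatial
  derivatives of \<open>kern\<close> and \<open>hrem\<close> at positive times. Given explicitly,
  they vanish at nonpositive times and can serve as L^1 limits of the derivatives of the
  time-truncated kernels.\<close>

definition dkern :: "real \<Rightarrow> 'a::euclidean_space \<Rightarrow> 'a \<times> real \<Rightarrow> real"
  where "dkern \<kappa> b z = (cut1 (quad \<kappa> \<kappa> z) * (2 * \<kappa> * (fst z \<bullet> b))) * heat z - ecut \<kappa> \<kappa> z * ((fst z \<bullet> b) / (2 * snd z)) * heat z"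

definition dhrem :: "real \<Rightarrow> 'a::euclidean_space \<Rightarrow> 'a \<times> real \<Rightarrow> real"
  where "dhrem \<kappa> b z = dirderiv (b, 0) (rem1 \<kappa>) z * heat z
     + (dirderiv (b, 0) (rem2 \<kappa>) z - rem1 \<kappa> z * ((fst z \<bullet> b) / 2)) * (heat z / snd z)
     - rem2 \<kappa> z * ((fst z \<bullet> b) / 2) * (heat z / (snd z)\<^sup>2)"

lemma tcut_facts:
  assumes "h > 0"
  shows "C21t (tcut h :: 'a::euclidean_space \<times> real \<Rightarrow> real) UNIV"
    and "dirderiv (b, 0) (tcut h :: 'a \<times> real \<Rightarrow> real) = (\<lambda>_. 0)"
    and "dirderiv (0, 1) (tcut h :: 'a \<times> real \<Rightarrow> real) = (\<lambda>z. - cut1 (snd z / h) / h)"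
    and "snd z \<le> h \<Longrightarrow> tcut h z = 0" "0 \<le> tcut h z" "tcut h z \<le> 1" "2 * h \<le> snd z \<Longrightarrow> tcut h z = 1"
proof -
  have x: "((\<lambda>s. tcut h (z + s *\<^sub>R (b, 0))) has_vector_derivative 0) (at 0)" for z and b :: 'a
    by (simp add: tcut_def)
  have t: "((\<lambda>s. tcut h (z + s *\<^sub>R (0, 1))) has_vector_derivative - cut1 (snd z / h) / h) (at 0)" for z :: "'a \<times> real"
  proof -
    have g: "((\<lambda>s. (snd z + s) / h) has_real_derivative 1 / h) (at 0)"
      using assms by (auto intro!: derivative_eq_intros)
    have "((\<lambda>s. cut ((snd z + s) / h)) has_real_derivative cut1 (snd z / h) * (1 / h)) (at 0)"
      using DERIV_chain2[where f=cut and g="\<lambda>s. (snd z + s) / h", OF cut_deriv g] by simp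
    from DERIV_diff[OF DERIV_const[of 1] this] show ?thesis
      by (simp add: tcut_def has_real_derivative_iff_has_vector_derivative)
  qed
  show dx: "dirderiv (b, 0) (tcut h :: 'a \<times> real \<Rightarrow> real) = (\<lambda>_. 0)" for b
    by (rule ext, rule dirderiv_eqI[OF x])
  show "dirderiv (0, 1) (tcut h :: 'a \<times> real \<Rightarrow> real) = (\<lambda>z. - cut1 (snd z / h) / h)"
    by (rule ext, rule dirderiv_eqI[OF t])
  show "C21t (tcut h :: 'a \<times> real \<Rightarrow> real) UNIV"
    unfolding C21t_def dx
  proof (intro conjI ballI dirderiv_const)
    show "continuous_on UNIV (tcut h :: 'a \<times> real \<Rightarrow> real)"
      unfolding tcut_def[abs_def] using assms by (intro continuous_intros) auto
    show "has_cont_dirderiv_on (0, 1) (tcut h :: 'a \<times> real \<Rightarrow> real) UNIV"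
      by (rule has_cont_dirderiv_onI[OF t]) (use assms in \<open>auto intro!: continuous_intros\<close>)
    show "has_cont_dirderiv_on (b, 0) (tcut h :: 'a \<times> real \<Rightarrow> real) UNIV" for b
      by (rule has_cont_dirderiv_onI[OF x]) (intro continuous_intros)
  qed
  show "snd z \<le> h \<Longrightarrow> tcut h z = 0" "0 \<le> tcut h z" "tcut h z \<le> 1" "2 * h \<le> snd z \<Longrightarrow> tcut h z = 1"
    using assms cut_bounds[of "snd z / h"] by (auto simp: tcut_def cut_eq field_simps)
qed

lemma kern_eqs:
  fixes z :: "'a::euclidean_space \<times> real"
  assumes z: "snd z > 0"
  shows "C21t (kern \<kappa> :: 'a \<times> real \<Rightarrow> real) upper"
    "dirderiv (b, 0) (kern \<kappa>) z = dkern \<kappa> b z"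
    "dirderiv (0, 1) (kern \<kappa>) z - lapl (kern \<kappa>) z = hrem \<kappa> z"
proof -
  have c: "C21t (ecut \<kappa> \<kappa> :: 'a \<times> real \<Rightarrow> real) upper" by (rule C21t_subset[OF ecut_derivs(4)]) auto
  have o: "open (upper :: ('a \<times> real) set)" by (rule open_snd_pos)
  have zu: "z \<in> upper" using z by simp
  show "C21t (kern \<kappa> :: 'a \<times> real \<Rightarrow> real) upper"
    unfolding kern_def[abs_def] by (intro C21t_mult o c heat_C21t(1))
  have c': "has_cont_dirderiv_on (b, 0) (ecut \<kappa> \<kappa> :: 'a \<times> real \<Rightarrow> real) upper" for b
    using dirderiv_cut_quad(1)[of "(b, 0)" \<kappa> \<kappa>] unfolding ecut_def[abs_def] by (rule has_cont_dirderiv_on_subset) auto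
  have h': "has_cont_dirderiv_on (b, 0) (heat :: 'a \<times> real \<Rightarrow> real) upper" for b
    by (rule has_cont_dirderiv_onI[OF heat_derivs(2)]) (auto intro!: continuous_intros heat_continuous)
  show "dirderiv (b, 0) (kern \<kappa>) z = dkern \<kappa> b z"
    unfolding kern_def[abs_def]
    using dirderiv_mult(2)[OF c' h' C21tD(1)[OF c] C21tD(1)[OF heat_C21t(1)] zu, of b] z
    by (simp add: ecut_derivs(2) heat_C21t(2) dkern_def)
  have l: "lapl (ecut \<kappa> \<kappa>) z = 4 * \<kappa>\<^sup>2 * (norm (fst z))\<^sup>2 * cut2 (quad \<kappa> \<kappa> z) + 2 * \<kappa> * real DIM('a) * cut1 (quad \<kappa> \<kappa> z)"
  proof -
    have "lapl (ecut \<kappa> \<kappa>) z = (\<Sum>b\<in>Basis. cut2 (quad \<kappa> \<kappa> z) * (2 * \<kappa> * (fst z \<bullet> b))\<^sup>2 + cut1 (quad \<kappa> \<kappa> z) * (2 * \<kappa>))"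
      unfolding lapl_def by (intro sum.cong) (simp_all add: ecut_derivs(3))
    also have "\<dots> = cut2 (quad \<kappa> \<kappa> z) * (4 * \<kappa>\<^sup>2 * (\<Sum>b\<in>Basis. (fst z \<bullet> b)\<^sup>2)) + real DIM('a) * (cut1 (quad \<kappa> \<kappa> z) * (2 * \<kappa>))"
      by (simp add: sum.distrib sum_distrib_left power_mult_distrib mult_ac)
    finally show ?thesis by (simp add: norm_square_eq_sum_Basis algebra_simps)
  qed
  have "(\<Sum>b\<in>Basis. dirderiv (b, 0) (ecut \<kappa> \<kappa>) z * dirderiv (b, 0) heat z) =
     (\<Sum>b\<in>Basis. (fst z \<bullet> b)\<^sup>2 * (- \<kappa> * cut1 (quad \<kappa> \<kappa> z) * heat z / snd z))"
    using z by (intro sum.cong) (auto simp: ecut_derivs(2) heat_C21t(2) power2_eq_square field_simps)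
  also have "\<dots> = (norm (fst z))\<^sup>2 * (- \<kappa> * cut1 (quad \<kappa> \<kappa> z) * heat z / snd z)"
    unfolding sum_distrib_right[symmetric] norm_square_eq_sum_Basis ..
  finally have s: "(\<Sum>b\<in>Basis. dirderiv (b, 0) (ecut \<kappa> \<kappa>) z * dirderiv (b, 0) heat z) =
    (norm (fst z))\<^sup>2 * (- \<kappa> * cut1 (quad \<kappa> \<kappa> z) * heat z / snd z)" .
  have "dirderiv (0, 1) (kern \<kappa>) z = dirderiv (0, 1) (ecut \<kappa> \<kappa>) z * heat z + ecut \<kappa> \<kappa> z * dirderiv (0, 1) heat z"
    unfolding kern_def[abs_def]
    by (intro dirderiv_mult(2)[where S=upper] C21tD[OF c] C21tD[OF heat_C21t(1)] zu)
  moreover have "lapl (kern \<kappa>) z = lapl (ecut \<kappa> \<kappa>) z * heat z + ecut \<kappa> \<kappa> z * lapl heat z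
     + 2 * (\<Sum>b\<in>Basis. dirderiv (b, 0) (ecut \<kappa> \<kappa>) z * dirderiv (b, 0) heat z)"
    unfolding kern_def[abs_def] by (rule lapl_mult[OF o c heat_C21t(1) zu])
  ultimately show "dirderiv (0, 1) (kern \<kappa>) z - lapl (kern \<kappa>) z = hrem \<kappa> z"
    unfolding s l heat_C21t(3)[OF z] ecut_derivs(1)
    by (simp add: hrem_def rem1_def rem2_def quad_def[of 1 0] algebra_simps power2_eq_square)
qed

lemma annulus_compact:
  assumes "\<kappa> > 0"
  shows "compact {z :: 'a::euclidean_space \<times> real. 1 \<le> quad \<kappa> \<kappa> z \<and> quad \<kappa> \<kappa> z \<le> c}"
    "compact {z :: 'a::euclidean_space \<times> real. quad \<kappa> \<kappa> z \<le> c}"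
proof -
  have "quad \<kappa> \<kappa> z = \<kappa> * (norm z)\<^sup>2" for z :: "'a \<times> real"
    by (simp add: quad_def norm_Pair[of "fst z" "snd z", simplified] algebra_simps)
  then have "norm z \<le> sqrt (c / \<kappa>)" if "quad \<kappa> \<kappa> z \<le> c" for z :: "'a \<times> real"
    using that assms by (intro real_le_rsqrt) (simp add: field_simps)
  then have b: "bounded {z :: 'a \<times> real. quad \<kappa> \<kappa> z \<le> c}"
    unfolding bounded_iff by blast
  have cl: "closed {z :: 'a \<times> real. quad \<kappa> \<kappa> z \<le> c}" "closed {z :: 'a \<times> real. 1 \<le> quad \<kappa> \<kappa> z}"
    by (intro closed_Collect_le continuous_intros)+
  show "compact {z :: 'a \<times> real. quad \<kappa> \<kappa> z \<le> c}"
    using b cl by (simp add: compact_eq_bounded_closed)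
  show "compact {z :: 'a \<times> real. 1 \<le> quad \<kappa> \<kappa> z \<and> quad \<kappa> \<kappa> z \<le> c}"
    using b cl by (auto simp: compact_eq_bounded_closed Collect_conj_eq intro: bounded_subset)
qed

text \<open>For \<open>s \<le> 1\<close> the inequality \<open>(1 + x / N)^N \<le> exp x\<close>
  with \<open>x = a / s\<close> beats a power of \<open>1 / s\<close> of order
  \<open>N \<ge> c\<close>; for larger \<open>s\<close> both factors are at most
  \<open>1\<close>.\<close>

lemma powr_exp_bounded:
  assumes "a > 0" "c \<ge> 0"
  obtains C where "\<And>s::real. s > 0 \<Longrightarrow> s powr (- c) * exp (- a / s) \<le> C"
proof -
  define N where "N = Suc (nat \<lceil>c\<rceil>)"
  have N: "c \<le> real N" "N > 0" by (auto simp: N_def) linarith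
  have "s powr (- c) * exp (- a / s) \<le> max 1 ((real N / a) ^ N)" if s: "s > 0" for s
  proof (cases "s \<le> 1")
    case True
    have "s powr (- c) \<le> s powr (- real N)"
      using True s N by (intro powr_mono') auto
    also have "\<dots> = 1 / s ^ N" using s by (simp add: powr_minus powr_realpow divide_inverse)
    also have "\<dots> = (real N / a) ^ N * (a / s / real N) ^ N"
      using assms s N by (simp add: power_mult_distrib[symmetric] power_one_over)
    also have "\<dots> \<le> (real N / a) ^ N * (1 + a / s / real N) ^ N"
      using assms s by (intro mult_left_mono power_mono) auto
    also have "\<dots> \<le> (real N / a) ^ N * exp (a / s)"
      using assms s N by (intro mult_left_mono exp_ge_one_plus_x_over_n_power_n) (auto simp: field_simps intro: order_trans[of _ 0])
    finally have "s powr (- c) * exp (- a / s) \<le> (real N / a) ^ N * exp (a / s) * exp (- a / s)"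
      by (rule mult_right_mono) simp
    also have "\<dots> = (real N / a) ^ N" by (simp add: exp_minus)
    finally show ?thesis by simp
  next
    case False
    have "s powr (- c) \<le> s powr 0"
      using False assms by (intro powr_mono) auto
    then have "s powr (- c) * exp (- a / s) \<le> 1 * 1"
      using False assms s by (intro mult_mono) auto
    then show ?thesis by simp
  qed
  then show thesis using that by blast
qed

text \<open>Away from the origin either the time or the spatial distance is bounded below. In the
  second case the Gaussian factor outweighs every negative power of the time.\<close>

lemma heat_bounded_annulus:
  assumes k: "\<kappa> > 0"
  obtains C where "\<And>z :: 'a::euclidean_space \<times> real. snd z > 0 \<Longrightarrow> 1 \<le> quad \<kappa> \<kappa> z \<Longrightarrow> heat z / snd z ^ j \<le> C"
proof -
  define c where "c = real DIM('a) / 2 + real j"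
  \<comment> \<open>\<open>a\<close> and \<open>s0\<close> are matched: a time below
    \<open>s0\<close> forces \<open>\<kappa> * |y|^2 \<ge> 1/2\<close>, that is
    \<open>|y|^2 \<ge> 4 * a\<close>, and the exponent is then at most
    \<open>- a / s\<close>.\<close>
  define a where "a = 1 / (8 * \<kappa>)"
  define s0 where "s0 = sqrt (1 / (2 * \<kappa>))"
  have pos: "a > 0" "s0 > 0" "c \<ge> 0" using k by (auto simp: a_def s0_def c_def)
  obtain C where C: "\<And>s::real. s > 0 \<Longrightarrow> s powr (- c) * exp (- a / s) \<le> C"
    using powr_exp_bounded[OF pos(1,3)] by blast
  define d where "d = (2 * sqrt pi) ^ DIM('a)"
  have d: "d > 0" by (simp add: d_def)
  have "heat z / snd z ^ j \<le> max C (s0 powr (- c)) / d" if z: "snd z > 0" "1 \<le> quad \<kappa> \<kappa> z" for z :: "'a \<times> real"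
  proof -
    define s where "s = snd z"
    define y where "y = fst z"
    have s: "s > 0" using z by (simp add: s_def)
    have "s powr (- c) = s powr (- real DIM('a) / 2) / s ^ j"
      using s by (simp add: c_def powr_diff powr_realpow)
    then have e: "heat z / snd z ^ j = s powr (- c) * exp (- (norm y)\<^sup>2 / (4 * s)) / d"
      using z by (simp add: heat_def s_def y_def d_def)
    have "s powr (- c) * exp (- (norm y)\<^sup>2 / (4 * s)) \<le> max C (s0 powr (- c))"
    proof (cases "s \<ge> s0")
      case True
      have "s powr (- c) * exp (- (norm y)\<^sup>2 / (4 * s)) \<le> s0 powr (- c) * 1"
        using True pos s by (intro mult_mono powr_mono2') auto
      then show ?thesis by simp
    next
      case False
      have "s\<^sup>2 \<le> s0\<^sup>2" using False s by (intro power_mono) auto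
      then have "\<kappa> * s\<^sup>2 \<le> \<kappa> * (1 / (2 * \<kappa>))"
        using k by (intro mult_left_mono) (auto simp: s0_def)
      then have "1 / 2 \<le> \<kappa> * (norm y)\<^sup>2"
        using z(2) k by (simp add: quad_def s_def y_def)
      then have "4 * a \<le> (norm y)\<^sup>2" using k by (simp add: a_def field_simps)
      then have "exp (- (norm y)\<^sup>2 / (4 * s)) \<le> exp (- a / s)"
        using s by (simp add: field_simps)
      then have "s powr (- c) * exp (- (norm y)\<^sup>2 / (4 * s)) \<le> s powr (- c) * exp (- a / s)"
        by (intro mult_left_mono) auto
      with C[OF s] show ?thesis by linarith
    qed
    then show ?thesis unfolding e using d by (intro divide_right_mono) auto
  qed
  then show thesis using that by blast
qed

lemma fst_snd_borel [measurable]: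
  "(snd :: 'a::euclidean_space \<times> real \<Rightarrow> real) \<in> borel_measurable borel"
  "(fst :: 'a::euclidean_space \<times> real \<Rightarrow> 'a) \<in> borel_measurable borel"
  by (intro borel_measurable_continuous_onI continuous_intros)+

text \<open>Factors supported in the annulus turn \<open>heat / t^j\<close> into a bounded integrable function.\<close>

lemma annulus_kernel:
  fixes g :: "'a::euclidean_space \<times> real \<Rightarrow> real"
  assumes k: "\<kappa> > 0" and g: "continuous_on UNIV g"
    and supp: "\<And>z. quad \<kappa> \<kappa> z < 1 \<or> quad \<kappa> \<kappa> z > 2 \<Longrightarrow> g z = 0"
  shows "\<exists>C. \<forall>z. \<bar>g z * (heat z / snd z ^ j)\<bar> \<le> C"
    and "integrable lborel (\<lambda>z. g z * (heat z / snd z ^ j))"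
proof -
  let ?A = "{z :: 'a \<times> real. 1 \<le> quad \<kappa> \<kappa> z \<and> quad \<kappa> \<kappa> z \<le> 2}"
  note A = annulus_compact(1)[OF k, of 2]
  have [measurable]: "g \<in> borel_measurable borel" using g by (rule borel_measurable_continuous_onI)
  obtain b where b: "b \<ge> 0" "\<And>z. \<bar>g z\<bar> \<le> b"
    using compact_support_imp_bounded[OF g A] supp by (metis (mono_tags, lifting) not_le mem_Collect_eq)
  obtain C where C: "\<And>z :: 'a \<times> real. snd z > 0 \<Longrightarrow> 1 \<le> quad \<kappa> \<kappa> z \<Longrightarrow> heat z / snd z ^ j \<le> C"
    using heat_bounded_annulus[OF k] by blast
  have bound: "\<bar>g z * (heat z / snd z ^ j)\<bar> \<le> b * max C 0 * indicator ?A z" for z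
  proof (cases "g z = 0 \<or> heat z = 0")
    case False
    then have z: "z \<in> ?A" "snd z > 0"
      using supp[of z] by (auto simp: heat_def not_less[symmetric] split: if_splits)
    then have "\<bar>heat z / snd z ^ j\<bar> \<le> max C 0"
      using C[of z] heat_nonneg[of z] by simp
    then have "\<bar>g z\<bar> * \<bar>heat z / snd z ^ j\<bar> \<le> b * max C 0"
      using b by (intro mult_mono) auto
    then show ?thesis using z by (simp add: abs_mult)
  qed (use b in auto)
  then show "\<exists>C. \<forall>z. \<bar>g z * (heat z / snd z ^ j)\<bar> \<le> C"
    using b by (intro exI[of _ "b * max C 0"] allI order_trans[OF bound]) (auto simp: indicator_def)
  have "integrable lborel (\<lambda>z. b * max C 0 * indicator ?A z)"
    using A emeasure_compact_finite[OF A] by (intro integrable_mult_right integrable_real_indicator) (auto intro: borel_compact)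
  then show "integrable lborel (\<lambda>z. g z * (heat z / snd z ^ j))"
    by (rule Bochner_Integration.integrable_bound) (use bound b in \<open>auto simp: abs_mult\<close>)
qed

lemma rem_facts:
  fixes b :: "'a::euclidean_space"
  shows "has_cont_dirderiv_on v (rem1 \<kappa> :: 'a \<times> real \<Rightarrow> real) UNIV" "has_cont_dirderiv_on v (rem2 \<kappa> :: 'a \<times> real \<Rightarrow> real) UNIV"
    "continuous_on UNIV (rem1 \<kappa> :: 'a \<times> real \<Rightarrow> real)" "continuous_on UNIV (rem2 \<kappa> :: 'a \<times> real \<Rightarrow> real)"
    "\<And>z :: 'a \<times> real. quad \<kappa> \<kappa> z < 1 \<or> quad \<kappa> \<kappa> z > 2 \<Longrightarrow> rem1 \<kappa> z = 0"
    "\<And>z :: 'a \<times> real. quad \<kappa> \<kappa> z < 1 \<or> quad \<kappa> \<kappa> z > 2 \<Longrightarrow> rem2 \<kappa> z = 0"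
proof -
  have lin: "has_cont_dirderiv_on v (\<lambda>z::'a\<times>real. 2 * \<kappa> * snd z - 2 * \<kappa> * real DIM('a)) UNIV"
  proof (rule has_cont_dirderiv_onI)
    show "((\<lambda>s. 2 * \<kappa> * snd (z + s *\<^sub>R v) - 2 * \<kappa> * real DIM('a)) has_vector_derivative 2 * \<kappa> * snd v) (at 0)" for z
      unfolding has_real_derivative_iff_has_vector_derivative[symmetric]
      by (auto intro!: derivative_eq_intros)
  qed (intro continuous_intros)
  have cm: "has_cont_dirderiv_on v (\<lambda>z. c * f z) UNIV" if "has_cont_dirderiv_on v f UNIV" "continuous_on UNIV f" for c and f :: "'a \<times> real \<Rightarrow> real"
    by (intro dirderiv_mult(1) dirderiv_const that continuous_intros)
  have minus: "has_cont_dirderiv_on v (\<lambda>z. f z - c * g z) UNIV" if "has_cont_dirderiv_on v f UNIV" "has_cont_dirderiv_on v g UNIV" "continuous_on UNIV g"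
    for f g :: "'a \<times> real \<Rightarrow> real" and c
    using dirderiv_add(1)[OF that(1) cm[OF that(2,3), of "- c"]] by simp
  show "has_cont_dirderiv_on v (rem1 \<kappa> :: 'a \<times> real \<Rightarrow> real) UNIV"
    unfolding rem1_def[abs_def]
    by (intro minus dirderiv_mult(1) lin dirderiv_cut_quad dirderiv_quad continuous_intros)
  show "has_cont_dirderiv_on v (rem2 \<kappa> :: 'a \<times> real \<Rightarrow> real) UNIV"
    unfolding rem2_def[abs_def]
    by (intro cm dirderiv_mult(1) dirderiv_cut_quad dirderiv_quad continuous_intros)
  show "continuous_on UNIV (rem1 \<kappa> :: 'a \<times> real \<Rightarrow> real)" "continuous_on UNIV (rem2 \<kappa> :: 'a \<times> real \<Rightarrow> real)"
    unfolding rem1_def[abs_def] rem2_def[abs_def] by (intro continuous_intros)+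
  show "\<And>z :: 'a \<times> real. quad \<kappa> \<kappa> z < 1 \<or> quad \<kappa> \<kappa> z > 2 \<Longrightarrow> rem1 \<kappa> z = 0"
    "\<And>z :: 'a \<times> real. quad \<kappa> \<kappa> z < 1 \<or> quad \<kappa> \<kappa> z > 2 \<Longrightarrow> rem2 \<kappa> z = 0"
    by (auto simp: rem1_def rem2_def cut_derivs_eq_0)
qed

lemma hrem_facts:
  assumes k: "\<kappa> > 0"
  shows "\<exists>C. \<forall>z. \<bar>hrem \<kappa> (z :: 'a::euclidean_space \<times> real)\<bar> \<le> C"
    and "integrable lborel (hrem \<kappa> :: 'a \<times> real \<Rightarrow> real)"
    and "integrable lborel (dhrem \<kappa> b :: 'a \<times> real \<Rightarrow> real)"
    and "quad \<kappa> \<kappa> (z :: 'a \<times> real) > 2 \<Longrightarrow> hrem \<kappa> z = 0"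
    and "quad \<kappa> \<kappa> (z :: 'a \<times> real) > 2 \<Longrightarrow> dhrem \<kappa> b z = 0"
proof -
  let ?r1 = "rem1 \<kappa> :: 'a \<times> real \<Rightarrow> real" and ?r2 = "rem2 \<kappa> :: 'a \<times> real \<Rightarrow> real"
  note r = rem_facts[where 'a='a and \<kappa>=\<kappa>]
  have h: "hrem \<kappa> = (\<lambda>z. ?r1 z * (heat z / snd z ^ 0) + ?r2 z * (heat z / snd z ^ 1))"
    by (auto simp: hrem_def algebra_simps)
  obtain C1 where C1: "\<And>z. \<bar>?r1 z * (heat z / snd z ^ 0)\<bar> \<le> C1"
    using annulus_kernel(1)[OF k r(3), of 0] r(5) by blast
  obtain C2 where C2: "\<And>z. \<bar>?r2 z * (heat z / snd z ^ 1)\<bar> \<le> C2"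
    using annulus_kernel(1)[OF k r(4), of 1] r(6) by blast
  have "\<bar>hrem \<kappa> z\<bar> \<le> C1 + C2" for z :: "'a \<times> real"
    unfolding h using C1[of z] C2[of z] by linarith
  then show "\<exists>C. \<forall>z. \<bar>hrem \<kappa> (z :: 'a \<times> real)\<bar> \<le> C" by blast
  show "integrable lborel (hrem \<kappa> :: 'a \<times> real \<Rightarrow> real)"
    unfolding h using r by (intro Bochner_Integration.integrable_add annulus_kernel(2)[OF k]) auto
  let ?A = "{z :: 'a \<times> real. 1 \<le> quad \<kappa> \<kappa> z \<and> quad \<kappa> \<kappa> z \<le> 2}"
  have cA: "closed ?A" using annulus_compact(1)[OF k, of 2] by (rule compact_imp_closed)
  have d: "continuous_on UNIV (dirderiv (b, 0) ?r1)" "continuous_on UNIV (dirderiv (b, 0) ?r2)"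
    using r(1,2) unfolding has_cont_dirderiv_on_def by auto
  have d0: "dirderiv (b, 0) ?r1 z = 0" "dirderiv (b, 0) ?r2 z = 0" if "quad \<kappa> \<kappa> z < 1 \<or> quad \<kappa> \<kappa> z > 2" for z
  proof -
    have "z \<notin> ?A" "\<And>w. w \<notin> ?A \<Longrightarrow> ?r1 w = 0" "\<And>w. w \<notin> ?A \<Longrightarrow> ?r2 w = 0"
      using that r(5,6) by (auto simp del: split_paired_All simp: not_le)
    then show "dirderiv (b, 0) ?r1 z = 0" "dirderiv (b, 0) ?r2 z = 0"
      using dirderiv_zero_outside[OF cA] by blast+
  qed
  have dh: "dhrem \<kappa> b = (\<lambda>z. dirderiv (b, 0) ?r1 z * (heat z / snd z ^ 0)
     + (dirderiv (b, 0) ?r2 z - ?r1 z * ((fst z \<bullet> b) / 2)) * (heat z / snd z ^ 1)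
     + (- ?r2 z * ((fst z \<bullet> b) / 2)) * (heat z / snd z ^ 2))"
    by (auto simp: dhrem_def)
  show "integrable lborel (dhrem \<kappa> b :: 'a \<times> real \<Rightarrow> real)"
    unfolding dh using r d d0 by (intro Bochner_Integration.integrable_add annulus_kernel(2)[OF k]) (auto intro!: continuous_intros)
  show "quad \<kappa> \<kappa> (z :: 'a \<times> real) > 2 \<Longrightarrow> hrem \<kappa> z = 0"
    "quad \<kappa> \<kappa> (z :: 'a \<times> real) > 2 \<Longrightarrow> dhrem \<kappa> b z = 0"
    using r(5,6)[of z] d0[of z] by (auto simp: hrem_def dhrem_def)
qed

text \<open>Multiplication by \<open>tcut h\<close> turns the kernel into an admissible test
  function on the whole of space-time. The heat operator leaves two terms: the bounded remainder,
  and the derivative of \<open>tcut h\<close>, which becomes an approximate identity.\<close>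

lemma tcut_kern_facts:
  assumes h: "h > 0"
  shows "C21t (\<lambda>z. tcut h z * kern \<kappa> (z :: 'a::euclidean_space \<times> real)) UNIV"
    and "dirderiv (b, 0) (\<lambda>z. tcut h z * kern \<kappa> (z :: 'a \<times> real)) = (\<lambda>z. tcut h z * dkern \<kappa> b z)"
    and "dirderiv (0, 1) (\<lambda>z. tcut h z * kern \<kappa> (z :: 'a \<times> real)) z - lapl (\<lambda>z. tcut h z * kern \<kappa> z) z
      = tcut h z * hrem \<kappa> z - cut1 (snd z / h) / h * kern \<kappa> z"
proof -
  let ?f = "\<lambda>z. tcut h z * kern \<kappa> (z :: 'a \<times> real)"
  have o: "open (upper :: ('a \<times> real) set)" by (rule open_snd_pos)
  have z0: "?f z = 0" if "snd z < h" for z using tcut_facts(4)[OF h, of z] that by simp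
  have t: "C21t (tcut h :: 'a \<times> real \<Rightarrow> real) upper" by (rule C21t_subset[OF tcut_facts(1)[OF h]]) auto
  have k: "C21t (kern \<kappa> :: 'a \<times> real \<Rightarrow> real) upper" using kern_eqs(1)[of "(0, 1)"] by simp
  have u: "C21t ?f upper" by (intro C21t_mult o t k)
  show U: "C21t ?f UNIV" by (rule C21t_extend[OF h u z0])
  have out: "dirderiv v ?f z = 0" if "snd z < h" for v z
    using dirderiv_cong_open[OF open_snd_less[of h], of z ?f "\<lambda>_. 0" v] that z0 by (simp add: dirderiv_const)
  have out2: "dirderiv v (dirderiv v ?f) z = 0" if "snd z < h" for v z
    using dirderiv_cong_open[OF open_snd_less[of h], of z "dirderiv v ?f" "\<lambda>_. 0" v] that out by (simp add: dirderiv_const)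
  have kd: "has_cont_dirderiv_on (b, 0) (kern \<kappa> :: 'a \<times> real \<Rightarrow> real) upper" for b
  proof -
    have "has_cont_dirderiv_on (b, 0) (ecut \<kappa> \<kappa> :: 'a \<times> real \<Rightarrow> real) upper"
      using dirderiv_cut_quad(1)[of "(b, 0)" \<kappa> \<kappa>] unfolding ecut_def[abs_def] by (rule has_cont_dirderiv_on_subset) auto
    moreover have "has_cont_dirderiv_on (b, 0) (heat :: 'a \<times> real \<Rightarrow> real) upper"
      by (rule has_cont_dirderiv_onI[OF heat_derivs(2)]) (auto intro!: continuous_intros heat_continuous)
    moreover have "continuous_on upper (ecut \<kappa> \<kappa> :: 'a \<times> real \<Rightarrow> real)"
      unfolding ecut_def[abs_def] by (intro continuous_intros)
    ultimately show ?thesis unfolding kern_def[abs_def] by (intro dirderiv_mult(1) heat_continuous)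
  qed
  have td: "has_cont_dirderiv_on (b, 0) (tcut h :: 'a \<times> real \<Rightarrow> real) upper" for b
  proof (rule has_cont_dirderiv_onI)
    show "((\<lambda>s. tcut h (z + s *\<^sub>R (b, 0))) has_vector_derivative 0) (at 0)" for z by (simp add: tcut_def)
  qed auto
  have upper: "dirderiv (b, 0) ?f z = tcut h z * dkern \<kappa> b z" if "snd z > 0" for b z
    using dirderiv_mult(2)[OF td kd C21tD(1)[OF t] C21tD(1)[OF k], of z b] that
    by (simp add: tcut_facts(2)[OF h] kern_eqs(2))
  show "dirderiv (b, 0) ?f = (\<lambda>z. tcut h z * dkern \<kappa> b z)"
  proof
    fix z show "dirderiv (b, 0) ?f z = tcut h z * dkern \<kappa> b z"
      using upper[of z b] out[of z "(b, 0)"] tcut_facts(4)[OF h, of z] h by (cases "snd z > 0") auto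
  qed
  show "dirderiv (0, 1) ?f z - lapl ?f z = tcut h z * hrem \<kappa> z - cut1 (snd z / h) / h * kern \<kappa> z"
  proof (cases "snd z > 0")
    case True
    then have zu: "z \<in> upper" by simp
    have "dirderiv (0, 1) ?f z = dirderiv (0, 1) (tcut h) z * kern \<kappa> z + tcut h z * dirderiv (0, 1) (kern \<kappa>) z"
      by (intro dirderiv_mult(2)[where S=upper] C21tD[OF t] C21tD[OF k] zu)
    moreover have "lapl ?f z = tcut h z * lapl (kern \<kappa>) z"
    proof -
      have "lapl (tcut h) z = 0" by (simp add: lapl_def tcut_facts(2)[OF h] dirderiv_const)
      then show ?thesis
        using lapl_mult[OF o t k zu] by (simp add: tcut_facts(2)[OF h])
    qed
    moreover have "tcut h z * hrem \<kappa> z = tcut h z * dirderiv (0, 1) (kern \<kappa>) z - tcut h z * lapl (kern \<kappa>) z"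
      using kern_eqs(3)[OF True, of \<kappa>] by (simp add: right_diff_distrib[symmetric])
    ultimately show ?thesis
      by (simp add: tcut_facts(3)[OF h])
  next
    case False
    then show ?thesis
      using h out[of z] out2[of z] tcut_facts(4)[OF h, of z]
      by (simp add: lapl_def kern_def heat_def)
  qed
qed

lemma tcut_hrem_facts:
  assumes h: "h > 0"
  shows "has_cont_dirderiv_on (b, 0) (\<lambda>z. tcut h z * hrem \<kappa> (z :: 'a::euclidean_space \<times> real)) UNIV"
    and "continuous_on UNIV (\<lambda>z. tcut h z * hrem \<kappa> (z :: 'a \<times> real))"
    and "dirderiv (b, 0) (\<lambda>z. tcut h z * hrem \<kappa> (z :: 'a \<times> real)) = (\<lambda>z. tcut h z * dhrem \<kappa> b z)"
proof -
  let ?f = "\<lambda>z. tcut h z * hrem \<kappa> (z :: 'a \<times> real)"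
  let ?r1 = "rem1 \<kappa> :: 'a \<times> real \<Rightarrow> real" and ?r2 = "rem2 \<kappa> :: 'a \<times> real \<Rightarrow> real"
  have z0: "?f z = 0" if "snd z < h" for z using tcut_facts(4)[OF h, of z] that by simp
  have r: "has_cont_dirderiv_on (b, 0) ?r1 upper" "has_cont_dirderiv_on (b, 0) ?r2 upper"
    "continuous_on upper ?r1" "continuous_on upper ?r2"
    using has_cont_dirderiv_on_subset[OF rem_facts(1) subset_UNIV] has_cont_dirderiv_on_subset[OF rem_facts(2) subset_UNIV]
      continuous_on_subset[OF rem_facts(3) subset_UNIV] continuous_on_subset[OF rem_facts(4) subset_UNIV] by blast+
  have iv: "((\<lambda>s. 1 / snd (z + s *\<^sub>R (b, 0))) has_vector_derivative 0) (at 0)" for z :: "'a \<times> real"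
    by simp
  have i: "has_cont_dirderiv_on (b, 0) (\<lambda>z::'a\<times>real. 1 / snd z) upper"
    by (rule has_cont_dirderiv_onI[OF iv]) auto
  have i': "dirderiv (b, 0) (\<lambda>z::'a\<times>real. 1 / snd z) z = 0" for z
    by (rule dirderiv_eqI[OF iv])
  have ic: "continuous_on upper (\<lambda>z::'a\<times>real. 1 / snd z)" by (intro continuous_intros) auto
  have hd: "has_cont_dirderiv_on (b, 0) (heat :: 'a \<times> real \<Rightarrow> real) upper"
    by (rule has_cont_dirderiv_onI[OF heat_derivs(2)]) (auto intro!: continuous_intros heat_continuous)
  have td: "has_cont_dirderiv_on (b, 0) (tcut h :: 'a \<times> real \<Rightarrow> real) upper"
  proof (rule has_cont_dirderiv_onI)
    show "((\<lambda>s. tcut h (z + s *\<^sub>R (b, 0))) has_vector_derivative 0) (at 0)" for z by (simp add: tcut_def)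
  qed auto
  have tc: "continuous_on upper (tcut h :: 'a \<times> real \<Rightarrow> real)"
    using C21tD(1)[OF tcut_facts(1)[OF h]] by (rule continuous_on_subset) auto
  note ih = dirderiv_mult[OF i hd ic heat_continuous]
  have ihc: "continuous_on upper (\<lambda>z::'a\<times>real. 1 / snd z * heat z)" by (intro continuous_intros ic heat_continuous)
  note p1 = dirderiv_mult[OF r(1) hd r(3) heat_continuous] and p2 = dirderiv_mult[OF r(2) ih(1) r(4) ihc]
  have hrem: "hrem \<kappa> = (\<lambda>z. ?r1 z * heat z + ?r2 z * (1 / snd z * heat z))"
    by (auto simp: hrem_def algebra_simps)
  note s = dirderiv_add[OF p1(1) p2(1), folded hrem]
  have hc: "continuous_on upper (hrem \<kappa> :: 'a \<times> real \<Rightarrow> real)"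
    unfolding hrem by (intro continuous_intros r ihc heat_continuous)
  note f = dirderiv_mult[OF td s(1) tc hc]
  show "has_cont_dirderiv_on (b, 0) ?f UNIV" by (rule has_cont_dirderiv_on_extend(1)[OF h f(1) z0])
  show "continuous_on UNIV ?f" by (rule continuous_on_extend[OF h _ z0]) (intro continuous_intros tc hc)
  show "dirderiv (b, 0) ?f = (\<lambda>z. tcut h z * dhrem \<kappa> b z)"
  proof
    fix z :: "'a \<times> real"
    show "dirderiv (b, 0) ?f z = tcut h z * dhrem \<kappa> b z"
    proof (cases "snd z > 0")
      case True
      then have zu: "z \<in> upper" by simp
      have "dirderiv (b, 0) ?f z = tcut h z * dirderiv (b, 0) (hrem \<kappa>) z"
        using f(2)[OF zu] by (simp add: tcut_facts(2)[OF h])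
      also have "dirderiv (b, 0) (hrem \<kappa>) z = dhrem \<kappa> b z"
        unfolding s(2)[OF zu] p1(2)[OF zu] p2(2)[OF zu] ih(2)[OF zu] i' heat_C21t(2)[OF True]
        using True by (simp add: dhrem_def field_simps power2_eq_square)
      finally show ?thesis .
    next
      case False
      then show ?thesis
        using has_cont_dirderiv_on_extend(2)[OF h f(1) z0, of z] tcut_facts(4)[OF h, of z] h by simp
    qed
  qed
qed

text \<open>Integrating in space leaves \<open>1 + M * s powr (-1/2)\<close> at time
  \<open>s\<close>, by the moments of the kernel, and this is integrable at \<open>0\<close>. Two
  spatial derivatives would leave a multiple of \<open>1 / s\<close>, so at most one derivative is
  ever put on the heat kernel.\<close>

lemma heat_weight_integrable:
  fixes f :: "'a::euclidean_space \<times> real \<Rightarrow> real"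
  assumes [measurable]: "f \<in> borel_measurable borel"
    and f: "\<And>z. \<bar>f z\<bar> \<le> (if 0 < snd z \<and> snd z \<le> T then heat z + norm (fst z) * heat z / snd z else 0)"
    and T: "T > 0"
  shows "integrable lborel f"
proof -
  obtain M where M: "M \<ge> 0" "\<And>s. s > 0 \<Longrightarrow> (\<integral>\<^sup>+y. ennreal (heat (y::'a, s)) \<partial>lborel) = 1"
    "\<And>s. s > 0 \<Longrightarrow> (\<integral>\<^sup>+y. ennreal (norm y * heat (y::'a, s)) \<partial>lborel) \<le> ennreal (M * sqrt s)"
    using heat_moments[where 'a='a] by metis
  have m[measurable]: "(\<lambda>y::'a. heat (y, r)) \<in> borel_measurable borel" for r
    by (rule measurable_compose[OF _ heat_measurable]) simp
  have inner: "(\<integral>\<^sup>+y. ennreal \<bar>f (y, s)\<bar> \<partial>lborel) \<le> ennreal ((1 + M * s powr (-1/2)) * indicator {0..T} s)" for s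
  proof (cases "0 < s \<and> s \<le> T")
    case True
    then have s: "s > 0" by simp
    have "(\<integral>\<^sup>+y. ennreal \<bar>f (y, s)\<bar> \<partial>lborel) \<le> (\<integral>\<^sup>+y. ennreal (heat (y::'a, s)) + ennreal (1 / s) * ennreal (norm y * heat (y, s)) \<partial>lborel)"
    proof (intro nn_integral_mono)
      fix y :: 'a
      have "ennreal \<bar>f (y, s)\<bar> \<le> ennreal (heat (y, s) + 1 / s * (norm y * heat (y, s)))"
        using f[of "(y, s)"] True by (intro ennreal_leI) simp
      also have "\<dots> = ennreal (heat (y, s)) + ennreal (1 / s) * ennreal (norm y * heat (y, s))"
        using s heat_nonneg[of "(y, s)"] ennreal_mult'[of "1 / s" "norm y * heat (y, s)"]
        by (subst ennreal_plus) auto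
      finally show "ennreal \<bar>f (y, s)\<bar> \<le> ennreal (heat (y, s)) + ennreal (1 / s) * ennreal (norm y * heat (y, s))" .
    qed
    also have "\<dots> = 1 + ennreal (1 / s) * (\<integral>\<^sup>+y. ennreal (norm y * heat (y::'a, s)) \<partial>lborel)"
      by (subst nn_integral_add) (auto simp: M(2)[OF s] nn_integral_cmult)
    also have "\<dots> \<le> 1 + ennreal (1 / s) * ennreal (M * sqrt s)"
      by (intro add_left_mono mult_left_mono M(3) s) auto
    also have "\<dots> = ennreal (1 + 1 / s * (M * sqrt s))"
      using s M(1) by (simp add: ennreal_plus ennreal_mult'[symmetric])
    also have "1 / s * (M * sqrt s) = M * s powr (-1/2)"
    proof -
      have "s powr (-1/2) = s powr (1/2 - 1)" by simp
      also have "\<dots> = s powr (1/2) / s powr 1" by (rule powr_diff)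
      finally show ?thesis using s by (simp add: powr_half_sqrt)
    qed
    finally show ?thesis using True by simp
  next
    case False
    then have "f (y, s) = 0" for y using f[of "(y, s)"] by auto
    then show ?thesis by simp
  qed
  have "((\<lambda>s. s powr (-1/2)) has_integral (T powr (-1/2 + 1) / (-1/2 + 1))) {0..T}"
    by (rule has_integral_powr_from_0) (use T in auto)
  then have "((\<lambda>s. 1 + M * s powr (-1/2)) has_integral ((T - 0) *\<^sub>R 1 + M * (T powr (-1/2 + 1) / (-1/2 + 1)))) {0..T}"
    using T by (intro has_integral_add has_integral_mult_right) (use has_integral_const_real[of "1::real" 0 T] in auto)
  then obtain I where I: "((\<lambda>s. 1 + M * s powr (-1/2)) has_integral I) {0..T}" by blast
  have eq: "(\<lambda>s. if s \<in> {0..T} then 1 + M * s powr (-1/2) else 0) = (\<lambda>s. (1 + M * s powr (-1/2)) * indicator {0..T} s)"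
    by (auto simp: indicator_def)
  have "((\<lambda>s. (1 + M * s powr (-1/2)) * indicator {0..T} s) has_integral I) UNIV"
    using I unfolding has_integral_restrict_UNIV[symmetric, of _ _ "{0..T}"] eq .
  then have fin: "(\<integral>\<^sup>+s. ennreal ((1 + M * s powr (-1/2)) * indicator {0..T} s) \<partial>lborel) = ennreal I"
    using M(1) by (intro nn_integral_has_integral_lborel) (auto simp: indicator_def)
  have "(\<integral>\<^sup>+z. ennreal \<bar>f z\<bar> \<partial>lborel) = (\<integral>\<^sup>+s. (\<integral>\<^sup>+y. ennreal \<bar>f (y, s)\<bar> \<partial>lborel) \<partial>lborel)"
    by (rule nn_integral_space_time) measurable
  also have "\<dots> \<le> ennreal I"
    unfolding fin[symmetric] by (intro nn_integral_mono inner)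
  finally have "(\<integral>\<^sup>+z. ennreal \<bar>f z\<bar> \<partial>lborel) < \<infinity>"
    using ennreal_less_top le_less_trans by (simp add: le_less_trans)
  then show ?thesis
    by (simp add: integrable_iff_bounded)
qed

lemma snd_le_of_quad_le:
  assumes "\<kappa> > 0" "quad \<kappa> \<kappa> z \<le> 2"
  shows "snd z \<le> sqrt (2 / \<kappa>)"
proof -
  have "\<kappa> * (snd z)\<^sup>2 \<le> 2"
    using assms by (auto simp: quad_def intro: order_trans[rotated])
  then show ?thesis
    using assms(1) by (auto intro!: real_le_rsqrt simp: field_simps)
qed

lemma ecut_bounds: "0 \<le> ecut A B z" "ecut A B z \<le> 1" "quad A B z \<ge> 2 \<Longrightarrow> ecut A B z = 0" "quad A B z \<le> 1 \<Longrightarrow> ecut A B z = 1"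
  by (auto simp: ecut_def cut_bounds cut_eq)

lemma kern_integrable:
  assumes k: "\<kappa> > 0"
  shows "integrable lborel (kern \<kappa> :: 'a::euclidean_space \<times> real \<Rightarrow> real)"
    and "b \<in> Basis \<Longrightarrow> integrable lborel (dkern \<kappa> b :: 'a \<times> real \<Rightarrow> real)"
proof -
  have [measurable]: "(ecut \<kappa> \<kappa> :: 'a \<times> real \<Rightarrow> real) \<in> borel_measurable borel"
    by (intro borel_measurable_continuous_onI C21tD(1)[OF ecut_derivs(4)])
  define T where "T = sqrt (2 / \<kappa>)"
  have T: "T > 0" using k by (simp add: T_def)
  have s: "snd z \<le> T" if "ecut \<kappa> \<kappa> z \<noteq> 0" for z :: "'a \<times> real"
    using snd_le_of_quad_le[OF k, of z] ecut_bounds(3)[of \<kappa> \<kappa> z] that by (force simp: T_def)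
  show "integrable lborel (kern \<kappa> :: 'a \<times> real \<Rightarrow> real)"
  proof (rule heat_weight_integrable[OF _ _ T])
    show "(kern \<kappa> :: 'a \<times> real \<Rightarrow> real) \<in> borel_measurable borel" unfolding kern_def[abs_def] by measurable
    show "\<bar>kern \<kappa> z\<bar> \<le> (if 0 < snd z \<and> snd z \<le> T then heat z + norm (fst z) * heat z / snd z else 0)" for z :: "'a \<times> real"
    proof (cases "ecut \<kappa> \<kappa> z = 0 \<or> snd z \<le> 0")
      case False
      have "ecut \<kappa> \<kappa> z * heat z \<le> 1 * heat z"
        by (intro mult_right_mono ecut_bounds heat_nonneg)
      moreover have "0 \<le> norm (fst z) * heat z / snd z" using False by (auto simp: heat_nonneg)
      ultimately have "ecut \<kappa> \<kappa> z * heat z \<le> heat z + norm (fst z) * heat z / snd z" by linarith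
      then show ?thesis using False s[of z] by (simp add: kern_def ecut_bounds heat_nonneg abs_mult)
    qed (auto simp: kern_def heat_def)
  qed
  assume b: "b \<in> Basis"
  have 1: "integrable lborel (\<lambda>z::'a \<times> real. (cut1 (quad \<kappa> \<kappa> z) * (2 * \<kappa> * (fst z \<bullet> b))) * (heat z / snd z ^ 0))"
    by (rule annulus_kernel(2)[OF k]) (auto simp: cut_derivs_eq_0 intro!: continuous_intros)
  have 2: "integrable lborel (\<lambda>z::'a \<times> real. ecut \<kappa> \<kappa> z * ((fst z \<bullet> b) / (2 * snd z)) * heat z)"
  proof (rule heat_weight_integrable[OF _ _ T])
    show "\<bar>ecut \<kappa> \<kappa> z * ((fst z \<bullet> b) / (2 * snd z)) * heat z\<bar> \<le> (if 0 < snd z \<and> snd z \<le> T then heat z + norm (fst z) * heat z / snd z else 0)" for z :: "'a \<times> real"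
    proof (cases "ecut \<kappa> \<kappa> z = 0 \<or> snd z \<le> 0")
      case False
      have "\<bar>ecut \<kappa> \<kappa> z * ((fst z \<bullet> b) / (2 * snd z)) * heat z\<bar> = ecut \<kappa> \<kappa> z * \<bar>(fst z \<bullet> b) / (2 * snd z)\<bar> * heat z"
        by (simp add: abs_mult ecut_bounds heat_nonneg)
      also have "\<dots> \<le> 1 * (norm (fst z) / snd z) * heat z"
      proof (intro mult_right_mono mult_mono ecut_bounds heat_nonneg)
        have "\<bar>fst z \<bullet> b\<bar> \<le> norm (fst z)" by (rule Basis_le_norm[OF b])
        then have "\<bar>fst z \<bullet> b\<bar> \<le> norm (fst z) * 2" using norm_ge_zero[of "fst z"] by linarith
        then show "\<bar>(fst z \<bullet> b) / (2 * snd z)\<bar> \<le> norm (fst z) / snd z"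
          using False by (simp add: field_simps)
      qed auto
      finally show ?thesis using False s[of z] heat_nonneg[of z] by simp
    qed (auto simp: heat_def)
  qed measurable
  show "integrable lborel (dkern \<kappa> b :: 'a \<times> real \<Rightarrow> real)"
    using Bochner_Integration.integrable_diff[OF 1 2] by (simp add: dkern_def[abs_def])
qed

text \<open>At each positive time the truncation is eventually inactive, at the other times
  \<open>f\<close> vanishes, and \<open>\<bar>f\<bar>\<close> dominates.\<close>

lemma tcut_L1_limit:
  fixes f :: "'a::euclidean_space \<times> real \<Rightarrow> real"
  assumes f: "integrable lborel f" "\<And>z. snd z \<le> 0 \<Longrightarrow> f z = 0"
    and \<delta>: "\<And>j. \<delta> j > 0" "\<delta> \<longlonglongrightarrow> (0::real)"
  shows "(\<lambda>j. \<integral>z. \<bar>tcut (\<delta> j) z * f z - f z\<bar> \<partial>lborel) \<longlonglongrightarrow> 0"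
proof -
  have [measurable]: "f \<in> borel_measurable borel" using f by auto
  have [measurable]: "(tcut (\<delta> j) :: 'a \<times> real \<Rightarrow> real) \<in> borel_measurable borel" for j
    by (intro borel_measurable_continuous_onI C21tD(1)[OF tcut_facts(1)] \<delta>)
  have "(\<lambda>j. \<integral>z. \<bar>tcut (\<delta> j) z * f z - f z\<bar> \<partial>lborel) \<longlonglongrightarrow> (\<integral>z. 0 \<partial>(lborel :: ('a \<times> real) measure))"
  proof (rule integral_dominated_convergence[where w="\<lambda>z. \<bar>f z\<bar>"])
    show "AE z in lborel. norm \<bar>tcut (\<delta> j) z * f z - f z\<bar> \<le> \<bar>f z\<bar>" for j
    proof (intro AE_I2)
      fix z
      have "\<bar>tcut (\<delta> j) z * f z - f z\<bar> = \<bar>tcut (\<delta> j) z - 1\<bar> * \<bar>f z\<bar>"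
        by (simp add: abs_mult[symmetric] algebra_simps)
      also have "\<dots> \<le> 1 * \<bar>f z\<bar>"
        using tcut_facts(5,6)[OF \<delta>(1)[of j], of z] by (intro mult_right_mono) auto
      finally show "norm \<bar>tcut (\<delta> j) z * f z - f z\<bar> \<le> \<bar>f z\<bar>" by simp
    qed
    show "AE z in lborel. (\<lambda>j. \<bar>tcut (\<delta> j) z * f z - f z\<bar>) \<longlonglongrightarrow> 0"
    proof (intro AE_I2)
      fix z :: "'a \<times> real"
      show "(\<lambda>j. \<bar>tcut (\<delta> j) z * f z - f z\<bar>) \<longlonglongrightarrow> 0"
      proof (cases "snd z > 0")
        case True
        have "\<forall>\<^sub>F j in sequentially. \<delta> j < snd z / 2" using \<delta>(2) True by (intro order_tendstoD) auto
        then have "\<forall>\<^sub>F j in sequentially. \<bar>tcut (\<delta> j) z * f z - f z\<bar> = 0"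
          by eventually_elim (simp add: tcut_facts(7)[OF \<delta>(1)])
        then show ?thesis by (rule tendsto_eventually)
      qed (use f(2) in auto)
    qed
  qed (use f in auto)
  then show ?thesis by simp
qed

text \<open>Heat kernels averaged over the times from \<open>h\<close> to \<open>2 * h\<close> with
  a weight of integral \<open>1\<close>; hence an approximate identity as \<open>h\<close> tends to
  \<open>0\<close>.\<close>

definition rho :: "real \<Rightarrow> 'a::euclidean_space \<times> real \<Rightarrow> real"
  where "rho h z = - cut1 (snd z / h) / h * heat z"

lemma rho_measurable [measurable]: "rho h \<in> borel_measurable borel"
proof -
  have "continuous_on UNIV cut1" by (rule continuous_cuts)
  then have [measurable]: "cut1 \<in> borel_measurable borel" by (rule borel_measurable_continuous_onI)
  show ?thesis unfolding rho_def[abs_def] by measurable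
qed

lemma rho_nonneg: "h > 0 \<Longrightarrow> rho h z \<ge> 0"
  using cut1_nonpos[of "snd z / h"] by (simp add: rho_def heat_nonneg divide_nonpos_pos mult_nonpos_nonneg)

lemma nn_integral_cut1:
  assumes h: "h > 0"
  shows "(\<integral>\<^sup>+s. ennreal (- cut1 (s / h) / h) * indicator {0..2 * h} s \<partial>lborel) = 1"
proof -
  have c: "continuous_on UNIV (\<lambda>s. - cut1 (s / h) / h)"
    using h by (intro continuous_intros) auto
  have "((\<lambda>s. - cut (s / h)) has_real_derivative - cut1 (s / h) / h) (at s)" for s
  proof -
    have g: "((\<lambda>s. s / h) has_real_derivative 1 / h) (at s)"
      using h by (auto intro!: derivative_eq_intros)
    from DERIV_minus[OF DERIV_chain2[where f=cut and g="\<lambda>s. s / h", OF cut_deriv g]] show ?thesis by simp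
  qed
  then have "(\<integral>\<^sup>+s. ennreal (- cut1 (s / h) / h) * indicator {0..2 * h} s \<partial>lborel) = ennreal ((- cut ((2 * h) / h)) - (- cut (0 / h)))"
    using h cut1_nonpos borel_measurable_continuous_onI[OF c]
    by (intro nn_integral_FTC_Icc) (auto intro!: divide_nonpos_pos)
  then show ?thesis using h by (simp add: cut_eq)
qed

text \<open>The second moment is all that is needed to express concentration at the origin: the
  Gaussian contributes a multiple of \<open>h\<close>, the time at most
  \<open>(2 * h)^2\<close>.\<close>

lemma rho_integrals:
  assumes h: "h > 0"
  shows "(\<integral>\<^sup>+z. ennreal (rho h (z :: 'a::euclidean_space \<times> real)) \<partial>lborel) = 1"
    and "\<exists>M\<ge>0. \<forall>h>0. (\<integral>\<^sup>+z. ennreal ((norm z)\<^sup>2 * rho h (z :: 'a \<times> real)) \<partial>lborel) \<le> ennreal (M * h + 4 * h\<^sup>2)"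
proof -
  obtain M where M: "M \<ge> 0" "\<And>s. s > 0 \<Longrightarrow> (\<integral>\<^sup>+y. ennreal (heat (y::'a, s)) \<partial>lborel) = 1"
    "\<And>s. s > 0 \<Longrightarrow> (\<integral>\<^sup>+y. ennreal ((norm y)\<^sup>2 * heat (y::'a, s)) \<partial>lborel) \<le> ennreal (M * s)"
    by (rule heat_moments[where 'a='a]) blast
  have m[measurable]: "(\<lambda>y::'a. heat (y, r)) \<in> borel_measurable borel" for r
    by (rule measurable_compose[OF _ heat_measurable]) simp
  have r: "ennreal (w * rho h (y, s)) = ennreal (- cut1 (s / h) / h) * indicator {0..2 * h} s * ennreal (w * heat (y :: 'a, s))"
    if "w \<ge> 0" "h > 0" for y s w h
  proof (cases "0 < s \<and> s \<le> 2 * h")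
    case True
    have "0 \<le> - cut1 (s / h) / h" using cut1_nonpos[of "s / h"] that by (simp add: divide_nonpos_pos)
    from ennreal_mult'[OF this, of "w * heat (y, s)"] True show ?thesis
      by (simp add: rho_def mult.left_commute)
  next
    case False
    then have "s \<le> 0 \<or> s / h \<ge> 2" using that by (auto simp: field_simps)
    then show ?thesis by (auto simp: rho_def heat_def cut_derivs_eq_0 indicator_def)
  qed
  have r': "(\<integral>\<^sup>+y. ennreal (w y * rho h (y, s)) \<partial>lborel) = ennreal (- cut1 (s / h) / h) * indicator {0..2 * h} s *
      (\<integral>\<^sup>+y. ennreal (w y * heat (y :: 'a, s)) \<partial>lborel)"
    if [measurable]: "w \<in> borel_measurable borel" and w: "\<And>y. w y \<ge> 0" "h > 0" for s w h
    unfolding r[OF w] by (rule nn_integral_cmult) measurable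
  have "(\<integral>\<^sup>+z. ennreal (rho h (z :: 'a \<times> real)) \<partial>lborel) = (\<integral>\<^sup>+s. (\<integral>\<^sup>+y. ennreal (1 * rho h (y :: 'a, s)) \<partial>lborel) \<partial>lborel)"
    by (simp, rule nn_integral_space_time) measurable
  also have "\<dots> = (\<integral>\<^sup>+s. ennreal (- cut1 (s / h) / h) * indicator {0..2 * h} s * (\<integral>\<^sup>+y. ennreal (1 * heat (y :: 'a, s)) \<partial>lborel) \<partial>lborel)"
    using h by (subst r') auto
  also have "\<dots> = (\<integral>\<^sup>+s. ennreal (- cut1 (s / h) / h) * indicator {0..2 * h} s \<partial>lborel)"
  proof (intro nn_integral_cong)
    fix s :: real
    show "ennreal (- cut1 (s / h) / h) * indicator {0..2 * h} s * (\<integral>\<^sup>+y. ennreal (1 * heat (y :: 'a, s)) \<partial>lborel) =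
      ennreal (- cut1 (s / h) / h) * indicator {0..2 * h} s"
      using M(2)[of s] by (cases "s = 0") (auto simp: cut_derivs_eq_0 indicator_def)
  qed
  also have "\<dots> = 1" by (rule nn_integral_cut1[OF h])
  finally show "(\<integral>\<^sup>+z. ennreal (rho h (z :: 'a \<times> real)) \<partial>lborel) = 1" .
  show "\<exists>M\<ge>0. \<forall>h>0. (\<integral>\<^sup>+z. ennreal ((norm z)\<^sup>2 * rho h (z :: 'a \<times> real)) \<partial>lborel) \<le> ennreal (M * h + 4 * h\<^sup>2)"
  proof (intro exI[of _ "2 * M"] conjI allI impI)
    fix h :: real assume h: "h > 0"
    have "(\<integral>\<^sup>+z. ennreal ((norm z)\<^sup>2 * rho h (z :: 'a \<times> real)) \<partial>lborel) = (\<integral>\<^sup>+s. (\<integral>\<^sup>+y. ennreal ((norm (y, s))\<^sup>2 * rho h (y :: 'a, s)) \<partial>lborel) \<partial>lborel)"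
      by (rule nn_integral_space_time) measurable
    also have "\<dots> = (\<integral>\<^sup>+s. ennreal (- cut1 (s / h) / h) * indicator {0..2 * h} s * (\<integral>\<^sup>+y. ennreal ((norm (y, s))\<^sup>2 * heat (y :: 'a, s)) \<partial>lborel) \<partial>lborel)"
      using h by (subst r') auto
    also have "\<dots> \<le> (\<integral>\<^sup>+s. ennreal (- cut1 (s / h) / h) * indicator {0..2 * h} s * ennreal (2 * M * h + 4 * h\<^sup>2) \<partial>lborel)"
    proof (intro nn_integral_mono)
      fix s :: real
      show "ennreal (- cut1 (s / h) / h) * indicator {0..2 * h} s * (\<integral>\<^sup>+y. ennreal ((norm (y, s))\<^sup>2 * heat (y :: 'a, s)) \<partial>lborel)
        \<le> ennreal (- cut1 (s / h) / h) * indicator {0..2 * h} s * ennreal (2 * M * h + 4 * h\<^sup>2)"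
      proof (cases "0 < s \<and> s \<le> 2 * h")
        case True
        then have s: "s > 0" by simp
        have "(\<integral>\<^sup>+y. ennreal ((norm (y, s))\<^sup>2 * heat (y :: 'a, s)) \<partial>lborel) =
          (\<integral>\<^sup>+y. ennreal ((norm y)\<^sup>2 * heat (y :: 'a, s)) + ennreal (s\<^sup>2) * ennreal (heat (y, s)) \<partial>lborel)"
          by (intro nn_integral_cong) (simp add: norm_Pair algebra_simps ennreal_plus[symmetric] ennreal_mult'[symmetric] heat_nonneg del: ennreal_plus)
        also have "\<dots> = (\<integral>\<^sup>+y. ennreal ((norm y)\<^sup>2 * heat (y :: 'a, s)) \<partial>lborel) + ennreal (s\<^sup>2) * 1"
          by (subst nn_integral_add) (auto simp: nn_integral_cmult M(2)[OF s])
        also have "\<dots> \<le> ennreal (M * s) + ennreal (s\<^sup>2)"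
          using M(3)[OF s] by (intro add_mono) auto
        also have "\<dots> = ennreal (M * s + s\<^sup>2)" using M(1) s by (simp add: ennreal_plus)
        also have "\<dots> \<le> ennreal (2 * M * h + 4 * h\<^sup>2)"
        proof (intro ennreal_leI add_mono)
          show "M * s \<le> 2 * M * h" using mult_left_mono[of s "2 * h" M] True M(1) by simp
          show "s\<^sup>2 \<le> 4 * h\<^sup>2" using power_mono[of s "2 * h" 2] True by simp
        qed
        finally show ?thesis by (intro mult_left_mono) auto
      next
        case False
        then show ?thesis by (cases "s = 0") (auto simp: cut_derivs_eq_0 indicator_def)
      qed
    qed
    also have "\<dots> = 1 * ennreal (2 * M * h + 4 * h\<^sup>2)"
    proof -
      have [measurable]: "cut1 \<in> borel_measurable borel"
        by (intro borel_measurable_continuous_onI continuous_cuts)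
      show ?thesis by (subst nn_integral_multc) (simp, simp only: nn_integral_cut1[OF h])
    qed
    finally show "(\<integral>\<^sup>+z. ennreal ((norm z)\<^sup>2 * rho h (z :: 'a \<times> real)) \<partial>lborel) \<le> ennreal (2 * M * h + 4 * h\<^sup>2)" by simp
  qed (use M in auto)
qed

text \<open>Continuity near the origin and boundedness away from it combine into one quadratic
  majorant of \<open>\<bar>g z - g 0\<bar>\<close>, whose integral against \<open>rho\<close> is
  small by the second moment.\<close>

lemma rho_approx_identity:
  fixes g :: "'a::euclidean_space \<times> real \<Rightarrow> real"
  assumes [measurable]: "g \<in> borel_measurable borel" and C: "\<And>z. \<bar>g z\<bar> \<le> C" and g: "isCont g 0"
    and \<delta>: "\<And>j. \<delta> j > 0" "\<delta> \<longlonglongrightarrow> (0::real)"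
  shows "(\<lambda>j. \<integral>z. rho (\<delta> j) z * g z \<partial>lborel) \<longlonglongrightarrow> g 0"
proof -
  obtain M where M: "M \<ge> 0" "\<And>h. h > 0 \<Longrightarrow> (\<integral>\<^sup>+z. ennreal ((norm z)\<^sup>2 * rho h (z :: 'a \<times> real)) \<partial>lborel) \<le> ennreal (M * h + 4 * h\<^sup>2)"
    using rho_integrals(2)[of 1, where 'a='a] by (auto simp del: ennreal_plus)
  have i1: "integrable lborel (rho h :: 'a \<times> real \<Rightarrow> real)" "(\<integral>z. rho h (z :: 'a \<times> real) \<partial>lborel) = 1" if "h > 0" for h
    using nn_integral_eq_integrable[of "rho h :: 'a \<times> real \<Rightarrow> real" lborel 1] rho_integrals(1)[OF that, where 'a='a]
      AE_I2[of lborel "\<lambda>z :: 'a \<times> real. 0 \<le> rho h z", OF rho_nonneg[OF that]] by auto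
  have i2: "integrable lborel (\<lambda>z. (norm z)\<^sup>2 * rho h (z :: 'a \<times> real))"
    "(\<integral>z. (norm z)\<^sup>2 * rho h (z :: 'a \<times> real) \<partial>lborel) \<le> M * h + 4 * h\<^sup>2" if "h > 0" for h
  proof -
    show i: "integrable lborel (\<lambda>z. (norm z)\<^sup>2 * rho h (z :: 'a \<times> real))"
      using M(2)[OF that] rho_nonneg[OF that, where 'a='a]
      by (auto simp: integrable_iff_bounded abs_mult less_top[symmetric] top_unique)
    have "ennreal (\<integral>z. (norm z)\<^sup>2 * rho h (z :: 'a \<times> real) \<partial>lborel) \<le> ennreal (M * h + 4 * h\<^sup>2)"
      using nn_integral_eq_integral[OF i] M(2)[OF that] rho_nonneg[OF that, where 'a='a] by simp
    then show "(\<integral>z. (norm z)\<^sup>2 * rho h (z :: 'a \<times> real) \<partial>lborel) \<le> M * h + 4 * h\<^sup>2"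
      using that M(1) by (subst (asm) ennreal_le_iff) auto
  qed
  have C0: "C \<ge> 0" using C[of 0] by simp
  show ?thesis
  proof (rule LIMSEQ_I)
    fix e :: real assume e: "e > 0"
    obtain d where d: "d > 0" "\<And>z. norm z < d \<Longrightarrow> \<bar>g z - g 0\<bar> < e / 2"
      using g e unfolding continuous_at_eps_delta dist_norm by (metis diff_zero half_gt_zero real_norm_def)
    have ptw: "\<bar>g z - g 0\<bar> \<le> e / 2 + 2 * C / d\<^sup>2 * (norm z)\<^sup>2" for z
    proof (cases "norm z < d")
      case True
      have "0 \<le> 2 * C / d\<^sup>2 * (norm z)\<^sup>2" using C0 by simp
      with d(2)[OF True] show ?thesis by linarith
    next
      case False
      then have "d\<^sup>2 \<le> (norm z)\<^sup>2" using d by (intro power_mono) auto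
      then have "2 * C * 1 \<le> 2 * C * ((norm z)\<^sup>2 / d\<^sup>2)" using C0 d by (intro mult_left_mono) auto
      moreover have "\<bar>g z - g 0\<bar> \<le> 2 * C" using C[of z] C[of 0] by linarith
      ultimately show ?thesis using e by simp
    qed
    have "(\<lambda>j. 2 * C / d\<^sup>2 * (M * \<delta> j + 4 * (\<delta> j)\<^sup>2)) \<longlonglongrightarrow> 2 * C / d\<^sup>2 * (M * 0 + 4 * 0\<^sup>2)"
      by (intro tendsto_intros \<delta>)
    then have "\<forall>\<^sub>F j in sequentially. 2 * C / d\<^sup>2 * (M * \<delta> j + 4 * (\<delta> j)\<^sup>2) < e / 2"
      using e by (intro order_tendstoD) auto
    then obtain N where N: "\<And>j. j \<ge> N \<Longrightarrow> 2 * C / d\<^sup>2 * (M * \<delta> j + 4 * (\<delta> j)\<^sup>2) < e / 2"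
      by (auto simp: eventually_sequentially)
    show "\<exists>N. \<forall>j\<ge>N. norm ((\<integral>z. rho (\<delta> j) z * g z \<partial>lborel) - g 0) < e"
    proof (intro exI allI impI)
      fix j assume j: "j \<ge> N"
      let ?r = "rho (\<delta> j) :: 'a \<times> real \<Rightarrow> real"
      note I1 = i1[OF \<delta>(1)[of j]] and I2 = i2[OF \<delta>(1)[of j]]
      have ig: "integrable lborel (\<lambda>z. ?r z * g z)"
        using conv_integrable[OF I1(1), of "\<lambda>z. g (- z)" C 0] C by simp
      have "(\<integral>z. ?r z * g z \<partial>lborel) - g 0 = (\<integral>z. ?r z * g z \<partial>lborel) - (\<integral>z. ?r z * g 0 \<partial>lborel)"
        using I1 by simp
      also have "\<dots> = (\<integral>z. ?r z * g z - ?r z * g 0 \<partial>lborel)"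
        by (rule Bochner_Integration.integral_diff[symmetric]) (use ig I1 in auto)
      finally have "\<bar>(\<integral>z. ?r z * g z \<partial>lborel) - g 0\<bar> = \<bar>\<integral>z. ?r z * g z - ?r z * g 0 \<partial>lborel\<bar>" by simp
      also have "\<dots> \<le> (\<integral>z. \<bar>?r z * g z - ?r z * g 0\<bar> \<partial>lborel)" by (rule integral_abs_bound)
      also have "\<dots> \<le> (\<integral>z. e / 2 * ?r z + 2 * C / d\<^sup>2 * ((norm z)\<^sup>2 * ?r z) \<partial>lborel)"
      proof (rule integral_mono)
        show "integrable lborel (\<lambda>z. \<bar>?r z * g z - ?r z * g 0\<bar>)" using ig I1 by auto
        show "integrable lborel (\<lambda>z. e / 2 * ?r z + 2 * C / d\<^sup>2 * ((norm z)\<^sup>2 * ?r z))"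
          by (intro Bochner_Integration.integrable_add integrable_mult_right I1 I2)
        fix z
        have "\<bar>?r z * g z - ?r z * g 0\<bar> = ?r z * \<bar>g z - g 0\<bar>"
          using rho_nonneg[OF \<delta>(1)[of j], of z] by (simp add: right_diff_distrib[symmetric] abs_mult)
        also have "\<dots> \<le> ?r z * (e / 2 + 2 * C / d\<^sup>2 * (norm z)\<^sup>2)"
          by (intro mult_left_mono ptw rho_nonneg \<delta>)
        finally show "\<bar>?r z * g z - ?r z * g 0\<bar> \<le> e / 2 * ?r z + 2 * C / d\<^sup>2 * ((norm z)\<^sup>2 * ?r z)"
          by (simp add: algebra_simps)
      qed
      also have "\<dots> = e / 2 + 2 * C / d\<^sup>2 * (\<integral>z. (norm z)\<^sup>2 * ?r z \<partial>lborel)"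
        using I1 I2(1) by (subst Bochner_Integration.integral_add) (auto intro!: integrable_mult_right)
      also have "\<dots> \<le> e / 2 + 2 * C / d\<^sup>2 * (M * \<delta> j + 4 * (\<delta> j)\<^sup>2)"
        using I2(2) C0 by (intro add_left_mono mult_left_mono) auto
      also have "\<dots> < e" using N[OF j] by simp
      finally show "norm ((\<integral>z. ?r z * g z \<partial>lborel) - g 0) < e" by simp
    qed
  qed
qed

text \<open>Serves to compare continuous functions known only off a null set: the set where they
  would differ is open.\<close>

lemma null_set_dense:
  fixes S N :: "'a::euclidean_space set"
  assumes "open S" "S \<noteq> {}" "N \<in> null_sets lborel"
  obtains x where "x \<in> S" "x \<notin> N"
proof -
  have "negligible N" using assms(3) by (simp add: negligible_iff_null_sets null_sets_completionI)
  then have "\<not> S \<subseteq> N" using open_not_negligible[OF assms(1,2)] negligible_subset by blast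
  then show thesis using that by blast
qed

section \<open>Regularity of weak solutions\<close>

text \<open>Extends the power by \<open>0\<close> to negative arguments. For \<open>p > 1\<close> it
  is continuously differentiable on the whole line and can be composed with a function whose sign is
  known only near the centre.\<close>

definition pospow :: "real \<Rightarrow> real \<Rightarrow> real"
  where "pospow p x = max 0 x powr p"

lemma pospow_deriv:
  assumes p: "p > 1"
  shows "(pospow p has_real_derivative p * pospow (p - 1) x) (at x)"
proof -
  consider "x > 0" | "x < 0" | "x = 0" by linarith
  then show ?thesis
  proof cases
    case 1
    have "((\<lambda>x. x powr p) has_real_derivative p * x powr (p - 1)) (at x)"
      using 1 by (rule has_real_derivative_powr)
    then have "(pospow p has_real_derivative p * x powr (p - 1)) (at x)"
      by (rule has_field_derivative_transform_within_open[where S="{0<..}"]) (use 1 in \<open>auto simp: pospow_def\<close>)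
    then show ?thesis using 1 by (simp add: pospow_def)
  next
    case 2
    have "(pospow p has_real_derivative 0) (at x)"
      by (rule has_field_derivative_transform_within_open[where S="{..<0}" and f="\<lambda>_. 0"])
        (use 2 p in \<open>auto simp: pospow_def\<close>)
    then show ?thesis using 2 p by (simp add: pospow_def)
  next
    case 3
    have "((\<lambda>h. \<bar>h\<bar> powr (p - 1)) \<longlongrightarrow> 0) (at 0)"
    proof -
      have "((\<lambda>h::real. \<bar>h\<bar> powr (p - 1)) \<longlongrightarrow> \<bar>0\<bar> powr (p - 1)) (at 0)"
        using p tendsto_rabs[OF tendsto_ident_at[of 0 UNIV]] by (intro tendsto_powr2) (auto intro!: tendsto_const)
      then show ?thesis by simp
    qed
    then have "((\<lambda>h. pospow p h / h) \<longlongrightarrow> 0) (at 0)"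
    proof (rule Lim_null_comparison[rotated], intro always_eventually allI)
      fix h :: real
      show "norm (pospow p h / h) \<le> \<bar>h\<bar> powr (p - 1)"
      proof (cases "h > 0")
        case False
        then have "pospow p h = 0" by (simp add: pospow_def max_def)
        then show ?thesis by simp
      qed (auto simp: pospow_def powr_diff)
    qed
    then show ?thesis using 3 p by (simp add: DERIV_def pospow_def)
  qed
qed

lemma pospow_continuous: "p > 0 \<Longrightarrow> continuous_on S (pospow p)"
  unfolding pospow_def by (intro continuous_on_powr' continuous_intros) auto

lemma pospow_mono: "p > 0 \<Longrightarrow> x \<le> y \<Longrightarrow> pospow p x \<le> pospow p y"
  unfolding pospow_def by (intro powr_mono2) auto

lemma conv_cong_AE:
  assumes [measurable]: "k \<in> borel_measurable borel" "g \<in> borel_measurable borel" "g' \<in> borel_measurable borel"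
    and "N \<in> null_sets lborel" "\<And>w. k w \<noteq> 0 \<Longrightarrow> z - w \<notin> N \<Longrightarrow> g (z - w) = g' (z - w)"
  shows "conv k g z = conv k g' z"
  unfolding conv_def
proof (rule integral_cong_AE)
  show "AE w in lborel. k w * g (z - w) = k w * g' (z - w)"
    using AE_lborel_reflect[OF assms(4), of z] by eventually_elim (use assms(5) in auto)
qed measurable

lemma conv_L1_limit:
  fixes k g :: "'a::euclidean_space \<Rightarrow> real"
  assumes k: "integrable lborel k" "\<And>j. integrable lborel (kj j)"
    and lim: "(\<lambda>j. \<integral>w. \<bar>kj j w - k w\<bar> \<partial>lborel) \<longlonglongrightarrow> 0"
    and [measurable]: "g \<in> borel_measurable borel" and g: "\<And>z. \<bar>g z\<bar> \<le> C"
  shows "(\<lambda>j. conv (kj j) g z) \<longlonglongrightarrow> conv k g z"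
proof -
  have "(\<lambda>j. C * (\<integral>w. \<bar>kj j w - k w\<bar> \<partial>lborel)) \<longlonglongrightarrow> 0"
    using tendsto_mult_left[OF lim, of C] by simp
  then have "(\<lambda>j. conv (kj j) g z - conv k g z) \<longlonglongrightarrow> 0"
  proof (rule Lim_null_comparison[rotated], intro always_eventually allI)
    fix j
    have "conv (kj j) g z - conv k g z = conv (\<lambda>w. kj j w - k w) g z"
      unfolding conv_def
      using conv_integrable[where g=g and k="kj j" and z=z and C=C] conv_integrable[where g=g and k=k and z=z and C=C] k g
      by (simp add: left_diff_distrib)
    then show "norm (conv (kj j) g z - conv k g z) \<le> C * (\<integral>w. \<bar>kj j w - k w\<bar> \<partial>lborel)"
      using conv_abs_le[where g=g and k="\<lambda>w. kj j w - k w" and z=z and C=C] k g by simp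
  qed
  then show ?thesis by (rule LIM_zero_cancel)
qed

lemma integrable_tcut_mult:
  fixes f :: "'a::euclidean_space \<times> real \<Rightarrow> real"
  assumes f: "integrable lborel f" and h: "h > 0"
  shows "integrable lborel (\<lambda>z. tcut h z * f z)"
proof (rule Bochner_Integration.integrable_bound[OF f])
  have [measurable]: "f \<in> borel_measurable borel" using f by auto
  have [measurable]: "(tcut h :: 'a \<times> real \<Rightarrow> real) \<in> borel_measurable borel"
    by (intro borel_measurable_continuous_onI C21tD(1)[OF tcut_facts(1)] h)
  show "(\<lambda>z. tcut h z * f z) \<in> borel_measurable lborel" by measurable
  show "AE z in lborel. norm (tcut h z * f z) \<le> norm (f z)"
  proof (intro AE_I2)
    fix z
    have "\<bar>tcut h z * f z\<bar> \<le> 1 * \<bar>f z\<bar>"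
      unfolding abs_mult using tcut_facts(5,6)[OF h, of z] by (intro mult_right_mono) auto
    then show "norm (tcut h z * f z) \<le> norm (f z)" by simp
  qed
qed

lemma kern_support:
  fixes w :: "'a::euclidean_space \<times> real"
  assumes k: "\<kappa> > 0" and w: "quad \<kappa> \<kappa> w > 2"
  shows "kern \<kappa> w = 0" "hrem \<kappa> w = 0" "dkern \<kappa> b w = 0" "dhrem \<kappa> b w = 0"
  using w hrem_facts(4,5)[OF k w] ecut_bounds(3)[of \<kappa> \<kappa> w] by (auto simp: kern_def dkern_def cut_derivs_eq_0)

lemma quad_norm: "quad \<kappa> \<kappa> z = \<kappa> * (norm z)\<^sup>2"
  by (simp add: quad_def norm_Pair[of "fst z" "snd z", simplified] algebra_simps)

text \<open>What remains of the problem once the cutoffs have done their work: the equation holds in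
  the sense of distributions in a full ball, while \<open>U\<close> is continuous only off the
  closed null set \<open>N\<close>. By convention \<open>U\<close> is \<open>0\<close> on
  \<open>N\<close> and outside the ball.\<close>

locale weak_absorption =
  fixes U :: "'a::euclidean_space \<times> real \<Rightarrow> real" and z0 :: "'a \<times> real" and R p :: real and N :: "('a \<times> real) set"
  assumes R: "R > 0" and p: "p > 1"
    and N: "closed N" "N \<in> null_sets lborel"
    and U_meas [measurable]: "U \<in> borel_measurable borel"
    and U_nonneg: "\<And>z. U z \<ge> 0"
    and U_zero: "\<And>z. z \<notin> ball z0 R - N \<Longrightarrow> U z = 0"
    and U_cont: "continuous_on (ball z0 R - N) U"
    and U_int: "integrable lborel U" "integrable lborel (\<lambda>z. U z powr p)"
    and weak: "\<And>\<psi> C. C21t \<psi> UNIV \<Longrightarrow> compact C \<Longrightarrow> C \<subseteq> ball z0 R \<Longrightarrow> (\<And>z. z \<notin> C \<Longrightarrow> \<psi> z = 0) \<Longrightarrow>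
       (\<integral>z. U z powr p * \<psi> z \<partial>lborel) = (\<integral>z. U z * adj_heat \<psi> z \<partial>lborel)"
begin

text \<open>With this value \<open>quad \<kappa> \<kappa> w \<le> 2\<close> means
  \<open>|w| \<le> R / 5\<close>. That leaves room for nested balls: \<open>3R/4 + R/5 < R\<close>
  for testing, \<open>R/2 + R/5 < 3R/4\<close> for the representation and
  \<open>R/4 + R/5 < R/2\<close> for the second derivatives.\<close>

definition \<kappa> :: real where "\<kappa> = 50 / R\<^sup>2"

lemma kappa: "\<kappa> > 0" using R by (simp add: \<kappa>_def)

lemma support: "quad \<kappa> \<kappa> w \<le> 2 \<Longrightarrow> norm w \<le> R / 5"
proof -
  assume "quad \<kappa> \<kappa> w \<le> 2"
  then have "(norm w)\<^sup>2 \<le> (R / 5)\<^sup>2" using R by (simp add: quad_norm \<kappa>_def field_simps power2_eq_square)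
  then show "norm w \<le> R / 5" by (rule power2_le_imp_le) (use R in simp)
qed

lemma support_mem:
  assumes "z \<in> ball z0 r" "norm w \<le> R / 5" "r + R / 5 \<le> r'"
  shows "z - w \<in> ball z0 r'"
proof -
  have "dist z0 (z - w) \<le> dist z0 z + norm w"
    using norm_triangle_ineq[of "z0 - z" w] by (simp add: dist_norm algebra_simps)
  then show ?thesis using assms by auto
qed

lemma cont_meas [measurable]:
  "ecut \<kappa> \<kappa> \<in> borel_measurable (borel :: ('a \<times> real) measure)"
  "kern \<kappa> \<in> borel_measurable (borel :: ('a \<times> real) measure)"
  "hrem \<kappa> \<in> borel_measurable (borel :: ('a \<times> real) measure)"
  "dhrem \<kappa> b \<in> borel_measurable (borel :: ('a \<times> real) measure)"
proof -
  show "ecut \<kappa> \<kappa> \<in> borel_measurable (borel :: ('a \<times> real) measure)"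
    by (intro borel_measurable_continuous_onI C21tD(1)[OF ecut_derivs(4)])
  show "kern \<kappa> \<in> borel_measurable (borel :: ('a \<times> real) measure)"
    "hrem \<kappa> \<in> borel_measurable (borel :: ('a \<times> real) measure)"
    "dhrem \<kappa> b \<in> borel_measurable (borel :: ('a \<times> real) measure)"
    using borel_measurable_integrable[OF kern_integrable(1)[OF kappa]] borel_measurable_integrable[OF hrem_facts(2)[OF kappa]]
      borel_measurable_integrable[OF hrem_facts(3)[OF kappa]] by simp_all
qed

lemma tcut_meas [measurable]: "h > 0 \<Longrightarrow> tcut h \<in> borel_measurable (borel :: ('a \<times> real) measure)"
  by (intro borel_measurable_continuous_onI C21tD(1)[OF tcut_facts(1)])

lemma integrable_U_mult:
  fixes k :: "'a \<times> real \<Rightarrow> real"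
  assumes [measurable]: "k \<in> borel_measurable borel" and k: "\<And>w. \<bar>k w\<bar> \<le> c"
  shows "integrable lborel (\<lambda>w. k w * U (z - w))"
proof -
  have "integrable (distr lborel borel (\<lambda>w. z - w)) U" using U_int(1) by (simp add: lborel_distr_reflect)
  then have r: "integrable lborel (\<lambda>w. U (z - w))" by (subst (asm) integrable_distr_eq) auto
  show ?thesis
  proof (rule Bochner_Integration.integrable_bound[OF integrable_mult_right[OF r, of c]])
    show "(\<lambda>w. k w * U (z - w)) \<in> borel_measurable lborel" by measurable
    show "AE w in lborel. norm (k w * U (z - w)) \<le> norm (c * U (z - w))"
      using order_trans[OF k abs_ge_self] by (intro AE_I2) (auto simp: abs_mult intro!: mult_right_mono)
  qed
qed

text \<open>The reflected truncated kernel is the test function. As \<open>h\<close> tends to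
  \<open>0\<close>, the left-hand side reproduces \<open>U z\<close>; the absorption term is
  nonnegative and may be dropped in an upper bound.\<close>

lemma tested:
  assumes z: "z \<in> ball z0 (3 * R / 4)" and h: "h > 0"
  shows "conv (\<lambda>w. rho h w * ecut \<kappa> \<kappa> w) U z =
     - conv (\<lambda>w. tcut h w * hrem \<kappa> w) U z - conv (\<lambda>w. tcut h w * kern \<kappa> w) (\<lambda>w. U w powr p) z"
    and "conv (\<lambda>w. tcut h w * kern \<kappa> w) (\<lambda>w. U w powr p) z \<ge> 0"
proof -
  let ?K = "\<lambda>w::'a\<times>real. tcut h w * kern \<kappa> w"
  let ?L = "\<lambda>w::'a\<times>real. tcut h w * hrem \<kappa> w + rho h w * ecut \<kappa> \<kappa> w"
  have L: "dirderiv (0, 1) ?K w - lapl ?K w = ?L w" for w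
    unfolding tcut_kern_facts(3)[OF h] by (simp add: rho_def kern_def)
  let ?C = "(\<lambda>w. z - w) ` {w :: 'a \<times> real. quad \<kappa> \<kappa> w \<le> 2}"
  have C: "compact ?C" by (intro compact_continuous_image annulus_compact(2) kappa continuous_intros)
  have CR: "?C \<subseteq> ball z0 R"
    using support_mem[OF z support] R by (auto simp del: mem_ball split_paired_All)
  have K0: "?K (z - w) = 0" if "w \<notin> ?C" for w
  proof -
    have "\<not> quad \<kappa> \<kappa> (z - w) \<le> 2" using that by (metis (mono_tags, lifting) diff_diff_eq2 add_diff_cancel_left' image_eqI mem_Collect_eq)
    then show ?thesis using kern_support(1)[OF kappa, of "z - w"] by simp
  qed
  have R': "C21t (\<lambda>w. ?K (z - w)) UNIV" "adj_heat (\<lambda>w. ?K (z - w)) = (\<lambda>w. - ?L (z - w))"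
    using C21t_reflect[OF tcut_kern_facts(1)[OF h, of \<kappa>], of z] by (auto simp: L[symmetric] fun_eq_iff)
  have eq: "(\<integral>w. U w powr p * ?K (z - w) \<partial>lborel) = (\<integral>w. U w * (- ?L (z - w)) \<partial>lborel)"
    using weak[OF R'(1) C CR K0] unfolding R'(2) .
  have 1: "(\<integral>w. U w powr p * ?K (z - w) \<partial>lborel) = conv ?K (\<lambda>w. U w powr p) z"
  proof -
    have "conv ?K (\<lambda>w. U w powr p) z = conv (\<lambda>w. U w powr p) ?K z" using h by (intro conv_comm) measurable
    then show ?thesis by (simp add: conv_def)
  qed
  have 2: "(\<integral>w. U w * (- ?L (z - w)) \<partial>lborel) = - conv ?L U z"
  proof -
    have "conv ?L U z = conv U ?L z" using h by (intro conv_comm) measurable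
    then show ?thesis
      unfolding mult_minus_right Bochner_Integration.integral_minus by (simp only: conv_def)
  qed
  obtain c1 where c1: "\<And>w. \<bar>tcut h w * hrem \<kappa> (w :: 'a \<times> real)\<bar> \<le> c1"
  proof -
    obtain c where c: "\<And>w. \<bar>hrem \<kappa> (w :: 'a \<times> real)\<bar> \<le> c" using hrem_facts(1)[OF kappa] by blast
    have "\<bar>tcut h w * hrem \<kappa> w\<bar> \<le> 1 * c" for w :: "'a \<times> real"
      unfolding abs_mult using tcut_facts(5,6)[OF h, of w] c[of w] by (intro mult_mono) auto
    then show thesis using that by blast
  qed
  have cK: "continuous_on UNIV ?K" by (rule C21tD(1)[OF tcut_kern_facts(1)[OF h]])
  obtain c2 where c2: "\<And>w. \<bar>rho h w * ecut \<kappa> \<kappa> (w :: 'a \<times> real)\<bar> \<le> c2"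
  proof -
    \<comment> \<open>Continuity of \<open>rho h w * ecut \<kappa> \<kappa> w\<close> across time
      \<open>0\<close> is read off from a difference of two functions already known to be
      continuous.\<close>
    have cL: "continuous_on UNIV ?L"
      using C21tD(5)[OF tcut_kern_facts(1)[OF h, of \<kappa>]] lapl_continuous[OF tcut_kern_facts(1)[OF h, of \<kappa>]]
      unfolding L[symmetric] by (intro continuous_intros)
    have "continuous_on UNIV (\<lambda>w. ?L w - tcut h w * hrem \<kappa> w)"
      by (intro continuous_on_diff cL tcut_hrem_facts(2)[OF h])
    then have "continuous_on UNIV (\<lambda>w::'a\<times>real. rho h w * ecut \<kappa> \<kappa> w)" by simp
    then show thesis
      using compact_support_imp_bounded[OF _ annulus_compact(2)[OF kappa, of 2], of "\<lambda>w. rho h w * ecut \<kappa> \<kappa> w"] that ecut_bounds(3)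
      by (metis (mono_tags, lifting) linorder_le_cases mem_Collect_eq mult_zero_right)
  qed
  have "conv ?L U z = conv (\<lambda>w. tcut h w * hrem \<kappa> w) U z + conv (\<lambda>w. rho h w * ecut \<kappa> \<kappa> w) U z"
    unfolding conv_def distrib_right
    using h by (intro Bochner_Integration.integral_add integrable_U_mult[OF _ c1] integrable_U_mult[OF _ c2]) measurable
  with eq 1 2 show "conv (\<lambda>w. rho h w * ecut \<kappa> \<kappa> w) U z =
     - conv (\<lambda>w. tcut h w * hrem \<kappa> w) U z - conv (\<lambda>w. tcut h w * kern \<kappa> w) (\<lambda>w. U w powr p) z"
    by simp
  show "conv ?K (\<lambda>w. U w powr p) z \<ge> 0"
    unfolding conv_def
    by (intro Bochner_Integration.integral_nonneg mult_nonneg_nonneg)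
      (simp_all add: kern_def ecut_bounds heat_nonneg tcut_facts(5)[OF h])
qed

definition \<delta> :: "nat \<Rightarrow> real" where "\<delta> j = inverse (real (Suc j))"

lemma delta: "\<delta> j > 0" "\<delta> \<longlonglongrightarrow> 0"
  using LIMSEQ_inverse_real_of_nat by (auto simp: \<delta>_def[abs_def])

lemma ecut_0: "ecut \<kappa> \<kappa> (0 :: 'a \<times> real) = 1"
  by (rule ecut_bounds(4)) (simp add: quad_def)

text \<open>Without the absorption term, \<open>tested\<close> bounds \<open>U z\<close> by the
  supremum of \<open>hrem\<close> times the integral of \<open>U\<close>. As \<open>U\<close> is not
  yet known to be bounded, the approximate identity is applied only to its restriction to a small
  ball about \<open>z\<close> avoiding \<open>N\<close>; since \<open>U\<close> is nonnegative, the
  restriction can only lower the integral.\<close>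

lemma locally_bounded: "\<exists>C. \<forall>z\<in>ball z0 (3 * R / 4). U z \<le> C"
proof -
  obtain c where c: "\<And>w. \<bar>hrem \<kappa> (w :: 'a \<times> real)\<bar> \<le> c" using hrem_facts(1)[OF kappa] by blast
  have c0: "c \<ge> 0" using c[of 0] by simp
  have "U z \<le> c * (\<integral>w. U w \<partial>lborel)" if z: "z \<in> ball z0 (3 * R / 4)" for z
  proof (cases "z \<in> N")
    case True
    then show ?thesis using U_zero[of z] c0 U_nonneg by (auto intro!: mult_nonneg_nonneg)
  next
    case False
    have zR: "z \<in> ball z0 R - N" using z False R by auto
    then obtain r where r: "r > 0" "cball z r \<subseteq> ball z0 R - N"
      using N(1) by (meson open_Diff open_ball open_contains_cball)
    have "compact (U ` cball z r)"
      by (intro compact_continuous_image continuous_on_subset[OF U_cont r(2)]) auto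
    then obtain b where b: "\<And>w. w \<in> cball z r \<Longrightarrow> \<bar>U w\<bar> \<le> b"
      by (metis bounded_real compact_imp_bounded imageI)
    define g where "g = (\<lambda>w. ecut \<kappa> \<kappa> w * (U (z - w) * indicator (ball 0 r) w))"
    have [measurable]: "ball (0 :: 'a \<times> real) r \<in> sets borel" by simp
    have gm[measurable]: "g \<in> borel_measurable borel" unfolding g_def by measurable
    have gb: "\<bar>g w\<bar> \<le> max b 0" for w
    proof -
      have "\<bar>U (z - w) * indicator (ball 0 r) w\<bar> \<le> max b 0"
        using b[of "z - w"] by (auto simp: indicator_def dist_norm)
      then have "\<bar>ecut \<kappa> \<kappa> w\<bar> * \<bar>U (z - w) * indicator (ball 0 r) w\<bar> \<le> 1 * max b 0"
        by (intro mult_mono) (auto simp: ecut_bounds)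
      then show ?thesis unfolding g_def abs_mult by simp
    qed
    have gc: "isCont g 0"
    proof -
      have "continuous_on (ball 0 r) (\<lambda>w. ecut \<kappa> \<kappa> w * U (z - w))"
      proof (intro continuous_intros continuous_on_compose2[OF U_cont])
        show "continuous_on (ball 0 r) (ecut \<kappa> \<kappa>)"
          using C21tD(1)[OF ecut_derivs(4)] by (rule continuous_on_subset) auto
        show "(\<lambda>w. z - w) ` ball 0 r \<subseteq> ball z0 R - N"
        proof (rule image_subsetI)
          fix w :: "'a \<times> real" assume "w \<in> ball 0 r"
          then have "z - w \<in> cball z r" by (simp add: dist_norm)
          then show "z - w \<in> ball z0 R - N" using r(2) by blast
        qed
      qed
      then have "isCont (\<lambda>w. ecut \<kappa> \<kappa> w * U (z - w)) 0"
        using r(1) by (simp add: continuous_on_eq_continuous_at)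
      moreover have "\<forall>\<^sub>F w in nhds 0. g w = ecut \<kappa> \<kappa> w * U (z - w)"
        using r(1) by (intro eventually_nhds_in_open[of "ball 0 r", THEN eventually_mono]) (auto simp: g_def)
      ultimately show ?thesis by (simp add: isCont_cong)
    qed
    have g0: "g 0 = U z" using r by (simp add: g_def ecut_0)
    have "(\<lambda>j. \<integral>w. rho (\<delta> j) w * g w \<partial>lborel) \<longlonglongrightarrow> U z"
      using rho_approx_identity[OF gm gb gc delta] unfolding g0 .
    moreover have "(\<integral>w. rho (\<delta> j) w * g w \<partial>lborel) \<le> c * (\<integral>w. U w \<partial>lborel)" for j
    proof -
      note h = delta(1)[of j]
      have "(\<integral>w. rho (\<delta> j) w * g w \<partial>lborel) \<le> conv (\<lambda>w. rho (\<delta> j) w * ecut \<kappa> \<kappa> w) U z"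
        unfolding conv_def
      proof (rule integral_mono)
        have i1: "integrable lborel (rho (\<delta> j) :: 'a \<times> real \<Rightarrow> real)"
          using nn_integral_eq_integrable[of "rho (\<delta> j) :: 'a \<times> real \<Rightarrow> real" lborel 1] rho_integrals(1)[OF h, where 'a='a]
            AE_I2[of lborel "\<lambda>z :: 'a \<times> real. 0 \<le> rho (\<delta> j) z", OF rho_nonneg[OF h]] by auto
        show "integrable lborel (\<lambda>w. rho (\<delta> j) w * g w)"
          using conv_integrable[OF i1, of "\<lambda>z. g (- z)" "max b 0" 0] gb by simp
        obtain B where B: "\<And>w. \<bar>rho (\<delta> j) w * ecut \<kappa> \<kappa> (w :: 'a \<times> real)\<bar> \<le> B"
        proof -
          have "rho (\<delta> j) w * ecut \<kappa> \<kappa> w = (dirderiv (0, 1) (\<lambda>w. tcut (\<delta> j) w * kern \<kappa> w) w - lapl (\<lambda>w. tcut (\<delta> j) w * kern \<kappa> w) w)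
             - tcut (\<delta> j) w * hrem \<kappa> w" for w :: "'a \<times> real"
            unfolding tcut_kern_facts(3)[OF h] by (simp add: rho_def kern_def)
          then have "continuous_on UNIV (\<lambda>w::'a\<times>real. rho (\<delta> j) w * ecut \<kappa> \<kappa> w)"
            by (simp only:) (intro continuous_on_diff tcut_hrem_facts(2)[OF h] C21tD(5)[OF tcut_kern_facts(1)[OF h]] lapl_continuous[OF tcut_kern_facts(1)[OF h]])
          then show thesis
            using compact_support_imp_bounded[OF _ annulus_compact(2)[OF kappa, of 2], of "\<lambda>w. rho (\<delta> j) w * ecut \<kappa> \<kappa> w"] that ecut_bounds(3)
            by (metis (mono_tags, lifting) linorder_le_cases mem_Collect_eq mult_zero_right)
        qed
        show "integrable lborel (\<lambda>w. rho (\<delta> j) w * ecut \<kappa> \<kappa> w * U (z - w))"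
          by (rule integrable_U_mult[OF _ B]) measurable
        show "rho (\<delta> j) w * g w \<le> rho (\<delta> j) w * ecut \<kappa> \<kappa> w * U (z - w)" for w
          unfolding g_def using rho_nonneg[OF h, of w] ecut_bounds(1)[of \<kappa> \<kappa> w] U_nonneg[of "z - w"]
          by (auto simp: indicator_def)
      qed
      also have "\<dots> \<le> - conv (\<lambda>w. tcut (\<delta> j) w * hrem \<kappa> w) U z"
        using tested[OF z h] by linarith
      also have "\<dots> \<le> (\<integral>w. c * U (z - w) \<partial>lborel)"
      proof -
        have cb: "\<bar>tcut (\<delta> j) w * hrem \<kappa> w\<bar> \<le> c" for w :: "'a \<times> real"
        proof -
          have "\<bar>tcut (\<delta> j) w * hrem \<kappa> w\<bar> \<le> 1 * c"
            unfolding abs_mult using tcut_facts(5,6)[OF h, of w] c[of w] by (intro mult_mono) auto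
          then show ?thesis by simp
        qed
        have "- conv (\<lambda>w. tcut (\<delta> j) w * hrem \<kappa> w) U z = (\<integral>w. - (tcut (\<delta> j) w * hrem \<kappa> w * U (z - w)) \<partial>lborel)"
          by (simp add: conv_def)
        also have "\<dots> \<le> (\<integral>w. c * U (z - w) \<partial>lborel)"
        proof (rule integral_mono)
          show "integrable lborel (\<lambda>w. - (tcut (\<delta> j) w * hrem \<kappa> w * U (z - w)))"
            using integrable_U_mult[where k="\<lambda>w. tcut (\<delta> j) w * hrem \<kappa> w" and c=c and z=z] cb h by simp
          show "integrable lborel (\<lambda>w. c * U (z - w))"
            by (rule integrable_U_mult[where c=c]) (use c0 in auto)
          show "- (tcut (\<delta> j) w * hrem \<kappa> w * U (z - w)) \<le> c * U (z - w)" for w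
            using mult_right_mono[of "- (tcut (\<delta> j) w * hrem \<kappa> w)" c "U (z - w)"] cb[of w] U_nonneg by simp
        qed
        finally show ?thesis .
      qed
      also have "\<dots> = c * (\<integral>w. U w \<partial>lborel)"
        using integral_lborel_reflect[OF U_meas, of z] by simp
      finally show ?thesis .
    qed
    ultimately show ?thesis by (intro LIMSEQ_le_const2[where x="U z"]) auto
  qed
  then show ?thesis by blast
qed

text \<open>By \<open>locally_bounded\<close> this restriction is bounded, at the price of a jump
  across the sphere, which is added to the exceptional null set.\<close>

definition U1 :: "'a \<times> real \<Rightarrow> real"
  where "U1 z = (if z \<in> ball z0 (3 * R / 4) then U z else 0)"

lemma U1_facts:
  shows "U1 \<in> borel_measurable borel" "\<And>z. U1 z \<ge> 0"
    "\<exists>C\<ge>0. \<forall>z. U1 z \<le> C" "integrable lborel U1" "integrable lborel (\<lambda>z. U1 z powr p)"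
    "N \<union> sphere z0 (3 * R / 4) \<in> null_sets lborel" "closed (N \<union> sphere z0 (3 * R / 4))"
    "continuous_on (- (N \<union> sphere z0 (3 * R / 4))) U1"
proof -
  have e: "U1 = (\<lambda>z. indicator (ball z0 (3 * R / 4)) z * U z)" by (auto simp: U1_def fun_eq_iff)
  have [measurable]: "ball z0 (3 * R / 4) \<in> sets borel" by simp
  show m[measurable]: "U1 \<in> borel_measurable borel" unfolding e by measurable
  show "\<And>z. U1 z \<ge> 0" by (auto simp: U1_def U_nonneg)
  obtain C where "\<forall>z\<in>ball z0 (3 * R / 4). U z \<le> C" using locally_bounded by blast
  then show "\<exists>C\<ge>0. \<forall>z. U1 z \<le> C" by (intro exI[of _ "max C 0"]) (auto simp: U1_def le_max_iff_disj)
  show "integrable lborel U1"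
    by (rule Bochner_Integration.integrable_bound[OF U_int(1)]) (auto simp: U1_def U_nonneg)
  show "integrable lborel (\<lambda>z. U1 z powr p)"
    by (rule Bochner_Integration.integrable_bound[OF U_int(2)]) (auto simp: U1_def)
  have "negligible (sphere z0 (3 * R / 4))" by (rule negligible_sphere)
  then have "sphere z0 (3 * R / 4) \<in> null_sets lborel"
    by (auto simp: negligible_iff_null_sets null_sets_completion_iff)
  then show "N \<union> sphere z0 (3 * R / 4) \<in> null_sets lborel" using N(2) by (rule null_sets.Un[rotated])
  show "closed (N \<union> sphere z0 (3 * R / 4))" using N(1) by auto
  have 1: "continuous_on (ball z0 (3 * R / 4) - N) U1"
  proof (rule continuous_on_eq[where f=U])
    show "continuous_on (ball z0 (3 * R / 4) - N) U" using R by (intro continuous_on_subset[OF U_cont]) auto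
  qed (auto simp: U1_def)
  have 2: "continuous_on (- cball z0 (3 * R / 4)) U1"
    by (rule continuous_on_eq[where f="\<lambda>_. 0"]) (auto simp: U1_def)
  have "continuous_on ((ball z0 (3 * R / 4) - N) \<union> (- cball z0 (3 * R / 4))) U1"
    by (intro continuous_on_open_Un 1 2 open_Diff N) auto
  then show "continuous_on (- (N \<union> sphere z0 (3 * R / 4))) U1"
    by (rule continuous_on_subset) auto
qed

text \<open>The formal limit of the right-hand side of \<open>tested\<close>: potentials of the
  bounded functions \<open>U1\<close> and \<open>U1 powr p\<close>. Unlike \<open>U\<close> it has
  meaningful values on \<open>N\<close>.\<close>

definition v :: "'a \<times> real \<Rightarrow> real"
  where "v z = - conv (hrem \<kappa>) U1 z - conv (kern \<kappa>) (\<lambda>w. U1 w powr p) z"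

lemma U1_bounds:
  obtains C where "C \<ge> 0" "\<And>z. \<bar>U1 z\<bar> \<le> C" "\<And>z. \<bar>U1 z powr p\<bar> \<le> C"
proof -
  obtain C where C: "C \<ge> 0" "\<forall>z. U1 z \<le> C" using U1_facts(3) by blast
  have "U1 z powr p \<le> C powr p" for z using C U1_facts(2) p by (intro powr_mono2) (auto simp del: split_paired_All)
  then show thesis by (intro that[of "max C (C powr p)"])
    (use C U1_facts(2) in \<open>auto simp: le_max_iff_disj simp del: split_paired_All\<close>)
qed

lemma U1p_facts:
  "(\<lambda>w. U1 w powr p) \<in> borel_measurable borel"
  "continuous_on (- (N \<union> sphere z0 (3 * R / 4))) (\<lambda>w. U1 w powr p)"
proof -
  note [measurable] = U1_facts(1)
  show "(\<lambda>w. U1 w powr p) \<in> borel_measurable borel" by measurable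
  show "continuous_on (- (N \<union> sphere z0 (3 * R / 4))) (\<lambda>w. U1 w powr p)"
    using p U1_facts(2) by (intro continuous_on_powr' U1_facts(8) continuous_intros) auto
qed

text \<open>The kernels live in \<open>|w| \<le> R / 5\<close>, so near the centre \<open>U\<close>
  may be replaced by the bounded \<open>U1\<close>. For a bounded function both the approximate
  identity and the L^1 limits of the kernels apply.\<close>

lemma v_eq_U:
  assumes z: "z \<in> ball z0 (R / 2) - N"
  shows "v z = U z"
proof -
  obtain C where C: "C \<ge> 0" "\<And>z. \<bar>U1 z\<bar> \<le> C" "\<And>z. \<bar>U1 z powr p\<bar> \<le> C" by (rule U1_bounds) blast
  have near: "U1 (z - w) = U (z - w)" if "quad \<kappa> \<kappa> w \<le> 2" for w
    using support_mem[of z "R / 2" w "3 * R / 4"] support[OF that] z R by (auto simp: U1_def)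
  have eqn: "conv (\<lambda>w. rho (\<delta> j) w * ecut \<kappa> \<kappa> w) U1 z =
     - conv (\<lambda>w. tcut (\<delta> j) w * hrem \<kappa> w) U1 z - conv (\<lambda>w. tcut (\<delta> j) w * kern \<kappa> w) (\<lambda>w. U1 w powr p) z" for j
  proof -
    have c: "conv k f z = conv k g z" if "\<And>w. quad \<kappa> \<kappa> w \<le> 2 \<Longrightarrow> f (z - w) = g (z - w)" "\<And>w. quad \<kappa> \<kappa> w > 2 \<Longrightarrow> k w = 0" for k f g
      unfolding conv_def using that by (intro Bochner_Integration.integral_cong) (auto, metis not_le)
    have z': "z \<in> ball z0 (3 * R / 4)" using z R by auto
    have "conv (\<lambda>w. rho (\<delta> j) w * ecut \<kappa> \<kappa> w) U1 z = conv (\<lambda>w. rho (\<delta> j) w * ecut \<kappa> \<kappa> w) U z"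
      by (rule c) (auto simp: near ecut_bounds)
    moreover have "conv (\<lambda>w. tcut (\<delta> j) w * hrem \<kappa> w) U1 z = conv (\<lambda>w. tcut (\<delta> j) w * hrem \<kappa> w) U z"
      by (rule c) (auto simp: near kern_support[OF kappa])
    moreover have "conv (\<lambda>w. tcut (\<delta> j) w * kern \<kappa> w) (\<lambda>w. U1 w powr p) z = conv (\<lambda>w. tcut (\<delta> j) w * kern \<kappa> w) (\<lambda>w. U w powr p) z"
      by (rule c) (auto simp: near kern_support[OF kappa])
    ultimately show ?thesis using tested(1)[OF z' delta(1)[of j]] by simp
  qed
  define g where "g = (\<lambda>w. ecut \<kappa> \<kappa> w * U1 (z - w))"
  have "(\<lambda>j. \<integral>w. rho (\<delta> j) w * g w \<partial>lborel) \<longlonglongrightarrow> g 0"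
  proof (rule rho_approx_identity[where g=g and C="1 * C", OF _ _ _ delta], unfold g_def)
    note [measurable] = U1_facts(1)
    show "(\<lambda>w. ecut \<kappa> \<kappa> w * U1 (z - w)) \<in> borel_measurable borel" by measurable
    show "\<bar>ecut \<kappa> \<kappa> w * U1 (z - w)\<bar> \<le> 1 * C" for w
      unfolding abs_mult using C by (intro mult_mono) (auto simp: ecut_bounds)
    have "isCont U1 z"
      using U1_facts(8) z R unfolding continuous_on_eq_continuous_at[OF open_Compl[OF U1_facts(7)]] by auto
    then have "isCont (\<lambda>w. U1 (z - w)) 0"
      by (intro isCont_o2[where g=U1 and f="\<lambda>w. z - w"]) (auto intro!: continuous_intros)
    moreover have "isCont (ecut \<kappa> \<kappa> :: 'a \<times> real \<Rightarrow> real) 0"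
      using C21tD(1)[OF ecut_derivs(4)[of \<kappa> \<kappa>]] unfolding continuous_on_eq_continuous_at[OF open_UNIV] by blast
    ultimately show "isCont (\<lambda>w. ecut \<kappa> \<kappa> w * U1 (z - w)) 0" by (intro continuous_intros)
  qed
  then have l1: "(\<lambda>j. conv (\<lambda>w. rho (\<delta> j) w * ecut \<kappa> \<kappa> w) U1 z) \<longlonglongrightarrow> U z"
    using near[of 0] by (simp add: g_def conv_def ecut_0 mult.assoc quad_def)
  have l2: "(\<lambda>j. conv (\<lambda>w. tcut (\<delta> j) w * hrem \<kappa> w) U1 z) \<longlonglongrightarrow> conv (hrem \<kappa>) U1 z"
    by (intro conv_L1_limit[OF _ _ _ U1_facts(1) C(2)] hrem_facts(2) kappa integrable_tcut_mult tcut_L1_limit delta)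
      (auto simp: hrem_def heat_def)
  have l3: "(\<lambda>j. conv (\<lambda>w. tcut (\<delta> j) w * kern \<kappa> w) (\<lambda>w. U1 w powr p) z) \<longlonglongrightarrow> conv (kern \<kappa>) (\<lambda>w. U1 w powr p) z"
    by (intro conv_L1_limit[OF _ _ _ U1p_facts(1) C(3)] kern_integrable(1) kappa integrable_tcut_mult tcut_L1_limit delta)
      (auto simp: kern_def heat_def)
  have "(\<lambda>j. conv (\<lambda>w. rho (\<delta> j) w * ecut \<kappa> \<kappa> w) U1 z) \<longlonglongrightarrow> v z"
    unfolding eqn v_def by (intro tendsto_intros l2 l3)
  with l1 show ?thesis using LIMSEQ_unique by blast
qed

text \<open>One spatial derivative may be placed on the kernels, because \<open>dkern\<close> and
  \<open>dhrem\<close> are integrable. The regular approximations are the kernels switched off up to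
  time \<open>\<delta> j\<close>; jumps of the densities on a closed null set do not harm
  continuity.\<close>

lemma v_bounds:
  shows "continuous_on UNIV v" "\<exists>C. \<forall>z. \<bar>v z\<bar> \<le> C"
    and "b \<in> Basis \<Longrightarrow> has_cont_dirderiv_on (b, 0) v UNIV"
    and "b \<in> Basis \<Longrightarrow> dirderiv (b, 0) v = (\<lambda>z. - conv (dhrem \<kappa> b) U1 z - conv (dkern \<kappa> b) (\<lambda>w. U1 w powr p) z)"
    and "b \<in> Basis \<Longrightarrow> \<exists>C. \<forall>z. \<bar>dirderiv (b, 0) v z\<bar> \<le> C"
proof -
  obtain C where C: "C \<ge> 0" "\<And>z. \<bar>U1 z\<bar> \<le> C" "\<And>z. \<bar>U1 z powr p\<bar> \<le> C" by (rule U1_bounds) blast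
  note h = hrem_facts(2)[OF kappa, where 'a='a] and k = kern_integrable(1)[OF kappa, where 'a='a]
  have cont: "continuous_on UNIV (\<lambda>z. - conv k1 U1 z - conv k2 (\<lambda>w. U1 w powr p) z)"
    if "integrable lborel k1" "integrable lborel k2" for k1 k2
    by (intro continuous_intros conv_continuous[OF that(1) U1_facts(1) C(2) U1_facts(6,7,8)]
        conv_continuous[OF that(2) U1p_facts(1) C(3) U1_facts(6,7) U1p_facts(2)])
  have bound: "\<exists>B. \<forall>z. \<bar>- conv k1 U1 z - conv k2 (\<lambda>w. U1 w powr p) z\<bar> \<le> B"
    if "integrable lborel k1" "integrable lborel k2" for k1 k2
  proof (intro exI allI)
    fix z
    show "\<bar>- conv k1 U1 z - conv k2 (\<lambda>w. U1 w powr p) z\<bar> \<le> C * (\<integral>w. \<bar>k1 w\<bar> \<partial>lborel) + C * (\<integral>w. \<bar>k2 w\<bar> \<partial>lborel)"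
      using conv_abs_le[where z=z, OF that(1) U1_facts(1) C(2)] conv_abs_le[where z=z, OF that(2) U1p_facts(1) C(3)] by linarith
  qed
  show "continuous_on UNIV v" "\<exists>C. \<forall>z. \<bar>v z\<bar> \<le> C"
    unfolding v_def[abs_def] by (rule cont[OF h k], rule bound[OF h k])
  assume b: "b \<in> Basis"
  note dh = hrem_facts(3)[OF kappa, where 'a='a and b=b] and dk = kern_integrable(2)[OF kappa b]
  have 1: "((\<lambda>s. conv (hrem \<kappa>) U1 (z + s *\<^sub>R (b, 0))) has_vector_derivative conv (dhrem \<kappa> b) U1 z) (at 0)" for z
  proof (rule conv_dirderiv_left_singular[where kj="\<lambda>j z. tcut (\<delta> j) z * hrem \<kappa> z" and A="\<lambda>_. {w. quad \<kappa> \<kappa> w \<le> 2}" and C=C, OF h dh])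
    show "(\<lambda>j. \<integral>w. \<bar>tcut (\<delta> j) w * hrem \<kappa> w - hrem \<kappa> w\<bar> \<partial>(lborel :: ('a \<times> real) measure)) \<longlonglongrightarrow> 0"
      by (rule tcut_L1_limit[OF h _ delta]) (simp add: hrem_def heat_def)
    show "(\<lambda>j. \<integral>w. \<bar>dirderiv (b, 0) (\<lambda>z. tcut (\<delta> j) z * hrem \<kappa> z) w - dhrem \<kappa> b w\<bar> \<partial>(lborel :: ('a \<times> real) measure)) \<longlonglongrightarrow> 0"
      unfolding tcut_hrem_facts(3)[OF delta(1)] by (rule tcut_L1_limit[OF dh _ delta]) (simp add: dhrem_def heat_def)
    show "tcut (\<delta> j) z * hrem \<kappa> z = 0" if "z \<notin> {w. quad \<kappa> \<kappa> w \<le> 2}" for j and z :: "'a \<times> real"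
      using kern_support(2)[OF kappa, of z] that by simp
  qed (intro tcut_hrem_facts delta annulus_compact(2) kappa U1_facts(4) C(2))+
  have 2: "((\<lambda>s. conv (kern \<kappa>) (\<lambda>w. U1 w powr p) (z + s *\<^sub>R (b, 0))) has_vector_derivative conv (dkern \<kappa> b) (\<lambda>w. U1 w powr p) z) (at 0)" for z
  proof (rule conv_dirderiv_left_singular[where kj="\<lambda>j z. tcut (\<delta> j) z * kern \<kappa> z" and A="\<lambda>_. {w. quad \<kappa> \<kappa> w \<le> 2}" and C=C, OF k dk])
    show "(\<lambda>j. \<integral>w. \<bar>tcut (\<delta> j) w * kern \<kappa> w - kern \<kappa> w\<bar> \<partial>(lborel :: ('a \<times> real) measure)) \<longlonglongrightarrow> 0"
      by (rule tcut_L1_limit[OF k _ delta]) (simp add: kern_def heat_def)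
    show "(\<lambda>j. \<integral>w. \<bar>dirderiv (b, 0) (\<lambda>z. tcut (\<delta> j) z * kern \<kappa> z) w - dkern \<kappa> b w\<bar> \<partial>(lborel :: ('a \<times> real) measure)) \<longlonglongrightarrow> 0"
      unfolding tcut_kern_facts(2)[OF delta(1)] by (rule tcut_L1_limit[OF dk _ delta]) (simp add: dkern_def heat_def)
    show "tcut (\<delta> j) z * kern \<kappa> z = 0" if "z \<notin> {w. quad \<kappa> \<kappa> w \<le> 2}" for j and z :: "'a \<times> real"
      using kern_support(1)[OF kappa, of z] that by simp
  qed (intro C21tD[OF tcut_kern_facts(1)[OF delta(1)]] b annulus_compact(2) kappa U1_facts(5) C(3))+
  have D: "((\<lambda>s. v (z + s *\<^sub>R (b, 0))) has_vector_derivative - conv (dhrem \<kappa> b) U1 z - conv (dkern \<kappa> b) (\<lambda>w. U1 w powr p) z) (at 0)" for z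
    unfolding v_def by (intro derivative_intros 1 2)
  show "has_cont_dirderiv_on (b, 0) v UNIV"
    by (rule has_cont_dirderiv_onI[OF D]) (rule cont[OF dh dk])
  show e: "dirderiv (b, 0) v = (\<lambda>z. - conv (dhrem \<kappa> b) U1 z - conv (dkern \<kappa> b) (\<lambda>w. U1 w powr p) z)"
    by (rule ext, rule dirderiv_eqI[OF D])
  show "\<exists>C. \<forall>z. \<bar>dirderiv (b, 0) v z\<bar> \<le> C"
    unfolding e by (rule bound[OF dh dk])
qed

text \<open>Off \<open>N\<close> the value is that of \<open>U\<close>; a negative value elsewhere
  would persist on an open set, which cannot lie inside a null set.\<close>

lemma v_nonneg: "z \<in> ball z0 (R / 2) \<Longrightarrow> v z \<ge> 0"
proof (rule ccontr)
  assume z: "z \<in> ball z0 (R / 2)" "\<not> v z \<ge> 0"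
  have "open ({w. v w < 0} \<inter> ball z0 (R / 2))"
    using v_bounds(1) by (intro open_Int open_Collect_less continuous_intros) auto
  moreover have "z \<in> {w. v w < 0} \<inter> ball z0 (R / 2)" using z by (simp add: not_le)
  then have "{w. v w < 0} \<inter> ball z0 (R / 2) \<noteq> {}" by blast
  ultimately obtain w where "w \<in> {w. v w < 0} \<inter> ball z0 (R / 2)" "w \<notin> N"
    using null_set_dense[OF _ _ N(2)] by metis
  then show False using v_eq_U[of w] U_nonneg[of w] by auto
qed

text \<open>A second derivative on the heat kernel would not be integrable. Near the centre,
  however, the densities agree almost everywhere with \<open>v\<close> and
  \<open>pospow p (v w)\<close>, which by now are \<open>C^1\<close> in space, so the second
  derivative is placed on them.\<close>

lemma v_second:
  assumes b: "b \<in> Basis" "b' \<in> Basis"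
  shows "has_cont_dirderiv_on (b', 0) (dirderiv (b, 0) v) (ball z0 (R / 4))"
proof -
  define V where "V z = - conv (dhrem \<kappa> b) v z - conv (dkern \<kappa> b) (\<lambda>w. pospow p (v w)) z" for z
  note vc = v_bounds(1) and vd = v_bounds(3)[OF b(2)]
  have p0: "p > 0" "p - 1 > 0" using p by auto
  have pc: "continuous_on UNIV (\<lambda>w. pospow p (v w))"
    by (rule continuous_on_compose2[OF pospow_continuous[OF p0(1), of UNIV] vc]) auto
  have c': "continuous_on UNIV (\<lambda>x. p * pospow (p - 1) x)"
    by (intro continuous_intros pospow_continuous p0)
  note pd = dirderiv_chain[OF vd vc pospow_deriv[OF p] c']
  obtain C0 C1 where C: "\<And>z. \<bar>v z\<bar> \<le> C0" "\<And>z. \<bar>dirderiv (b', 0) v z\<bar> \<le> C1"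
    using v_bounds(2) v_bounds(5)[OF b(2)] by blast
  have C0: "C0 \<ge> 0" "C1 \<ge> 0" using C(1)[of 0] C(2)[of 0] by auto
  have pb: "\<bar>pospow p (v z)\<bar> \<le> pospow p C0" for z
    using pospow_mono[OF p0(1), of "v z" C0] C(1)[of z] by (auto simp: pospow_def)
  have pb': "\<bar>dirderiv (b', 0) (\<lambda>w. pospow p (v w)) z\<bar> \<le> p * pospow (p - 1) C0 * C1" for z
  proof -
    have "\<bar>p * pospow (p - 1) (v z) * dirderiv (b', 0) v z\<bar> \<le> p * pospow (p - 1) C0 * C1"
      unfolding abs_mult using pospow_mono[OF p0(2), of "v z" C0] C[of z] p C0
      by (intro mult_mono) (auto simp: pospow_def)
    then show ?thesis by (simp add: pd(2))
  qed
  have h1: "has_cont_dirderiv_on (b', 0) (conv (dhrem \<kappa> b) v) UNIV"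
    by (rule conv_dirderiv_right'(1)[OF hrem_facts(3)[OF kappa] vc vd, where C="max C0 C1"])
      (use C in \<open>auto simp: le_max_iff_disj simp del: split_paired_All\<close>)
  have h2: "has_cont_dirderiv_on (b', 0) (conv (dkern \<kappa> b) (\<lambda>w. pospow p (v w))) UNIV"
    by (rule conv_dirderiv_right'(1)[OF kern_integrable(2)[OF kappa b(1)] pc pd(1), where C="max (pospow p C0) (p * pospow (p - 1) C0 * C1)"])
      (use pb pb' in \<open>auto simp: le_max_iff_disj simp del: split_paired_All\<close>)
  have "has_cont_dirderiv_on (b', 0) V UNIV"
  proof -
    have m: "has_cont_dirderiv_on (b', 0) (\<lambda>z. - f z) UNIV" if "has_cont_dirderiv_on (b', 0) f UNIV" for f :: "'a \<times> real \<Rightarrow> real"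
      using has_cont_dirderiv_onD[OF that] that unfolding has_cont_dirderiv_on_def[of "(b', 0)" f]
      by (auto intro!: has_cont_dirderiv_onI[where f'="\<lambda>w. - dirderiv (b', 0) f w"] derivative_eq_intros continuous_intros)
    show ?thesis using dirderiv_add(1)[OF m[OF h1] m[OF h2]] by (simp add: V_def[abs_def])
  qed
  then have V: "has_cont_dirderiv_on (b', 0) V (ball z0 (R / 4))"
    by (rule has_cont_dirderiv_on_subset) auto
  have "V z = dirderiv (b, 0) v z" if z: "z \<in> ball z0 (R / 4)" for z
  proof -
    \<comment> \<open>The kernels see only points within \<open>R / 5\<close> of \<open>z\<close>,
      where \<open>U1\<close>, \<open>U\<close> and \<open>v\<close> coincide off \<open>N\<close>;
      nonnegativity of \<open>v\<close> there identifies \<open>pospow\<close> with the true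
      power.\<close>
    have near: "U1 (z - w) = v (z - w) \<and> U1 (z - w) powr p = pospow p (v (z - w))" if "quad \<kappa> \<kappa> w \<le> 2" "z - w \<notin> N" for w
    proof -
      have zw: "z - w \<in> ball z0 (R / 2)" using support_mem[OF z support[OF that(1)], of "R / 2"] R by simp
      then have "U1 (z - w) = U (z - w)" using R by (auto simp: U1_def)
      also have "\<dots> = v (z - w)" using v_eq_U[of "z - w"] zw that(2) by simp
      finally show ?thesis using v_nonneg[OF zw] by (simp add: pospow_def)
    qed
    have [measurable]: "v \<in> borel_measurable borel" "(\<lambda>w. pospow p (v w)) \<in> borel_measurable borel"
      "dkern \<kappa> b \<in> borel_measurable (borel :: ('a \<times> real) measure)"
      using vc pc kern_integrable(2)[OF kappa b(1)] by (auto intro: borel_measurable_continuous_onI)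
    note [measurable] = U1_facts(1) U1p_facts(1)
    have "conv (dhrem \<kappa> b) U1 z = conv (dhrem \<kappa> b) v z"
    proof (rule conv_cong_AE[OF _ _ _ N(2)])
      show "U1 (z - w) = v (z - w)" if "dhrem \<kappa> b w \<noteq> 0" "z - w \<notin> N" for w
        using near[of w] kern_support(4)[OF kappa, of w] that by (metis not_le)
    qed measurable
    moreover have "conv (dkern \<kappa> b) (\<lambda>w. U1 w powr p) z = conv (dkern \<kappa> b) (\<lambda>w. pospow p (v w)) z"
    proof (rule conv_cong_AE[OF _ _ _ N(2)])
      show "U1 (z - w) powr p = pospow p (v (z - w))" if "dkern \<kappa> b w \<noteq> 0" "z - w \<notin> N" for w
        using near[of w] kern_support(3)[OF kappa, of w] that by (metis not_le)
    qed measurable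
    ultimately show ?thesis by (simp add: V_def v_bounds(4)[OF b(1)])
  qed
  then show ?thesis
    by (intro has_cont_dirderiv_on_cong_open[OF open_ball _ V]) auto
qed

end

lemma C21t_conv:
  fixes k g :: "'a::euclidean_space \<times> real \<Rightarrow> real"
  assumes k: "integrable lborel k" and g: "C21t g UNIV" and C: "compact C" "\<And>z. z \<notin> C \<Longrightarrow> g z = 0"
  shows "C21t (conv k g) UNIV"
    and "dirderiv (0, 1) (conv k g) = conv k (dirderiv (0, 1) g)"
    and "b \<in> Basis \<Longrightarrow> dirderiv (b, 0) (conv k g) = conv k (dirderiv (b, 0) g)"
    and "b \<in> Basis \<Longrightarrow> dirderiv (b, 0) (dirderiv (b, 0) (conv k g)) = conv k (dirderiv (b, 0) (dirderiv (b, 0) g))"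
proof -
  note G = C21tD[OF g]
  have z1: "dirderiv v g z = 0" if "z \<notin> C" for v z
    using dirderiv_zero_outside[OF compact_imp_closed[OF C(1)] C(2) that] .
  have z2: "dirderiv v (dirderiv v' g) z = 0" if "z \<notin> C" for v v' z
    using dirderiv_zero_outside[OF compact_imp_closed[OF C(1)] z1 that] .
  have bd: "has_cont_dirderiv_on v (conv k f) UNIV \<and> dirderiv v (conv k f) = conv k (dirderiv v f)"
    if f: "continuous_on UNIV f" "has_cont_dirderiv_on v f UNIV" and f0: "\<And>z. z \<notin> C \<Longrightarrow> f z = 0" for v f
  proof -
    have d: "continuous_on UNIV (dirderiv v f)" using f(2) by (simp add: has_cont_dirderiv_on_def)
    have d0: "dirderiv v f z = 0" if "z \<notin> C" for z
      using dirderiv_zero_outside[OF compact_imp_closed[OF C(1)] f0 that] .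
    obtain b1 where b1: "\<And>z. \<bar>f z\<bar> \<le> b1" using compact_support_imp_bounded[OF f(1) C(1) f0] by blast
    obtain b2 where b2: "\<And>z. \<bar>dirderiv v f z\<bar> \<le> b2" using compact_support_imp_bounded[OF d C(1) d0] by blast
    have "\<bar>f z\<bar> \<le> max b1 b2" "\<bar>dirderiv v f z\<bar> \<le> max b1 b2" for z using b1[of z] b2[of z] by linarith+
    from conv_dirderiv_right'[OF k f this] show ?thesis by blast
  qed
  have c: "continuous_on UNIV (conv k g)"
  proof -
    obtain b1 where b1: "\<And>z. \<bar>g z\<bar> \<le> b1" using compact_support_imp_bounded[OF G(1) C(1) C(2)] by blast
    show ?thesis
      by (rule conv_continuous[OF k _ b1, where N="{}"]) (use G(1) in \<open>auto intro: borel_measurable_continuous_onI\<close>)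
  qed
  note t = bd[OF G(1,2) C(2)] and x = bd[OF G(1,3) C(2)] and xx = bd[OF G(6,4) z1]
  show "C21t (conv k g) UNIV" unfolding C21t_def using c t x xx by auto
  show "dirderiv (0, 1) (conv k g) = conv k (dirderiv (0, 1) g)" using t by blast
  show "b \<in> Basis \<Longrightarrow> dirderiv (b, 0) (conv k g) = conv k (dirderiv (b, 0) g)" using x by blast
  show "b \<in> Basis \<Longrightarrow> dirderiv (b, 0) (dirderiv (b, 0) (conv k g)) = conv k (dirderiv (b, 0) (dirderiv (b, 0) g))"
    using x xx by auto
qed

section \<open>Parabolic coverings and cutoffs\<close>

text \<open>A closed cylinder at the scaling of the heat equation; its volume is a constant times
  the radius to the spatial dimension plus \<open>2\<close>.\<close>

definition pcyl :: "'a::euclidean_space \<times> real \<Rightarrow> real \<Rightarrow> ('a \<times> real) set"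
  where "pcyl z r = cball (fst z) r \<times> cball (snd z) (r\<^sup>2)"

text \<open>A bound on the box-counting dimension in the parabolic metric. The centres have to lie
  in \<open>N\<close>, so that enlarged cylinders still shrink to \<open>N\<close> with
  \<open>\<epsilon>\<close>.\<close>

definition parabolic_cover :: "('a::euclidean_space \<times> real) set \<Rightarrow> nat \<Rightarrow> real \<Rightarrow> bool"
  where "parabolic_cover N d C \<longleftrightarrow> (\<forall>\<epsilon>. 0 < \<epsilon> \<and> \<epsilon> \<le> 1 \<longrightarrow>
     (\<exists>Z. finite Z \<and> Z \<subseteq> N \<and> real (card Z) \<le> C / \<epsilon> ^ d \<and> N \<subseteq> (\<Union>z\<in>Z. pcyl z \<epsilon>)))"

lemma compact_pcyl: "compact (pcyl z r)"
  unfolding pcyl_def by (intro compact_Times compact_cball)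

lemma pcyl_finite_measure: "pcyl z r \<in> sets borel" "emeasure lborel (pcyl z r) < \<infinity>"
  using borel_compact[OF compact_pcyl] emeasure_compact_finite[OF compact_pcyl] by blast+

lemma measure_pcyl:
  fixes z :: "'a::euclidean_space \<times> real"
  assumes r: "r \<ge> 0"
  shows "measure lborel (pcyl z r) = 2 * unit_ball_vol (DIM('a)) * r ^ (DIM('a) + 2)"
proof -
  have "emeasure lborel (pcyl z r) = emeasure (lborel \<Otimes>\<^sub>M lborel) (cball (fst z) r \<times> cball (snd z) (r\<^sup>2))"
    by (simp add: pcyl_def lborel_prod)
  also have "\<dots> = emeasure lborel (cball (fst z) r) * emeasure lborel (cball (snd z) (r\<^sup>2))"
    by (rule lborel.emeasure_pair_measure_Times) auto
  also have "\<dots> = ennreal (unit_ball_vol (DIM('a)) * r ^ DIM('a)) * ennreal (2 * r\<^sup>2)"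
    using r by (simp add: emeasure_cball cball_eq_atLeastAtMost)
  also have "\<dots> = ennreal (2 * unit_ball_vol (DIM('a)) * r ^ (DIM('a) + 2))"
    using r by (simp add: ennreal_mult'[symmetric] power_add mult_ac power2_eq_square)
  finally show ?thesis using r by (simp add: measure_def)
qed

text \<open>The count \<open>\<epsilon>^(-d)\<close> times the volume of one cylinder;
  \<open>k\<close> is thus the codimension with respect to the parabolic dimension of
  space-time.\<close>

lemma measure_pcyl_Union:
  fixes Z :: "('a::euclidean_space \<times> real) set"
  assumes Z: "finite Z" "real (card Z) \<le> C / \<epsilon> ^ d" and e: "\<epsilon> > 0" "c > 0" and d: "d + k = DIM('a) + 2"
  shows "measure lborel (\<Union>z\<in>Z. pcyl z (c * \<epsilon>)) \<le> C * (2 * unit_ball_vol (DIM('a)) * c ^ (DIM('a) + 2)) * \<epsilon> ^ k"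
proof -
  let ?w = "2 * unit_ball_vol (DIM('a))"
  have "measure lborel (\<Union>z\<in>Z. pcyl z (c * \<epsilon>)) \<le> (\<Sum>z\<in>Z. measure lborel (pcyl z (c * \<epsilon>)))"
    by (rule measure_UNION_le[OF Z(1)]) (auto intro: borel_compact compact_pcyl)
  also have "\<dots> = real (card Z) * (?w * (c * \<epsilon>) ^ (DIM('a) + 2))"
    using e by (simp add: measure_pcyl)
  also have "\<dots> \<le> C / \<epsilon> ^ d * (?w * (c * \<epsilon>) ^ (DIM('a) + 2))"
    using Z(2) e by (intro mult_right_mono) auto
  also have "\<dots> = C * (?w * c ^ (DIM('a) + 2)) * (\<epsilon> ^ (d + k) / \<epsilon> ^ d)"
    unfolding d by (simp add: power_mult_distrib)
  also have "\<epsilon> ^ (d + k) / \<epsilon> ^ d = \<epsilon> ^ k" using e by (simp add: power_add)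
  finally show ?thesis .
qed

lemma pcyl_add:
  assumes "z \<in> pcyl c r" "w \<in> pcyl 0 s" "r \<ge> 0" "s \<ge> 0"
  shows "z - w \<in> pcyl c (r + s)"
proof -
  have "dist (fst c) (fst (z - w)) \<le> dist (fst c) (fst z) + norm (fst w)"
    using norm_triangle_ineq[of "fst c - fst z" "fst w"] by (simp add: dist_norm algebra_simps)
  moreover have "dist (snd c) (snd (z - w)) \<le> dist (snd c) (snd z) + norm (snd w)"
    using norm_triangle_ineq[of "snd c - snd z" "snd w"] by (simp add: dist_norm algebra_simps)
  moreover have "r\<^sup>2 + s\<^sup>2 \<le> (r + s)\<^sup>2" using assms by (simp add: power2_sum)
  ultimately show ?thesis
    using assms unfolding pcyl_def by (auto simp: mem_Times_iff)
qed

lemma quad_pcyl: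
  fixes w :: "'a::euclidean_space \<times> real"
  assumes e: "\<epsilon> > 0"
  shows "quad (1 / \<epsilon>\<^sup>2) (1 / (\<epsilon>\<^sup>2)\<^sup>2) w \<le> 2 \<Longrightarrow> w \<in> pcyl 0 (2 * \<epsilon>)"
    and "w \<in> pcyl 0 (\<epsilon> / 2) \<Longrightarrow> quad (1 / \<epsilon>\<^sup>2) (1 / (\<epsilon>\<^sup>2)\<^sup>2) w \<le> 1"
proof -
  have q: "quad (1 / \<epsilon>\<^sup>2) (1 / (\<epsilon>\<^sup>2)\<^sup>2) w = (norm (fst w) / \<epsilon>)\<^sup>2 + (snd w / \<epsilon>\<^sup>2)\<^sup>2"
    by (simp add: quad_def power_divide)
  show "w \<in> pcyl 0 (2 * \<epsilon>)" if "quad (1 / \<epsilon>\<^sup>2) (1 / (\<epsilon>\<^sup>2)\<^sup>2) w \<le> 2"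
  proof -
    have "(norm (fst w) / \<epsilon>)\<^sup>2 \<le> 2" "(snd w / \<epsilon>\<^sup>2)\<^sup>2 \<le> 2"
      using that unfolding q by (smt (verit) zero_le_power2)+
    moreover have "(2::real) \<le> 2\<^sup>2" by simp
    ultimately have "(norm (fst w) / \<epsilon>)\<^sup>2 \<le> 2\<^sup>2" "(snd w / \<epsilon>\<^sup>2)\<^sup>2 \<le> 2\<^sup>2" by linarith+
    then have "(norm (fst w) / \<epsilon>)\<^sup>2 \<le> 2\<^sup>2" "\<bar>snd w / \<epsilon>\<^sup>2\<bar>\<^sup>2 \<le> 2\<^sup>2"
      by (simp_all only: power2_abs)
    from this[THEN power2_le_imp_le] have "norm (fst w) / \<epsilon> \<le> 2" "\<bar>snd w / \<epsilon>\<^sup>2\<bar> \<le> 2"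
      by simp_all
    then have "norm (fst w) \<le> 2 * \<epsilon>" "\<bar>snd w\<bar> \<le> 2 * \<epsilon>\<^sup>2"
      using e by (auto simp: field_simps)
    moreover have "2 * \<epsilon>\<^sup>2 \<le> (2 * \<epsilon>)\<^sup>2" by (simp add: power_mult_distrib)
    ultimately show ?thesis by (auto simp: pcyl_def mem_Times_iff)
  qed
  show "quad (1 / \<epsilon>\<^sup>2) (1 / (\<epsilon>\<^sup>2)\<^sup>2) w \<le> 1" if "w \<in> pcyl 0 (\<epsilon> / 2)"
  proof -
    have "norm (fst w) / \<epsilon> \<le> 1 / 2" "\<bar>snd w / \<epsilon>\<^sup>2\<bar> \<le> 1 / 2"
      using that e by (auto simp: pcyl_def mem_Times_iff field_simps power2_eq_square)
    then have "(norm (fst w) / \<epsilon>)\<^sup>2 \<le> (1/2)\<^sup>2" "\<bar>snd w / \<epsilon>\<^sup>2\<bar>\<^sup>2 \<le> (1/2)\<^sup>2"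
      using e by (intro power_mono; simp)+
    moreover have "((1::real) / 2)\<^sup>2 = 1 / 4" by (simp add: power_divide)
    ultimately show ?thesis unfolding q power2_abs by linarith
  qed
qed

text \<open>The mollifier lives at parabolic scale: width \<open>\<epsilon>\<close> in space and \<open>\<epsilon>\<^sup>2\<close> in time.\<close>

lemma parabolic_mollifier:
  obtains C where "C \<ge> 0"
    "\<And>\<epsilon>. 0 < \<epsilon> \<Longrightarrow> \<exists>\<beta> :: 'a::euclidean_space \<times> real \<Rightarrow> real. C21t \<beta> UNIV \<and> (\<forall>z. \<beta> z \<ge> 0) \<and>
       (\<forall>z. z \<notin> pcyl 0 (2 * \<epsilon>) \<longrightarrow> \<beta> z = 0) \<and> (\<integral>z. \<beta> z \<partial>lborel) = 1 \<and>
       (\<integral>z. \<bar>dirderiv (0, 1) \<beta> z\<bar> \<partial>lborel) \<le> C / \<epsilon>\<^sup>2 \<and>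
       (\<forall>b\<in>Basis. (\<integral>z. \<bar>dirderiv (b, 0) \<beta> z\<bar> \<partial>lborel) \<le> C / \<epsilon>) \<and>
       (\<forall>b\<in>Basis. (\<integral>z. \<bar>dirderiv (b, 0) (dirderiv (b, 0) \<beta>) z\<bar> \<partial>lborel) \<le> C / \<epsilon>\<^sup>2)"
proof -
  obtain K where K: "K \<ge> 1" "\<And>x. \<bar>cut1 x\<bar> \<le> K" "\<And>x. \<bar>cut2 x\<bar> \<le> K"
    using cut_derivs_bound by metis
  let ?n = "DIM('a) + 2"
  \<comment> \<open>\<open>4 ^ ?n\<close> is the volume ratio of the cylinders of radii
    \<open>2 * \<epsilon>\<close> and \<open>\<epsilon> / 2\<close>, between which the bump is
    sandwiched before normalization. \<open>18 = 16 + 2\<close> comes from the two terms of its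
    second derivative.\<close>
  define C where "C = 18 * K * 4 ^ ?n"
  have CK: "C \<ge> 0" using K by (simp add: C_def)
  show thesis
  proof (rule that[OF CK])
    fix \<epsilon> :: real assume e: "0 < \<epsilon>"
    let ?A = "1 / \<epsilon>\<^sup>2" and ?B = "1 / (\<epsilon>\<^sup>2)\<^sup>2"
    let ?f = "ecut ?A ?B :: 'a \<times> real \<Rightarrow> real"
    let ?P = "pcyl 0 (2 * \<epsilon>) :: ('a \<times> real) set"
    note F = C21tD[OF ecut_derivs(4)[of ?A ?B, where 'a='a]]
    have supp: "quad ?A ?B z \<ge> 2" if "z \<notin> ?P" for z :: "'a \<times> real"
      using quad_pcyl(1)[OF e, of z] that by linarith
    have f0: "?f z = 0" if "z \<notin> ?P" for z using supp[OF that] by (rule ecut_bounds(3))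
    have fi: "integrable lborel ?f" by (rule compact_support_integrable[OF F(1) compact_pcyl f0])
    define I where "I = (\<integral>z. ?f z \<partial>lborel)"
    have small: "measure lborel (pcyl (0 :: 'a \<times> real) (\<epsilon> / 2)) \<le> I"
    proof -
      have i: "integrable lborel (indicat_real (pcyl (0 :: 'a \<times> real) (\<epsilon> / 2)))"
        by (intro integrable_real_indicator) (simp_all add: pcyl_finite_measure pcyl_finite_measure[unfolded infinity_ennreal_def])
      have "(\<integral>z. indicat_real (pcyl (0 :: 'a \<times> real) (\<epsilon> / 2)) z \<partial>lborel) \<le> I"
        unfolding I_def
      proof (rule integral_mono[OF i fi])
        fix z :: "'a \<times> real"
        show "indicat_real (pcyl 0 (\<epsilon> / 2)) z \<le> ?f z"
          using ecut_bounds(1)[of ?A ?B z] ecut_bounds(4)[OF quad_pcyl(2)[OF e, of z]] by (auto simp: indicator_def)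
      qed
      then show ?thesis by simp
    qed
    define w where "w = measure lborel (pcyl (0 :: 'a \<times> real) (\<epsilon> / 2))"
    have w: "w > 0" using e by (simp add: w_def measure_pcyl unit_ball_vol_pos)
    have I: "I > 0" "w \<le> I" using small w by (auto simp: w_def)
    have vol: "measure lborel ?P = 4 ^ ?n * w"
    proof -
      have "(2 * \<epsilon>) ^ ?n = 4 ^ ?n * (\<epsilon> / 2) ^ ?n" unfolding power_mult_distrib[symmetric] by simp
      then show ?thesis using e by (simp add: w_def measure_pcyl)
    qed
    have bound: "(\<integral>z. \<bar>g z / I\<bar> \<partial>lborel) \<le> 4 ^ ?n * D"
      if g: "continuous_on UNIV g" "\<And>z. z \<notin> ?P \<Longrightarrow> g z = 0" "\<And>z. z \<in> ?P \<Longrightarrow> \<bar>g z\<bar> \<le> D" and D: "D \<ge> 0" for g D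
    proof -
      have gi: "integrable lborel g" by (rule compact_support_integrable[OF g(1) compact_pcyl g(2)])
      have ii: "integrable lborel (indicat_real ?P)"
        by (intro integrable_real_indicator) (simp_all add: pcyl_finite_measure pcyl_finite_measure[unfolded infinity_ennreal_def])
      have "(\<integral>z. \<bar>g z / I\<bar> \<partial>lborel) = (\<integral>z. \<bar>g z\<bar> \<partial>lborel) / I" using I by simp
      also have "\<dots> \<le> (\<integral>z. D * indicat_real ?P z \<partial>lborel) / I"
      proof (intro divide_right_mono integral_mono)
        show "\<bar>g z\<bar> \<le> D * indicat_real ?P z" for z using g(2,3)[of z] by (auto simp: indicator_def)
      qed (use gi ii I in auto)
      also have "\<dots> = D * (4 ^ ?n * w) / I" using vol by simp
      also have "\<dots> \<le> D * (4 ^ ?n * w) / w" using I w D by (intro divide_left_mono) auto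
      finally show ?thesis using w by (simp add: mult.commute)
    qed
    have fst_b: "\<bar>fst z \<bullet> b\<bar> \<le> 2 * \<epsilon>" if "z \<in> ?P" "b \<in> Basis" for z :: "'a \<times> real" and b
      using Basis_le_norm[OF that(2), of "fst z"] that(1) by (simp add: pcyl_def mem_Times_iff)
    define \<beta> where "\<beta> z = ?f z * (1 / I)" for z
    have cI: "C21t (\<lambda>_ :: 'a \<times> real. 1 / I) UNIV" by (simp add: C21t_def dirderiv_const)
    have d: "dirderiv v (\<lambda>z. h z * (1 / I)) = (\<lambda>z. dirderiv v h z / I)" if "has_cont_dirderiv_on v h UNIV" "continuous_on UNIV h" for v and h :: "'a \<times> real \<Rightarrow> real"
      using dirderiv_mult(2)[OF that(1) dirderiv_const(1)[of v "1 / I" UNIV] that(2)] by (auto simp: dirderiv_const)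
    have d1: "dirderiv (0, 1) \<beta> = (\<lambda>z. dirderiv (0, 1) ?f z / I)"
      unfolding \<beta>_def[abs_def] by (rule d[OF F(2,1)])
    have d2: "dirderiv (b, 0) \<beta> = (\<lambda>z. dirderiv (b, 0) ?f z / I)" if "b \<in> Basis" for b
      unfolding \<beta>_def[abs_def] by (rule d[OF F(3)[OF that] F(1)])
    have d3: "dirderiv (b, 0) (dirderiv (b, 0) \<beta>) = (\<lambda>z. dirderiv (b, 0) (dirderiv (b, 0) ?f) z / I)" if "b \<in> Basis" for b
      unfolding d2[OF that] using d[OF F(4)[OF that] F(6)[OF that]] by simp
    have z: "dirderiv (0, 1) ?f z = 0" "b \<in> Basis \<Longrightarrow> dirderiv (b, 0) ?f z = 0" "b \<in> Basis \<Longrightarrow> dirderiv (b, 0) (dirderiv (b, 0) ?f) z = 0"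
      if "z \<notin> ?P" for z b
    proof -
      show "dirderiv (0, 1) ?f z = 0" "b \<in> Basis \<Longrightarrow> dirderiv (b, 0) ?f z = 0"
        using supp[OF that] by (simp_all add: ecut_derivs(1,2) cut_derivs_eq_0)
      show "b \<in> Basis \<Longrightarrow> dirderiv (b, 0) (dirderiv (b, 0) ?f) z = 0"
        unfolding ecut_derivs(3) using supp[OF that] by (simp add: cut_derivs_eq_0)
    qed
    show "\<exists>\<beta> :: 'a \<times> real \<Rightarrow> real. C21t \<beta> UNIV \<and> (\<forall>z. \<beta> z \<ge> 0) \<and>
       (\<forall>z. z \<notin> pcyl 0 (2 * \<epsilon>) \<longrightarrow> \<beta> z = 0) \<and> (\<integral>z. \<beta> z \<partial>lborel) = 1 \<and>
       (\<integral>z. \<bar>dirderiv (0, 1) \<beta> z\<bar> \<partial>lborel) \<le> C / \<epsilon>\<^sup>2 \<and>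
       (\<forall>b\<in>Basis. (\<integral>z. \<bar>dirderiv (b, 0) \<beta> z\<bar> \<partial>lborel) \<le> C / \<epsilon>) \<and>
       (\<forall>b\<in>Basis. (\<integral>z. \<bar>dirderiv (b, 0) (dirderiv (b, 0) \<beta>) z\<bar> \<partial>lborel) \<le> C / \<epsilon>\<^sup>2)"
    proof (intro exI[of _ \<beta>] conjI ballI allI impI)
      show "C21t \<beta> UNIV" unfolding \<beta>_def[abs_def] by (rule C21t_mult[OF open_UNIV ecut_derivs(4) cI])
      show "\<beta> z \<ge> 0" for z using I by (simp add: \<beta>_def ecut_bounds)
      show "\<beta> z = 0" if "z \<notin> pcyl 0 (2 * \<epsilon>)" for z using f0[OF that] by (simp add: \<beta>_def)
      show "(\<integral>z. \<beta> z \<partial>lborel) = 1" using I fi unfolding \<beta>_def by (simp add: I_def)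
      have "(\<integral>z. \<bar>dirderiv (0, 1) \<beta> z\<bar> \<partial>lborel) \<le> 4 ^ ?n * (8 * K / \<epsilon>\<^sup>2)"
        unfolding d1
      proof (rule bound[OF F(5) z(1)])
        fix z :: "'a \<times> real" assume "z \<in> ?P"
        then have "\<bar>snd z\<bar> \<le> 4 * \<epsilon>\<^sup>2" by (simp add: pcyl_def mem_Times_iff power_mult_distrib)
        then have "\<bar>2 * ?B * snd z\<bar> \<le> 2 * ?B * (4 * \<epsilon>\<^sup>2)" unfolding abs_mult by (intro mult_mono) auto
        also have "\<dots> = 8 / \<epsilon>\<^sup>2" using e by (simp add: power2_eq_square)
        finally have "\<bar>cut1 (quad ?A ?B z)\<bar> * \<bar>2 * ?B * snd z\<bar> \<le> K * (8 / \<epsilon>\<^sup>2)"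
          using K by (intro mult_mono) auto
        then show "\<bar>dirderiv (0, 1) ?f z\<bar> \<le> 8 * K / \<epsilon>\<^sup>2" by (simp add: ecut_derivs(1) abs_mult mult.commute)
      qed (use K in auto)
      also have "\<dots> \<le> C / \<epsilon>\<^sup>2" using K e by (simp add: C_def divide_right_mono)
      finally show "(\<integral>z. \<bar>dirderiv (0, 1) \<beta> z\<bar> \<partial>lborel) \<le> C / \<epsilon>\<^sup>2" .
      fix b :: 'a assume b: "b \<in> Basis"
      have lin: "\<bar>2 * ?A * (fst z \<bullet> b)\<bar> \<le> 4 / \<epsilon>" if "z \<in> ?P" for z :: "'a \<times> real"
      proof -
        have "\<bar>2 * ?A * (fst z \<bullet> b)\<bar> \<le> 2 * ?A * (2 * \<epsilon>)" unfolding abs_mult using fst_b[OF that b] by (intro mult_mono) auto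
        also have "\<dots> = 4 / \<epsilon>" using e by (simp add: power2_eq_square)
        finally show ?thesis .
      qed
      have "(\<integral>z. \<bar>dirderiv (b, 0) \<beta> z\<bar> \<partial>lborel) \<le> 4 ^ ?n * (4 * K / \<epsilon>)"
        unfolding d2[OF b]
      proof (rule bound[OF F(6)[OF b] z(2)[OF _ b]])
        fix z :: "'a \<times> real" assume "z \<in> ?P"
        then have "\<bar>cut1 (quad ?A ?B z)\<bar> * \<bar>2 * ?A * (fst z \<bullet> b)\<bar> \<le> K * (4 / \<epsilon>)"
          using K lin by (intro mult_mono) auto
        then show "\<bar>dirderiv (b, 0) ?f z\<bar> \<le> 4 * K / \<epsilon>" by (simp add: ecut_derivs(2) abs_mult mult.commute)
      qed (use K e in auto)
      also have "\<dots> \<le> C / \<epsilon>" using K e by (simp add: C_def divide_right_mono)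
      finally show "(\<integral>z. \<bar>dirderiv (b, 0) \<beta> z\<bar> \<partial>lborel) \<le> C / \<epsilon>" .
      have "(\<integral>z. \<bar>dirderiv (b, 0) (dirderiv (b, 0) \<beta>) z\<bar> \<partial>lborel) \<le> 4 ^ ?n * (18 * K / \<epsilon>\<^sup>2)"
        unfolding d3[OF b]
      proof (rule bound[OF F(7)[OF b] z(3)[OF _ b]])
        fix z :: "'a \<times> real" assume zP: "z \<in> ?P"
        have "\<bar>2 * ?A * (fst z \<bullet> b)\<bar>\<^sup>2 \<le> (4 / \<epsilon>)\<^sup>2" using lin[OF zP] by (intro power_mono) auto
        then have "\<bar>cut2 (quad ?A ?B z)\<bar> * (2 * ?A * (fst z \<bullet> b))\<^sup>2 \<le> K * (16 / \<epsilon>\<^sup>2)"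
          using K by (intro mult_mono) (auto simp: power_divide)
        moreover have "\<bar>cut1 (quad ?A ?B z)\<bar> * (2 * ?A) \<le> K * (2 * ?A)" using K by (intro mult_right_mono) auto
        ultimately have "\<bar>cut2 (quad ?A ?B z)\<bar> * (2 * ?A * (fst z \<bullet> b))\<^sup>2 + \<bar>cut1 (quad ?A ?B z)\<bar> * (2 * ?A) \<le> 18 * K / \<epsilon>\<^sup>2"
          by (simp add: add_divide_distrib[symmetric])
        moreover have "\<bar>dirderiv (b, 0) (dirderiv (b, 0) ?f) z\<bar> \<le> \<bar>cut2 (quad ?A ?B z) * (2 * ?A * (fst z \<bullet> b))\<^sup>2\<bar> + \<bar>cut1 (quad ?A ?B z) * (2 * ?A)\<bar>"
          unfolding ecut_derivs(3)[OF b] by (rule abs_triangle_ineq)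
        ultimately show "\<bar>dirderiv (b, 0) (dirderiv (b, 0) ?f) z\<bar> \<le> 18 * K / \<epsilon>\<^sup>2"
          by (simp add: abs_mult)
      qed (use K e in auto)
      also have "\<dots> \<le> C / \<epsilon>\<^sup>2" by (simp add: C_def mult.commute)
      finally show "(\<integral>z. \<bar>dirderiv (b, 0) (dirderiv (b, 0) \<beta>) z\<bar> \<partial>lborel) \<le> C / \<epsilon>\<^sup>2" .
    qed
  qed
qed

text \<open>\<open>O'\<close> is an open neighbourhood of \<open>N\<close> on which the cutoff
  vanishes, so that its products with test functions have compact support off \<open>N\<close>.
  \<open>A\<close> contains the transition region and stays close to \<open>N\<close>.\<close>

definition parabolic_cutoff ::
  "('a::euclidean_space \<times> real) set \<Rightarrow> nat \<Rightarrow> real \<Rightarrow> real \<Rightarrow> ('a \<times> real \<Rightarrow> real) \<Rightarrow> ('a \<times> real) set \<Rightarrow> ('a \<times> real) set \<Rightarrow> bool"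
  where "parabolic_cutoff N k C \<epsilon> \<eta> A O' \<longleftrightarrow> C21t \<eta> UNIV \<and> (\<forall>z. 0 \<le> \<eta> z \<and> \<eta> z \<le> 1) \<and>
      open O' \<and> N \<subseteq> O' \<and> (\<forall>z\<in>O'. \<eta> z = 0) \<and> compact A \<and> measure lborel A \<le> C * \<epsilon> ^ k \<and>
      (\<forall>z. z \<notin> A \<longrightarrow> \<eta> z = 1) \<and> (\<forall>z\<in>A. \<exists>w\<in>N. dist w z \<le> 42 * \<epsilon>) \<and>
      (\<forall>z. \<bar>dirderiv (0, 1) \<eta> z\<bar> \<le> C / \<epsilon>\<^sup>2) \<and>
      (\<forall>b\<in>Basis. \<forall>z. \<bar>dirderiv (b, 0) \<eta> z\<bar> \<le> C / \<epsilon>) \<and>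
      (\<forall>b\<in>Basis. \<forall>z. \<bar>dirderiv (b, 0) (dirderiv (b, 0) \<eta>) z\<bar> \<le> C / \<epsilon>\<^sup>2)"

text \<open>The cutoff is one minus a mollified indicator of a union of enlarged cylinders.
  Mollifying the union instead of adding up bumps makes the derivative bounds independent of
  overlaps: they are L^1 norms of derivatives of the mollifier.\<close>

lemma parabolic_cutoffs:
  fixes N :: "('a::euclidean_space \<times> real) set"
  assumes cover: "parabolic_cover N d Cc" "Cc \<ge> 0" and dk: "d + k = DIM('a) + 2"
  obtains C where "C > 0" "\<And>\<epsilon>. 0 < \<epsilon> \<Longrightarrow> \<epsilon> \<le> 1 \<Longrightarrow> \<exists>\<eta> A O'. parabolic_cutoff N k C \<epsilon> \<eta> A O'"
proof -
  obtain Cm where Cm: "Cm \<ge> 0"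
    "\<And>\<epsilon>. 0 < \<epsilon> \<Longrightarrow> \<exists>\<beta> :: 'a \<times> real \<Rightarrow> real. C21t \<beta> UNIV \<and> (\<forall>z. \<beta> z \<ge> 0) \<and>
       (\<forall>z. z \<notin> pcyl 0 (2 * \<epsilon>) \<longrightarrow> \<beta> z = 0) \<and> (\<integral>z. \<beta> z \<partial>lborel) = 1 \<and>
       (\<integral>z. \<bar>dirderiv (0, 1) \<beta> z\<bar> \<partial>lborel) \<le> Cm / \<epsilon>\<^sup>2 \<and>
       (\<forall>b\<in>Basis. (\<integral>z. \<bar>dirderiv (b, 0) \<beta> z\<bar> \<partial>lborel) \<le> Cm / \<epsilon>) \<and>
       (\<forall>b\<in>Basis. (\<integral>z. \<bar>dirderiv (b, 0) (dirderiv (b, 0) \<beta>) z\<bar> \<partial>lborel) \<le> Cm / \<epsilon>\<^sup>2)"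
    using parabolic_mollifier by blast
  define Cv where "Cv = Cc * (2 * unit_ball_vol (DIM('a)) * 6 ^ (DIM('a) + 2))"
  have Cv: "Cv \<ge> 0" using cover(2) by (simp add: Cv_def)
  define C where "C = Cm + Cv + 1"
  have C: "C > 0" "Cm \<le> C" "Cv \<le> C" using Cm Cv by (auto simp: C_def)
  show thesis
  proof (rule that[OF C(1)])
    fix \<epsilon> :: real assume e: "0 < \<epsilon>" "\<epsilon> \<le> 1"
    have "\<exists>Z. finite Z \<and> Z \<subseteq> N \<and> real (card Z) \<le> Cc / \<epsilon> ^ d \<and> N \<subseteq> (\<Union>z\<in>Z. pcyl z \<epsilon>)"
      using cover(1)[unfolded parabolic_cover_def, rule_format, OF conjI[OF e]] .
    then obtain Z where Z: "finite Z" "Z \<subseteq> N" "real (card Z) \<le> Cc / \<epsilon> ^ d" "N \<subseteq> (\<Union>z\<in>Z. pcyl z \<epsilon>)"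
      by (elim exE conjE)
    from Cm(2)[OF e(1)] obtain \<beta> :: "'a \<times> real \<Rightarrow> real" where \<beta>0: "C21t \<beta> UNIV \<and> (\<forall>z. \<beta> z \<ge> 0) \<and>
       (\<forall>z. z \<notin> pcyl 0 (2 * \<epsilon>) \<longrightarrow> \<beta> z = 0) \<and> (\<integral>z. \<beta> z \<partial>lborel) = 1 \<and>
       (\<integral>z. \<bar>dirderiv (0, 1) \<beta> z\<bar> \<partial>lborel) \<le> Cm / \<epsilon>\<^sup>2 \<and>
       (\<forall>b\<in>Basis. (\<integral>z. \<bar>dirderiv (b, 0) \<beta> z\<bar> \<partial>lborel) \<le> Cm / \<epsilon>) \<and>
       (\<forall>b\<in>Basis. (\<integral>z. \<bar>dirderiv (b, 0) (dirderiv (b, 0) \<beta>) z\<bar> \<partial>lborel) \<le> Cm / \<epsilon>\<^sup>2)"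
      by (rule exE)
    note \<beta> = \<beta>0[THEN conjunct1, rule_format]
      \<beta>0[THEN conjunct2, THEN conjunct1, rule_format]
      \<beta>0[THEN conjunct2, THEN conjunct2, THEN conjunct1, rule_format]
      \<beta>0[THEN conjunct2, THEN conjunct2, THEN conjunct2, THEN conjunct1, rule_format]
      \<beta>0[THEN conjunct2, THEN conjunct2, THEN conjunct2, THEN conjunct2, THEN conjunct1, rule_format]
      \<beta>0[THEN conjunct2, THEN conjunct2, THEN conjunct2, THEN conjunct2, THEN conjunct2, THEN conjunct1, rule_format]
      \<beta>0[THEN conjunct2, THEN conjunct2, THEN conjunct2, THEN conjunct2, THEN conjunct2, THEN conjunct2, rule_format]
    note B = C21tD[OF \<beta>(1)]
    \<comment> \<open>The mollifier reaches \<open>2 * \<epsilon>\<close>. Hence from a point of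
      \<open>O'\<close> (radius \<open>2 * \<epsilon>\<close>) it sees only \<open>A0\<close>
      (radius \<open>4 * \<epsilon>\<close>), and from outside \<open>A\<close> (radius
      \<open>6 * \<epsilon>\<close>) nothing of it.\<close>
    define A0 where "A0 = (\<Union>z\<in>Z. pcyl z (4 * \<epsilon>))"
    define A where "A = (\<Union>z\<in>Z. pcyl z (6 * \<epsilon>))"
    define O' where "O' = (\<Union>z\<in>Z. ball (fst z) (2 * \<epsilon>) \<times> ball (snd z) ((2 * \<epsilon>)\<^sup>2))"
    define g where "g = indicat_real A0"
    have cA: "compact A0" "compact A" unfolding A0_def A_def by (intro compact_UN Z(1) compact_pcyl)+
    have gm[measurable]: "g \<in> borel_measurable borel" unfolding g_def using borel_compact[OF cA(1)] by simp
    have gi: "integrable lborel g"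
      unfolding g_def using borel_compact[OF cA(1)] emeasure_compact_finite[OF cA(1)] by (intro integrable_real_indicator) auto
    have g1: "\<bar>g z\<bar> \<le> 1" "g z \<ge> 0" for z by (auto simp: g_def)
    have z1: "dirderiv v \<beta> z = 0" if "z \<notin> pcyl 0 (2 * \<epsilon>)" for v z
      using dirderiv_zero_outside[OF compact_imp_closed[OF compact_pcyl] \<beta>(3) that] .
    have z2: "dirderiv v (dirderiv v' \<beta>) z = 0" if "z \<notin> pcyl 0 (2 * \<epsilon>)" for v v' z
      using dirderiv_zero_outside[OF compact_imp_closed[OF compact_pcyl] z1 that] .
    have cv: "C21t (conv g \<beta>) UNIV" "dirderiv (0, 1) (conv g \<beta>) = conv g (dirderiv (0, 1) \<beta>)"
      "b \<in> Basis \<Longrightarrow> dirderiv (b, 0) (conv g \<beta>) = conv g (dirderiv (b, 0) \<beta>)"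
      "b \<in> Basis \<Longrightarrow> dirderiv (b, 0) (dirderiv (b, 0) (conv g \<beta>)) = conv g (dirderiv (b, 0) (dirderiv (b, 0) \<beta>))" for b
      using C21t_conv[where k=g and g=\<beta> and C="pcyl 0 (2 * \<epsilon>)", OF gi \<beta>(1) compact_pcyl] \<beta>(3) by blast+
    have cb: "\<bar>conv g f z\<bar> \<le> (\<integral>w. \<bar>f w\<bar> \<partial>lborel)" if f: "continuous_on UNIV f" "\<And>z. z \<notin> pcyl 0 (2 * \<epsilon>) \<Longrightarrow> f z = 0" for f z
    proof -
      have fi: "integrable lborel f" by (rule compact_support_integrable[OF f(1) compact_pcyl f(2)])
      then have "conv g f z = conv f g z" by (intro conv_comm) auto
      then show ?thesis using conv_abs_le[where z=z, OF fi gm g1(1)] by simp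
    qed
    define \<eta> where "\<eta> z = 1 + conv g \<beta> z * (-1)" for z
    have m1: "C21t (\<lambda>_ :: 'a \<times> real. c) UNIV" for c by (simp add: C21t_def dirderiv_const)
    have dm: "has_cont_dirderiv_on v (\<lambda>z. 1 + h z * (-1)) UNIV \<and> dirderiv v (\<lambda>z. 1 + h z * (-1)) = (\<lambda>z. - dirderiv v h z)"
      "has_cont_dirderiv_on v (\<lambda>z. - h z) UNIV \<and> dirderiv v (\<lambda>z. - h z) = (\<lambda>z. - dirderiv v h z)"
      if "has_cont_dirderiv_on v h UNIV" "continuous_on UNIV h" for v and h :: "'a \<times> real \<Rightarrow> real"
    proof -
      note m = dirderiv_mult[OF that(1) dirderiv_const(1)[of v "-1" UNIV] that(2) continuous_on_const]
      have m2: "dirderiv v (\<lambda>z. h z * (-1)) = (\<lambda>z. - dirderiv v h z)" using m(2) by (auto simp: dirderiv_const)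
      show "has_cont_dirderiv_on v (\<lambda>z. - h z) UNIV \<and> dirderiv v (\<lambda>z. - h z) = (\<lambda>z. - dirderiv v h z)"
        using m(1) m2 by simp
      show "has_cont_dirderiv_on v (\<lambda>z. 1 + h z * (-1)) UNIV \<and> dirderiv v (\<lambda>z. 1 + h z * (-1)) = (\<lambda>z. - dirderiv v h z)"
        using dirderiv_add[OF dirderiv_const(1)[of v 1 UNIV] m(1)] m2 by (auto simp: dirderiv_const)
    qed
    note V = C21tD[OF cv(1)]
    have e1: "dirderiv (0, 1) \<eta> = (\<lambda>z. - conv g (dirderiv (0, 1) \<beta>) z)"
      unfolding \<eta>_def[abs_def] using dm(1)[OF V(2,1)] cv(2) by simp
    have e2: "dirderiv (b, 0) \<eta> = (\<lambda>z. - conv g (dirderiv (b, 0) \<beta>) z)" if "b \<in> Basis" for b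
      unfolding \<eta>_def[abs_def] using dm(1)[OF V(3)[OF that] V(1)] cv(3)[OF that] by simp
    have e2': "dirderiv (b, 0) \<eta> = (\<lambda>z. - dirderiv (b, 0) (conv g \<beta>) z)" if "b \<in> Basis" for b
      unfolding \<eta>_def[abs_def] using dm(1)[OF V(3)[OF that] V(1)] by simp
    have e3: "dirderiv (b, 0) (dirderiv (b, 0) \<eta>) = (\<lambda>z. - conv g (dirderiv (b, 0) (dirderiv (b, 0) \<beta>)) z)" if "b \<in> Basis" for b
      unfolding e2'[OF that] using dm(2)[OF V(4)[OF that] V(6)[OF that]] cv(4)[OF that] by simp
    have C\<eta>: "C21t \<eta> UNIV"
      unfolding C21t_def
    proof (intro conjI ballI)
      show "continuous_on UNIV \<eta>" unfolding \<eta>_def[abs_def] by (intro continuous_intros V)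
      show "has_cont_dirderiv_on (0, 1) \<eta> UNIV" unfolding \<eta>_def[abs_def] using dm(1)[OF V(2,1)] by simp
      fix b :: 'a assume b: "b \<in> Basis"
      show "has_cont_dirderiv_on (b, 0) \<eta> UNIV" unfolding \<eta>_def[abs_def] using dm(1)[OF V(3)[OF b] V(1)] by simp
      show "has_cont_dirderiv_on (b, 0) (dirderiv (b, 0) \<eta>) UNIV"
        unfolding e2'[OF b] using dm(2)[OF V(4)[OF b] V(6)[OF b]] by simp
    qed
    have bi: "integrable lborel \<beta>" by (rule compact_support_integrable[OF B(1) compact_pcyl \<beta>(3)])
    have cgb: "conv g \<beta> z = (\<integral>w. \<beta> w * g (z - w) \<partial>lborel)" for z
      using conv_comm[of g \<beta> z] bi by (simp add: conv_def)
    have prodi: "integrable lborel (\<lambda>w. \<beta> w * g (z - w))" for z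
      using conv_integrable[where k=\<beta> and g=g and C=1 and z=z] bi g1 by simp
    have r01: "0 \<le> conv g \<beta> z" "conv g \<beta> z \<le> 1" for z
    proof -
      show "0 \<le> conv g \<beta> z" unfolding cgb by (intro Bochner_Integration.integral_nonneg mult_nonneg_nonneg \<beta>(2) g1(2))
      have "(\<integral>w. \<beta> w * g (z - w) \<partial>lborel) \<le> (\<integral>w. \<beta> w \<partial>lborel)"
        using \<beta>(2) g1(1)[THEN order_trans[OF abs_ge_self]] by (intro integral_mono prodi bi) (simp add: mult_left_le)
      then show "conv g \<beta> z \<le> 1" unfolding cgb \<beta>(4) .
    qed
    have zO: "\<eta> z = 0" if z: "z \<in> O'" for z
    proof -
      obtain c where c0: "c \<in> Z" "z \<in> ball (fst c) (2 * \<epsilon>) \<times> ball (snd c) ((2 * \<epsilon>)\<^sup>2)"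
        using z unfolding O'_def by blast
      then have c: "c \<in> Z" "z \<in> pcyl c (2 * \<epsilon>)" by (auto simp: pcyl_def mem_Times_iff)
      have "\<beta> w * g (z - w) = \<beta> w" for w
      proof (cases "w \<in> pcyl 0 (2 * \<epsilon>)")
        case True
        then have "z - w \<in> pcyl c (2 * \<epsilon> + 2 * \<epsilon>)" using c(2) e by (intro pcyl_add) auto
        then have "z - w \<in> A0" using c(1) by (auto simp: A0_def)
        then show ?thesis by (simp add: g_def)
      qed (use \<beta>(3) in auto)
      then have "conv g \<beta> z = 1" unfolding cgb by (simp only: \<beta>(4))
      then show ?thesis by (simp add: \<eta>_def)
    qed
    have oA: "\<eta> z = 1" if "z \<notin> A" for z
    proof -
      have "\<beta> w * g (z - w) = 0" for w
      proof (cases "w \<in> pcyl 0 (2 * \<epsilon>)")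
        case True
        have "z - w \<notin> A0"
        proof
          assume "z - w \<in> A0"
          then obtain c where c: "c \<in> Z" "z - w \<in> pcyl c (4 * \<epsilon>)" by (auto simp: A0_def)
          have "- w \<in> pcyl 0 (2 * \<epsilon>)" using True by (simp add: pcyl_def mem_Times_iff)
          then have "(z - w) - (- w) \<in> pcyl c (4 * \<epsilon> + 2 * \<epsilon>)" using c(2) e by (intro pcyl_add) auto
          then show False using that c(1) by (auto simp: A_def)
        qed
        then show ?thesis by (simp add: g_def)
      qed (use \<beta>(3) in auto)
      then have "conv g \<beta> z = 0" unfolding cgb by (simp only: Bochner_Integration.integral_zero)
      then show ?thesis by (simp add: \<eta>_def)
    qed
    show "\<exists>\<eta> A O'. parabolic_cutoff N k C \<epsilon> \<eta> A O'"
    proof (rule exI[of _ \<eta>], rule exI[of _ A], rule exI[of _ O'], unfold parabolic_cutoff_def, intro conjI allI ballI impI)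
      show "C21t \<eta> UNIV" by (rule C\<eta>)
      show "0 \<le> \<eta> z" "\<eta> z \<le> 1" for z using r01[of z] by (auto simp: \<eta>_def)
      show "open O'" unfolding O'_def by (intro open_UN ballI open_Times open_ball)
      show "N \<subseteq> O'"
      proof
        fix z assume "z \<in> N"
        then obtain c where c: "c \<in> Z" "z \<in> pcyl c \<epsilon>" using Z(4) by blast
        have lt: "\<epsilon>\<^sup>2 < (2 * \<epsilon>)\<^sup>2" using e by (intro power_strict_mono) auto
        have "dist (snd c) (snd z) < (2 * \<epsilon>)\<^sup>2"
          by (rule le_less_trans[OF _ lt]) (use c(2) in \<open>simp add: pcyl_def mem_Times_iff\<close>)
        moreover have "dist (fst c) (fst z) < 2 * \<epsilon>" using c(2) e by (simp add: pcyl_def mem_Times_iff)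
        ultimately have "z \<in> ball (fst c) (2 * \<epsilon>) \<times> ball (snd c) ((2 * \<epsilon>)\<^sup>2)"
          by (simp only: mem_Times_iff mem_ball)
        then show "z \<in> O'" using c(1) by (auto simp: O'_def)
      qed
      show "\<eta> z = 0" if "z \<in> O'" for z by (rule zO[OF that])
      show "compact A" by (rule cA)
      have "measure lborel A \<le> Cv * \<epsilon> ^ k"
        unfolding A_def Cv_def by (rule measure_pcyl_Union[OF Z(1,3) e(1) _ dk]) simp
      also have "\<dots> \<le> C * \<epsilon> ^ k" using C e by (intro mult_right_mono) auto
      finally show "measure lborel A \<le> C * \<epsilon> ^ k" .
      show "\<eta> z = 1" if "z \<notin> A" for z by (rule oA[OF that])
      show "\<exists>w\<in>N. dist w z \<le> 42 * \<epsilon>" if z: "z \<in> A" for z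
      proof -
        obtain c where c: "c \<in> Z" "z \<in> pcyl c (6 * \<epsilon>)" using z unfolding A_def by blast
        have "dist c z \<le> dist (fst c) (fst z) + dist (snd c) (snd z)"
          unfolding dist_prod_def by (rule sqrt_sum_squares_le_sum) auto
        also have "\<dots> \<le> 6 * \<epsilon> + (6 * \<epsilon>)\<^sup>2" using c(2) by (auto simp: pcyl_def mem_Times_iff)
        \<comment> \<open>\<open>6 * \<epsilon>\<close> in space plus
          \<open>36 * \<epsilon>^2 \<le> 36 * \<epsilon>\<close> in time.\<close>
        also have "\<dots> \<le> 42 * \<epsilon>" using e mult_left_mono[of \<epsilon> 1 \<epsilon>] by (simp add: power2_eq_square)
        finally show ?thesis using c(1) Z(2) by blast
      qed
      show "\<bar>dirderiv (0, 1) \<eta> z\<bar> \<le> C / \<epsilon>\<^sup>2" for z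
      proof -
        have "\<bar>dirderiv (0, 1) \<eta> z\<bar> \<le> Cm / \<epsilon>\<^sup>2" using cb[OF B(5) z1, of z] \<beta>(5) by (simp add: e1)
        also have "\<dots> \<le> C / \<epsilon>\<^sup>2" using C by (intro divide_right_mono) auto
        finally show ?thesis .
      qed
      show "\<bar>dirderiv (b, 0) \<eta> z\<bar> \<le> C / \<epsilon>" if b: "b \<in> Basis" for b z
      proof -
        have "\<bar>dirderiv (b, 0) \<eta> z\<bar> \<le> Cm / \<epsilon>" using cb[OF B(6)[OF b] z1, of z] \<beta>(6)[OF b] by (simp add: e2[OF b])
        also have "\<dots> \<le> C / \<epsilon>" using C e by (intro divide_right_mono) auto
        finally show ?thesis .
      qed
      show "\<bar>dirderiv (b, 0) (dirderiv (b, 0) \<eta>) z\<bar> \<le> C / \<epsilon>\<^sup>2" if b: "b \<in> Basis" for b z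
      proof -
        have "\<bar>dirderiv (b, 0) (dirderiv (b, 0) \<eta>) z\<bar> \<le> Cm / \<epsilon>\<^sup>2" using cb[OF B(7)[OF b] z2, of z] \<beta>(7)[OF b] by (simp add: e3[OF b])
        also have "\<dots> \<le> C / \<epsilon>\<^sup>2" using C by (intro divide_right_mono) auto
        finally show ?thesis .
      qed
    qed
  qed
qed

section \<open>Integration by parts, Young's inequality and bounds for test functions\<close>

lemma glue_continuous:
  fixes f \<psi> :: "'a::euclidean_space \<Rightarrow> real"
  assumes S: "open S" and f: "continuous_on S f" and \<psi>: "continuous_on UNIV \<psi>"
    and C: "compact C" "C \<subseteq> S" "\<And>z. z \<notin> C \<Longrightarrow> \<psi> z = 0"
  shows "continuous_on UNIV (\<lambda>z. f z * \<psi> z)"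
proof -
  have 1: "continuous_on S (\<lambda>z. f z * \<psi> z)"
    by (intro continuous_intros f continuous_on_subset[OF \<psi>]) auto
  have 2: "continuous_on (- C) (\<lambda>z. f z * \<psi> z)"
    by (rule continuous_on_eq[where f="\<lambda>_. 0"]) (use C(3) in auto)
  have "S \<union> - C = UNIV" using C(2) by auto
  then show ?thesis
    using continuous_on_open_Un[OF S open_Compl[OF compact_imp_closed[OF C(1)]] 1 2] by simp
qed

text \<open>\<open>f\<close> is regular only on \<open>S\<close>, but the product with
  \<open>\<psi>\<close> extends by \<open>0\<close> off the compact support, and the derivative of
  that extension has integral \<open>0\<close>.\<close>

lemma integral_by_parts:
  fixes f \<psi> :: "'a::euclidean_space \<Rightarrow> real"
  assumes S: "open S" and f: "continuous_on S f" "has_cont_dirderiv_on v f S"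
    and \<psi>: "continuous_on UNIV \<psi>" "has_cont_dirderiv_on v \<psi> UNIV"
    and C: "compact C" "C \<subseteq> S" "\<And>z. z \<notin> C \<Longrightarrow> \<psi> z = 0"
  shows "(\<integral>z. dirderiv v f z * \<psi> z \<partial>lborel) = - (\<integral>z. f z * dirderiv v \<psi> z \<partial>lborel)"
    and "integrable lborel (\<lambda>z. dirderiv v f z * \<psi> z)" "integrable lborel (\<lambda>z. f z * dirderiv v \<psi> z)"
proof -
  have oC: "open (- C)" using C(1) by (simp add: compact_imp_closed open_Compl)
  have \<psi>S: "continuous_on S \<psi>" "has_cont_dirderiv_on v \<psi> S"
    using \<psi> continuous_on_subset has_cont_dirderiv_on_subset by blast+
  have df: "continuous_on S (dirderiv v f)" and d\<psi>: "continuous_on UNIV (dirderiv v \<psi>)"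
    using f \<psi> by (auto simp: has_cont_dirderiv_on_def)
  have d0: "dirderiv v \<psi> z = 0" if "z \<notin> C" for z
    by (rule dirderiv_zero_outside[OF compact_imp_closed[OF C(1)] C(3) that])
  note m = dirderiv_mult[OF f(2) \<psi>S(2) f(1) \<psi>S(1)]
  have p0: "f z * \<psi> z = 0" if "z \<notin> C" for z using C(3)[OF that] by simp
  have 2: "has_cont_dirderiv_on v (\<lambda>z. f z * \<psi> z) (- C)"
    by (rule has_cont_dirderiv_on_cong_open[OF oC _ dirderiv_const(1)[of v 0]]) (use p0 in auto)
  have "S \<union> - C = UNIV" using C(2) by auto
  then have d: "has_cont_dirderiv_on v (\<lambda>z. f z * \<psi> z) UNIV"
    using has_cont_dirderiv_on_Un[OF S oC m(1) 2] by simp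
  have eq: "dirderiv v (\<lambda>z. f z * \<psi> z) z = dirderiv v f z * \<psi> z + f z * dirderiv v \<psi> z" for z
  proof (cases "z \<in> C")
    case True then show ?thesis using m(2) C(2) by blast
  next
    case False then show ?thesis
      using dirderiv_zero_outside[OF compact_imp_closed[OF C(1)] p0 False, where v=v] d0 C(3) by simp
  qed
  have c1: "continuous_on UNIV (\<lambda>z. dirderiv v f z * \<psi> z)" by (rule glue_continuous[OF S df \<psi>(1) C])
  have c2: "continuous_on UNIV (\<lambda>z. f z * dirderiv v \<psi> z)" by (rule glue_continuous[OF S f(1) d\<psi> C(1,2) d0])
  show i1: "integrable lborel (\<lambda>z. dirderiv v f z * \<psi> z)"
    by (rule compact_support_integrable[OF c1 C(1)]) (use C(3) in auto)
  show i2: "integrable lborel (\<lambda>z. f z * dirderiv v \<psi> z)"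
    by (rule compact_support_integrable[OF c2 C(1)]) (use d0 in auto)
  have "(\<integral>z. dirderiv v (\<lambda>z. f z * \<psi> z) z \<partial>lborel) = 0"
    by (rule integral_dirderiv_eq_0[OF glue_continuous[OF S f(1) \<psi>(1) C] d C(1) p0])
  then show "(\<integral>z. dirderiv v f z * \<psi> z \<partial>lborel) = - (\<integral>z. f z * dirderiv v \<psi> z \<partial>lborel)"
    unfolding eq using i1 i2 by simp
qed

lemma integral_adj_heat:
  fixes u \<psi> :: "'a::euclidean_space \<times> real \<Rightarrow> real"
  assumes S: "open S" and u: "C21t u S" and \<psi>: "C21t \<psi> UNIV"
    and C: "compact C" "C \<subseteq> S" "\<And>z. z \<notin> C \<Longrightarrow> \<psi> z = 0"
  shows "(\<integral>z. (lapl u z - dirderiv (0, 1) u z) * \<psi> z \<partial>lborel) = (\<integral>z. u z * adj_heat \<psi> z \<partial>lborel)"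
proof -
  note u' = C21tD[OF u] and \<psi>' = C21tD[OF \<psi>]
  have d0: "dirderiv v \<psi> z = 0" if "z \<notin> C" for z v
    by (rule dirderiv_zero_outside[OF compact_imp_closed[OF C(1)] C(3) that])
  note t = integral_by_parts[OF S u'(1,2) \<psi>'(1,2) C]
  have x1: "(\<integral>z. dirderiv (b, 0) (dirderiv (b, 0) u) z * \<psi> z \<partial>lborel) = - (\<integral>z. dirderiv (b, 0) u z * dirderiv (b, 0) \<psi> z \<partial>lborel)"
    and i1: "integrable lborel (\<lambda>z. dirderiv (b, 0) (dirderiv (b, 0) u) z * \<psi> z)" if "b \<in> Basis" for b
    using integral_by_parts[OF S u'(6)[OF that] u'(4)[OF that] \<psi>'(1) \<psi>'(3)[OF that] C] by auto
  have x2: "(\<integral>z. dirderiv (b, 0) u z * dirderiv (b, 0) \<psi> z \<partial>lborel) = - (\<integral>z. u z * dirderiv (b, 0) (dirderiv (b, 0) \<psi>) z \<partial>lborel)"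
    and i2: "integrable lborel (\<lambda>z. u z * dirderiv (b, 0) (dirderiv (b, 0) \<psi>) z)" if "b \<in> Basis" for b
    using integral_by_parts[OF S u'(1) u'(3)[OF that] \<psi>'(6)[OF that] \<psi>'(4)[OF that] C(1,2) d0] by auto
  have "(\<integral>z. (lapl u z - dirderiv (0, 1) u z) * \<psi> z \<partial>lborel) =
    (\<integral>z. (\<Sum>b\<in>Basis. dirderiv (b, 0) (dirderiv (b, 0) u) z * \<psi> z) - dirderiv (0, 1) u z * \<psi> z \<partial>lborel)"
    by (simp add: lapl_def left_diff_distrib sum_distrib_right)
  also have "\<dots> = (\<Sum>b\<in>Basis. \<integral>z. dirderiv (b, 0) (dirderiv (b, 0) u) z * \<psi> z \<partial>lborel) - (\<integral>z. dirderiv (0, 1) u z * \<psi> z \<partial>lborel)"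
    using i1 t(2) by simp
  also have "\<dots> = (\<Sum>b\<in>Basis. \<integral>z. u z * dirderiv (b, 0) (dirderiv (b, 0) \<psi>) z \<partial>lborel) + (\<integral>z. u z * dirderiv (0, 1) \<psi> z \<partial>lborel)"
    using x1 x2 t(1) by simp
  also have "\<dots> = (\<integral>z. (\<Sum>b\<in>Basis. u z * dirderiv (b, 0) (dirderiv (b, 0) \<psi>) z) + u z * dirderiv (0, 1) \<psi> z \<partial>lborel)"
    using i2 t(3) by simp
  also have "\<dots> = (\<integral>z. u z * adj_heat \<psi> z \<partial>lborel)"
    by (simp add: adj_heat_def lapl_def distrib_left sum_distrib_left add.commute)
  finally show ?thesis .
qed

text \<open>Either \<open>b \<le> \<theta> * a powr (p - 1)\<close> and the first term alone
  suffices, or \<open>a\<close> is at most a power of \<open>b / \<theta>\<close> and the second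
  does. The free weight is used twice: \<open>\<theta> = 1/2\<close> for absorption,
  \<open>\<theta>\<close> large to make the error vanish.\<close>

lemma young_split:
  fixes a b \<theta> p :: real
  assumes "a \<ge> 0" "b \<ge> 0" "\<theta> > 0" "p > 1"
  shows "a * b \<le> \<theta> * a powr p + \<theta> powr (- (1 / (p - 1))) * b powr (1 + 1 / (p - 1))"
proof (cases "b \<le> \<theta> * a powr (p - 1)")
  case True
  have "a * b \<le> a * (\<theta> * a powr (p - 1))" using True assms by (intro mult_left_mono) auto
  also have "\<dots> = \<theta> * a powr p"
    using assms by (cases "a = 0") (auto simp: powr_diff)
  also have "\<dots> \<le> \<theta> * a powr p + \<theta> powr (- (1 / (p - 1))) * b powr (1 + 1 / (p - 1))" by simp
  finally show ?thesis .
next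
  case False
  then have b: "b > 0" "a powr (p - 1) \<le> b / \<theta>"
    using assms by (auto simp: field_simps not_le intro: le_less_trans[rotated])
  have "a = (a powr (p - 1)) powr (1 / (p - 1))" using assms by (simp add: powr_powr)
  also have "\<dots> \<le> (b / \<theta>) powr (1 / (p - 1))" using b assms by (intro powr_mono2) auto
  finally have "a * b \<le> (b / \<theta>) powr (1 / (p - 1)) * b" using b by (intro mult_right_mono) auto
  also have "(b / \<theta>) powr (1 / (p - 1)) = b powr (1 / (p - 1)) / \<theta> powr (1 / (p - 1))"
    by (rule powr_divide)
  also have "b powr (1 / (p - 1)) / \<theta> powr (1 / (p - 1)) * b = \<theta> powr (- (1 / (p - 1))) * b powr (1 + 1 / (p - 1))"
    using b by (simp add: powr_add powr_minus field_simps)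
  finally show ?thesis using assms by (simp add: add_increasing)
qed

lemma test_bounded:
  fixes \<psi> :: "'a::euclidean_space \<times> real \<Rightarrow> real"
  assumes \<psi>: "C21t \<psi> UNIV" and C: "compact C" "\<And>z. z \<notin> C \<Longrightarrow> \<psi> z = 0"
  obtains M where "M \<ge> 0" "\<And>z. \<bar>\<psi> z\<bar> \<le> M" "\<And>b z. b \<in> Basis \<Longrightarrow> \<bar>dirderiv (b, 0) \<psi> z\<bar> \<le> M" "\<And>z. \<bar>adj_heat \<psi> z\<bar> \<le> M"
proof -
  note P = C21tD[OF \<psi>]
  have d0: "dirderiv v \<psi> z = 0" if "z \<notin> C" for z v
    by (rule dirderiv_zero_outside[OF compact_imp_closed[OF C(1)] C(2) that])
  obtain m1 where m1: "m1 \<ge> 0" "\<And>z. \<bar>\<psi> z\<bar> \<le> m1" using compact_support_imp_bounded[OF P(1) C] by blast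
  obtain m2 where m2: "m2 \<ge> 0" "\<And>z. \<bar>adj_heat \<psi> z\<bar> \<le> m2"
    using compact_support_imp_bounded[OF adj_heat_continuous[OF \<psi>] C(1) adj_heat_zero_outside[OF compact_imp_closed[OF C(1)] C(2)]] by blast
  have "\<exists>m\<ge>0. \<forall>z. \<bar>dirderiv (b, 0) \<psi> z\<bar> \<le> m" if "b \<in> Basis" for b
    using compact_support_imp_bounded[OF P(6)[OF that] C(1) d0] by blast
  then obtain m3 where m3: "\<And>b. b \<in> Basis \<Longrightarrow> m3 b \<ge> 0 \<and> (\<forall>z. \<bar>dirderiv (b, 0) \<psi> z\<bar> \<le> m3 b)"
    by metis
  define M where "M = m1 + m2 + sum m3 Basis"
  have s: "m3 b \<le> sum m3 Basis" if "b \<in> Basis" for b using m3 that by (intro member_le_sum) auto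
  have s0: "sum m3 Basis \<ge> 0" using m3 by (intro sum_nonneg) auto
  show thesis
  proof (rule that[of M])
    show "M \<ge> 0" using m1 m2 s0 by (simp add: M_def)
    show "\<bar>\<psi> z\<bar> \<le> M" "\<bar>adj_heat \<psi> z\<bar> \<le> M" for z
      using m1(1) m1(2)[of z] m2(1) m2(2)[of z] s0 unfolding M_def by linarith+
    show "\<bar>dirderiv (b, 0) \<psi> z\<bar> \<le> M" if "b \<in> Basis" for b z
      using m3[OF that, THEN conjunct2, rule_format, of z] s[OF that] m1(1) m2(1) unfolding M_def by linarith
  qed
qed

section \<open>Removable singularities\<close>

text \<open>A sequence of parabolic cutoffs around a compact null set. That the scales shrink enters
  only through \<open>A_lim\<close>: every point off \<open>N\<close> eventually leaves the sets
  \<open>A j\<close>.\<close>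

locale cutoff_seq =
  fixes N :: "('a::euclidean_space \<times> real) set" and k :: nat and C0 :: real
    and \<epsilon> :: "nat \<Rightarrow> real" and \<eta> :: "nat \<Rightarrow> 'a \<times> real \<Rightarrow> real" and A O' :: "nat \<Rightarrow> ('a \<times> real) set"
  assumes N: "compact N" "N \<in> null_sets lborel" and C0: "C0 > 0"
    and eps: "\<And>j. 0 < \<epsilon> j" "\<And>j. \<epsilon> j \<le> 1"
    and eta: "\<And>j. C21t (\<eta> j) UNIV" "\<And>j z. 0 \<le> \<eta> j z" "\<And>j z. \<eta> j z \<le> 1"
    and O': "\<And>j. open (O' j)" "\<And>j. N \<subseteq> O' j" "\<And>j z. z \<in> O' j \<Longrightarrow> \<eta> j z = 0"
    and A: "\<And>j. compact (A j)" "\<And>j. measure lborel (A j) \<le> C0 * \<epsilon> j ^ k" "\<And>j z. z \<notin> A j \<Longrightarrow> \<eta> j z = 1"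
    and A_lim: "\<And>z. z \<notin> N \<Longrightarrow> \<forall>\<^sub>F j in sequentially. z \<notin> A j"
    and eta_t: "\<And>j z. \<bar>dirderiv (0, 1) (\<eta> j) z\<bar> \<le> C0 / (\<epsilon> j)\<^sup>2"
    and eta_x: "\<And>j b z. b \<in> Basis \<Longrightarrow> \<bar>dirderiv (b, 0) (\<eta> j) z\<bar> \<le> C0 / \<epsilon> j"
    and eta_xx: "\<And>j b z. b \<in> Basis \<Longrightarrow> \<bar>dirderiv (b, 0) (dirderiv (b, 0) (\<eta> j)) z\<bar> \<le> C0 / (\<epsilon> j)\<^sup>2"
begin

text \<open>With \<open>n\<close> the dimension of space, \<open>1 + n\<close> accounts for the heat
  operator of the cutoff and \<open>2 * n\<close> for the cross term in \<open>err\<close>.\<close>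

definition C1 :: real where "C1 = C0 * (1 + 3 * real DIM('a))"

lemma C1: "C1 > 0" using C0 by (simp add: C1_def add_pos_nonneg)

lemma A_borel: "A j \<in> sets borel" "emeasure lborel (A j) < \<infinity>"
  using borel_compact[OF A(1)] emeasure_compact_finite[OF A(1)] by blast+

lemma eta_flat:
  assumes "z \<notin> A j"
  shows "dirderiv v (\<eta> j) z = 0" "adj_heat (\<eta> j) z = 0"
proof -
  have o: "open (- A j)" using A(1) by (simp add: compact_imp_closed open_Compl)
  have d: "dirderiv v (\<eta> j) w = 0" if "w \<notin> A j" for v w
    using dirderiv_cong_open[OF o, of w "\<eta> j" "\<lambda>_. 1" v] that A(3) by (simp add: dirderiv_const)
  have dd: "dirderiv v (dirderiv v (\<eta> j)) z = 0" for v
    using dirderiv_cong_open[OF o, of z "dirderiv v (\<eta> j)" "\<lambda>_. 0" v] assms d by (simp add: dirderiv_const)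
  show "dirderiv v (\<eta> j) z = 0" by (rule d[OF assms])
  show "adj_heat (\<eta> j) z = 0" using d[OF assms] dd by (simp add: adj_heat_def lapl_def)
qed

text \<open>The commutator of the adjoint heat operator with multiplication by the cutoff. It lives
  on \<open>A j\<close> and has size \<open>1 / \<epsilon>^2\<close>.\<close>

definition err :: "nat \<Rightarrow> ('a \<times> real \<Rightarrow> real) \<Rightarrow> 'a \<times> real \<Rightarrow> real"
  where "err j \<psi> z = \<psi> z * adj_heat (\<eta> j) z + 2 * (\<Sum>b\<in>Basis. dirderiv (b, 0) \<psi> z * dirderiv (b, 0) (\<eta> j) z)"

lemma adj_heat_cut:
  assumes "C21t \<psi> UNIV"
  shows "adj_heat (\<lambda>z. \<psi> z * \<eta> j z) z = \<eta> j z * adj_heat \<psi> z + err j \<psi> z"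
  using adj_heat_mult[OF open_UNIV assms eta(1) UNIV_I, of j z] by (simp add: err_def)

lemma err_bound:
  assumes M: "M \<ge> 0" "\<bar>\<psi> z\<bar> \<le> M" "\<And>b. b \<in> Basis \<Longrightarrow> \<bar>dirderiv (b, 0) \<psi> z\<bar> \<le> M"
  shows "\<bar>err j \<psi> z\<bar> \<le> C1 * M / (\<epsilon> j)\<^sup>2 * indicator (A j) z"
proof (cases "z \<in> A j")
  case False
  then show ?thesis by (simp add: err_def eta_flat)
next
  case True
  note e = eps[of j]
  have 1: "\<bar>adj_heat (\<eta> j) z\<bar> \<le> C0 / (\<epsilon> j)\<^sup>2 + real DIM('a) * (C0 / (\<epsilon> j)\<^sup>2)"
  proof -
    have "\<bar>lapl (\<eta> j) z\<bar> \<le> (\<Sum>b\<in>Basis. \<bar>dirderiv (b, 0) (dirderiv (b, 0) (\<eta> j)) z\<bar>)"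
      unfolding lapl_def by (rule sum_abs)
    also have "\<dots> \<le> (\<Sum>b\<in>(Basis :: 'a set). C0 / (\<epsilon> j)\<^sup>2)" by (intro sum_mono eta_xx)
    finally have "\<bar>lapl (\<eta> j) z\<bar> \<le> real DIM('a) * (C0 / (\<epsilon> j)\<^sup>2)" by simp
    then show ?thesis unfolding adj_heat_def using eta_t[of j z] by linarith
  qed
  have 2: "\<bar>\<Sum>b\<in>Basis. dirderiv (b, 0) \<psi> z * dirderiv (b, 0) (\<eta> j) z\<bar> \<le> real DIM('a) * (M * (C0 / (\<epsilon> j)\<^sup>2))"
  proof -
    \<comment> \<open>Scales are at most \<open>1\<close>, so the first-order bound is absorbed into
      the second-order one.\<close>
    have "C0 / \<epsilon> j \<le> C0 / (\<epsilon> j)\<^sup>2"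
      using e C0 mult_left_mono[of "\<epsilon> j" 1 "\<epsilon> j"] by (intro divide_left_mono) (auto simp: power2_eq_square)
    then have "\<bar>dirderiv (b, 0) \<psi> z * dirderiv (b, 0) (\<eta> j) z\<bar> \<le> M * (C0 / (\<epsilon> j)\<^sup>2)" if "b \<in> Basis" for b
      unfolding abs_mult using M(3)[OF that] eta_x[OF that, of j z] M(1) by (intro mult_mono) auto
    then have "(\<Sum>b\<in>Basis. \<bar>dirderiv (b, 0) \<psi> z * dirderiv (b, 0) (\<eta> j) z\<bar>) \<le> (\<Sum>b\<in>(Basis :: 'a set). M * (C0 / (\<epsilon> j)\<^sup>2))"
      by (intro sum_mono)
    from order_trans[OF sum_abs this] show ?thesis by simp
  qed
  have "\<bar>err j \<psi> z\<bar> \<le> \<bar>\<psi> z\<bar> * \<bar>adj_heat (\<eta> j) z\<bar> + 2 * \<bar>\<Sum>b\<in>Basis. dirderiv (b, 0) \<psi> z * dirderiv (b, 0) (\<eta> j) z\<bar>"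
    unfolding err_def abs_mult[symmetric] by (rule order_trans[OF abs_triangle_ineq]) (simp add: abs_mult)
  also have "\<dots> \<le> M * (C0 / (\<epsilon> j)\<^sup>2 + real DIM('a) * (C0 / (\<epsilon> j)\<^sup>2)) + 2 * (real DIM('a) * (M * (C0 / (\<epsilon> j)\<^sup>2)))"
    using M 1 2 C0 by (intro add_mono mult_mono) auto
  also have "\<dots> = C1 * M / (\<epsilon> j)\<^sup>2" by (simp add: C1_def algebra_simps add_divide_distrib)
  finally show ?thesis using True by simp
qed

end

text \<open>\<open>1 + 1 / (p - 1)\<close> is the exponent conjugate to \<open>p\<close>, so
  \<open>kp\<close> compares twice that exponent with \<open>k\<close>, which in the application is
  the codimension of the submanifold.\<close>

locale removable = cutoff_seq +
  fixes u :: "'a \<times> real \<Rightarrow> real" and z0 :: "'a \<times> real" and R p :: real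
  assumes R: "R > 0" and p: "p > 1" and kp: "2 * (1 + 1 / (p - 1)) \<le> real k"
    and u: "C21t u (ball z0 R - N)" "\<And>z. z \<in> ball z0 R - N \<Longrightarrow> u z \<ge> 0"
    and eq: "\<And>z. z \<in> ball z0 R - N \<Longrightarrow> dirderiv (0, 1) u z - lapl u z = - (u z powr p)"
begin

definition S where "S = ball z0 R - N"

lemma S_open: "open S" unfolding S_def using N(1) by (intro open_Diff compact_imp_closed) auto

definition U where "U z = (if z \<in> S then u z else 0)"

lemma U_nonneg: "U z \<ge> 0" using u(2)[of z] by (auto simp: U_def S_def)

lemma U_measurable [measurable]: "U \<in> borel_measurable borel"
proof -
  have "(\<lambda>z. indicator S z *\<^sub>R u z) \<in> borel_measurable borel"
    using C21tD(1)[OF u(1)] S_open by (intro borel_measurable_continuous_on_indicator) (auto simp: S_def)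
  moreover have "(\<lambda>z. indicator S z *\<^sub>R u z) = U" by (auto simp: U_def indicator_def fun_eq_iff)
  ultimately show ?thesis by simp
qed

lemma U_continuous: "continuous_on S U"
  by (rule continuous_on_eq[OF C21tD(1)[OF u(1)[folded S_def]]]) (simp add: U_def)

lemma U_powr_continuous: "continuous_on S (\<lambda>z. U z powr p)"
  using U_nonneg p by (intro continuous_on_powr' U_continuous continuous_intros) auto

text \<open>Test functions supported off \<open>N\<close> see the classical equation. The
  integrability of both sides matters as much as the identity, since only a finite integral can be
  absorbed.\<close>

lemma tested_off:
  assumes \<psi>: "C21t \<psi> UNIV" and C: "compact C" "C \<subseteq> S" "\<And>z. z \<notin> C \<Longrightarrow> \<psi> z = 0"
  shows "(\<integral>z. U z powr p * \<psi> z \<partial>lborel) = (\<integral>z. U z * adj_heat \<psi> z \<partial>lborel)"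
    "integrable lborel (\<lambda>z. U z powr p * \<psi> z)" "integrable lborel (\<lambda>z. U z * adj_heat \<psi> z)"
proof -
  have a0: "adj_heat \<psi> z = 0" if "z \<notin> C" for z
    by (rule adj_heat_zero_outside[OF compact_imp_closed[OF C(1)] C(3) that])
  have "(\<integral>z. U z powr p * \<psi> z \<partial>lborel) = (\<integral>z. (lapl u z - dirderiv (0, 1) u z) * \<psi> z \<partial>lborel)"
  proof (rule Bochner_Integration.integral_cong[OF refl])
    fix z
    show "U z powr p * \<psi> z = (lapl u z - dirderiv (0, 1) u z) * \<psi> z"
      using eq[of z] C(2,3) by (cases "z \<in> C") (auto simp: U_def S_def)
  qed
  also have "\<dots> = (\<integral>z. u z * adj_heat \<psi> z \<partial>lborel)"
    by (rule integral_adj_heat[OF S_open u(1)[folded S_def] \<psi> C])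
  also have "\<dots> = (\<integral>z. U z * adj_heat \<psi> z \<partial>lborel)"
  proof (rule Bochner_Integration.integral_cong[OF refl])
    fix z
    show "u z * adj_heat \<psi> z = U z * adj_heat \<psi> z"
      using a0[of z] C(2) by (cases "z \<in> C") (auto simp: U_def)
  qed
  finally show "(\<integral>z. U z powr p * \<psi> z \<partial>lborel) = (\<integral>z. U z * adj_heat \<psi> z \<partial>lborel)" .
  show "integrable lborel (\<lambda>z. U z powr p * \<psi> z)"
    by (rule compact_support_integrable[OF glue_continuous[OF S_open U_powr_continuous C21tD(1)[OF \<psi>] C] C(1)]) (use C(3) in auto)
  show "integrable lborel (\<lambda>z. U z * adj_heat \<psi> z)"
    by (rule compact_support_integrable[OF glue_continuous[OF S_open U_continuous adj_heat_continuous[OF \<psi>] C(1,2) a0] C(1)]) (use a0 in auto)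
qed

lemma cut_support:
  assumes C: "compact C" "C \<subseteq> ball z0 R" "\<forall>z. z \<notin> C \<longrightarrow> \<psi> z = 0"
  shows "compact (C - O' j)" "C - O' j \<subseteq> S" "\<And>z. z \<notin> C - O' j \<Longrightarrow> \<psi> z * \<eta> j z = 0"
proof -
  show "compact (C - O' j)" by (rule compact_diff[OF C(1) O'(1)])
  show "C - O' j \<subseteq> S" using C(2) O'(2)[of j] by (auto simp: S_def)
  show "\<And>z. z \<notin> C - O' j \<Longrightarrow> \<psi> z * \<eta> j z = 0" using C(3) O'(3) by auto
qed

definition q where "q = 1 / (p - 1)"

lemma q: "q > 0" "2 * (1 + q) \<le> real k" using p kp by (auto simp: q_def)

text \<open>The critical balance of \<open>\<epsilon>^(-2 * (1 + q))\<close> against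
  \<open>\<epsilon>^k\<close>. At the critical exponent the product is merely bounded.\<close>

lemma measure_power_A: "(1 / (\<epsilon> j)\<^sup>2) powr (1 + q) * measure lborel (A j) \<le> C0"
proof -
  note e = eps[of j]
  have "(1 / (\<epsilon> j)\<^sup>2) = \<epsilon> j powr (- 2)" using e by (simp add: powr_minus powr_numeral divide_inverse)
  then have "(1 / (\<epsilon> j)\<^sup>2) powr (1 + q) = \<epsilon> j powr (- (2 * (1 + q)))" by (simp add: powr_powr algebra_simps)
  then have "(1 / (\<epsilon> j)\<^sup>2) powr (1 + q) * measure lborel (A j) \<le> \<epsilon> j powr (- (2 * (1 + q))) * (C0 * \<epsilon> j ^ k)"
    using A(2)[of j] by (simp add: mult_left_mono)
  also have "\<dots> = C0 * (\<epsilon> j powr (real k - 2 * (1 + q)))"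
    using e by (simp add: powr_realpow[symmetric] powr_add[symmetric] algebra_simps)
  also have "\<dots> \<le> C0 * 1"
    using e q C0 by (intro mult_left_mono powr_le1) auto
  finally show ?thesis by simp
qed

text \<open>With \<open>\<omega> = \<phi> * \<eta>\<close> the test function is
  \<open>\<omega>^(n+2)\<close>, whose heat operator keeps a factor \<open>\<omega>^n\<close>. For
  \<open>n\<close> so large that \<open>n * p \<ge> n + 2\<close>, the power
  \<open>(U * \<omega>^n)^p\<close> is at most \<open>U^p * \<omega>^(n+2)\<close>, so Young's
  inequality returns half of the left-hand side, which is finite because the test function vanishes
  near \<open>N\<close>.\<close>

lemma U_powr_bound:
  assumes \<phi>: "C21t \<phi> UNIV" "\<And>z. 0 \<le> \<phi> z" "\<And>z. \<phi> z \<le> 1" and C: "compact C" "C \<subseteq> ball z0 R" "\<And>z. z \<notin> C \<Longrightarrow> \<phi> z = 0"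
  shows "\<exists>B n. \<forall>j. (\<integral>\<^sup>+z. ennreal (U z powr p * (\<phi> z * \<eta> j z) ^ n) \<partial>lborel) \<le> ennreal B"
proof -
  obtain M where M: "M \<ge> 0" "\<And>z. \<bar>\<phi> z\<bar> \<le> M" "\<And>b z. b \<in> Basis \<Longrightarrow> \<bar>dirderiv (b, 0) \<phi> z\<bar> \<le> M" "\<And>z. \<bar>adj_heat \<phi> z\<bar> \<le> M"
    using test_bounded[OF \<phi>(1) C(1,3)] by blast
  define n where "n = nat \<lceil>2 / (p - 1)\<rceil> + 1"
  have n: "n \<ge> 1" "real n * p \<ge> real n + 2"
  proof -
    have "real n \<ge> 2 / (p - 1)" unfolding n_def by linarith
    then show "real n * p \<ge> real n + 2" using p by (simp add: field_simps)
  qed (simp add: n_def)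
  define D where "D = M + C1 * M + real DIM('a) * (2 * M\<^sup>2 + 2 * (M * C0)\<^sup>2)"
  define c where "c = (real n + 2) * (real n + 2)"
  \<comment> \<open>Twice the bound for the integral of the Young remainder, as half of the
    left-hand side is absorbed. \<open>2 powr q\<close> is the weight
    \<open>(1/2) powr (- q)\<close>.\<close>
  define B where "B = 2 * (2 powr q * ((2 * c * D) powr (1 + q) * (measure lborel C + C0)))"
  have D0: "D \<ge> 0" using M C1 by (simp add: D_def)
  have c0: "c \<ge> 0" by (simp add: c_def)
  have "(\<integral>\<^sup>+z. ennreal (U z powr p * (\<phi> z * \<eta> j z) ^ Suc (Suc n)) \<partial>lborel) \<le> ennreal B" for j
  proof -
    note e = eps[of j]
    define \<omega> where "\<omega> z = \<phi> z * \<eta> j z" for z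
    have \<omega>C: "C21t \<omega> UNIV" unfolding \<omega>_def[abs_def] by (intro C21t_mult open_UNIV \<phi> eta)
    have \<omega>01: "0 \<le> \<omega> z" "\<omega> z \<le> 1" for z
      using \<phi>(2,3)[of z] eta(2,3)[of j z] by (auto simp: \<omega>_def intro: mult_le_one)
    have cs1: "compact (C - O' j)" "C - O' j \<subseteq> S" "\<And>z. z \<notin> C - O' j \<Longrightarrow> \<omega> z = 0"
      using cut_support[where C=C and \<psi>=\<phi> and j=j, OF C(1,2)] C(3) by (simp_all only: \<omega>_def) blast+
    have pw: "C21t (\<lambda>z. \<omega> z ^ Suc (Suc n)) UNIV" by (rule C21t_power[OF open_UNIV \<omega>C])
    have p0: "\<omega> z ^ Suc (Suc n) = 0" if "z \<notin> C - O' j" for z using cs1(3)[OF that] by simp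
    note T = tested_off[OF pw cs1(1,2) p0]
    define Q where "Q z = \<bar>adj_heat \<omega> z\<bar> + (\<Sum>b\<in>Basis. (dirderiv (b, 0) \<omega> z)\<^sup>2)" for z
    have Q0: "Q z \<ge> 0" for z unfolding Q_def by (intro add_nonneg_nonneg sum_nonneg) auto
    have Qout: "Q z = 0" if "z \<notin> C" for z
    proof -
      have z: "\<And>z. z \<notin> C \<Longrightarrow> \<omega> z = 0" using C(3) by (simp add: \<omega>_def)
      then show ?thesis
        using adj_heat_zero_outside[OF compact_imp_closed[OF C(1)] z that] dirderiv_zero_outside[OF compact_imp_closed[OF C(1)] z that]
        by (simp add: Q_def)
    qed
    \<comment> \<open>Off \<open>A j\<close> the cutoff is flat and only the fixed
      \<open>\<phi>\<close> contributes. On \<open>A j\<close> the squared gradient and the heat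
      operator are both of order \<open>1 / \<epsilon>^2\<close>.\<close>
    have Qb: "Q z \<le> 2 * D * (if z \<in> A j then 1 / (\<epsilon> j)\<^sup>2 else 1)" for z
    proof -
      let ?a = "indicator (A j) z / (\<epsilon> j)\<^sup>2 :: real"
      have a0: "?a \<ge> 0" by simp
      have "\<bar>adj_heat \<omega> z\<bar> \<le> \<bar>\<eta> j z * adj_heat \<phi> z\<bar> + \<bar>err j \<phi> z\<bar>"
        unfolding \<omega>_def[abs_def] adj_heat_cut[OF \<phi>(1)] by (rule abs_triangle_ineq)
      also have "\<bar>\<eta> j z * adj_heat \<phi> z\<bar> \<le> 1 * M"
        unfolding abs_mult using eta(2,3)[of j z] M by (intro mult_mono) auto
      also have "\<bar>err j \<phi> z\<bar> \<le> C1 * M / (\<epsilon> j)\<^sup>2 * indicator (A j) z" by (rule err_bound[OF M(1,2,3)])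
      finally have 1: "\<bar>adj_heat \<omega> z\<bar> \<le> M + C1 * M * ?a" by simp
      have 2: "(dirderiv (b, 0) \<omega> z)\<^sup>2 \<le> 2 * M\<^sup>2 + 2 * (M * C0)\<^sup>2 * ?a" if b: "b \<in> Basis" for b
      proof -
        have d: "dirderiv (b, 0) \<omega> z = dirderiv (b, 0) \<phi> z * \<eta> j z + \<phi> z * dirderiv (b, 0) (\<eta> j) z"
          unfolding \<omega>_def[abs_def] by (intro dirderiv_mult(2)[where S=UNIV] C21tD[OF \<phi>(1)] C21tD[OF eta(1)] b UNIV_I)
        have x: "\<bar>dirderiv (b, 0) \<phi> z * \<eta> j z\<bar> \<le> M * 1"
          unfolding abs_mult using eta(2,3)[of j z] M(1) M(3)[OF b, of z] by (intro mult_mono) auto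
        have y: "\<bar>\<phi> z * dirderiv (b, 0) (\<eta> j) z\<bar> \<le> M * (C0 / \<epsilon> j * indicator (A j) z)"
          unfolding abs_mult using M(1) M(2)[of z] eta_x[OF b, of j z] eta_flat(1)[of z j "(b, 0)"]
          by (intro mult_mono) (auto simp: indicator_def)
        have "(x + y)\<^sup>2 \<le> 2 * x\<^sup>2 + 2 * y\<^sup>2" for x y :: real
          using zero_le_power2[of "x - y"] by (simp add: power2_eq_square algebra_simps)
        then have "(dirderiv (b, 0) \<omega> z)\<^sup>2 \<le> 2 * (dirderiv (b, 0) \<phi> z * \<eta> j z)\<^sup>2 + 2 * (\<phi> z * dirderiv (b, 0) (\<eta> j) z)\<^sup>2"
          unfolding d .
        also have "(dirderiv (b, 0) \<phi> z * \<eta> j z)\<^sup>2 \<le> (M * 1)\<^sup>2" using power_mono[OF x, of 2] by simp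
        also have "(\<phi> z * dirderiv (b, 0) (\<eta> j) z)\<^sup>2 \<le> (M * (C0 / \<epsilon> j * indicator (A j) z))\<^sup>2" using power_mono[OF y, of 2] by simp
        also have "(M * (C0 / \<epsilon> j * indicator (A j) z))\<^sup>2 = (M * C0)\<^sup>2 * ?a"
          by (auto simp: indicator_def power_mult_distrib power_divide)
        finally show ?thesis by simp
      qed
      have "(\<Sum>b\<in>Basis. (dirderiv (b, 0) \<omega> z)\<^sup>2) \<le> (\<Sum>b\<in>(Basis :: 'a set). 2 * M\<^sup>2 + 2 * (M * C0)\<^sup>2 * ?a)"
        by (intro sum_mono 2)
      with 1 have "Q z \<le> (M + C1 * M * ?a) + real DIM('a) * (2 * M\<^sup>2 + 2 * (M * C0)\<^sup>2 * ?a)"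
        unfolding Q_def by simp
      also have "\<dots> \<le> D * (1 + ?a)"
      proof -
        have "0 \<le> (C1 * M + real DIM('a) * (2 * (M * C0)\<^sup>2)) + (M + real DIM('a) * (2 * M\<^sup>2)) * ?a"
          using C1 M(1) a0 by (intro add_nonneg_nonneg mult_nonneg_nonneg) auto
        then show ?thesis by (simp add: D_def algebra_simps)
      qed
      also have "\<dots> \<le> 2 * D * (if z \<in> A j then 1 / (\<epsilon> j)\<^sup>2 else 1)"
      proof (cases "z \<in> A j")
        case True
        have "(\<epsilon> j)\<^sup>2 \<le> 1" using e by (simp add: power_le_one)
        then have "1 \<le> 1 / (\<epsilon> j)\<^sup>2" using e by simp
        then have "D * (1 + 1 / (\<epsilon> j)\<^sup>2) \<le> D * (2 * (1 / (\<epsilon> j)\<^sup>2))" using D0 by (intro mult_left_mono) auto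
        then show ?thesis using True by simp
      qed (use D0 in simp)
      finally show ?thesis .
    qed
    define V where "V z = 2 powr q * ((2 * c * D) powr (1 + q) * (indicator C z + (1 / (\<epsilon> j)\<^sup>2) powr (1 + q) * indicator (A j) z))" for z :: "'a \<times> real"
    have ptw: "U z * adj_heat (\<lambda>z. \<omega> z ^ Suc (Suc n)) z \<le> 1 / 2 * (U z powr p * \<omega> z ^ Suc (Suc n)) + V z" for z
    proof -
      have "\<bar>adj_heat (\<lambda>z. \<omega> z ^ Suc (Suc n)) z\<bar> \<le> \<bar>real (Suc (Suc n)) * \<omega> z ^ Suc n * adj_heat \<omega> z\<bar>
         + \<bar>real (Suc (Suc n)) * real (Suc n) * \<omega> z ^ n * (\<Sum>b\<in>Basis. (dirderiv (b, 0) \<omega> z)\<^sup>2)\<bar>"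
        unfolding adj_heat_power[OF open_UNIV \<omega>C UNIV_I] by (rule abs_triangle_ineq)
      also have "\<dots> = real (Suc (Suc n)) * \<omega> z ^ Suc n * \<bar>adj_heat \<omega> z\<bar>
         + real (Suc (Suc n)) * real (Suc n) * \<omega> z ^ n * (\<Sum>b\<in>Basis. (dirderiv (b, 0) \<omega> z)\<^sup>2)"
        using \<omega>01[of z] by (simp add: abs_mult sum_nonneg)
      also have "\<dots> \<le> c * \<omega> z ^ n * \<bar>adj_heat \<omega> z\<bar> + c * \<omega> z ^ n * (\<Sum>b\<in>Basis. (dirderiv (b, 0) \<omega> z)\<^sup>2)"
      proof (intro add_mono mult_right_mono sum_nonneg zero_le_power2)
        have "real (Suc (Suc n)) * \<omega> z ^ Suc n \<le> c * \<omega> z ^ n"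
          unfolding c_def using \<omega>01[of z] by (intro mult_mono power_decreasing) (auto simp: algebra_simps)
        then show "real (Suc (Suc n)) * \<omega> z ^ Suc n \<le> c * \<omega> z ^ n" .
        show "real (Suc (Suc n)) * real (Suc n) \<le> c" unfolding c_def by (intro mult_mono) auto
      qed (use \<omega>01 in auto)
      also have "\<dots> = \<omega> z ^ n * (c * Q z)" by (simp add: Q_def algebra_simps)
      finally have "U z * adj_heat (\<lambda>z. \<omega> z ^ Suc (Suc n)) z \<le> U z * (\<omega> z ^ n * (c * Q z))"
        using U_nonneg by (intro mult_left_mono) auto
      also have "\<dots> = (U z * \<omega> z ^ n) * (c * Q z)" by simp
      also have "\<dots> \<le> 1 / 2 * (U z * \<omega> z ^ n) powr p + (1 / 2) powr (- (1 / (p - 1))) * (c * Q z) powr (1 + 1 / (p - 1))"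
        using U_nonneg \<omega>01 c0 Q0 p by (intro young_split) auto
      also have "(U z * \<omega> z ^ n) powr p \<le> U z powr p * \<omega> z ^ Suc (Suc n)"
      proof -
        \<comment> \<open>The choice of \<open>n\<close> pays off here:
          \<open>0 \<le> \<omega> \<le> 1\<close> and the exponent \<open>n * p\<close> is at least
          \<open>n + 2\<close>.\<close>
        have "(\<omega> z ^ n) powr p \<le> \<omega> z ^ Suc (Suc n)"
        proof (cases "\<omega> z = 0")
          case True then show ?thesis using n(1) p by simp
        next
          case False
          then have pos: "\<omega> z > 0" using \<omega>01(1)[of z] by linarith
          have "(\<omega> z ^ n) powr p = \<omega> z powr (real n * p)" using pos by (simp add: powr_realpow[symmetric] powr_powr)
          also have "\<dots> \<le> \<omega> z powr (real (Suc (Suc n)))" using pos \<omega>01(2)[of z] n(2) by (intro powr_mono') auto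
          also have "\<dots> = \<omega> z ^ Suc (Suc n)" using pos by (rule powr_realpow)
          finally show ?thesis .
        qed
        then show ?thesis using U_nonneg[of z] \<omega>01(1)[of z] by (simp add: powr_mult mult_left_mono)
      qed
      also have "(1 / 2) powr (- (1 / (p - 1))) * (c * Q z) powr (1 + 1 / (p - 1)) \<le> V z"
      proof -
        have h: "(1 / 2 :: real) powr (- q) = 2 powr q" by (simp add: powr_minus powr_divide)
        have "(c * Q z) powr (1 + q) \<le> (2 * c * D) powr (1 + q) * (indicator C z + (1 / (\<epsilon> j)\<^sup>2) powr (1 + q) * indicator (A j) z)"
        proof (cases "z \<in> C")
          case False then show ?thesis using Qout[OF False] q by (auto simp: indicator_def)
        next
          case True
          have "(c * Q z) powr (1 + q) \<le> (2 * c * D * (if z \<in> A j then 1 / (\<epsilon> j)\<^sup>2 else 1)) powr (1 + q)"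
            using mult_left_mono[OF Qb[of z] c0] c0 Q0[of z] q by (intro powr_mono2) (auto simp: mult_ac)
          also have "\<dots> = (2 * c * D) powr (1 + q) * (if z \<in> A j then 1 / (\<epsilon> j)\<^sup>2 else 1) powr (1 + q)"
            by (rule powr_mult)
          also have "\<dots> \<le> (2 * c * D) powr (1 + q) * (indicator C z + (1 / (\<epsilon> j)\<^sup>2) powr (1 + q) * indicator (A j) z)"
            using True by (intro mult_left_mono) (auto simp: indicator_def)
          finally show ?thesis .
        qed
        then show ?thesis unfolding V_def q_def[symmetric] h by (intro mult_left_mono) auto
      qed
      finally show ?thesis by simp
    qed
    have Cm: "C \<in> sets borel" "emeasure lborel C < \<infinity>" using borel_compact[OF C(1)] emeasure_compact_finite[OF C(1)] by auto
    have iC: "integrable lborel (indicat_real C)" "integrable lborel (indicat_real (A j))"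
      using Cm A_borel[of j] by (auto intro!: integrable_real_indicator)
    have iV: "integrable lborel V"
      unfolding V_def[abs_def] by (intro integrable_mult_right Bochner_Integration.integrable_add iC)
    have "(\<integral>z. V z \<partial>lborel) = 2 powr q * ((2 * c * D) powr (1 + q) * (measure lborel C + (1 / (\<epsilon> j)\<^sup>2) powr (1 + q) * measure lborel (A j)))"
      unfolding V_def[abs_def] using iC by simp
    also have "\<dots> \<le> B / 2"
      unfolding B_def using measure_power_A[of j] by (auto intro!: mult_left_mono)
    finally have V: "(\<integral>z. V z \<partial>lborel) \<le> B / 2" .
    have "(\<integral>z. U z powr p * \<omega> z ^ Suc (Suc n) \<partial>lborel) = (\<integral>z. U z * adj_heat (\<lambda>z. \<omega> z ^ Suc (Suc n)) z \<partial>lborel)"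
      by (rule T(1))
    also have "\<dots> \<le> (\<integral>z. 1 / 2 * (U z powr p * \<omega> z ^ Suc (Suc n)) + V z \<partial>lborel)"
      by (intro integral_mono ptw T(3) Bochner_Integration.integrable_add integrable_mult_right T(2) iV)
    also have "\<dots> = 1 / 2 * (\<integral>z. U z powr p * \<omega> z ^ Suc (Suc n) \<partial>lborel) + (\<integral>z. V z \<partial>lborel)"
      using T(2) iV by (subst Bochner_Integration.integral_add) (auto intro!: integrable_mult_right simp del: power_Suc)
    finally have "(\<integral>z. U z powr p * \<omega> z ^ Suc (Suc n) \<partial>lborel) \<le> B" using V by linarith
    moreover have "(\<integral>\<^sup>+z. ennreal (U z powr p * \<omega> z ^ Suc (Suc n)) \<partial>lborel) = ennreal (\<integral>z. U z powr p * \<omega> z ^ Suc (Suc n) \<partial>lborel)"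
      by (intro nn_integral_eq_integral T(2) AE_I2 mult_nonneg_nonneg powr_ge_zero zero_le_power \<omega>01(1))
    ultimately show ?thesis unfolding \<omega>_def by (simp only:) (intro ennreal_leI)
  qed
  then show ?thesis by blast
qed

text \<open>Off \<open>N\<close> the cutoffs are eventually \<open>1\<close>, so Fatou's lemma turns
  the bound uniform in \<open>j\<close> into integrability up to the singular set.\<close>

lemma U_powr_integrable: "integrable lborel (\<lambda>z. indicator (ball z0 (R / 3)) z * U z powr p)"
proof -
  \<comment> \<open>The factor \<open>8 / R^2\<close> makes \<open>\<phi>\<close> equal to
    \<open>1\<close> on the ball of radius \<open>R / 3\<close>, as \<open>8/9 \<le> 1\<close>, and
    \<open>0\<close> off the ball of radius \<open>R / 2\<close>, as \<open>8/4 = 2\<close>.\<close>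
  define \<phi> :: "'a \<times> real \<Rightarrow> real" where "\<phi> z = ecut (8 / R\<^sup>2) (8 / R\<^sup>2) (z - z0)" for z
  have \<phi>: "C21t \<phi> UNIV" "\<And>z. 0 \<le> \<phi> z" "\<And>z. \<phi> z \<le> 1"
    unfolding \<phi>_def[abs_def] by (auto intro!: C21t_shift ecut_derivs(4) simp: ecut_bounds)
  have C: "compact (cball z0 (R / 2))" "cball z0 (R / 2) \<subseteq> ball z0 R" using R by auto
  have out: "\<phi> z = 0" if "z \<notin> cball z0 (R / 2)" for z
  proof -
    have "(R / 2)\<^sup>2 \<le> (norm (z - z0))\<^sup>2" using that R by (intro power_mono) (auto simp: dist_norm norm_minus_commute)
    then have "2 \<le> 8 / R\<^sup>2 * (norm (z - z0))\<^sup>2" using R by (simp add: field_simps)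
    then show ?thesis unfolding \<phi>_def by (intro ecut_bounds(3)) (simp add: quad_norm)
  qed
  have ins: "\<phi> z = 1" if "z \<in> ball z0 (R / 3)" for z
  proof -
    have "(norm (z - z0))\<^sup>2 \<le> (R / 3)\<^sup>2" using that by (intro power_mono) (auto simp: dist_norm norm_minus_commute)
    then have "9 * (norm (z - z0))\<^sup>2 \<le> R\<^sup>2" by (simp add: power_divide)
    then have "8 * (norm (z - z0))\<^sup>2 \<le> R\<^sup>2" using zero_le_power2[of "norm (z - z0)"] by linarith
    then have "8 / R\<^sup>2 * (norm (z - z0))\<^sup>2 \<le> 1" using R by (simp add: field_simps)
    then show ?thesis unfolding \<phi>_def by (intro ecut_bounds(4)) (simp add: quad_norm)
  qed
  obtain B n where B: "\<And>j. (\<integral>\<^sup>+z. ennreal (U z powr p * (\<phi> z * \<eta> j z) ^ n) \<partial>lborel) \<le> ennreal B"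
    using U_powr_bound[OF \<phi> C out] by blast
  have [measurable]: "\<phi> \<in> borel_measurable borel" "\<eta> j \<in> borel_measurable borel" for j
    using C21tD(1)[OF \<phi>(1)] C21tD(1)[OF eta(1)] by (auto intro: borel_measurable_continuous_onI)
  have [measurable]: "ball z0 (R / 3) \<in> sets borel" by simp
  let ?f = "\<lambda>j z. ennreal (U z powr p * (\<phi> z * \<eta> j z) ^ n)"
  have "(\<integral>\<^sup>+z. ennreal (indicator (ball z0 (R / 3)) z * U z powr p) \<partial>lborel) \<le> (\<integral>\<^sup>+z. liminf (\<lambda>j. ?f j z) \<partial>lborel)"
  proof (rule nn_integral_mono)
    fix z
    show "ennreal (indicator (ball z0 (R / 3)) z * U z powr p) \<le> liminf (\<lambda>j. ?f j z)"
    proof (cases "z \<in> ball z0 (R / 3) - N")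
      case True
      then have "\<forall>\<^sub>F j in sequentially. z \<notin> A j" using A_lim by blast
      then have "\<forall>\<^sub>F j in sequentially. ennreal (indicator (ball z0 (R / 3)) z * U z powr p) \<le> ?f j z"
        by eventually_elim (use True ins[of z] in \<open>simp add: A(3)\<close>)
      then show ?thesis by (rule Liminf_bounded)
    next
      case False
      then have "indicator (ball z0 (R / 3)) z * U z powr p = 0"
        by (auto simp: indicator_def U_def S_def)
      then show ?thesis by (simp only: ennreal_0 zero_le)
    qed
  qed
  also have "\<dots> \<le> liminf (\<lambda>j. \<integral>\<^sup>+z. ?f j z \<partial>lborel)" by (rule nn_integral_liminf) measurable
  also have "\<dots> \<le> liminf (\<lambda>j::nat. ennreal B)" by (intro Liminf_mono always_eventually allI B)
  also have "\<dots> = ennreal B" by (simp add: Liminf_const)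
  finally have "(\<integral>\<^sup>+z. ennreal (indicator (ball z0 (R / 3)) z * U z powr p) \<partial>lborel) \<le> ennreal B" .
  then have "(\<integral>\<^sup>+z. ennreal (indicator (ball z0 (R / 3)) z * U z powr p) \<partial>lborel) < \<infinity>"
    by (simp add: le_less_trans)
  then show ?thesis by (simp add: integrable_iff_bounded abs_mult)
qed

definition W where "W z = indicator (ball z0 (R / 3)) z * U z"

lemma W_facts:
  "W \<in> borel_measurable borel" "W z \<ge> 0" "integrable lborel (\<lambda>z. W z powr p)" "integrable lborel W"
  "z \<notin> ball z0 (R / 3) - N \<Longrightarrow> W z = 0" "continuous_on (ball z0 (R / 3) - N) W"
proof -
  have [measurable]: "ball z0 (R / 3) \<in> sets borel" by simp
  show m: "W \<in> borel_measurable borel" unfolding W_def by measurable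
  show W0: "W z \<ge> 0" for z by (simp add: W_def U_nonneg)
  have Wp: "W z powr p = indicator (ball z0 (R / 3)) z * U z powr p" for z by (simp add: W_def indicator_def)
  show i: "integrable lborel (\<lambda>z. W z powr p)" unfolding Wp by (rule U_powr_integrable)
  have ib: "integrable lborel (indicat_real (ball z0 (R / 3)))"
    using emeasure_lborel_ball_finite by (intro integrable_real_indicator) auto
  show "integrable lborel W"
  proof (rule Bochner_Integration.integrable_bound[OF Bochner_Integration.integrable_add[OF ib i]])
    show "AE z in lborel. norm (W z) \<le> norm (indicat_real (ball z0 (R / 3)) z + W z powr p)"
    proof (intro AE_I2)
      fix z
      show "norm (W z) \<le> norm (indicat_real (ball z0 (R / 3)) z + W z powr p)"
      \<comment> \<open>On the ball, which has finite measure, \<open>W\<close> is bounded by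
        \<open>1\<close> where it is small and by its power where it is large.\<close>
      proof (cases "W z \<le> 1")
        case True
        have "W z \<le> indicat_real (ball z0 (R / 3)) z + W z powr p"
        proof (cases "z \<in> ball z0 (R / 3)")
          case False then show ?thesis by (simp add: W_def)
        next
          case in_ball: True
          show ?thesis using True powr_ge_zero[of "W z" p] unfolding indicator_simps(1)[OF in_ball] by linarith
        qed
        then show ?thesis using W0[of z] by simp
      next
        case False
        then have "W z powr 1 \<le> W z powr p" using p by (intro powr_mono) auto
        then show ?thesis using False by (simp add: indicator_def)
      qed
    qed
  qed (use m in simp)
  show "W z = 0" if "z \<notin> ball z0 (R / 3) - N"
    using that by (auto simp: W_def indicator_def U_def S_def)
  show "continuous_on (ball z0 (R / 3) - N) W"
  proof (rule continuous_on_eq[where f=U])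
    show "continuous_on (ball z0 (R / 3) - N) U"
      using R by (intro continuous_on_subset[OF U_continuous]) (auto simp: S_def)
  qed (auto simp: W_def)
qed

lemma mult_bounded_integrable:
  fixes f g :: "'a \<times> real \<Rightarrow> real"
  assumes f: "integrable lborel f" and [measurable]: "g \<in> borel_measurable borel" and g: "\<And>z. \<bar>g z\<bar> \<le> c"
  shows "integrable lborel (\<lambda>z. f z * g z)"
proof (rule Bochner_Integration.integrable_bound[OF integrable_mult_right[OF f, of c]])
  have [measurable]: "f \<in> borel_measurable borel" using f by auto
  show "(\<lambda>z. f z * g z) \<in> borel_measurable lborel" by measurable
  show "AE z in lborel. norm (f z * g z) \<le> norm (c * f z)"
    using abs_mult_le_mult_abs[OF order_trans[OF g abs_ge_self]] by (intro AE_I2) (simp add: abs_mult)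
qed

text \<open>Test with \<open>\<psi> * \<eta>\<close> and let the cutoffs tend to \<open>1\<close>.
  Only the commutator needs an argument, its Young remainder being bounded but not small: a large
  weight on \<open>W powr p\<close> makes the remainder small, and the weighted integral over
  \<open>A j\<close> tends to \<open>0\<close> because \<open>W powr p\<close> is
  integrable.\<close>

lemma W_weak:
  assumes \<psi>: "C21t \<psi> UNIV" and C: "compact C" "C \<subseteq> ball z0 (R / 3)" "\<And>z. z \<notin> C \<Longrightarrow> \<psi> z = 0"
  shows "(\<integral>z. W z powr p * \<psi> z \<partial>lborel) = (\<integral>z. W z * adj_heat \<psi> z \<partial>lborel)"
proof -
  obtain M where M: "M \<ge> 0" "\<And>z. \<bar>\<psi> z\<bar> \<le> M" "\<And>b z. b \<in> Basis \<Longrightarrow> \<bar>dirderiv (b, 0) \<psi> z\<bar> \<le> M" "\<And>z. \<bar>adj_heat \<psi> z\<bar> \<le> M"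
    using test_bounded[OF \<psi> C(1,3)] by blast
  note [measurable] = W_facts(1) borel_measurable_continuous_onI[OF C21tD(1)[OF \<psi>]]
    borel_measurable_continuous_onI[OF adj_heat_continuous[OF \<psi>]]
  have [measurable]: "\<eta> j \<in> borel_measurable borel" for j
    using C21tD(1)[OF eta(1)] by (rule borel_measurable_continuous_onI)
  have \<omega>: "C21t (\<lambda>z. \<psi> z * \<eta> j z) UNIV" for j by (intro C21t_mult open_UNIV \<psi> eta)
  have errm[measurable]: "err j \<psi> \<in> borel_measurable borel" for j
  proof -
    have e: "err j \<psi> = (\<lambda>z. adj_heat (\<lambda>z. \<psi> z * \<eta> j z) z - \<eta> j z * adj_heat \<psi> z)"
      using adj_heat_cut[OF \<psi>, of j] by auto
    have "continuous_on UNIV (err j \<psi>)"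
      unfolding e by (intro continuous_intros adj_heat_continuous \<omega> \<psi> C21tD(1)[OF eta(1)])
    then show ?thesis by (rule borel_measurable_continuous_onI)
  qed
  have err_b: "\<bar>err j \<psi> z\<bar> \<le> C1 * M / (\<epsilon> j)\<^sup>2 * indicator (A j) z" for j z by (rule err_bound[OF M(1,2,3)])
  have err_c: "\<bar>err j \<psi> z\<bar> \<le> C1 * M / (\<epsilon> j)\<^sup>2" for j z
    using err_b[of j z] C1 M(1) by (auto simp: indicator_def split: if_splits intro: order_trans)
  have C': "C \<subseteq> ball z0 R" using C(2) R by auto
  have UW: "U z = W z" if "z \<in> C" for z using that C(2) by (auto simp: W_def)
  have main: "(\<integral>z. W z powr p * (\<psi> z * \<eta> j z) \<partial>lborel) = (\<integral>z. W z * (\<eta> j z * adj_heat \<psi> z) \<partial>lborel) + (\<integral>z. W z * err j \<psi> z \<partial>lborel)" for j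
  proof -
    have cs: "compact (C - O' j)" "C - O' j \<subseteq> S" "\<And>z. z \<notin> C - O' j \<Longrightarrow> \<psi> z * \<eta> j z = 0"
      using cut_support[where C=C and \<psi>=\<psi> and j=j, OF C(1) C'] C(3) by blast+
    have z0: "\<psi> z * \<eta> j z = 0" "adj_heat (\<lambda>z. \<psi> z * \<eta> j z) z = 0" if "z \<notin> C" for z
    proof -
      have z: "\<And>z. z \<notin> C \<Longrightarrow> \<psi> z * \<eta> j z = 0" using C(3) by simp
      show "\<psi> z * \<eta> j z = 0" "adj_heat (\<lambda>z. \<psi> z * \<eta> j z) z = 0"
        using z[OF that] adj_heat_zero_outside[OF compact_imp_closed[OF C(1)] z that] by auto
    qed
    have "(\<integral>z. W z powr p * (\<psi> z * \<eta> j z) \<partial>lborel) = (\<integral>z. U z powr p * (\<psi> z * \<eta> j z) \<partial>lborel)"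
      by (rule Bochner_Integration.integral_cong[OF refl]) (metis UW z0(1) mult_zero_right)
    also have "\<dots> = (\<integral>z. U z * adj_heat (\<lambda>z. \<psi> z * \<eta> j z) z \<partial>lborel)"
      by (rule tested_off(1)[OF \<omega> cs])
    also have "\<dots> = (\<integral>z. W z * adj_heat (\<lambda>z. \<psi> z * \<eta> j z) z \<partial>lborel)"
      by (rule Bochner_Integration.integral_cong[OF refl]) (metis UW z0(2) mult_zero_right)
    also have "\<dots> = (\<integral>z. W z * (\<eta> j z * adj_heat \<psi> z) + W z * err j \<psi> z \<partial>lborel)"
      by (simp add: adj_heat_cut[OF \<psi>] distrib_left)
    also have "\<dots> = (\<integral>z. W z * (\<eta> j z * adj_heat \<psi> z) \<partial>lborel) + (\<integral>z. W z * err j \<psi> z \<partial>lborel)"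
    proof (intro Bochner_Integration.integral_add mult_bounded_integrable[OF W_facts(4)])
      show "\<bar>\<eta> j z * adj_heat \<psi> z\<bar> \<le> 1 * M" for z
        unfolding abs_mult using eta(2,3)[of j z] M by (intro mult_mono) auto
      show "\<bar>err j \<psi> z\<bar> \<le> C1 * M / (\<epsilon> j)\<^sup>2" for z by (rule err_c)
    qed measurable
    finally show ?thesis .
  qed
  have eta_lim: "(\<lambda>j. \<eta> j z) \<longlonglongrightarrow> 1" if "z \<notin> N" for z
    by (rule tendsto_eventually) (use A_lim[OF that] in eventually_elim, rule A(3))
  have AE_N: "AE z in lborel. z \<notin> N" using N(2) by (rule AE_not_in)
  have lim1: "(\<lambda>j. \<integral>z. W z powr p * (\<psi> z * \<eta> j z) \<partial>lborel) \<longlonglongrightarrow> (\<integral>z. W z powr p * \<psi> z \<partial>lborel)"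
  proof (rule integral_dominated_convergence[where w="\<lambda>z. M * W z powr p"])
    show "AE z in lborel. (\<lambda>j. W z powr p * (\<psi> z * \<eta> j z)) \<longlonglongrightarrow> W z powr p * \<psi> z"
      using AE_N
    proof eventually_elim
      case (elim z)
      have "(\<lambda>j. W z powr p * (\<psi> z * \<eta> j z)) \<longlonglongrightarrow> W z powr p * (\<psi> z * 1)"
        by (intro tendsto_intros eta_lim[OF elim])
      then show ?case by simp
    qed
    show "AE z in lborel. norm (W z powr p * (\<psi> z * \<eta> j z)) \<le> M * W z powr p" for j
    proof (intro AE_I2)
      fix z
      have "\<bar>\<psi> z * \<eta> j z\<bar> \<le> M * 1"
        unfolding abs_mult using eta(2,3)[of j z] M by (intro mult_mono) auto
      then show "norm (W z powr p * (\<psi> z * \<eta> j z)) \<le> M * W z powr p"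
        using abs_mult_le_mult_abs[of "\<psi> z * \<eta> j z" M "W z powr p"] by simp
    qed
  qed (use W_facts(3) in auto)
  have lim2: "(\<lambda>j. \<integral>z. W z * (\<eta> j z * adj_heat \<psi> z) \<partial>lborel) \<longlonglongrightarrow> (\<integral>z. W z * adj_heat \<psi> z \<partial>lborel)"
  proof (rule integral_dominated_convergence[where w="\<lambda>z. M * W z"])
    show "AE z in lborel. (\<lambda>j. W z * (\<eta> j z * adj_heat \<psi> z)) \<longlonglongrightarrow> W z * adj_heat \<psi> z"
      using AE_N
    proof eventually_elim
      case (elim z)
      have "(\<lambda>j. W z * (\<eta> j z * adj_heat \<psi> z)) \<longlonglongrightarrow> W z * (1 * adj_heat \<psi> z)"
        by (intro tendsto_intros eta_lim[OF elim])
      then show ?case by simp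
    qed
    show "AE z in lborel. norm (W z * (\<eta> j z * adj_heat \<psi> z)) \<le> M * W z" for j
    proof (intro AE_I2)
      fix z
      have "\<bar>\<eta> j z * adj_heat \<psi> z\<bar> \<le> 1 * M"
        unfolding abs_mult using eta(2,3)[of j z] M by (intro mult_mono) auto
      then show "norm (W z * (\<eta> j z * adj_heat \<psi> z)) \<le> M * W z"
        using abs_mult_le_mult_abs[of "\<eta> j z * adj_heat \<psi> z" M "W z"] W_facts(2)[of z] by simp
    qed
  qed (use W_facts(4) in auto)
  have limA: "(\<lambda>j. \<integral>z. W z powr p * indicator (A j) z \<partial>lborel) \<longlonglongrightarrow> (\<integral>z. 0 \<partial>(lborel :: ('a \<times> real) measure))"
  proof (rule integral_dominated_convergence[where w="\<lambda>z. W z powr p"])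
    show "AE z in lborel. (\<lambda>j. W z powr p * indicator (A j) z) \<longlonglongrightarrow> 0"
      using AE_N
    proof eventually_elim
      case (elim z)
      show ?case by (rule tendsto_eventually) (use A_lim[OF elim] in eventually_elim, simp)
    qed
    show "AE z in lborel. norm (W z powr p * indicator (A j) z) \<le> W z powr p" for j
      by (intro AE_I2) (auto simp: indicator_def)
    show "(\<lambda>z. W z powr p * indicator (A j) z) \<in> borel_measurable lborel" for j
      using A_borel(1)[of j] by measurable
  qed (use W_facts(3) in auto)
  have lim3: "(\<lambda>j. \<integral>z. W z * err j \<psi> z \<partial>lborel) \<longlonglongrightarrow> 0"
  proof (rule LIMSEQ_I)
    fix e :: real assume e: "e > 0"
    define X where "X = (C1 * M) powr (1 + q) * C0"
    have X: "X \<ge> 0" using C0 by (simp add: X_def)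
    \<comment> \<open>Since \<open>q = 1 / (p - 1)\<close>, this gives
      \<open>\<theta> powr (- q) = e / (2 * (X + 1))\<close>; the summand \<open>1\<close> makes the
      estimate strict and covers \<open>X = 0\<close>.\<close>
    define \<theta> where "\<theta> = (2 * (X + 1) / e) powr (p - 1)"
    have \<theta>: "\<theta> > 0" using X e by (simp add: \<theta>_def)
    have \<theta>X: "\<theta> powr (- q) * X < e / 2"
    proof -
      have "\<theta> powr (- q) = (2 * (X + 1) / e) powr (- 1)"
        unfolding \<theta>_def powr_powr using p by (simp add: q_def)
      also have "\<dots> = e / (2 * (X + 1))" using X e by (simp add: powr_minus_divide)
      finally have "\<theta> powr (- q) * X = e / 2 * (X / (X + 1))" by simp
      also have "\<dots> < e / 2 * 1" using X e by (intro mult_strict_left_mono) auto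
      finally show ?thesis by simp
    qed
    have "(\<lambda>j. \<theta> * (\<integral>z. W z powr p * indicator (A j) z \<partial>lborel)) \<longlonglongrightarrow> 0"
      using tendsto_mult_left[OF limA, of \<theta>] by simp
    then have "\<forall>\<^sub>F j in sequentially. \<theta> * (\<integral>z. W z powr p * indicator (A j) z \<partial>lborel) < e / 2"
      using e by (intro order_tendstoD(2)[where y=0]) auto
    then obtain n0 where n0: "\<And>j. j \<ge> n0 \<Longrightarrow> \<theta> * (\<integral>z. W z powr p * indicator (A j) z \<partial>lborel) < e / 2"
      by (auto simp: eventually_sequentially)
    show "\<exists>n0. \<forall>j\<ge>n0. norm ((\<integral>z. W z * err j \<psi> z \<partial>lborel) - 0) < e"
    proof (intro exI allI impI)
      fix j assume j: "j \<ge> n0"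
      have iA: "integrable lborel (indicat_real (A j))"
        using A_borel[of j] by (auto intro!: integrable_real_indicator)
      have iWA: "integrable lborel (\<lambda>z. W z powr p * indicator (A j) z)"
        by (rule mult_bounded_integrable[OF W_facts(3), where c=1]) (use A_borel(1)[of j] in \<open>auto simp: indicator_def\<close>)
      let ?b = "C1 * M / (\<epsilon> j)\<^sup>2"
      have b0: "?b \<ge> 0" using C1 M(1) by simp
      have "norm ((\<integral>z. W z * err j \<psi> z \<partial>lborel) - 0) \<le> (\<integral>z. \<bar>W z * err j \<psi> z\<bar> \<partial>lborel)"
        by simp
      also have "\<dots> \<le> (\<integral>z. \<theta> * (W z powr p * indicator (A j) z) + \<theta> powr (- q) * ?b powr (1 + q) * indicator (A j) z \<partial>lborel)"
      proof (rule integral_mono)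
        show "integrable lborel (\<lambda>z. \<bar>W z * err j \<psi> z\<bar>)"
          by (intro integrable_abs mult_bounded_integrable[OF W_facts(4) errm err_c])
        show "integrable lborel (\<lambda>z. \<theta> * (W z powr p * indicator (A j) z) + \<theta> powr (- q) * ?b powr (1 + q) * indicator (A j) z)"
          by (intro Bochner_Integration.integrable_add integrable_mult_right iWA iA)
        fix z
        have "\<bar>W z * err j \<psi> z\<bar> \<le> W z * (?b * indicator (A j) z)"
          unfolding abs_mult abs_of_nonneg[OF W_facts(2)] by (rule mult_left_mono[OF err_b W_facts(2)])
        also have "\<dots> \<le> \<theta> * (W z powr p * indicator (A j) z) + \<theta> powr (- q) * ?b powr (1 + q) * indicator (A j) z"
          using young_split[OF W_facts(2)[of z] b0 \<theta> p] by (auto simp: indicator_def q_def)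
        finally show "\<bar>W z * err j \<psi> z\<bar> \<le> \<theta> * (W z powr p * indicator (A j) z) + \<theta> powr (- q) * ?b powr (1 + q) * indicator (A j) z" .
      qed
      also have "\<dots> = \<theta> * (\<integral>z. W z powr p * indicator (A j) z \<partial>lborel) + \<theta> powr (- q) * ?b powr (1 + q) * measure lborel (A j)"
        using iWA iA by (subst Bochner_Integration.integral_add) (auto intro!: integrable_mult_right)
      also have "\<theta> powr (- q) * ?b powr (1 + q) * measure lborel (A j) \<le> \<theta> powr (- q) * X"
      proof -
        have "?b powr (1 + q) = (C1 * M) powr (1 + q) * (1 / (\<epsilon> j)\<^sup>2) powr (1 + q)"
          using powr_mult[of "C1 * M" "1 / (\<epsilon> j)\<^sup>2" "1 + q"] C1 M(1) by simp
        then have "?b powr (1 + q) * measure lborel (A j) = (C1 * M) powr (1 + q) * ((1 / (\<epsilon> j)\<^sup>2) powr (1 + q) * measure lborel (A j))" by simp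
        also have "\<dots> \<le> X" unfolding X_def using measure_power_A by (intro mult_left_mono) auto
        finally show ?thesis by (simp add: mult.assoc mult_left_mono)
      qed
      finally show "norm ((\<integral>z. W z * err j \<psi> z \<partial>lborel) - 0) < e" using n0[OF j] \<theta>X by linarith
    qed
  qed
  have "(\<lambda>j. \<integral>z. W z powr p * (\<psi> z * \<eta> j z) \<partial>lborel) \<longlonglongrightarrow> (\<integral>z. W z * adj_heat \<psi> z \<partial>lborel) + 0"
    unfolding main by (intro tendsto_add lim2 lim3)
  then have "(\<integral>z. W z powr p * \<psi> z \<partial>lborel) = (\<integral>z. W z * adj_heat \<psi> z \<partial>lborel) + 0"
    by (rule LIMSEQ_unique[OF lim1])
  then show ?thesis by simp
qed

lemma weak_absorption: "weak_absorption W z0 (R / 3) p N"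
proof
  show "R / 3 > 0" using R by simp
  show "p > 1" by (rule p)
  show "closed N" using N(1) by (rule compact_imp_closed)
  show "N \<in> null_sets lborel" by (rule N(2))
qed (rule W_facts W_weak | assumption)+

end

context removable
begin

text \<open>The time derivative is obtained as a uniform limit along the vertical lines that miss \<open>N\<close>, on
  which the equation for \<open>u\<close> holds classically.\<close>

lemma extension:
  assumes lines: "\<And>X. open X \<Longrightarrow> X \<noteq> {} \<Longrightarrow> \<exists>x\<in>X. x \<notin> fst ` N"
  shows "\<exists>v r. r > 0 \<and> (\<forall>z \<in> ball z0 r - N. v z = u z) \<and> (\<forall>z \<in> ball z0 r. v z \<ge> 0) \<and> C21t v (ball z0 r) \<and>
    (\<forall>b\<in>Basis. \<forall>b'\<in>Basis. has_cont_dirderiv_on (b', 0) (dirderiv (b, 0) v) (ball z0 r)) \<and>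
    (\<forall>z \<in> ball z0 r. dirderiv (0, 1) v z - lapl v z = - (v z powr p))"
proof -
  interpret W: weak_absorption W z0 "R / 3" p N by (rule weak_absorption)
  \<comment> \<open>A quarter of \<open>R / 3\<close>, the radius up to which
    \<open>v_second\<close> provides the second derivatives.\<close>
  define r where "r = R / 12"
  have r: "r > 0" "r < R / 6" "r \<le> R / 3 / 4" "r < R" using R by (auto simp: r_def)
  define v where "v = W.v"
  let ?B = "ball z0 r"
  have vu: "v z = u z" if z: "z \<in> ?B - N" for z
  proof -
    have "v z = W z" unfolding v_def by (rule W.v_eq_U) (use z r in auto)
    also have "\<dots> = u z" using z r by (auto simp: W_def U_def S_def)
    finally show ?thesis .
  qed
  have v0: "v z \<ge> 0" if "z \<in> ?B" for z
    unfolding v_def by (rule W.v_nonneg) (use that r in auto)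
  have vc: "continuous_on ?B v"
    unfolding v_def using W.v_bounds(1) by (rule continuous_on_subset) auto
  have vx: "has_cont_dirderiv_on (b, 0) v ?B" if "b \<in> Basis" for b
    unfolding v_def using W.v_bounds(3)[OF that] by (rule has_cont_dirderiv_on_subset) auto
  have vxx: "has_cont_dirderiv_on (b', 0) (dirderiv (b, 0) v) ?B" if "b \<in> Basis" "b' \<in> Basis" for b b'
    unfolding v_def using W.v_second[OF that] by (rule has_cont_dirderiv_on_subset) (use r in auto)
  \<comment> \<open>The equation, solved for the time derivative, names the only candidate; it is
    continuous also on \<open>N\<close>.\<close>
  define g where "g z = lapl v z - v z powr p" for z
  have gc: "continuous_on ?B g"
  proof -
    have "continuous_on ?B (lapl v)"
      unfolding lapl_def[abs_def] using vxx by (intro continuous_intros) (auto simp: has_cont_dirderiv_on_def)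
    then show ?thesis unfolding g_def[abs_def] using v0 p
      by (intro continuous_on_diff continuous_on_powr' vc continuous_on_const) auto
  qed
  have oBN: "open (?B - N)" using N(1) by (intro open_Diff compact_imp_closed) auto
  have off: "((\<lambda>s. v (z + s *\<^sub>R (0, 1))) has_vector_derivative g z) (at 0)" if z: "z \<in> ?B - N" for z
  proof -
    have zR: "z \<in> ball z0 R - N" using z r by auto
    have l: "lapl u z = lapl v z"
    proof -
      have 1: "dirderiv b u w = dirderiv b v w" if "w \<in> ?B - N" for b w
        using vu by (intro dirderiv_cong_open[OF oBN that]) simp
      have "dirderiv b (dirderiv b u) z = dirderiv b (dirderiv b v) z" for b
        using 1 by (intro dirderiv_cong_open[OF oBN z]) simp
      then show ?thesis by (simp add: lapl_def)
    qed
    have "((\<lambda>s. u (z + s *\<^sub>R (0, 1))) has_vector_derivative dirderiv (0, 1) u z) (at 0)"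
      by (rule has_cont_dirderiv_onD[OF C21tD(2)[OF u(1)] zR])
    also have "dirderiv (0, 1) u z = g z" using eq[OF zR] l vu[OF z] by (simp add: g_def)
    finally have D: "((\<lambda>s. u (z + s *\<^sub>R (0, 1))) has_vector_derivative g z) (at 0)" .
    show ?thesis by (rule dirderiv_transfer[OF oBN z _ D]) (rule vu[symmetric])
  qed
  have time: "((\<lambda>s. v (z + s *\<^sub>R (0, 1))) has_vector_derivative g z) (at 0)" if zB: "z \<in> ?B" for z
  proof -
    obtain x t where z: "z = (x, t)" by (cases z)
    obtain e where e: "e > 0" "ball z e \<subseteq> ?B" using zB open_contains_ball by blast
    define d where "d = e / 3"
    have d: "d > 0" using e by (simp add: d_def)
    have box: "cball x d \<times> cball t d \<subseteq> ?B"
    proof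
      fix w assume w: "w \<in> cball x d \<times> cball t d"
      have "dist z w \<le> dist x (fst w) + dist t (snd w)"
        unfolding z dist_prod_def by (simp add: sqrt_sum_squares_le_sum)
      also have "\<dots> < e" using w e by (auto simp: d_def mem_Times_iff)
      finally show "w \<in> ?B" using e by auto
    qed
    \<comment> \<open>Uniform continuity of \<open>g\<close> on a box makes the time derivatives
      along neighbouring vertical lines converge uniformly.\<close>
    have "uniformly_continuous_on (cball x d \<times> cball t d) g"
      by (intro compact_uniformly_continuous continuous_on_subset[OF gc box] compact_Times compact_cball)
    note uc = this[unfolded uniformly_continuous_on_def, rule_format]
    \<comment> \<open>By \<open>lines\<close> there are vertical lines that avoid \<open>N\<close>
      altogether, arbitrarily close to the one through \<open>z\<close>.\<close>
    have "\<exists>y. y \<in> ball x (d / real (Suc n)) \<and> y \<notin> fst ` N" for n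
    proof -
      have "0 < d / real (Suc n)" by (intro divide_pos_pos d) simp
      then have "ball x (d / real (Suc n)) \<noteq> {}" by (metis centre_in_ball empty_iff)
      from lines[OF open_ball this] show ?thesis by blast
    qed
    then obtain y where y: "\<And>n. y n \<in> ball x (d / real (Suc n))" "\<And>n. y n \<notin> fst ` N" by metis
    have ylim: "y \<longlonglongrightarrow> x"
    proof (rule Lim_null_comparison[THEN LIM_zero_cancel])
      show "\<forall>\<^sub>F n in sequentially. norm (y n - x) \<le> d * inverse (real (Suc n))"
        using y(1) by (intro always_eventually) (simp add: dist_norm norm_minus_commute divide_inverse less_imp_le)
      show "(\<lambda>n. d * inverse (real (Suc n))) \<longlonglongrightarrow> 0"
        using tendsto_mult_left[OF LIMSEQ_inverse_real_of_nat, of d] by simp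
    qed
    have yd: "y n \<in> cball x d" for n
    proof -
      have "d / real (Suc n) \<le> d" using d by (simp add: field_simps)
      then show ?thesis using y(1)[of n] by auto
    qed
    have "\<exists>G. \<forall>s\<in>cball 0 d. (\<lambda>n. v (y n, t + s)) \<longlonglongrightarrow> G s \<and> (G has_derivative (\<lambda>h. h * g (x, t + s))) (at s within cball 0 d)"
    proof (rule has_derivative_sequence[where f'="\<lambda>n s h. h * g (y n, t + s)" and l="v (x, t + 0)"])
      show "((\<lambda>s. v (y n, t + s)) has_derivative (\<lambda>h. h * g (y n, t + s))) (at s within cball 0 d)" if s: "s \<in> cball 0 d" for n s
      proof -
        have "(y n, t + s) \<in> ?B" using box yd[of n] s by (auto simp: dist_norm subset_iff)
        moreover have "(y n, t + s) \<notin> N" using y(2)[of n] by force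
        ultimately have "(y n, t + s) \<in> ?B - N" by simp
        from off[OF this] have "((\<lambda>r. v (((y n, t) + s *\<^sub>R (0, 1)) + r *\<^sub>R (0, 1))) has_vector_derivative g (y n, t + s)) (at 0)"
          by simp
        from dirderiv_along_line[OF this] have "((\<lambda>s. v (y n, t + s)) has_vector_derivative g (y n, t + s)) (at s)"
          by simp
        then show ?thesis by (simp add: has_vector_derivative_def has_derivative_at_withinI)
      qed
      fix \<epsilon>' :: real assume e': "\<epsilon>' > 0"
      obtain \<delta>' where \<delta>': "\<delta>' > 0" "\<And>w w'. w \<in> cball x d \<times> cball t d \<Longrightarrow> w' \<in> cball x d \<times> cball t d \<Longrightarrow> dist w' w < \<delta>' \<Longrightarrow> dist (g w') (g w) < \<epsilon>'"
        using uc[OF e'] by metis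
      have "\<forall>\<^sub>F n in sequentially. dist (y n) x < \<delta>'" using ylim \<delta>'(1) by (rule tendstoD)
      then show "\<forall>\<^sub>F n in sequentially. \<forall>s\<in>cball 0 d. \<forall>h. norm (h * g (y n, t + s) - h * g (x, t + s)) \<le> \<epsilon>' * norm h"
      proof eventually_elim
        case (elim n)
        show ?case
        proof (intro ballI allI)
          fix s h :: real assume s: "s \<in> cball 0 d"
          have "dist (g (y n, t + s)) (g (x, t + s)) < \<epsilon>'"
            using yd[of n] s d elim by (intro \<delta>'(2)) (auto simp: dist_Pair_Pair dist_norm)
          then have "\<bar>h\<bar> * \<bar>g (y n, t + s) - g (x, t + s)\<bar> \<le> \<bar>h\<bar> * \<epsilon>'"
            by (intro mult_left_mono) (auto simp: dist_norm)
          then show "norm (h * g (y n, t + s) - h * g (x, t + s)) \<le> \<epsilon>' * norm h"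
            by (simp add: right_diff_distrib[symmetric] abs_mult mult.commute)
        qed
      qed
    next
      show "(\<lambda>n. v (y n, t + 0)) \<longlonglongrightarrow> v (x, t + 0)"
      proof -
        have "isCont v z" using vc zB by (simp add: continuous_on_eq_continuous_at)
        moreover have "(\<lambda>n. (y n, t)) \<longlonglongrightarrow> z" unfolding z by (intro tendsto_intros ylim)
        ultimately show ?thesis unfolding z add_0_right by (rule isCont_tendsto_compose)
      qed
    qed (use d in auto)
    then obtain G where G: "\<And>s. s \<in> cball 0 d \<Longrightarrow> (\<lambda>n. v (y n, t + s)) \<longlonglongrightarrow> G s"
      "\<And>s. s \<in> cball 0 d \<Longrightarrow> (G has_derivative (\<lambda>h. h * g (x, t + s))) (at s within cball 0 d)"
      by blast
    \<comment> \<open>The limit along the approximating lines is \<open>v\<close> itself, by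
      continuity, so the derivative is inherited by the line through \<open>z\<close> even if that
      line meets \<open>N\<close>.\<close>
    have Gv: "G s = v (x, t + s)" if s: "s \<in> cball 0 d" for s
    proof -
      have "(x, t + s) \<in> ?B" using box s d by (auto simp: dist_norm subset_iff)
      then have "isCont v (x, t + s)" using vc by (simp add: continuous_on_eq_continuous_at)
      moreover have "(\<lambda>n. (y n, t + s)) \<longlonglongrightarrow> (x, t + s)" by (intro tendsto_intros ylim)
      ultimately have "(\<lambda>n. v (y n, t + s)) \<longlonglongrightarrow> v (x, t + s)" by (rule isCont_tendsto_compose)
      then show ?thesis using LIMSEQ_unique[OF G(1)[OF s]] by blast
    qed
    have "(G has_derivative (\<lambda>h. h * g (x, t + 0))) (at 0 within ball 0 d)"
      by (rule has_derivative_subset[OF G(2)]) (use d in auto)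
    then have "(G has_derivative (\<lambda>h. h * g (x, t + 0))) (at 0)"
      using d by (subst (asm) at_within_open) auto
    then have "((\<lambda>s. v (x, t + s)) has_derivative (\<lambda>h. h * g (x, t + 0))) (at 0)"
      by (rule has_derivative_transform_within_open[OF _ open_ball[of 0 d]]) (use d Gv in auto)
    then show ?thesis by (simp add: z has_vector_derivative_def)
  qed
  have vt: "has_cont_dirderiv_on (0, 1) v ?B" by (rule has_cont_dirderiv_onI[OF time gc])
  have eqn: "dirderiv (0, 1) v z - lapl v z = - (v z powr p)" if "z \<in> ?B" for z
    using dirderiv_eqI[OF time[OF that]] by (simp add: g_def)
  have "C21t v ?B" unfolding C21t_def using vc vt vx vxx by auto
  then show ?thesis
    using r(1) vu v0 vxx eqn by blast
qed

end

text \<open>The projection to space is covered by at most \<open>C * \<epsilon>^(-d)\<close> balls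
  whose volume is \<open>\<epsilon>\<close> to the dimension of space, so \<open>d\<close> below
  that dimension makes it null too. In the application \<open>d = m + 2\<close>, and this is the
  condition of codimension at least \<open>3\<close>.\<close>

lemma cover_null_sets:
  fixes N :: "('a::euclidean_space \<times> real) set"
  assumes cover: "parabolic_cover N d C" "C \<ge> 0" and N: "compact N" and d: "d < DIM('a)"
  shows "N \<in> null_sets lborel" "fst ` N \<in> null_sets lborel"
proof -
  have small: "\<exists>B\<ge>0. \<forall>\<epsilon>. 0 < \<epsilon> \<and> \<epsilon> \<le> 1 \<longrightarrow> measure lborel X \<le> B * \<epsilon> \<Longrightarrow> emeasure lborel X < \<infinity> \<Longrightarrow> X \<in> sets borel \<Longrightarrow> X \<in> null_sets lborel"
    for X :: "'b::euclidean_space set"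
  proof -
    assume "\<exists>B\<ge>0. \<forall>\<epsilon>. 0 < \<epsilon> \<and> \<epsilon> \<le> 1 \<longrightarrow> measure lborel X \<le> B * \<epsilon>" and fin: "emeasure lborel X < \<infinity>" and s: "X \<in> sets borel"
    then obtain B where B: "B \<ge> 0" "\<And>\<epsilon>. 0 < \<epsilon> \<Longrightarrow> \<epsilon> \<le> 1 \<Longrightarrow> measure lborel X \<le> B * \<epsilon>" by blast
    have "measure lborel X \<le> 0 + e" if e: "e > 0" for e
    proof -
      define \<epsilon> where "\<epsilon> = min 1 (e / (B + 1))"
      have "\<epsilon> > 0" "\<epsilon> \<le> 1" using e B(1) by (auto simp: \<epsilon>_def)
      then have "measure lborel X \<le> B * \<epsilon>" by (rule B(2))
      also have "\<dots> \<le> B * (e / (B + 1))" using B(1) by (intro mult_left_mono) (auto simp: \<epsilon>_def)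
      also have "\<dots> \<le> e" using B(1) e by (simp add: field_simps)
      finally show ?thesis by simp
    qed
    then have "measure lborel X \<le> 0" by (rule field_le_epsilon)
    then have "measure lborel X = 0" using measure_nonneg[of lborel X] by linarith
    moreover have "emeasure lborel X = ennreal (measure lborel X)"
      using fin by (intro emeasure_eq_ennreal_measure) auto
    ultimately show "X \<in> null_sets lborel" using s by (auto simp: null_sets_def)
  qed
  define k where "k = DIM('a) + 2 - d"
  have k: "d + k = DIM('a) + 2" "k \<ge> 1" using d by (auto simp: k_def)
  have get: "\<exists>Z. finite Z \<and> Z \<subseteq> N \<and> real (card Z) \<le> C / \<epsilon> ^ d \<and> N \<subseteq> (\<Union>z\<in>Z. pcyl z \<epsilon>)" if "0 < \<epsilon>" "\<epsilon> \<le> 1" for \<epsilon>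
    using cover(1)[unfolded parabolic_cover_def, rule_format, OF conjI[OF that]] .
  show "N \<in> null_sets lborel"
  proof (rule small)
    let ?B = "C * (2 * unit_ball_vol (DIM('a)) * 1 ^ (DIM('a) + 2))"
    have "measure lborel N \<le> ?B * \<epsilon>" if e: "0 < \<epsilon>" "\<epsilon> \<le> 1" for \<epsilon>
    proof -
      obtain Z where Z: "finite Z" "Z \<subseteq> N" "real (card Z) \<le> C / \<epsilon> ^ d" "N \<subseteq> (\<Union>z\<in>Z. pcyl z \<epsilon>)"
        using get[OF e] by (elim exE conjE)
      have cU: "compact (\<Union>z\<in>Z. pcyl z \<epsilon>)" by (intro compact_UN Z(1) compact_pcyl)
      have "measure lborel N \<le> measure lborel (\<Union>z\<in>Z. pcyl z \<epsilon>)"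
        by (rule measure_mono_fmeasurable[OF Z(4)]) (use N cU in \<open>auto intro: borel_compact fmeasurable_compact\<close>)
      also have "\<dots> \<le> ?B * \<epsilon> ^ k" using measure_pcyl_Union[OF Z(1,3) e(1) zero_less_one k(1)] by simp
      also have "\<dots> \<le> ?B * \<epsilon> ^ 1" using e k(2) cover(2) by (intro mult_left_mono power_decreasing) auto
      finally show ?thesis by simp
    qed
    then show "\<exists>B\<ge>0. \<forall>\<epsilon>. 0 < \<epsilon> \<and> \<epsilon> \<le> 1 \<longrightarrow> measure lborel N \<le> B * \<epsilon>"
      using cover(2) by (intro exI[of _ ?B]) auto
  qed (use N in \<open>auto intro: borel_compact emeasure_compact_finite[unfolded infinity_ennreal_def]\<close>)
  have cf: "compact (fst ` N)" using N by (intro compact_continuous_image continuous_intros)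
  show "fst ` N \<in> null_sets lborel"
  proof (rule small)
    let ?w = "unit_ball_vol (DIM('a))"
    have "measure lborel (fst ` N) \<le> C * ?w * \<epsilon>" if e: "0 < \<epsilon>" "\<epsilon> \<le> 1" for \<epsilon>
    proof -
      obtain Z where Z: "finite Z" "Z \<subseteq> N" "real (card Z) \<le> C / \<epsilon> ^ d" "N \<subseteq> (\<Union>z\<in>Z. pcyl z \<epsilon>)"
        using get[OF e] by (elim exE conjE)
      have cU: "compact (\<Union>z\<in>Z. cball (fst z) \<epsilon>)" by (intro compact_UN Z(1) compact_cball)
      have sub: "fst ` N \<subseteq> (\<Union>z\<in>Z. cball (fst z) \<epsilon>)"
      proof (rule image_subsetI)
        fix w assume "w \<in> N"
        then obtain c where "c \<in> Z" "w \<in> pcyl c \<epsilon>" using Z(4) by blast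
        then show "fst w \<in> (\<Union>z\<in>Z. cball (fst z) \<epsilon>)" by (auto simp: pcyl_def mem_Times_iff intro!: bexI[of _ c])
      qed
      have "measure lborel (fst ` N) \<le> measure lborel (\<Union>z\<in>Z. cball (fst z) \<epsilon>)"
        by (rule measure_mono_fmeasurable[OF sub]) (use cf cU in \<open>auto intro: borel_compact fmeasurable_compact\<close>)
      also have "\<dots> \<le> (\<Sum>z\<in>Z. measure lborel (cball (fst z) \<epsilon>))" by (rule measure_UNION_le[OF Z(1)]) auto
      also have "\<dots> = real (card Z) * (?w * \<epsilon> ^ DIM('a))" using e by (simp add: content_cball)
      also have "\<dots> \<le> C / \<epsilon> ^ d * (?w * \<epsilon> ^ DIM('a))" using Z(3) e by (intro mult_right_mono) auto
      also have "\<epsilon> ^ DIM('a) = \<epsilon> ^ d * \<epsilon> ^ (DIM('a) - d)" using d by (simp add: power_add[symmetric])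
      also have "C / \<epsilon> ^ d * (?w * (\<epsilon> ^ d * \<epsilon> ^ (DIM('a) - d))) = C * ?w * \<epsilon> ^ (DIM('a) - d)" using e by simp
      also have "\<dots> \<le> C * ?w * \<epsilon> ^ 1" using e d cover(2) by (intro mult_left_mono power_decreasing) auto
      finally show ?thesis by simp
    qed
    then show "\<exists>B\<ge>0. \<forall>\<epsilon>. 0 < \<epsilon> \<and> \<epsilon> \<le> 1 \<longrightarrow> measure lborel (fst ` N) \<le> B * \<epsilon>"
      using cover(2) by (intro exI[of _ "C * ?w"]) auto
  qed (use cf in \<open>auto intro: borel_compact emeasure_compact_finite[unfolded infinity_ennreal_def]\<close>)
qed

text \<open>Cutoffs at the scales \<open>1 / (j + 1)\<close> provide the sequence required by
  \<open>removable\<close>; the null projection of \<open>N\<close> to space provides the vertical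
  lines along which the time derivative is computed.\<close>

lemma removable_local:
  fixes N :: "('a::euclidean_space \<times> real) set"
  assumes cover: "parabolic_cover N d Cc" "Cc \<ge> 0" and N: "compact N" and dk: "d + k = DIM('a) + 2" "d < DIM('a)"
    and p: "p > 1" "2 * (1 + 1 / (p - 1)) \<le> real k" and R: "R > 0"
    and u: "C21t u (ball z0 R - N)" "\<And>z. z \<in> ball z0 R - N \<Longrightarrow> u z \<ge> 0"
      "\<And>z. z \<in> ball z0 R - N \<Longrightarrow> dirderiv (0, 1) u z - lapl u z = - (u z powr p)"
  shows "\<exists>v r. r > 0 \<and> (\<forall>z \<in> ball z0 r - N. v z = u z) \<and> (\<forall>z \<in> ball z0 r. v z \<ge> 0) \<and> C21t v (ball z0 r) \<and>
    (\<forall>b\<in>Basis. \<forall>b'\<in>Basis. has_cont_dirderiv_on (b', 0) (dirderiv (b, 0) v) (ball z0 r)) \<and>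
    (\<forall>z \<in> ball z0 r. dirderiv (0, 1) v z - lapl v z = - (v z powr p))"
proof -
  note null = cover_null_sets[OF cover N dk(2)]
  obtain C0 where C0: "C0 > 0" "\<And>\<epsilon>. 0 < \<epsilon> \<Longrightarrow> \<epsilon> \<le> 1 \<Longrightarrow> \<exists>\<eta> A O'. parabolic_cutoff N k C0 \<epsilon> \<eta> A O'"
    using parabolic_cutoffs[OF cover dk(1)] by blast
  define \<epsilon> where "\<epsilon> j = inverse (real (Suc j))" for j
  have eps: "0 < \<epsilon> j" "\<epsilon> j \<le> 1" for j by (auto simp: \<epsilon>_def field_simps)
  have epslim: "\<epsilon> \<longlonglongrightarrow> 0" unfolding \<epsilon>_def by (rule LIMSEQ_inverse_real_of_nat)
  have "\<forall>j. \<exists>\<eta> A O'. parabolic_cutoff N k C0 (\<epsilon> j) \<eta> A O'"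
    by (rule allI) (rule C0(2)[OF eps])
  then obtain \<eta> A O' where "\<And>j. parabolic_cutoff N k C0 (\<epsilon> j) (\<eta> j) (A j) (O' j)" by metis
  note sq = this[unfolded parabolic_cutoff_def]
  \<comment> \<open>Points of \<open>A j\<close> lie within \<open>42 * \<epsilon> j\<close> of the
    closed set \<open>N\<close>, so a fixed point off \<open>N\<close> is eventually left
    out.\<close>
  have Alim: "\<forall>\<^sub>F j in sequentially. z \<notin> A j" if z: "z \<notin> N" for z
  proof -
    have "open (- N)" using N by (simp add: compact_imp_closed open_Compl)
    then obtain e where e: "e > 0" "ball z e \<subseteq> - N" using z by (meson ComplI open_contains_ball)
    have "\<forall>\<^sub>F j in sequentially. \<epsilon> j < e / 42" using epslim e(1) by (intro order_tendstoD) auto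
    then show ?thesis
    proof eventually_elim
      case (elim j)
      show ?case
      proof
        assume "z \<in> A j"
        then obtain w where w: "w \<in> N" "dist w z \<le> 42 * \<epsilon> j" using sq[of j] by blast
        then have "w \<in> ball z e" using elim by (simp add: dist_commute)
        then show False using e(2) w(1) by blast
      qed
    qed
  qed
  interpret removable N k C0 \<epsilon> \<eta> A O' u z0 R p
    by unfold_locales (use N null(1) C0(1) eps sq Alim R p u in \<open>blast+\<close>)
  show ?thesis
  proof (rule extension)
    show "\<exists>x\<in>X. x \<notin> fst ` N" if "open X" "X \<noteq> {}" for X
      using null_set_dense[OF that null(2)] by blast
  qed
qed

section \<open>Coverings of the moving submanifold\<close>

text \<open>\<open>Ck_on\<close> gives continuity of the derivative in each fixed direction. The sum
  of the norms over the basis directions is therefore continuous, bounded on the compact set, and an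
  upper bound for the operator norm; convexity allows the mean value inequality.\<close>

lemma Ck_on_Suc_0_lipschitz:
  fixes f :: "'a::euclidean_space \<Rightarrow> 'b::real_normed_vector"
  assumes f: "Ck_on (Suc 0) f V" and K: "compact K" "convex K" "K \<subseteq> V"
  obtains L where "L \<ge> 0" "\<And>x y. x \<in> K \<Longrightarrow> y \<in> K \<Longrightarrow> dist (f x) (f y) \<le> L * dist x y"
proof -
  define s where "s x = (\<Sum>b\<in>Basis. norm (frechet_derivative f (at x) b))" for x
  have "continuous_on K s"
    unfolding s_def using f by (intro continuous_intros continuous_on_subset[OF _ K(3)]) simp
  then have "compact (s ` K)" by (rule compact_continuous_image) (rule K(1))
  then obtain L where L: "\<And>x. x \<in> K \<Longrightarrow> \<bar>s x\<bar> \<le> L"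
    by (metis bounded_real compact_imp_bounded imageI)
  have D: "(f has_derivative frechet_derivative f (at x)) (at x)" if "x \<in> K" for x
    using f K(3) that frechet_derivative_works by auto
  have "norm (f x - f y) \<le> max L 0 * norm (x - y)" if "x \<in> K" "y \<in> K" for x y
  proof (rule differentiable_bound[OF K(2) _ _ that])
    show "(f has_derivative frechet_derivative f (at x)) (at x within K)" if "x \<in> K" for x
      using D[OF that] by (rule has_derivative_at_withinI)
    show "onorm (frechet_derivative f (at x)) \<le> max L 0" if x: "x \<in> K" for x
    proof (rule onorm_bound)
      fix h :: 'a
      let ?D = "frechet_derivative f (at x)"
      have lin: "linear ?D" using D[OF x] by (rule has_derivative_linear)
      have "?D h = ?D (\<Sum>b\<in>Basis. (h \<bullet> b) *\<^sub>R b)" by (simp add: euclidean_representation)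
      also have "\<dots> = (\<Sum>b\<in>Basis. (h \<bullet> b) *\<^sub>R ?D b)"
        using lin by (simp add: linear_sum linear_scale)
      finally have "norm (?D h) \<le> (\<Sum>b\<in>Basis. norm ((h \<bullet> b) *\<^sub>R ?D b))" by (simp only: norm_sum)
      also have "\<dots> \<le> (\<Sum>b\<in>Basis. norm h * norm (?D b))"
        by (intro sum_mono) (simp add: Basis_le_norm mult_right_mono)
      also have "\<dots> = norm h * s x" by (simp add: s_def sum_distrib_left)
      also have "\<dots> \<le> norm h * max L 0" using L[OF x] by (intro mult_left_mono) auto
      finally show "norm (?D h) \<le> max L 0 * norm h" by (simp add: mult.commute)
    qed simp
  qed
  then show thesis by (intro that[of "max L 0"]) (auto simp: dist_norm)
qed

text \<open>One representative is chosen for each value of \<open>key\<close>, so the centres lie in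
  \<open>X\<close> itself. The keys used below are the cells of a grid.\<close>

lemma finite_key_cover:
  fixes X :: "'a::metric_space set"
  assumes fin: "finite (key ` X)" and close: "\<And>x y. x \<in> X \<Longrightarrow> y \<in> X \<Longrightarrow> key x = key y \<Longrightarrow> dist x y \<le> \<epsilon>"
  shows "\<exists>P. finite P \<and> P \<subseteq> X \<and> card P \<le> card (key ` X) \<and> X \<subseteq> (\<Union>p\<in>P. cball p \<epsilon>)"
proof -
  define rep where "rep k = (SOME x. x \<in> X \<and> key x = k)" for k
  have rep: "rep (key x) \<in> X \<and> key (rep (key x)) = key x" if "x \<in> X" for x
    unfolding rep_def by (rule someI_ex) (use that in blast)
  show ?thesis
  proof (intro exI[of _ "rep ` key ` X"] conjI)
    show "rep ` key ` X \<subseteq> X" using rep by blast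
    show "card (rep ` key ` X) \<le> card (key ` X)" by (rule card_image_le[OF fin])
    show "X \<subseteq> (\<Union>p\<in>rep ` key ` X. cball p \<epsilon>)"
    proof
      fix x assume x: "x \<in> X"
      then have "dist (rep (key x)) x \<le> \<epsilon>" using rep[OF x] by (intro close) auto
      then show "x \<in> (\<Union>p\<in>rep ` key ` X. cball p \<epsilon>)" using x by auto
    qed
  qed (use fin in simp)
qed

text \<open>In a slice chart only the \<open>m\<close> coordinates in \<open>S\<close> vary on the
  submanifold. Grid cells in these coordinates, of mesh proportional to \<open>\<epsilon>\<close>,
  serve as keys; the inverse chart is Lipschitz on a small ball, so each cell pulls back to a set of
  diameter at most \<open>\<epsilon>\<close>.\<close>

lemma submanifold_local_cover:
  fixes M0 :: "(real ^ 'n) set"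
  assumes M: "embedded_submanifold m M0" and x: "x \<in> M0"
  shows "\<exists>W C. open W \<and> x \<in> W \<and> C \<ge> 0 \<and> (\<forall>\<epsilon>. 0 < \<epsilon> \<and> \<epsilon> \<le> 1 \<longrightarrow>
    (\<exists>P. finite P \<and> P \<subseteq> M0 \<and> real (card P) \<le> C / \<epsilon> ^ m \<and> M0 \<inter> W \<subseteq> (\<Union>p\<in>P. cball p \<epsilon>)))"
proof -
  obtain U V \<phi> S where c: "x \<in> U" "diffeomorphism U V \<phi>" "card S = m"
    "\<phi> ` (M0 \<inter> U) = V \<inter> {y :: real ^ 'n. \<forall>i. i \<notin> S \<longrightarrow> y $ i = 0}"
    using M x unfolding embedded_submanifold_def by blast
  define g where "g = inv_into U \<phi>"
  have d: "open U" "open V" "bij_betw \<phi> U V" "Ck_on 0 \<phi> U" "Ck_on (Suc 0) g V"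
    using c(2) unfolding diffeomorphism_def smooth_on_def g_def by blast+
  have \<phi>x: "\<phi> x \<in> V" using d(3) c(1) by (auto simp: bij_betw_def)
  then obtain r where r: "r > 0" "cball (\<phi> x) r \<subseteq> V" using d(2) open_contains_cball by blast
  obtain L where L: "L \<ge> 0" "\<And>a b. a \<in> cball (\<phi> x) r \<Longrightarrow> b \<in> cball (\<phi> x) r \<Longrightarrow> dist (g a) (g b) \<le> L * dist a b"
    using Ck_on_Suc_0_lipschitz[OF d(5) compact_cball convex_cball r(2)] by blast
  define W where "W = {p \<in> U. \<phi> p \<in> ball (\<phi> x) r}"
  have "W = U \<inter> \<phi> -` ball (\<phi> x) r" by (auto simp: W_def)
  moreover have "open (U \<inter> \<phi> -` ball (\<phi> x) r)"
    using d(1,4) by (intro continuous_open_preimage) auto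
  ultimately have "open W" by simp
  define n where "n = real CARD('n)"
  have n: "n \<ge> 1" using zero_less_card_finite[where 'a='n] by (simp add: n_def)
  define b where "b = norm (\<phi> x) + r"
  have b: "b \<ge> 0" using r by (simp add: b_def)
  define C where "C = 2 * b * (L + 1) * n + 2"
  have C: "C \<ge> 0" using b L n by (simp add: C_def)
  show ?thesis
  proof (rule exI[of _ W], rule exI[of _ "C ^ m"], intro conjI allI impI)
    show "open W" by fact
    show "x \<in> W" using c(1) r by (simp add: W_def)
    show "C ^ m \<ge> 0" using C by simp
    fix \<epsilon> :: real assume e: "0 < \<epsilon> \<and> \<epsilon> \<le> 1"
    \<comment> \<open>Coordinates within \<open>\<delta>\<close> of each other give a distance of at
      most \<open>n * \<delta>\<close>, and at most
      \<open>(L + 1) * n * \<delta> = \<epsilon>\<close> after the inverse chart.\<close>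
    define \<delta> where "\<delta> = \<epsilon> / ((L + 1) * n)"
    have \<delta>: "\<delta> > 0" using e L n by (simp add: \<delta>_def)
    define key where "key p = restrict (\<lambda>i. \<lfloor>\<phi> p $ i / \<delta>\<rfloor>) S" for p
    let ?X = "M0 \<inter> W"
    let ?K = "{\<lfloor>- b / \<delta>\<rfloor>..\<lfloor>b / \<delta>\<rfloor>}"
    have sub: "key ` ?X \<subseteq> PiE S (\<lambda>_. ?K)"
    proof (rule image_subsetI)
      fix p assume p: "p \<in> ?X"
      have "norm (\<phi> p) \<le> b"
        using p norm_triangle_ineq[of "\<phi> x" "\<phi> p - \<phi> x"] by (auto simp: W_def b_def dist_norm norm_minus_commute)
      then have "\<bar>\<phi> p $ i\<bar> \<le> b" for i using component_le_norm_cart[of "\<phi> p" i] by linarith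
      then have "- b / \<delta> \<le> \<phi> p $ i / \<delta> \<and> \<phi> p $ i / \<delta> \<le> b / \<delta>" for i
        using \<delta> by (intro conjI divide_right_mono) (auto simp: abs_le_iff minus_le_iff)
      then show "key p \<in> PiE S (\<lambda>_. ?K)" unfolding key_def by (auto intro!: floor_mono)
    qed
    have finK: "finite (PiE S (\<lambda>_. ?K))" by (intro finite_PiE) auto
    have cK: "real (card ?K) \<le> C / \<epsilon>"
    proof -
      \<comment> \<open>The summand \<open>2\<close> pays for rounding at the two ends of the
        interval; it becomes \<open>2 / \<epsilon>\<close> because
        \<open>\<epsilon> \<le> 1\<close>.\<close>
      have "real (card ?K) \<le> 2 * b / \<delta> + 2"
      proof -
        have "real_of_int \<lfloor>b / \<delta>\<rfloor> \<le> b / \<delta>" by (rule of_int_floor_le)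
        moreover have "real_of_int \<lfloor>- b / \<delta>\<rfloor> > - b / \<delta> - 1" by linarith
        moreover have le: "\<lfloor>- b / \<delta>\<rfloor> \<le> \<lfloor>b / \<delta>\<rfloor>" using b \<delta> by (intro floor_mono divide_right_mono) auto
        have "real (card ?K) = real_of_int \<lfloor>b / \<delta>\<rfloor> - real_of_int \<lfloor>- b / \<delta>\<rfloor> + 1" using le by simp
        moreover have "2 * b / \<delta> = b / \<delta> - (- b / \<delta>)" by simp
        ultimately show ?thesis by linarith
      qed
      also have "2 * b / \<delta> = 2 * b * (L + 1) * n / \<epsilon>" using e L n by (simp add: \<delta>_def)
      also have "\<dots> + 2 \<le> 2 * b * (L + 1) * n / \<epsilon> + 2 / \<epsilon>" using e by (simp add: field_simps)
      finally show ?thesis by (simp add: C_def add_divide_distrib)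
    qed
    have "real (card (key ` ?X)) \<le> real (card (PiE S (\<lambda>_. ?K)))"
      using card_mono[OF finK sub] by simp
    also have "\<dots> = real (card ?K) ^ m" by (simp add: card_PiE c(3))
    also have "\<dots> \<le> (C / \<epsilon>) ^ m" using cK by (intro power_mono) auto
    finally have card: "real (card (key ` ?X)) \<le> C ^ m / \<epsilon> ^ m" by (simp add: power_divide)
    have close: "dist p p' \<le> \<epsilon>" if p: "p \<in> ?X" "p' \<in> ?X" "key p = key p'" for p p'
    proof -
      have comp: "\<bar>(\<phi> p - \<phi> p') $ i\<bar> \<le> \<delta>" for i
      proof (cases "i \<in> S")
        case True
        then have "\<lfloor>\<phi> p $ i / \<delta>\<rfloor> = \<lfloor>\<phi> p' $ i / \<delta>\<rfloor>" using fun_cong[OF p(3), of i] by (simp add: key_def)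
        then have "\<bar>\<phi> p $ i / \<delta> - \<phi> p' $ i / \<delta>\<bar> \<le> 1" by linarith
        then show ?thesis using \<delta> by (simp add: diff_divide_distrib[symmetric])
      next
        case False
        then have "\<phi> p $ i = 0" "\<phi> p' $ i = 0" using c(4) p by (auto simp: W_def)
        then show ?thesis using \<delta> by simp
      qed
      have "norm (\<phi> p - \<phi> p') \<le> (\<Sum>i\<in>UNIV. \<bar>(\<phi> p - \<phi> p') $ i\<bar>)" by (rule norm_le_l1_cart)
      also have "\<dots> \<le> (\<Sum>i\<in>(UNIV::'n set). \<delta>)" by (intro sum_mono comp)
      finally have "dist (\<phi> p) (\<phi> p') \<le> n * \<delta>" by (simp add: n_def dist_norm)
      moreover have "dist p p' \<le> L * dist (\<phi> p) (\<phi> p')"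
      proof -
        have "g (\<phi> p) = p" "g (\<phi> p') = p'"
          using p d(3) by (auto simp: g_def W_def bij_betw_def inv_into_f_f)
        moreover have "\<phi> p \<in> cball (\<phi> x) r" "\<phi> p' \<in> cball (\<phi> x) r" using p by (auto simp: W_def)
        ultimately show ?thesis using L(2)[of "\<phi> p" "\<phi> p'"] by simp
      qed
      ultimately have "dist p p' \<le> (L + 1) * (n * \<delta>)"
        using L(1) by (smt (verit) mult_left_mono mult_right_mono zero_le_dist)
      then show ?thesis using L n by (simp add: \<delta>_def)
    qed
    obtain P where P: "finite P" "P \<subseteq> ?X" "card P \<le> card (key ` ?X)" "?X \<subseteq> (\<Union>p\<in>P. cball p \<epsilon>)"
      using finite_key_cover[OF finite_subset[OF sub finK] close] by blast
    then show "\<exists>P. finite P \<and> P \<subseteq> M0 \<and> real (card P) \<le> C ^ m / \<epsilon> ^ m \<and> M0 \<inter> W \<subseteq> (\<Union>p\<in>P. cball p \<epsilon>)"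
      using card by (intro exI[of _ P]) auto
  qed
qed

text \<open>Compactness leaves finitely many charts, whose constants add up.\<close>

lemma submanifold_cover:
  fixes M0 :: "(real ^ 'n) set"
  assumes M: "embedded_submanifold m M0" and cM: "compact M0"
  obtains C where "C \<ge> 0" "\<And>\<epsilon>. 0 < \<epsilon> \<Longrightarrow> \<epsilon> \<le> 1 \<Longrightarrow>
    \<exists>P. finite P \<and> P \<subseteq> M0 \<and> real (card P) \<le> C / \<epsilon> ^ m \<and> M0 \<subseteq> (\<Union>p\<in>P. cball p \<epsilon>)"
proof -
  obtain W C where WC: "\<And>x. x \<in> M0 \<Longrightarrow> open (W x) \<and> x \<in> W x \<and> C x \<ge> 0 \<and> (\<forall>\<epsilon>. 0 < \<epsilon> \<and> \<epsilon> \<le> 1 \<longrightarrow>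
    (\<exists>P. finite P \<and> P \<subseteq> M0 \<and> real (card P) \<le> C x / \<epsilon> ^ m \<and> M0 \<inter> W x \<subseteq> (\<Union>p\<in>P. cball p \<epsilon>)))"
    using submanifold_local_cover[OF M] by metis
  obtain D where D: "D \<subseteq> M0" "finite D" "M0 \<subseteq> (\<Union>x\<in>D. W x)"
    by (rule compactE_image[OF cM, of M0 W]) (use WC in auto)
  show thesis
  proof (rule that[of "sum C D"])
    show "sum C D \<ge> 0" using WC D(1) by (intro sum_nonneg) auto
    fix \<epsilon> :: real assume e: "0 < \<epsilon>" "\<epsilon> \<le> 1"
    have "\<forall>x\<in>D. \<exists>P. finite P \<and> P \<subseteq> M0 \<and> real (card P) \<le> C x / \<epsilon> ^ m \<and> M0 \<inter> W x \<subseteq> (\<Union>p\<in>P. cball p \<epsilon>)"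
      using WC D(1) e by blast
    then obtain P where P: "\<And>x. x \<in> D \<Longrightarrow> finite (P x) \<and> P x \<subseteq> M0 \<and> real (card (P x)) \<le> C x / \<epsilon> ^ m \<and> M0 \<inter> W x \<subseteq> (\<Union>p\<in>P x. cball p \<epsilon>)"
      by metis
    show "\<exists>P. finite P \<and> P \<subseteq> M0 \<and> real (card P) \<le> sum C D / \<epsilon> ^ m \<and> M0 \<subseteq> (\<Union>p\<in>P. cball p \<epsilon>)"
    proof (intro exI[of _ "\<Union>x\<in>D. P x"] conjI)
      show "finite (\<Union>x\<in>D. P x)" "(\<Union>x\<in>D. P x) \<subseteq> M0" using P D by blast+
      have "real (card (\<Union>x\<in>D. P x)) \<le> (\<Sum>x\<in>D. real (card (P x)))"
        using card_UN_le[OF D(2), of P] by (simp add: of_nat_sum[symmetric] del: of_nat_sum)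
      also have "\<dots> \<le> (\<Sum>x\<in>D. C x / \<epsilon> ^ m)" using P by (intro sum_mono) auto
      finally show "real (card (\<Union>x\<in>D. P x)) \<le> sum C D / \<epsilon> ^ m" by (simp add: sum_divide_distrib)
      show "M0 \<subseteq> (\<Union>p\<in>(\<Union>x\<in>D. P x). cball p \<epsilon>)"
      proof
        fix y assume y: "y \<in> M0"
        then obtain x where x: "x \<in> D" "y \<in> W x" using D(3) by blast
        then obtain p where "p \<in> P x" "y \<in> cball p \<epsilon>" using P[OF x(1)] y by blast
        then show "y \<in> (\<Union>p\<in>(\<Union>x\<in>D. P x). cball p \<epsilon>)" using x(1) by blast
      qed
    qed
  qed
qed

text \<open>In the parabolic metric time has dimension two: about \<open>\<epsilon>^(-m)\<close>
  points of \<open>M0\<close> are combined with about \<open>\<epsilon>^(-2)\<close> times.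
  \<open>F\<close> is Lipschitz in both variables, so a time step of order
  \<open>\<epsilon>^2\<close> moves the submanifold by much less than the spatial radius
  allows.\<close>

lemma moving_cover:
  fixes M0 :: "(real ^ 'n) set" and F :: "(real ^ 'n) \<times> real \<Rightarrow> real ^ 'n"
  assumes M: "embedded_submanifold m M0" "compact M0" and F: "smooth_on F (UNIV \<times> I)"
    and ab: "a \<le> b" "{a..b} \<subseteq> I"
  defines "N \<equiv> (\<lambda>(q, t). (F (q, t), t)) ` (M0 \<times> {a..b})"
  shows "compact N" "\<exists>C\<ge>0. parabolic_cover N (m + 2) C"
proof -
  have F1: "Ck_on (Suc 0) F (UNIV \<times> I)" and F0: "continuous_on (UNIV \<times> I) F"
    using F Ck_on.simps(1) unfolding smooth_on_def by blast+
  have "continuous_on (M0 \<times> {a..b}) (\<lambda>z. (F z, snd z))"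
    using ab by (intro continuous_intros continuous_on_subset[OF F0]) auto
  then have "compact ((\<lambda>z. (F z, snd z)) ` (M0 \<times> {a..b}))"
    by (rule compact_continuous_image) (intro compact_Times M compact_Icc)
  then show "compact N" unfolding N_def by (simp add: case_prod_beta)
  \<comment> \<open>The mean value inequality needs a convex set, so the Lipschitz bound is taken on
    a ball containing \<open>M0\<close>; \<open>F\<close> is defined there because it is a family on
    the whole space.\<close>
  obtain \<rho> where "\<forall>x\<in>M0. norm x \<le> \<rho>"
    using compact_imp_bounded[OF M(2)] unfolding bounded_iff by blast
  then have \<rho>: "M0 \<subseteq> cball 0 \<rho>" by auto
  let ?K = "cball 0 \<rho> \<times> {a..b} :: ((real ^ 'n) \<times> real) set"
  have K: "compact ?K" "convex ?K" "?K \<subseteq> UNIV \<times> I"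
    using ab by (auto intro!: compact_Times convex_Times simp del: split_paired_All)
  obtain L where L: "L \<ge> 0" "\<And>z z'. z \<in> ?K \<Longrightarrow> z' \<in> ?K \<Longrightarrow> dist (F z) (F z') \<le> L * dist z z'"
    by (rule Ck_on_Suc_0_lipschitz[OF F1 K], rule that) (simp_all del: split_paired_All mem_Times_iff)
  obtain C where C: "C \<ge> 0" "\<And>\<epsilon>. 0 < \<epsilon> \<Longrightarrow> \<epsilon> \<le> 1 \<Longrightarrow>
    \<exists>P. finite P \<and> P \<subseteq> M0 \<and> real (card P) \<le> C / \<epsilon> ^ m \<and> M0 \<subseteq> (\<Union>p\<in>P. cball p \<epsilon>)"
    by (rule submanifold_cover[OF M], rule that) simp_all
  \<comment> \<open>With grids finer by the factor \<open>l\<close>, parameter and time each change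
    by at most \<open>\<epsilon> / l\<close>, and the image moves by at most
    \<open>2 * L * \<epsilon> / l \<le> \<epsilon>\<close>.\<close>
  define l where "l = 2 * (L + 1)"
  have l: "l \<ge> 1" "L \<le> l / 2" using L by (auto simp: l_def)
  define C' where "C' = C * l ^ m * ((b - a) * l + 1)"
  have C': "C' \<ge> 0" using C l ab by (simp add: C'_def)
  have "parabolic_cover N (m + 2) C'"
    unfolding parabolic_cover_def
  proof (intro allI impI)
    fix \<epsilon> :: real assume e: "0 < \<epsilon> \<and> \<epsilon> \<le> 1"
    define e' where "e' = \<epsilon> / l"
    define \<tau> where "\<tau> = \<epsilon>\<^sup>2 / l"
    have e2: "\<epsilon>\<^sup>2 \<le> \<epsilon>" "0 < \<epsilon>\<^sup>2" "\<epsilon>\<^sup>2 \<le> 1" using e by (auto simp: power2_eq_square mult_left_le mult_le_one)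
    have l0: "l > 0" using l by simp
    have shrink: "x / l \<le> x" if "x \<ge> 0" for x
      using mult_left_mono[OF l(1) that] l0 by (simp add: divide_le_eq)
    have ee: "0 < e'" "e' \<le> 1" "0 < \<tau>" "\<tau> \<le> \<epsilon>\<^sup>2" "\<tau> \<le> \<epsilon> / l"
    proof -
      show "0 < e'" unfolding e'_def using e l0 by (intro divide_pos_pos) auto
      show "e' \<le> 1" using shrink[of \<epsilon>] e by (simp add: e'_def)
      show "0 < \<tau>" unfolding \<tau>_def using e2(2) l0 by (rule divide_pos_pos)
      show "\<tau> \<le> \<epsilon>\<^sup>2" using shrink[of "\<epsilon>\<^sup>2"] by (simp add: \<tau>_def)
      show "\<tau> \<le> \<epsilon> / l" unfolding \<tau>_def using e2(1) l0 by (intro divide_right_mono) auto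
    qed
    obtain P where P: "finite P" "P \<subseteq> M0" "real (card P) \<le> C / e' ^ m" "M0 \<subseteq> (\<Union>p\<in>P. cball p e')"
      using C(2)[OF ee(1,2)] by blast
    \<comment> \<open>Rounding down keeps the last grid time inside the interval; what is left
      beyond it is shorter than one step \<open>\<tau>\<close> and is covered from that last
      time.\<close>
    define n where "n = nat \<lfloor>(b - a) / \<tau>\<rfloor>"
    define T where "T = (\<lambda>j. a + real j * \<tau>) ` {..n}"
    have nb: "real n \<le> (b - a) / \<tau>" using ab ee by (simp add: n_def)
    have Tsub: "T \<subseteq> {a..b}"
      unfolding T_def
    proof (rule image_subsetI)
      fix j assume "j \<in> {..n}"
      then have "real j \<le> (b - a) / \<tau>" using nb by auto
      then have "real j * \<tau> \<le> b - a" using ee by (simp add: pos_le_divide_eq)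
      then show "a + real j * \<tau> \<in> {a..b}" using ee by auto
    qed
    have Tcov: "\<exists>s\<in>T. s \<le> t \<and> t \<le> s + \<tau>" if t: "t \<in> {a..b}" for t
    proof -
      define j where "j = nat \<lfloor>(t - a) / \<tau>\<rfloor>"
      have "(t - a) / \<tau> \<le> (b - a) / \<tau>" using t ee by (intro divide_right_mono) auto
      then have "j \<le> n" unfolding j_def n_def by (intro nat_mono floor_mono)
      moreover have j: "real j \<le> (t - a) / \<tau>" "(t - a) / \<tau> \<le> real j + 1"
        using t ee by (auto simp: j_def)
      have "real j * \<tau> \<le> t - a" "t - a \<le> (real j + 1) * \<tau>"
        using j ee(3) by (simp_all add: pos_le_divide_eq pos_divide_le_eq)
      then have "a + real j * \<tau> \<le> t" "t \<le> a + real j * \<tau> + \<tau>" by (simp_all add: algebra_simps)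
      ultimately show ?thesis unfolding T_def by blast
    qed
    define Z where "Z = (\<lambda>(q, t). (F (q, t), t)) ` (P \<times> T)"
    have finT: "finite T" by (simp add: T_def)
    have cT: "real (card T) \<le> ((b - a) * l + 1) / \<epsilon>\<^sup>2"
    proof -
      have "card T \<le> n + 1" unfolding T_def using card_image_le[of "{..n}" "\<lambda>j. a + real j * \<tau>"] by simp
      then have "real (card T) \<le> real n + 1" by linarith
      also have "\<dots> \<le> (b - a) * l / \<epsilon>\<^sup>2 + 1" using nb by (simp add: \<tau>_def)
      also have "\<dots> \<le> (b - a) * l / \<epsilon>\<^sup>2 + 1 / \<epsilon>\<^sup>2" using e2 by simp
      finally show ?thesis by (simp add: add_divide_distrib)
    qed
    show "\<exists>Z. finite Z \<and> Z \<subseteq> N \<and> real (card Z) \<le> C' / \<epsilon> ^ (m + 2) \<and> N \<subseteq> (\<Union>z\<in>Z. pcyl z \<epsilon>)"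
    proof (intro exI[of _ Z] conjI)
      show "finite Z" unfolding Z_def using P(1) finT by auto
      show "Z \<subseteq> N" unfolding Z_def N_def using P(2) Tsub by (intro image_mono Sigma_mono) auto
      have "card Z \<le> card P * card T"
        unfolding Z_def using card_image_le[of "P \<times> T"] P(1) finT by (simp add: card_cartesian_product)
      then have "real (card Z) \<le> real (card P) * real (card T)" by (metis of_nat_le_iff of_nat_mult)
      also have "\<dots> \<le> C / e' ^ m * (((b - a) * l + 1) / \<epsilon>\<^sup>2)"
        using P(3) cT C(1) ee by (intro mult_mono) auto
      also have "\<dots> = C' / \<epsilon> ^ (m + 2)" using e l by (simp add: C'_def e'_def power_divide power_add power2_eq_square)
      finally show "real (card Z) \<le> C' / \<epsilon> ^ (m + 2)" .
      show "N \<subseteq> (\<Union>z\<in>Z. pcyl z \<epsilon>)"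
      proof
        fix w assume "w \<in> N"
        then obtain q t where w: "w = (F (q, t), t)" "q \<in> M0" "t \<in> {a..b}" by (auto simp: N_def)
        obtain p where p: "p \<in> P" "q \<in> cball p e'" using P(4) w(2) by blast
        obtain s where s: "s \<in> T" "s \<le> t" "t \<le> s + \<tau>" using Tcov[OF w(3)] by blast
        have "dist (F (p, s)) (F (q, t)) \<le> L * dist (p, s) (q, t)"
          using p(1) P(2) \<rho> w Tsub s(1) by (intro L(2)) auto
        also have "\<dots> \<le> L * (dist p q + dist s t)"
          using L(1) by (intro mult_left_mono) (auto simp: dist_Pair_Pair sqrt_sum_squares_le_sum)
        also have "\<dots> \<le> (l / 2) * (\<epsilon> / l + \<epsilon> / l)"
          using p(2) s ee l by (intro mult_mono add_mono) (auto simp: e'_def dist_real_def)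
        also have "\<dots> = \<epsilon>" using l by simp
        finally have "w \<in> pcyl (F (p, s), s) \<epsilon>"
          using s ee by (simp add: pcyl_def w(1) dist_real_def)
        moreover have "(F (p, s), s) \<in> Z" unfolding Z_def using p(1) s(1) by force
        ultimately show "w \<in> (\<Union>z\<in>Z. pcyl z \<epsilon>)" by blast
      qed
    qed
  qed
  then show "\<exists>C\<ge>0. parabolic_cover N (m + 2) C" using C' by blast
qed

section \<open>From local extensions to the global statement\<close>

lemma has_cont_dirderiv_on_local:
  assumes "\<And>z. z \<in> S \<Longrightarrow> \<exists>T. open T \<and> z \<in> T \<and> has_cont_dirderiv_on v f T"
  shows "has_cont_dirderiv_on v f S"
  unfolding has_cont_dirderiv_on_def
proof (intro conjI ballI continuous_at_imp_continuous_on)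
  fix z assume "z \<in> S"
  then obtain T where T: "open T" "z \<in> T" "has_cont_dirderiv_on v f T" using assms by blast
  then show "(\<lambda>s::real. f (z + s *\<^sub>R v)) differentiable (at 0)" "isCont (dirderiv v f) z"
    unfolding has_cont_dirderiv_on_def by (auto simp: continuous_on_eq_continuous_at)
qed

lemma Basis_vec_real: "(Basis :: (real ^ 'n) set) = range (\<lambda>i. axis i 1)"
  by (auto simp: Basis_vec_def)

lemma laplacian_x_eq_lapl:
  fixes f :: "(real ^ 'n) \<times> real \<Rightarrow> real"
  shows "laplacian_x f z = lapl f z"
proof -
  have "inj (\<lambda>i::'n. axis i (1::real))" by (auto simp: inj_def axis_eq_axis)
  then show ?thesis
    unfolding laplacian_x_def lapl_def Basis_vec_real by (subst sum.reindex) (auto simp: o_def)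
qed

lemma C21_on_imp_C21t: "C21_on f S \<Longrightarrow> C21t f S"
  unfolding C21_on_def C21t_def Basis_vec_real by auto

text \<open>Writing \<open>k = n - m\<close>, the threshold exceeds \<open>1\<close> by exactly
  \<open>2 / (k - 2)\<close>, so \<open>1 / (p - 1)\<close> is at most
  \<open>(k - 2) / 2\<close>.\<close>

lemma critical_exponent:
  fixes n m :: nat and p :: real
  assumes "n \<ge> m + 3" "p \<ge> (real n - real m) / (real n - real m - 2)"
  shows "p > 1" "2 * (1 + 1 / (p - 1)) \<le> real (n - m)"
proof -
  define k where "k = real n - real m"
  have k: "k \<ge> 3" "real (n - m) = k" using assms(1) by (auto simp: k_def)
  have "k / (k - 2) = 1 + 2 / (k - 2)" using k(1) by (simp add: field_simps)
  then have p: "p - 1 \<ge> 2 / (k - 2)" using assms(2) by (simp add: k_def)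
  moreover have "2 / (k - 2) > 0" using k(1) by simp
  ultimately show "p > 1" by linarith
  have "1 / (p - 1) \<le> 1 / (2 / (k - 2))"
    using p \<open>2 / (k - 2) > 0\<close> \<open>p > 1\<close> by (intro divide_left_mono mult_pos_pos) auto
  then show "2 * (1 + 1 / (p - 1)) \<le> real (n - m)" using k by (simp add: field_simps)
qed

theorem theorem2p2:
  fixes m :: nat and p B :: real
    and M0 \<Omega> :: "(real ^ 'n) set"
    and I J :: "real set"
    and F G :: "(real ^ 'n) \<times> real \<Rightarrow> real ^ 'n"
    and M :: "real \<Rightarrow> (real ^ 'n) set"
    and u :: "(real ^ 'n) \<times> real \<Rightarrow> real"
  assumes "m \<ge> 1" and "CARD('n) \<ge> m + 3"
    and "p \<ge> (real CARD('n) - real m) / (real CARD('n) - real m - 2)"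
    and "connected M0" and "compact M0" and "embedded_submanifold m M0"
    and "open I" and "is_interval I" and "0 \<in> I"
    and "diffeo_family F I" and "\<And>x. F (x, 0) = x"
    and "open J" and "is_interval J" and "closure I \<subseteq> J"
    and "diffeo_family G J" and "\<And>x t. t \<in> I \<Longrightarrow> G (x, t) = F (x, t)"
    and "B > 0" and "B_bounded B M0 I F"
    and "M = moving_set F G I M0"
    and "open \<Omega>" and "connected \<Omega>"
    and "\<And>t. t \<in> closure I \<Longrightarrow> M t \<subseteq> \<Omega>"
    and "nonneg_classical_solution p (\<Omega> \<times> I - track M I) u"
  shows "\<exists>v. (\<forall>z \<in> \<Omega> \<times> I - track M I. v z = u z) \<and>
             nonneg_classical_solution p (\<Omega> \<times> I) v"
proof -
  note exps = critical_exponent[OF assms(2,3)]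
  have Mt: "M t = (\<lambda>x. F (x, t)) ` M0" if "t \<in> I" for t
    using that assms(19) by (simp add: moving_set_def)
  define T where "T = track M I"
  define S where "S = \<Omega> \<times> I - T"
  have sol: "C21t u S" "\<And>z. z \<in> S \<Longrightarrow> u z \<ge> 0"
    "\<And>z. z \<in> S \<Longrightarrow> dirderiv (0, 1) u z - lapl u z = - (u z powr p)"
    using assms(23) C21_on_imp_C21t unfolding nonneg_classical_solution_def S_def T_def laplacian_x_eq_lapl by blast+
  \<comment> \<open>Besides the local extension, two things are recorded: the track is null inside
    the ball, which makes extensions on overlapping balls agree, and all mixed second derivatives
    exist, which \<open>C21t\<close> omits.\<close>
  define good where "good z v r \<longleftrightarrow> r > 0 \<and> ball z r \<subseteq> \<Omega> \<times> I \<and> (\<exists>N. N \<in> null_sets lborel \<and> T \<inter> ball z r \<subseteq> N) \<and>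
    (\<forall>w \<in> ball z r - T. v w = u w) \<and> (\<forall>w \<in> ball z r. v w \<ge> 0) \<and> C21t v (ball z r) \<and>
    (\<forall>b\<in>Basis. \<forall>b'\<in>Basis. has_cont_dirderiv_on (b', 0) (dirderiv (b, 0) v) (ball z r)) \<and>
    (\<forall>w \<in> ball z r. dirderiv (0, 1) v w - lapl v w = - (v w powr p))" for z v r
  have "\<exists>v r. good z v r" if z: "z \<in> \<Omega> \<times> I" for z
  proof -
    obtain x t where xt: "z = (x, t)" "x \<in> \<Omega>" "t \<in> I" using z by auto
    \<comment> \<open>A compact time interval inside \<open>I\<close> makes the relevant piece of
      the track compact and its covering constant finite; that constant may depend on the
      point.\<close>
    obtain d where d: "d > 0" "cball t d \<subseteq> I" using assms(7) xt(3) open_contains_cball by blast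
    have "open (\<Omega> \<times> ball t d)" using assms(20) by (intro open_Times open_ball)
    moreover have "z \<in> \<Omega> \<times> ball t d" using xt d by simp
    ultimately obtain R where R: "R > 0" "ball z R \<subseteq> \<Omega> \<times> ball t d" using open_contains_ball by blast
    define N where "N = (\<lambda>(q, t). (F (q, t), t)) ` (M0 \<times> {t - d..t + d})"
    have ab: "t - d \<le> t + d" "{t - d..t + d} \<subseteq> I" using d by (auto simp: cball_eq_atLeastAtMost)
    have sm: "smooth_on F (UNIV \<times> I)" using assms(10) by (simp add: diffeo_family_def)
    note mc = moving_cover[OF assms(6,5) sm ab, folded N_def]
    obtain C where C: "C \<ge> 0" "parabolic_cover N (m + 2) C" using mc(2) by blast
    \<comment> \<open>Within the ball the track and its compact piece are the same set, as all times
      occurring there lie in the chosen interval.\<close>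
    have TN: "w \<in> T \<longleftrightarrow> w \<in> N" if wR: "w \<in> ball z R" for w
    proof -
      obtain y s where w: "w = (y, s)" "s \<in> ball t d" using R(2) wR by auto
      have "s \<in> {t - d..t + d}" using w(2) by (auto simp: dist_real_def)
      then have s: "s \<in> I" "s \<in> {t - d..t + d}" using ab(2) by blast+
      show ?thesis using s Mt[OF s(1)] by (auto simp: T_def track_def N_def w(1))
    qed
    have sub: "ball z R \<subseteq> \<Omega> \<times> I" using R(2) d(2) ball_subset_cball[of t d] by blast
    have BS: "ball z R - N \<subseteq> S" using TN sub by (auto simp: S_def simp del: split_paired_All)
    \<comment> \<open>The parabolic dimension \<open>m + 2\<close> of the track and the codimension
      \<open>n - m\<close> add up to the parabolic dimension of space-time; \<open>m + 2 < n\<close>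
      is codimension at least \<open>3\<close>.\<close>
    have dims: "m + 2 + (CARD('n) - m) = DIM(real ^ 'n) + 2" "m + 2 < DIM(real ^ 'n)" using assms(2) by auto
    obtain v r where v: "r > 0" "\<forall>w \<in> ball z r - N. v w = u w" "\<forall>w \<in> ball z r. v w \<ge> 0" "C21t v (ball z r)"
      "\<forall>b\<in>Basis. \<forall>b'\<in>Basis. has_cont_dirderiv_on (b', 0) (dirderiv (b, 0) v) (ball z r)"
      "\<forall>w \<in> ball z r. dirderiv (0, 1) v w - lapl v w = - (v w powr p)"
      using removable_local[OF C(2,1) mc(1) dims exps R(1) C21t_subset[OF sol(1) BS]] sol(2,3) BS by blast
    define r' where "r' = min r R"
    have r': "r' > 0" "ball z r' \<subseteq> ball z r" "ball z r' \<subseteq> ball z R" using v(1) R(1) by (auto simp: r'_def)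
    have "good z v r'"
      unfolding good_def
    proof (intro conjI)
      show "\<exists>N. N \<in> null_sets lborel \<and> T \<inter> ball z r' \<subseteq> N"
        using cover_null_sets(1)[OF C(2,1) mc(1) dims(2)] TN r'(3) by blast
      show "\<forall>w \<in> ball z r' - T. v w = u w" using v(2) TN r'(2,3) by blast
      show "C21t v (ball z r')" by (rule C21t_subset[OF v(4) r'(2)])
      show "\<forall>b\<in>Basis. \<forall>b'\<in>Basis. has_cont_dirderiv_on (b', 0) (dirderiv (b, 0) v) (ball z r')"
        using v(5) has_cont_dirderiv_on_subset[OF _ r'(2)] by blast
    qed (use r' sub v(3,6) in blast)+
    then show ?thesis by blast
  qed
  then obtain vv rr where good: "\<And>z. z \<in> \<Omega> \<times> I \<Longrightarrow> good z (vv z) (rr z)" by metis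
  have g: "rr z > 0" "ball z (rr z) \<subseteq> \<Omega> \<times> I" "\<exists>N. N \<in> null_sets lborel \<and> T \<inter> ball z (rr z) \<subseteq> N"
    "\<forall>w \<in> ball z (rr z) - T. vv z w = u w" "\<forall>w \<in> ball z (rr z). vv z w \<ge> 0" "C21t (vv z) (ball z (rr z))"
    "\<forall>b\<in>Basis. \<forall>b'\<in>Basis. has_cont_dirderiv_on (b', 0) (dirderiv (b, 0) (vv z)) (ball z (rr z))"
    "\<forall>w \<in> ball z (rr z). dirderiv (0, 1) (vv z) w - lapl (vv z) w = - (vv z w powr p)"
    if "z \<in> \<Omega> \<times> I" for z
    using good[OF that] unfolding good_def by - (elim conjE, assumption)+
  have zb: "z \<in> ball z (rr z)" if "z \<in> \<Omega> \<times> I" for z using g(1)[OF that] by simp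
  \<comment> \<open>At a point of the track the value comes from the extension centred at that
    point, so agreement with the extensions centred at neighbouring points has to be proved.\<close>
  define V where "V z = (if z \<in> S then u z else vv z z)" for z
  have V: "V w = vv z w" if z: "z \<in> \<Omega> \<times> I" and w: "w \<in> ball z (rr z)" for z w
  proof (cases "w \<in> S")
    case True
    then have "w \<in> ball z (rr z) - T" using w by (simp add: S_def)
    then show ?thesis using g(4)[OF z] True by (simp add: V_def)
  next
    case False
    have w': "w \<in> \<Omega> \<times> I" using g(2)[OF z] w by blast
    define X where "X = ball z (rr z) \<inter> ball w (rr w)"
    have X: "open X" "w \<in> X" "X \<subseteq> ball z (rr z)" "X \<subseteq> ball w (rr w)" using w zb[OF w'] by (auto simp: X_def)
    \<comment> \<open>Both extensions are continuous near \<open>w\<close> and equal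
      \<open>u\<close> off the track. If they differed at \<open>w\<close>, they would differ on an
      open set, which contains points off the null track.\<close>
    have "vv w w = vv z w"
    proof (rule ccontr)
      assume ne: "vv w w \<noteq> vv z w"
      define Y where "Y = X \<inter> (\<lambda>y. vv w y - vv z y) -` (- {0})"
      have "continuous_on X (\<lambda>y. vv w y - vv z y)"
        using continuous_on_subset[OF C21tD(1)[OF g(6)[OF z]] X(3)] continuous_on_subset[OF C21tD(1)[OF g(6)[OF w']] X(4)]
        by (intro continuous_on_diff)
      then have "open Y" unfolding Y_def using X(1) by (intro continuous_open_preimage) auto
      moreover have "w \<in> Y" using X(2) ne by (simp add: Y_def)
      moreover obtain N where N: "N \<in> null_sets lborel" "T \<inter> ball z (rr z) \<subseteq> N" using g(3)[OF z] by blast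
      ultimately obtain y where y: "y \<in> Y" "y \<notin> N" using null_set_dense[of Y N] by blast
      then have "y \<in> X" "y \<notin> T" using N(2) X(3) by (auto simp: Y_def)
      then have "vv w y = u y" "vv z y = u y" using g(4)[OF z] g(4)[OF w'] X(3,4) by blast+
      then show False using y(1) by (simp add: Y_def)
    qed
    then show ?thesis using False by (simp add: V_def)
  qed
  have D: "dirderiv e V w = dirderiv e (vv z) w" if "z \<in> \<Omega> \<times> I" "w \<in> ball z (rr z)" for e z w
    using V[OF that(1)] by (intro dirderiv_cong_open[OF open_ball that(2)])
  have D2: "dirderiv e (dirderiv e' V) w = dirderiv e (dirderiv e' (vv z)) w" if "z \<in> \<Omega> \<times> I" "w \<in> ball z (rr z)" for e e' z w
    using D[OF that(1)] by (intro dirderiv_cong_open[OF open_ball that(2)])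
  have h1: "has_cont_dirderiv_on e V (\<Omega> \<times> I)"
    if "\<And>z. z \<in> \<Omega> \<times> I \<Longrightarrow> has_cont_dirderiv_on e (vv z) (ball z (rr z))" for e
  proof (rule has_cont_dirderiv_on_local)
    fix z assume z: "z \<in> \<Omega> \<times> I"
    have "has_cont_dirderiv_on e V (ball z (rr z))"
      by (rule has_cont_dirderiv_on_cong_open[OF open_ball _ that[OF z]]) (simp add: V[OF z])
    then show "\<exists>T. open T \<and> z \<in> T \<and> has_cont_dirderiv_on e V T" using zb[OF z] open_ball by blast
  qed
  have h2: "has_cont_dirderiv_on e (dirderiv e' V) (\<Omega> \<times> I)"
    if "\<And>z. z \<in> \<Omega> \<times> I \<Longrightarrow> has_cont_dirderiv_on e (dirderiv e' (vv z)) (ball z (rr z))" for e e'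
  proof (rule has_cont_dirderiv_on_local)
    fix z assume z: "z \<in> \<Omega> \<times> I"
    have "has_cont_dirderiv_on e (dirderiv e' V) (ball z (rr z))"
      by (rule has_cont_dirderiv_on_cong_open[OF open_ball _ that[OF z]]) (simp add: D[OF z])
    then show "\<exists>T. open T \<and> z \<in> T \<and> has_cont_dirderiv_on e (dirderiv e' V) T" using zb[OF z] open_ball by blast
  qed
  have cont: "continuous_on (\<Omega> \<times> I) V"
  proof (rule continuous_at_imp_continuous_on, rule ballI)
    fix z assume z: "z \<in> \<Omega> \<times> I"
    have "continuous_on (ball z (rr z)) (vv z)" by (rule C21tD(1)[OF g(6)[OF z]])
    then have "continuous_on (ball z (rr z)) V" by (rule continuous_on_eq) (simp add: V[OF z])
    then show "isCont V z" using zb[OF z] by (simp add: continuous_on_eq_continuous_at)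
  qed
  have ax: "axis i 1 \<in> (Basis :: (real ^ 'n) set)" for i by (auto simp: Basis_vec_real)
  have "nonneg_classical_solution p (\<Omega> \<times> I) V"
    unfolding nonneg_classical_solution_def C21_on_def laplacian_x_eq_lapl
  proof (intro conjI ballI allI cont h1 h2)
    fix z assume z: "z \<in> \<Omega> \<times> I"
    show "has_cont_dirderiv_on (0, 1) (vv z) (ball z (rr z))" by (rule C21tD(2)[OF g(6)[OF z]])
    show "has_cont_dirderiv_on (axis i 1, 0) (vv z) (ball z (rr z))" for i by (rule C21tD(3)[OF g(6)[OF z] ax])
    show "has_cont_dirderiv_on (axis j 1, 0) (dirderiv (axis i 1, 0) (vv z)) (ball z (rr z))" for i j
      using g(7)[OF z] ax by blast
    show "V z \<ge> 0" using g(5)[OF z] zb[OF z] V[OF z zb[OF z]] by simp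
    show "dirderiv (0, 1) V z - lapl V z = - (V z powr p)"
      using g(8)[OF z] zb[OF z] V[OF z zb[OF z]] D[OF z zb[OF z]] D2[OF z zb[OF z]] by (simp add: lapl_def)
  qed
  moreover have "\<forall>z \<in> \<Omega> \<times> I - track M I. V z = u z" by (simp add: V_def S_def T_def)
  ultimately show ?thesis by blast
qed

end
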